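(* Let $R$ and $S$ be rings, $C={}_SC_R$ a faithfully semidualizing $(S,R)$-bimodule, $n$ a positive integer and $k\ge 0$ an integer. Let $M$ be a left $R$-module and $N$ a left $S$-module. Then: (i) $M\in Cfp_nI(R)_{\leq k}$ if and only if $M\in\mathcal{A}_C(R)$ and $C\otimes_RM\in fp_nI(S)_{\leq k}$; (ii) $N\in Cfp_nF(S)_{\leq k}$ if and only if $N\in\mathcal{B}_C(S)$ and $\operatorname{Hom}_S(C,N)\in fp_nF(R)_{\leq k}$.
   Context: Rings are associative with unit; modules are unital left modules unless said otherwise, and right modules over a ring are identified with left modules over the opposite ring. A module $M$ is finitely $n$-presented if there is an exact sequence $F_n\to F_{n-1}\to\cdots\to F_0\to M\to 0$ with every $F_i$ finitely generated free. A left $R$-module $M$ is $fp_n$-injective (resp. $fp_n$-flat) if for every injective homomorphism $K\to L$ of finitely $n$-presented left (resp. right) $R$-modules, the induced map $\operatorname{Hom}_R(L,M)\to\operatorname{Hom}_R(K,M)$ is surjective (resp. $K\otimes_RM\to L\otimes_RM$ is injective). $fp_nI(R)$ and $fp_nF(R)$ denote the classes of $fp_n$-injective and $fp_n$-flat left $R$-modules (similarly for $S$). An $(S,R)$-bimodule $C={}_SC_R$ is semidualizing if: ${}_SC$ and $C_R$ each admit a projective resolution by finitely generated projective modules; the homothety maps $S\to\operatorname{Hom}_{R^{op}}(C,C)$ and $R\to\operatorname{Hom}_S(C,C)$ are isomorphisms; and $\operatorname{Ext}^i_S(C,C)=0=\operatorname{Ext}^i_{R^{op}}(C,C)$ for all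 $i\ge1$. It is faithfully semidualizing if moreover for all modules ${}_SN$ and $M_R$: $\operatorname{Hom}_S(C,N)=0$ implies $N=0$, and $\operatorname{Hom}_{R^{op}}(C,M)=0$ implies $M=0$. The Auslander class $\mathcal{A}_C(R)$ consists of all left $R$-modules $M$ with $\operatorname{Tor}_i^R(C,M)=0$ and $\operatorname{Ext}^i_S(C,C\otimes_RM)=0$ for all $i\ge1$ and such that the natural evaluation map $M\to\operatorname{Hom}_S(C,C\otimes_RM)$ is an isomorphism. The Bass class $\mathcal{B}_C(S)$ consists of all left $S$-modules $N$ with $\operatorname{Ext}^i_S(C,N)=0$ and $\operatorname{Tor}^R_i(C,\operatorname{Hom}_S(C,N))=0$ for all $i\ge1$ and such that the natural evaluation map $C\otimes_R\operatorname{Hom}_S(C,N)\to N$ is an isomorphism. $Cfp_nI(R)$ is the class of left $R$-modules of the form $\operatorname{Hom}_S(C,X)$ with $X\in fp_nI(S)$; $Cfp_nF(S)$ is the class of left $S$-modules of the form $C\otimes_RY$ with $Y\in fp_nF(R)$ (both up to isomorphism). For $\mathcal{I}$ one of $fp_nI(S)$, $Cfp_nI(R)$, the class $\mathcal{I}_{\leq k}$ consists of all modules $M$ having an exact sequence $0\to M\to I_0\to I_1\to\cdots\to I_k\to0$ with all $I_i\in\mathcal{I}$. For $\mathcal{F}$ one of $fp_nF(R)$, $Cfp_nF(S)$, the class $\mathcal{F}_{\leq k}$ consists of all modules $N$ having an exact sequence $0\to F_k\to\cdots\to F_1\to F_0\to N\to0$ with all $F_i\in\mathcal{F}$. *)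

theory Defs
  imports
    "HOL-Algebra.Free_Abelian_Groups"
    "HOL-Algebra.AbelCoset"
    "HOL-Algebra.Module"
begin

text \<open>
  HOL has no type of all modules.  Following a standard convention, the statement is relative to a
  type \<open>'u\<close> that plays the role of the universe: the bimodule, the two given modules, and every
  module that is quantified over in a definition below has its carrier inside \<open>'u\<close>.
  The statement is made for every infinite type \<open>'u\<close> into which both rings embed.  Any set of
  modules can be transported into such a type.  Modules that are constructed (homomorphism modules,
  tensor products) live in the type given by their construction, so notions that are applied to
  them are polymorphic in the carrier type.
\<close>

section \<open>Modules over noncommutative rings\<close>

text \<open>The record is the one of \<^theory>\<open>HOL-Algebra.Module\<close>.  The locale \<open>module\<close> of that
  theory cannot be used because it requires a commutative ring.\<close>

locale lmodule = R?: ring R + M?: abelian_group M for R (structure) and M (structure) +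
  assumes smult_closed [simp, intro]:
      "\<lbrakk> a \<in> carrier R; x \<in> carrier M \<rbrakk> \<Longrightarrow> a \<odot>\<^bsub>M\<^esub> x \<in> carrier M"
    and smult_l_distr:
      "\<lbrakk> a \<in> carrier R; b \<in> carrier R; x \<in> carrier M \<rbrakk> \<Longrightarrow>
      (a \<oplus> b) \<odot>\<^bsub>M\<^esub> x = a \<odot>\<^bsub>M\<^esub> x \<oplus>\<^bsub>M\<^esub> b \<odot>\<^bsub>M\<^esub> x"
    and smult_r_distr:
      "\<lbrakk> a \<in> carrier R; x \<in> carrier M; y \<in> carrier M \<rbrakk> \<Longrightarrow>
      a \<odot>\<^bsub>M\<^esub> (x \<oplus>\<^bsub>M\<^esub> y) = a \<odot>\<^bsub>M\<^esub> x \<oplus>\<^bsub>M\<^esub> a \<odot>\<^bsub>M\<^esub> y"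
    and smult_assoc:
      "\<lbrakk> a \<in> carrier R; b \<in> carrier R; x \<in> carrier M \<rbrakk> \<Longrightarrow>
      (a \<otimes> b) \<odot>\<^bsub>M\<^esub> x = a \<odot>\<^bsub>M\<^esub> (b \<odot>\<^bsub>M\<^esub> x)"
    and smult_one [simp]:
      "x \<in> carrier M \<Longrightarrow> \<one> \<odot>\<^bsub>M\<^esub> x = x"

lemma module_iff_lmodule: "module R M \<longleftrightarrow> cring R \<and> lmodule R M"
  by (auto simp: module_def module_axioms_def lmodule_def lmodule_axioms_def cring_def)

text \<open>A right \<open>R\<close>-module is an \<open>lmodule\<close> over \<open>opp R\<close>: \<open>r \<odot> x\<close> then stands for \<open>x r\<close>.\<close>

definition opp :: "'r ring \<Rightarrow> 'r ring"
  where "opp R = R\<lparr>mult := (\<lambda>a b. b \<otimes>\<^bsub>R\<^esub> a)\<rparr>"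

definition mhom :: "'r ring \<Rightarrow> ('r, 'a) module \<Rightarrow> ('r, 'b) module \<Rightarrow> ('a \<Rightarrow> 'b) set"
  where "mhom R A B =
    {f \<in> carrier A \<rightarrow> carrier B.
       (\<forall>x\<in>carrier A. \<forall>y\<in>carrier A. f (x \<oplus>\<^bsub>A\<^esub> y) = f x \<oplus>\<^bsub>B\<^esub> f y) \<and>
       (\<forall>r\<in>carrier R. \<forall>x\<in>carrier A. f (r \<odot>\<^bsub>A\<^esub> x) = r \<odot>\<^bsub>B\<^esub> f x)}"

definition miso :: "'r ring \<Rightarrow> ('r, 'a) module \<Rightarrow> ('r, 'b) module \<Rightarrow> ('a \<Rightarrow> 'b) set"
  where "miso R A B = {f \<in> mhom R A B. bij_betw f (carrier A) (carrier B)}"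

definition fin_gen :: "'r ring \<Rightarrow> ('r, 'a) module \<Rightarrow> bool"
  where "fin_gen R M \<longleftrightarrow> lmodule R M \<and>
    (\<exists>X. finite X \<and> X \<subseteq> carrier M \<and>
      (\<forall>m\<in>carrier M. \<exists>c \<in> X \<rightarrow>\<^sub>E carrier R. m = (\<Oplus>\<^bsub>M\<^esub>x\<in>X. c x \<odot>\<^bsub>M\<^esub> x)))"

text \<open>\<open>M\<close> has a finite basis \<open>X\<close>.\<close>

definition fin_free :: "'r ring \<Rightarrow> ('r, 'a) module \<Rightarrow> bool"
  where "fin_free R M \<longleftrightarrow> lmodule R M \<and>
    (\<exists>X. finite X \<and> X \<subseteq> carrier M \<and>
      (\<forall>m\<in>carrier M. \<exists>!c. c \<in> X \<rightarrow>\<^sub>E carrier R \<and> m = (\<Oplus>\<^bsub>M\<^esub>x\<in>X. c x \<odot>\<^bsub>M\<^esub> x)))"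

definition projective :: "'r ring \<Rightarrow> ('r, 'u) module \<Rightarrow> bool"
  where "projective R P \<longleftrightarrow> lmodule R P \<and>
    (\<forall>(A :: ('r, 'u) module) (B :: ('r, 'u) module) g f.
       lmodule R A \<and> lmodule R B \<and> g \<in> mhom R A B \<and> g ` carrier A = carrier B \<and> f \<in> mhom R P B \<longrightarrow>
       (\<exists>h \<in> mhom R P A. \<forall>x\<in>carrier P. g (h x) = f x))"

section \<open>Exact sequences\<close>

text \<open>Exactness of \<open>F n \<rightarrow> \<dots> \<rightarrow> F 1 \<rightarrow> F 0 \<rightarrow> M \<rightarrow> 0\<close> with maps \<open>d i : F (Suc i) \<rightarrow> F i\<close> and
  \<open>e : F 0 \<rightarrow> M\<close>; nothing is required at the leftmost term.\<close>

definition left_exact_seq ::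
    "'r ring \<Rightarrow> nat \<Rightarrow> (nat \<Rightarrow> ('r, 'u) module) \<Rightarrow> (nat \<Rightarrow> 'u \<Rightarrow> 'u) \<Rightarrow> ('u \<Rightarrow> 'm) \<Rightarrow> ('r, 'm) module \<Rightarrow> bool"
  where "left_exact_seq R n F d e M \<longleftrightarrow>
    lmodule R M \<and> (\<forall>i\<le>n. lmodule R (F i)) \<and>
    e \<in> mhom R (F 0) M \<and> (\<forall>i<n. d i \<in> mhom R (F (Suc i)) (F i)) \<and>
    e ` carrier (F 0) = carrier M \<and>
    (0 < n \<longrightarrow> d 0 ` carrier (F 1) = a_kernel (F 0) M e) \<and>
    (\<forall>i. Suc i < n \<longrightarrow> d (Suc i) ` carrier (F (Suc (Suc i))) = a_kernel (F (Suc i)) (F i) (d i))"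

text \<open>Exactness of \<open>0 \<rightarrow> M \<rightarrow> I 0 \<rightarrow> I 1 \<rightarrow> \<dots> \<rightarrow> I n\<close> with maps \<open>e : M \<rightarrow> I 0\<close> and
  \<open>d i : I i \<rightarrow> I (Suc i)\<close>; nothing is required at the rightmost term.\<close>

definition right_exact_seq ::
    "'r ring \<Rightarrow> nat \<Rightarrow> ('r, 'm) module \<Rightarrow> ('m \<Rightarrow> 'u) \<Rightarrow> (nat \<Rightarrow> 'u \<Rightarrow> 'u) \<Rightarrow> (nat \<Rightarrow> ('r, 'u) module) \<Rightarrow> bool"
  where "right_exact_seq R n M e d I \<longleftrightarrow>
    lmodule R M \<and> (\<forall>i\<le>n. lmodule R (I i)) \<and>
    e \<in> mhom R M (I 0) \<and> (\<forall>i<n. d i \<in> mhom R (I i) (I (Suc i))) \<and>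
    inj_on e (carrier M) \<and>
    (0 < n \<longrightarrow> e ` carrier M = a_kernel (I 0) (I 1) (d 0)) \<and>
    (\<forall>i. Suc i < n \<longrightarrow> d i ` carrier (I i) = a_kernel (I (Suc i)) (I (Suc (Suc i))) (d (Suc i)))"

text \<open>In the next two definitions the term with index \<open>Suc k\<close> is the zero module that ends the
  sequence \<open>0 \<rightarrow> F k \<rightarrow> \<dots> \<rightarrow> F 0 \<rightarrow> N \<rightarrow> 0\<close>, respectively \<open>0 \<rightarrow> M \<rightarrow> I 0 \<rightarrow> \<dots> \<rightarrow> I k \<rightarrow> 0\<close>.\<close>

definition left_resolved ::
    "'r ring \<Rightarrow> (('r, 'u) module \<Rightarrow> bool) \<Rightarrow> nat \<Rightarrow> ('r, 'm) module \<Rightarrow> bool"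
  where "left_resolved R \<F> k N \<longleftrightarrow>
    (\<exists>F d e. left_exact_seq R (Suc k) F d e N \<and> carrier (F (Suc k)) = {\<zero>\<^bsub>F (Suc k)\<^esub>} \<and>
      (\<forall>i\<le>k. \<F> (F i)))"

definition right_resolved ::
    "'r ring \<Rightarrow> (('r, 'u) module \<Rightarrow> bool) \<Rightarrow> nat \<Rightarrow> ('r, 'm) module \<Rightarrow> bool"
  where "right_resolved R \<I> k M \<longleftrightarrow>
    (\<exists>I d e. right_exact_seq R (Suc k) M e d I \<and> carrier (I (Suc k)) = {\<zero>\<^bsub>I (Suc k)\<^esub>} \<and>
      (\<forall>i\<le>k. \<I> (I i)))"

definition fin_presented :: "'r ring \<Rightarrow> nat \<Rightarrow> ('r, 'u) module \<Rightarrow> bool"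
  where "fin_presented R n M \<longleftrightarrow>
    (\<exists>(F :: nat \<Rightarrow> ('r, 'u) module) d e. left_exact_seq R n F d e M \<and> (\<forall>i\<le>n. fin_free R (F i)))"

definition proj_resolution ::
    "'r ring \<Rightarrow> ('r, 'u) module \<Rightarrow> (nat \<Rightarrow> ('r, 'u) module) \<Rightarrow> (nat \<Rightarrow> 'u \<Rightarrow> 'u) \<Rightarrow> ('u \<Rightarrow> 'u) \<Rightarrow> bool"
  where "proj_resolution R A P d e \<longleftrightarrow>
    (\<forall>n. left_exact_seq R n P d e A) \<and> (\<forall>i. projective R (P i))"

section \<open>Homomorphism groups and tensor products\<close>

text \<open>Abelian groups are \<open>ring\<close> records whose multiplicative part is irrelevant, as for
  \<^locale>\<open>abelian_group\<close>.  Homomorphisms are taken extensional, so that equality of elements of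
  the group is equality on the carrier of \<open>A\<close>.\<close>

definition hom_group :: "'r ring \<Rightarrow> ('r, 'a) module \<Rightarrow> ('r, 'b) module \<Rightarrow> ('a \<Rightarrow> 'b) ring"
  where "hom_group R A B =
    \<lparr>carrier = mhom R A B \<inter> extensional (carrier A), mult = undefined, one = undefined,
     zero = (\<lambda>x\<in>carrier A. \<zero>\<^bsub>B\<^esub>), add = (\<lambda>f g. \<lambda>x\<in>carrier A. f x \<oplus>\<^bsub>B\<^esub> g x)\<rparr>"

text \<open>\<open>A\<close> is a right and \<open>B\<close> a left \<open>R\<close>-module.  The tensor product is the free abelian group on
  \<open>carrier A \<times> carrier B\<close> modulo the subgroup generated by the bilinearity relations; the last
  relation is \<open>(a r, b) - (a, r b)\<close>.\<close>

definition tensor_rel :: "'r ring \<Rightarrow> ('r, 'a) module \<Rightarrow> ('r, 'b) module \<Rightarrow> ('a \<times> 'b \<Rightarrow>\<^sub>0 int) set"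
  where "tensor_rel R A B = generate (free_Abelian_group (carrier A \<times> carrier B))
    ({frag_of (a \<oplus>\<^bsub>A\<^esub> a', b) - frag_of (a, b) - frag_of (a', b) | a a' b.
        a \<in> carrier A \<and> a' \<in> carrier A \<and> b \<in> carrier B} \<union>
     {frag_of (a, b \<oplus>\<^bsub>B\<^esub> b') - frag_of (a, b) - frag_of (a, b') | a b b'.
        a \<in> carrier A \<and> b \<in> carrier B \<and> b' \<in> carrier B} \<union>
     {frag_of (r \<odot>\<^bsub>A\<^esub> a, b) - frag_of (a, r \<odot>\<^bsub>B\<^esub> b) | r a b.
        r \<in> carrier R \<and> a \<in> carrier A \<and> b \<in> carrier B})"

definition tensor :: "'r ring \<Rightarrow> ('r, 'a) module \<Rightarrow> ('r, 'b) module \<Rightarrow> ('a \<times> 'b \<Rightarrow>\<^sub>0 int) set ring"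
  where "tensor R A B =
    (let G = free_Abelian_group (carrier A \<times> carrier B) Mod tensor_rel R A B
     in \<lparr>carrier = carrier G, mult = undefined, one = undefined, zero = one G, add = mult G\<rparr>)"

definition pure_tensor ::
    "'r ring \<Rightarrow> ('r, 'a) module \<Rightarrow> ('r, 'b) module \<Rightarrow> 'a \<Rightarrow> 'b \<Rightarrow> ('a \<times> 'b \<Rightarrow>\<^sub>0 int) set"
  where "pure_tensor R A B a b =
    tensor_rel R A B #>\<^bsub>free_Abelian_group (carrier A \<times> carrier B)\<^esub> frag_of (a, b)"

text \<open>The map \<open>A \<otimes> B \<rightarrow> A' \<otimes> B\<close> induced by \<open>f : A \<rightarrow> A'\<close>: a coset \<open>X\<close> is mapped to the coset that
  contains the image of \<open>X\<close> under the extension of \<open>(a, b) \<mapsto> (f a, b)\<close> to the free abelian groups.\<close>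

definition tensor_map ::
    "'r ring \<Rightarrow> ('r, 'a) module \<Rightarrow> ('r, 'a2) module \<Rightarrow> ('r, 'b) module \<Rightarrow> ('a \<Rightarrow> 'a2) \<Rightarrow>
     ('a \<times> 'b \<Rightarrow>\<^sub>0 int) set \<Rightarrow> ('a2 \<times> 'b \<Rightarrow>\<^sub>0 int) set"
  where "tensor_map R A A' B f X =
    tensor_rel R A' B <#>\<^bsub>free_Abelian_group (carrier A' \<times> carrier B)\<^esub>
      (frag_extend (\<lambda>(a, b). frag_of (f a, b)) ` X)"

section \<open>Ext and Tor\<close>

text \<open>Homology at \<open>A\<close>, where \<open>Z\<close> is the kernel of the outgoing and \<open>B\<close> the image of the incoming
  map.\<close>

definition homology_at :: "'a ring \<Rightarrow> 'a set \<Rightarrow> 'a set \<Rightarrow> 'a set monoid"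
  where "homology_at A Z B = (A\<lparr>carrier := Z\<rparr>) A_Mod B"

text \<open>A chosen projective resolution, within the carrier type of \<open>A\<close>; one exists whenever that
  type is infinite and \<open>R\<close> embeds in it.\<close>

definition chosen_resolution ::
    "'r ring \<Rightarrow> ('r, 'u) module \<Rightarrow> (nat \<Rightarrow> ('r, 'u) module) \<times> (nat \<Rightarrow> 'u \<Rightarrow> 'u)"
  where "chosen_resolution R A = (SOME (P, d). \<exists>e. proj_resolution R A P d e)"

definition Ext :: "'r ring \<Rightarrow> nat \<Rightarrow> ('r, 'u) module \<Rightarrow> ('r, 'b) module \<Rightarrow> ('u \<Rightarrow> 'b) set monoid"
  where "Ext R i A B =
    (let (P, d) = chosen_resolution R A;
         H = (\<lambda>j. hom_group R (P j) B);
         \<delta> = (\<lambda>j f. \<lambda>x\<in>carrier (P (Suc j)). f (d j x))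
     in homology_at (H i) (a_kernel (H i) (H (Suc i)) (\<delta> i))
          (case i of 0 \<Rightarrow> {\<zero>\<^bsub>H 0\<^esub>} | Suc j \<Rightarrow> \<delta> j ` carrier (H j)))"

text \<open>\<open>A\<close> is a right and \<open>B\<close> a left \<open>R\<close>-module; the resolution is one of \<open>A\<close>.\<close>

definition Tor ::
    "'r ring \<Rightarrow> nat \<Rightarrow> ('r, 'u) module \<Rightarrow> ('r, 'b) module \<Rightarrow> ('u \<times> 'b \<Rightarrow>\<^sub>0 int) set set monoid"
  where "Tor R i A B =
    (let (P, d) = chosen_resolution (opp R) A;
         T = (\<lambda>j. tensor R (P j) B);
         \<delta> = (\<lambda>j. tensor_map R (P (Suc j)) (P j) B (d j))
     in homology_at (T i)
          (case i of 0 \<Rightarrow> carrier (T 0) | Suc j \<Rightarrow> a_kernel (T (Suc j)) (T j) (\<delta> j))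
          (\<delta> i ` carrier (T (Suc i))))"

section \<open>Injectivity and flatness relative to finitely presented modules\<close>

definition fp_injective :: "nat \<Rightarrow> 'r ring \<Rightarrow> ('r, 'u) module \<Rightarrow> bool"
  where "fp_injective n R M \<longleftrightarrow> lmodule R M \<and>
    (\<forall>(K :: ('r, 'u) module) (L :: ('r, 'u) module) j.
       fin_presented R n K \<and> fin_presented R n L \<and> j \<in> mhom R K L \<and> inj_on j (carrier K) \<longrightarrow>
       (\<forall>f \<in> mhom R K M. \<exists>g \<in> mhom R L M. \<forall>x\<in>carrier K. g (j x) = f x))"

definition fp_flat :: "nat \<Rightarrow> 'r ring \<Rightarrow> ('r, 'u) module \<Rightarrow> bool"
  where "fp_flat n R M \<longleftrightarrow> lmodule R M \<and>
    (\<forall>(K :: ('r, 'u) module) (L :: ('r, 'u) module) j.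
       fin_presented (opp R) n K \<and> fin_presented (opp R) n L \<and>
       j \<in> mhom (opp R) K L \<and> inj_on j (carrier K) \<longrightarrow>
       inj_on (tensor_map R K L M j) (carrier (tensor R K M)))"

section \<open>Bimodules\<close>

record ('s, 'r, 'c) bimodule = "('s, 'c) module" +
  rsmult :: "'c \<Rightarrow> 'r \<Rightarrow> 'c"

definition left_mod :: "('s, 'r, 'c) bimodule \<Rightarrow> ('s, 'c) module"
  where "left_mod C = module.truncate C"

definition right_mod :: "('s, 'r, 'c) bimodule \<Rightarrow> ('r, 'c) module"
  where "right_mod C =
    \<lparr>carrier = carrier C, mult = mult C, one = one C, zero = zero C, add = add C,
     smult = (\<lambda>r x. rsmult C x r)\<rparr>"

definition bimodule :: "'s ring \<Rightarrow> 'r ring \<Rightarrow> ('s, 'r, 'c) bimodule \<Rightarrow> bool"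
  where "bimodule S R C \<longleftrightarrow> lmodule S (left_mod C) \<and> lmodule (opp R) (right_mod C) \<and>
    (\<forall>s\<in>carrier S. \<forall>r\<in>carrier R. \<forall>x\<in>carrier C.
       s \<odot>\<^bsub>C\<^esub> rsmult C x r = rsmult C (s \<odot>\<^bsub>C\<^esub> x) r)"

text \<open>\<open>Hom\<^sub>S(C, N)\<close> as a left \<open>R\<close>-module, with \<open>(r f)(x) = f (x r)\<close>.\<close>

definition hom_mod :: "'s ring \<Rightarrow> ('s, 'r, 'c) bimodule \<Rightarrow> ('s, 'b) module \<Rightarrow> ('r, 'c \<Rightarrow> 'b) module"
  where "hom_mod S C N = ring.extend (hom_group S (left_mod C) N)
    (module.fields (\<lambda>r f. \<lambda>x\<in>carrier C. f (rsmult C x r)))"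

text \<open>\<open>C \<otimes>\<^sub>R M\<close> as a left \<open>S\<close>-module, with \<open>s (x \<otimes> m) = (s x) \<otimes> m\<close>.\<close>

definition tensor_mod ::
    "'r ring \<Rightarrow> ('s, 'r, 'c) bimodule \<Rightarrow> ('r, 'b) module \<Rightarrow> ('s, ('c \<times> 'b \<Rightarrow>\<^sub>0 int) set) module"
  where "tensor_mod R C M = ring.extend (tensor R (right_mod C) M)
    (module.fields (\<lambda>s. tensor_map R (right_mod C) (right_mod C) M (\<lambda>x. s \<odot>\<^bsub>C\<^esub> x)))"

text \<open>The evaluation map \<open>M \<rightarrow> Hom\<^sub>S(C, C \<otimes>\<^sub>R M)\<close>, \<open>m \<mapsto> (x \<mapsto> x \<otimes> m)\<close>.\<close>

definition eval_unit ::
    "'r ring \<Rightarrow> ('s, 'r, 'c) bimodule \<Rightarrow> ('r, 'b) module \<Rightarrow> 'b \<Rightarrow> 'c \<Rightarrow> ('c \<times> 'b \<Rightarrow>\<^sub>0 int) set"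
  where "eval_unit R C M m = (\<lambda>x\<in>carrier C. pure_tensor R (right_mod C) M x m)"

text \<open>The evaluation map \<open>C \<otimes>\<^sub>R Hom\<^sub>S(C, N) \<rightarrow> N\<close>, \<open>x \<otimes> f \<mapsto> f x\<close>.  The additive extension of
  \<open>(x, f) \<mapsto> f x\<close> to the free abelian group is constant on each coset.\<close>

definition eval_counit :: "('s, 'b) module \<Rightarrow> ('c \<times> ('c \<Rightarrow> 'b) \<Rightarrow>\<^sub>0 int) set \<Rightarrow> 'b"
  where "eval_counit N X =
    the_elem ((\<lambda>u. \<Oplus>\<^bsub>N\<^esub>p\<in>Poly_Mapping.keys u. [Poly_Mapping.lookup u p] \<cdot>\<^bsub>N\<^esub> (snd p (fst p))) ` X)"

text \<open>The homothety maps are isomorphisms for the additive structure as soon as they are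
  isomorphisms for any of the other structures (rings, bimodules), and conversely.\<close>

definition semidualizing :: "'s ring \<Rightarrow> 'r ring \<Rightarrow> ('s, 'r, 'u) bimodule \<Rightarrow> bool"
  where "semidualizing S R C \<longleftrightarrow>
    bimodule S R C \<and>
    (\<exists>P d e. proj_resolution S (left_mod C) P d e \<and> (\<forall>i. fin_gen S (P i))) \<and>
    (\<exists>P d e. proj_resolution (opp R) (right_mod C) P d e \<and> (\<forall>i. fin_gen (opp R) (P i))) \<and>
    (\<lambda>s. \<lambda>x\<in>carrier C. s \<odot>\<^bsub>C\<^esub> x)
      \<in> iso (add_monoid S) (add_monoid (hom_group (opp R) (right_mod C) (right_mod C))) \<and>
    (\<lambda>r. \<lambda>x\<in>carrier C. rsmult C x r)
      \<in> iso (add_monoid R) (add_monoid (hom_group S (left_mod C) (left_mod C))) \<and>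
    (\<forall>i\<ge>1. trivial_group (Ext S i (left_mod C) (left_mod C))) \<and>
    (\<forall>i\<ge>1. trivial_group (Ext (opp R) i (right_mod C) (right_mod C)))"

definition faithfully_semidualizing :: "'s ring \<Rightarrow> 'r ring \<Rightarrow> ('s, 'r, 'u) bimodule \<Rightarrow> bool"
  where "faithfully_semidualizing S R C \<longleftrightarrow>
    semidualizing S R C \<and>
    (\<forall>N :: ('s, 'u) module. lmodule S N \<longrightarrow>
       carrier (hom_group S (left_mod C) N) = {\<zero>\<^bsub>hom_group S (left_mod C) N\<^esub>} \<longrightarrow>
       carrier N = {\<zero>\<^bsub>N\<^esub>}) \<and>
    (\<forall>M :: ('r, 'u) module. lmodule (opp R) M \<longrightarrow>
       carrier (hom_group (opp R) (right_mod C) M) = {\<zero>\<^bsub>hom_group (opp R) (right_mod C) M\<^esub>} \<longrightarrow>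
       carrier M = {\<zero>\<^bsub>M\<^esub>})"

section \<open>Auslander and Bass classes and the classes defined by \<open>C\<close>\<close>

definition Auslander :: "'s ring \<Rightarrow> 'r ring \<Rightarrow> ('s, 'r, 'u) bimodule \<Rightarrow> ('r, 'm) module \<Rightarrow> bool"
  where "Auslander S R C M \<longleftrightarrow>
    lmodule R M \<and>
    (\<forall>i\<ge>1. trivial_group (Tor R i (right_mod C) M)) \<and>
    (\<forall>i\<ge>1. trivial_group (Ext S i (left_mod C) (tensor_mod R C M))) \<and>
    eval_unit R C M \<in> miso R M (hom_mod S C (tensor_mod R C M))"

definition Bass :: "'s ring \<Rightarrow> 'r ring \<Rightarrow> ('s, 'r, 'u) bimodule \<Rightarrow> ('s, 'm) module \<Rightarrow> bool"
  where "Bass S R C N \<longleftrightarrow>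
    lmodule S N \<and>
    (\<forall>i\<ge>1. trivial_group (Ext S i (left_mod C) N)) \<and>
    (\<forall>i\<ge>1. trivial_group (Tor R i (right_mod C) (hom_mod S C N))) \<and>
    eval_counit N \<in> miso S (tensor_mod R C (hom_mod S C N)) N"

definition C_fp_injective ::
    "nat \<Rightarrow> 's ring \<Rightarrow> 'r ring \<Rightarrow> ('s, 'r, 'u) bimodule \<Rightarrow> ('r, 'u) module \<Rightarrow> bool"
  where "C_fp_injective n S R C M \<longleftrightarrow> lmodule R M \<and>
    (\<exists>X :: ('s, 'u) module. fp_injective n S X \<and> miso R M (hom_mod S C X) \<noteq> {})"

definition C_fp_flat ::
    "nat \<Rightarrow> 's ring \<Rightarrow> 'r ring \<Rightarrow> ('s, 'r, 'u) bimodule \<Rightarrow> ('s, 'u) module \<Rightarrow> bool"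
  where "C_fp_flat n S R C N \<longleftrightarrow> lmodule S N \<and>
    (\<exists>Y :: ('r, 'u) module. fp_flat n R Y \<and> miso S N (tensor_mod R C Y) \<noteq> {})"

end

theory Submission
  imports Defs
begin

text \<open>Let \<open>P\<close> be a resolution of \<open>C\<close> by finitely generated projectives. Since \<open>Ext(C, C) = 0\<close> and the
  homothety maps are bijective, the dual complex \<open>Hom(P, C)\<close> is exact and starts with the ring;
  all its terms and images are finitely \<open>n\<close>-presented, because \<open>C\<close> is. Therefore \<open>Hom(-, X)\<close> with
  \<open>X\<close> \<open>fp\<^sub>n\<close>-injective and \<open>- \<otimes> Y\<close> with \<open>Y\<close> \<open>fp\<^sub>n\<close>-flat keep it exact, and the natural isomorphisms
  \<open>P \<otimes> Hom(C, X) \<cong> Hom(Hom(P, C), X)\<close> and \<open>Hom(P, C) \<otimes> Y \<cong> Hom(P, C \<otimes> Y)\<close> show that \<open>X\<close> is in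
  the Bass class and \<open>Y\<close> in the Auslander class. The Auslander class is closed under kernels of
  epimorphisms and the Bass class under cokernels of monomorphisms, and \<open>C \<otimes> -\<close> and \<open>Hom(C, -)\<close>
  are exact on short exact sequences in them, so resolutions are transported by induction on \<open>k\<close>.\<close>

text \<open>Ext and Tor are defined by a chosen projective resolution whose terms need not be
  finitely generated, while every argument needs dual bases. Hence \<open>Ext_vanish\<close> and
  \<open>Tor_vanish\<close> speak of a given resolution, and a homotopy argument shows that any
  resolution decides them. The second obstacle is the universe: \<open>projective\<close>,
  \<open>fp_injective\<close> and \<open>fp_flat\<close> test only modules with elements in
  \<open>'u\<close>, but Hom modules and tensor products have other types. So projectivity is
  replaced by a dual basis, which lifts maps into modules of every type, and finite presentation by
  \<open>fpg\<close>, which speaks of syzygies in finite powers of the ring. A module that has to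
  return to \<open>'u\<close> is finitely generated or no larger than a finite power of a module
  there. That the dual complex is finitely presented rests on two facts: \<open>Hom(P, C)\<close> is
  a direct summand of a power of C, and the cokernel of an \<open>n\<close>-presented module in an
  \<open>(n+1)\<close>-presented one is \<open>(n+1)\<close>-presented.\<close>

definition ahom :: "('a, 'x) ring_scheme \<Rightarrow> ('b, 'y) ring_scheme \<Rightarrow> ('a \<Rightarrow> 'b) set"
  where "ahom G H = {f \<in> carrier G \<rightarrow> carrier H.
    \<forall>x\<in>carrier G. \<forall>y\<in>carrier G. f (x \<oplus>\<^bsub>G\<^esub> y) = f x \<oplus>\<^bsub>H\<^esub> f y}"

lemma ahomI:
  assumes "\<And>x. x \<in> carrier G \<Longrightarrow> f x \<in> carrier H"
    and "\<And>x y. x \<in> carrier G \<Longrightarrow> y \<in> carrier G \<Longrightarrow> f (x \<oplus>\<^bsub>G\<^esub> y) = f x \<oplus>\<^bsub>H\<^esub> f y"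
  shows "f \<in> ahom G H"
  using assms by (auto simp: ahom_def)

lemma ahom_closed: "f \<in> ahom G H \<Longrightarrow> x \<in> carrier G \<Longrightarrow> f x \<in> carrier H"
  by (auto simp: ahom_def)

lemma ahom_add:
  "f \<in> ahom G H \<Longrightarrow> x \<in> carrier G \<Longrightarrow> y \<in> carrier G \<Longrightarrow> f (x \<oplus>\<^bsub>G\<^esub> y) = f x \<oplus>\<^bsub>H\<^esub> f y"
  by (auto simp: ahom_def)

lemma ahom_zero:
  assumes "abelian_group G" "abelian_group H" "f \<in> ahom G H"
  shows "f \<zero>\<^bsub>G\<^esub> = \<zero>\<^bsub>H\<^esub>"
proof -
  interpret G: abelian_group G by fact
  interpret H: abelian_group H by fact
  have "f \<zero>\<^bsub>G\<^esub> \<oplus>\<^bsub>H\<^esub> f \<zero>\<^bsub>G\<^esub> = f \<zero>\<^bsub>G\<^esub>"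
    using ahom_add[OF assms(3), of "\<zero>\<^bsub>G\<^esub>" "\<zero>\<^bsub>G\<^esub>"] ahom_closed[OF assms(3)] by simp
  then show ?thesis
    using ahom_closed[OF assms(3)] using H.add.l_cancel_one by (meson G.zero_closed)
qed

lemma ahom_neg:
  assumes "abelian_group G" "abelian_group H" "f \<in> ahom G H" "x \<in> carrier G"
  shows "f (\<ominus>\<^bsub>G\<^esub> x) = \<ominus>\<^bsub>H\<^esub> f x"
proof -
  interpret G: abelian_group G by fact
  interpret H: abelian_group H by fact
  have "f (\<ominus>\<^bsub>G\<^esub> x) \<oplus>\<^bsub>H\<^esub> f x = \<zero>\<^bsub>H\<^esub>"
    using ahom_add[OF assms(3), of "\<ominus>\<^bsub>G\<^esub> x" x] ahom_zero[OF assms(1-3)] assms(4)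
    by (simp add: G.l_neg)
  then show ?thesis
    using ahom_closed[OF assms(3)] assms(4) by (metis G.a_inv_closed H.minus_equality)
qed

lemma ahom_minus:
  assumes "abelian_group G" "abelian_group H" "f \<in> ahom G H" "x \<in> carrier G" "y \<in> carrier G"
  shows "f (x \<ominus>\<^bsub>G\<^esub> y) = f x \<ominus>\<^bsub>H\<^esub> f y"
proof -
  interpret G: abelian_group G by fact
  interpret H: abelian_group H by fact
  show ?thesis
    using assms ahom_add[OF assms(3), of x "\<ominus>\<^bsub>G\<^esub> y"] ahom_neg[OF assms(1-3)]
    by (simp add: G.minus_eq H.minus_eq)
qed

lemma ahom_comp: "f \<in> ahom G H \<Longrightarrow> g \<in> ahom H K \<Longrightarrow> (\<lambda>x. g (f x)) \<in> ahom G K"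
  by (auto simp: ahom_def Pi_iff)

lemma (in abelian_group) minus_add_cancel [simp]:
  "x \<in> carrier G \<Longrightarrow> y \<in> carrier G \<Longrightarrow> (x \<ominus> y) \<oplus> y = x"
  by (simp add: minus_eq a_assoc l_neg)

lemma (in abelian_group) minus_eq_zero_iff:
  "x \<in> carrier G \<Longrightarrow> y \<in> carrier G \<Longrightarrow> x \<ominus> y = \<zero> \<longleftrightarrow> x = y"
  using minus_add_cancel[of x y] by (auto simp: minus_eq r_neg simp del: minus_add_cancel)

lemma ahom_inj:
  assumes "abelian_group G" "abelian_group H" "f \<in> ahom G H"
    and "\<And>x. x \<in> carrier G \<Longrightarrow> f x = \<zero>\<^bsub>H\<^esub> \<Longrightarrow> x = \<zero>\<^bsub>G\<^esub>"
  shows "inj_on f (carrier G)"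
proof (rule inj_onI)
  interpret G: abelian_group G by fact
  interpret H: abelian_group H by fact
  fix x y assume xy: "x \<in> carrier G" "y \<in> carrier G" "f x = f y"
  have "f (x \<ominus>\<^bsub>G\<^esub> y) = \<zero>\<^bsub>H\<^esub>"
    using ahom_minus[OF assms(1-3) xy(1,2)] xy ahom_closed[OF assms(3)]
    by (simp add: H.minus_eq_zero_iff)
  then have "x \<ominus>\<^bsub>G\<^esub> y = \<zero>\<^bsub>G\<^esub>"
    by (intro assms(4)) (use xy in auto)
  then show "x = y"
    using xy by (simp add: G.minus_eq_zero_iff)
qed

section \<open>Finite sums indexed by initial segments of the naturals\<close>

text \<open>Recursion instead of \<open>finsum\<close>: unfolding and congruence then need no
  membership in the carrier, and a sum in a module of functions is evaluated at a point by plain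
  induction.\<close>

primrec gsum :: "('a, 'x) ring_scheme \<Rightarrow> (nat \<Rightarrow> 'a) \<Rightarrow> nat \<Rightarrow> 'a"
  where
    "gsum G f 0 = \<zero>\<^bsub>G\<^esub>"
  | "gsum G f (Suc n) = gsum G f n \<oplus>\<^bsub>G\<^esub> f n"

lemma gsum_cong: "(\<And>i. i < n \<Longrightarrow> f i = g i) \<Longrightarrow> gsum G f n = gsum G g n"
  by (induction n) auto

lemma gsum_eq_finsum:
  assumes "abelian_group G" "\<And>i. i < n \<Longrightarrow> f i \<in> carrier G"
  shows "gsum G f n = finsum G f {..<n}"
  using assms(2)
proof (induction n)
  interpret abelian_group G by fact
  case 0
  show ?case by simp
next
  interpret abelian_group G by fact
  case (Suc n)
  have "{..<Suc n} = insert n {..<n}" by auto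
  then show ?case
    using Suc by (simp add: Pi_def a_comm)
qed

context abelian_group
begin

lemma gsum_closed [simp, intro]: "(\<And>i. i < n \<Longrightarrow> f i \<in> carrier G) \<Longrightarrow> gsum G f n \<in> carrier G"
  by (induction n) auto

lemma gsum_zero [simp]: "gsum G (\<lambda>i. \<zero>) n = \<zero>"
  by (induction n) auto

lemma gsum_add:
  "(\<And>i. i < n \<Longrightarrow> f i \<in> carrier G) \<Longrightarrow> (\<And>i. i < n \<Longrightarrow> g i \<in> carrier G) \<Longrightarrow>
    gsum G (\<lambda>i. f i \<oplus> g i) n = gsum G f n \<oplus> gsum G g n"
  by (induction n) (simp_all add: a_ac)

lemma gsum_append:
  "(\<And>i. i < m + n \<Longrightarrow> f i \<in> carrier G) \<Longrightarrow>
    gsum G f (m + n) = gsum G f m \<oplus> gsum G (\<lambda>i. f (m + i)) n"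
  by (induction n) (simp_all add: a_ac)

lemma gsum_single:
  assumes "j < n" "x \<in> carrier G"
  shows "gsum G (\<lambda>i. if i = j then x else \<zero>) n = x"
  using assms(1)
proof (induction n)
  case (Suc n)
  show ?case
  proof (cases "j = n")
    case True
    have "gsum G (\<lambda>i. if i = j then x else \<zero>) n = gsum G (\<lambda>i. \<zero>) n"
      by (rule gsum_cong) (simp add: True)
    then show ?thesis using True assms by simp
  next
    case False
    then show ?thesis using Suc assms by simp
  qed
qed simp

end

lemma ahom_gsum:
  assumes "abelian_group G" "abelian_group H" "f \<in> ahom G H" "\<And>i. i < n \<Longrightarrow> x i \<in> carrier G"
  shows "f (gsum G x n) = gsum H (\<lambda>i. f (x i)) n"
  using assms(4)
proof (induction n)
  case 0
  show ?case using ahom_zero[OF assms(1-3)] by simp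
next
  interpret abelian_group G by fact
  case (Suc n)
  then show ?case by (simp add: ahom_add[OF assms(3)])
qed

section \<open>Modules\<close>

lemma lmodule_ab: "lmodule R M \<Longrightarrow> abelian_group M"
  by (rule lmodule.axioms)

lemma lmodule_ring: "lmodule R M \<Longrightarrow> ring R"
  by (rule lmodule.axioms)

lemma lmoduleI':
  assumes "ring R" "abelian_group M"
    and "\<And>a x. a \<in> carrier R \<Longrightarrow> x \<in> carrier M \<Longrightarrow> a \<odot>\<^bsub>M\<^esub> x \<in> carrier M"
    and "\<And>a b x. a \<in> carrier R \<Longrightarrow> b \<in> carrier R \<Longrightarrow> x \<in> carrier M \<Longrightarrow>
      (a \<oplus>\<^bsub>R\<^esub> b) \<odot>\<^bsub>M\<^esub> x = a \<odot>\<^bsub>M\<^esub> x \<oplus>\<^bsub>M\<^esub> b \<odot>\<^bsub>M\<^esub> x"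
    and "\<And>a x y. a \<in> carrier R \<Longrightarrow> x \<in> carrier M \<Longrightarrow> y \<in> carrier M \<Longrightarrow>
      a \<odot>\<^bsub>M\<^esub> (x \<oplus>\<^bsub>M\<^esub> y) = a \<odot>\<^bsub>M\<^esub> x \<oplus>\<^bsub>M\<^esub> a \<odot>\<^bsub>M\<^esub> y"
    and "\<And>a b x. a \<in> carrier R \<Longrightarrow> b \<in> carrier R \<Longrightarrow> x \<in> carrier M \<Longrightarrow>
      (a \<otimes>\<^bsub>R\<^esub> b) \<odot>\<^bsub>M\<^esub> x = a \<odot>\<^bsub>M\<^esub> (b \<odot>\<^bsub>M\<^esub> x)"
    and "\<And>x. x \<in> carrier M \<Longrightarrow> \<one>\<^bsub>R\<^esub> \<odot>\<^bsub>M\<^esub> x = x"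
  shows "lmodule R M"
  using assms by (simp add: lmodule_def lmodule_axioms_def)

context lmodule
begin

lemma smult_zero [simp]: "a \<in> carrier R \<Longrightarrow> a \<odot>\<^bsub>M\<^esub> \<zero>\<^bsub>M\<^esub> = \<zero>\<^bsub>M\<^esub>"
  using smult_r_distr[of a "\<zero>\<^bsub>M\<^esub>" "\<zero>\<^bsub>M\<^esub>"] M.zero_closed smult_closed[of a "\<zero>\<^bsub>M\<^esub>"]
  M.add.l_cancel_one[of "a \<odot>\<^bsub>M\<^esub> \<zero>\<^bsub>M\<^esub>" "a \<odot>\<^bsub>M\<^esub> \<zero>\<^bsub>M\<^esub>"] by simp

lemma zero_smult [simp]: "x \<in> carrier M \<Longrightarrow> \<zero> \<odot>\<^bsub>M\<^esub> x = \<zero>\<^bsub>M\<^esub>"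
  using smult_l_distr[of \<zero> \<zero> x] smult_closed[of \<zero> x]
  M.add.l_cancel_one[of "\<zero> \<odot>\<^bsub>M\<^esub> x" "\<zero> \<odot>\<^bsub>M\<^esub> x"] by simp

lemma smult_ahom: "a \<in> carrier R \<Longrightarrow> (\<lambda>x. a \<odot>\<^bsub>M\<^esub> x) \<in> ahom M M"
  by (auto intro!: ahomI simp: smult_r_distr)

lemma neg_eq_smult: "x \<in> carrier M \<Longrightarrow> \<ominus>\<^bsub>M\<^esub> x = (\<ominus> \<one>) \<odot>\<^bsub>M\<^esub> x"
  using smult_l_distr[of "\<ominus> \<one>" \<one> x] by (simp add: R.l_neg M.minus_equality)

lemma smult_neg: "a \<in> carrier R \<Longrightarrow> x \<in> carrier M \<Longrightarrow> a \<odot>\<^bsub>M\<^esub> (\<ominus>\<^bsub>M\<^esub> x) = \<ominus>\<^bsub>M\<^esub> (a \<odot>\<^bsub>M\<^esub> x)"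
  using ahom_neg[OF M.abelian_group_axioms M.abelian_group_axioms smult_ahom] .

lemma smult_l_ahom: "x \<in> carrier M \<Longrightarrow> (\<lambda>a. a \<odot>\<^bsub>M\<^esub> x) \<in> ahom R M"
  by (auto intro!: ahomI simp: smult_l_distr)

end

lemma mhomI:
  assumes "\<And>x. x \<in> carrier A \<Longrightarrow> f x \<in> carrier B"
    and "\<And>x y. x \<in> carrier A \<Longrightarrow> y \<in> carrier A \<Longrightarrow> f (x \<oplus>\<^bsub>A\<^esub> y) = f x \<oplus>\<^bsub>B\<^esub> f y"
    and "\<And>r x. r \<in> carrier R \<Longrightarrow> x \<in> carrier A \<Longrightarrow> f (r \<odot>\<^bsub>A\<^esub> x) = r \<odot>\<^bsub>B\<^esub> f x"
  shows "f \<in> mhom R A B"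
  using assms by (auto simp: mhom_def)

lemma mhom_ahom: "f \<in> mhom R A B \<Longrightarrow> f \<in> ahom A B"
  by (auto simp: mhom_def ahom_def)

lemma mhom_closed: "f \<in> mhom R A B \<Longrightarrow> x \<in> carrier A \<Longrightarrow> f x \<in> carrier B"
  by (auto simp: mhom_def)

lemma mhom_add:
  "f \<in> mhom R A B \<Longrightarrow> x \<in> carrier A \<Longrightarrow> y \<in> carrier A \<Longrightarrow> f (x \<oplus>\<^bsub>A\<^esub> y) = f x \<oplus>\<^bsub>B\<^esub> f y"
  by (auto simp: mhom_def)

lemma mhom_smult:
  "f \<in> mhom R A B \<Longrightarrow> r \<in> carrier R \<Longrightarrow> x \<in> carrier A \<Longrightarrow> f (r \<odot>\<^bsub>A\<^esub> x) = r \<odot>\<^bsub>B\<^esub> f x"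
  by (auto simp: mhom_def)

lemma mhom_zero: "lmodule R A \<Longrightarrow> lmodule R B \<Longrightarrow> f \<in> mhom R A B \<Longrightarrow> f \<zero>\<^bsub>A\<^esub> = \<zero>\<^bsub>B\<^esub>"
  by (blast intro: ahom_zero lmodule_ab mhom_ahom)

lemma mhom_neg:
  "lmodule R A \<Longrightarrow> lmodule R B \<Longrightarrow> f \<in> mhom R A B \<Longrightarrow> x \<in> carrier A \<Longrightarrow>
    f (\<ominus>\<^bsub>A\<^esub> x) = \<ominus>\<^bsub>B\<^esub> f x"
  by (blast intro: ahom_neg lmodule_ab mhom_ahom)

lemma mhom_minus:
  "lmodule R A \<Longrightarrow> lmodule R B \<Longrightarrow> f \<in> mhom R A B \<Longrightarrow> x \<in> carrier A \<Longrightarrow> y \<in> carrier A \<Longrightarrow>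
    f (x \<ominus>\<^bsub>A\<^esub> y) = f x \<ominus>\<^bsub>B\<^esub> f y"
  by (blast intro: ahom_minus lmodule_ab mhom_ahom)

lemma mhom_gsum:
  "lmodule R A \<Longrightarrow> lmodule R B \<Longrightarrow> f \<in> mhom R A B \<Longrightarrow> (\<And>i. i < n \<Longrightarrow> x i \<in> carrier A) \<Longrightarrow>
    f (gsum A x n) = gsum B (\<lambda>i. f (x i)) n"
  by (blast intro: ahom_gsum lmodule_ab mhom_ahom)

lemma mhom_comp: "f \<in> mhom R A B \<Longrightarrow> g \<in> mhom R B D \<Longrightarrow> (\<lambda>x. g (f x)) \<in> mhom R A D"
  by (auto simp: mhom_def Pi_iff)

lemma mhom_id: "(\<lambda>x. x) \<in> mhom R A A"
  by (auto simp: mhom_def)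

lemma mhom_cong:
  "lmodule R A \<Longrightarrow> f \<in> mhom R A B \<Longrightarrow> (\<And>x. x \<in> carrier A \<Longrightarrow> g x = f x) \<Longrightarrow> g \<in> mhom R A B"
  unfolding mhom_def
  by (auto simp: lmodule.smult_closed abelian_monoid.a_closed[OF abelian_group.axioms(1)[OF lmodule_ab]])

lemma mhom_zero_map: "lmodule R B \<Longrightarrow> (\<lambda>x. \<zero>\<^bsub>B\<^esub>) \<in> mhom R A B"
proof -
  assume "lmodule R B"
  then interpret B: lmodule R B .
  show ?thesis by (auto simp: mhom_def)
qed

lemma mhom_add_map:
  assumes "lmodule R B" "f \<in> mhom R A B" "g \<in> mhom R A B"
  shows "(\<lambda>x. f x \<oplus>\<^bsub>B\<^esub> g x) \<in> mhom R A B"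
proof -
  interpret B: lmodule R B by fact
  show ?thesis
    using assms(2,3)
    by (intro mhomI) (auto simp: mhom_closed mhom_add mhom_smult B.a_ac B.smult_r_distr)
qed

lemma mhom_neg_map:
  assumes "lmodule R B" "f \<in> mhom R A B"
  shows "(\<lambda>x. \<ominus>\<^bsub>B\<^esub> f x) \<in> mhom R A B"
proof -
  interpret B: lmodule R B by fact
  show ?thesis
    using assms(2)
    by (intro mhomI) (auto simp: mhom_closed mhom_add mhom_smult B.minus_add B.smult_neg)
qed

lemma mhom_diff_map:
  assumes "lmodule R B" "f \<in> mhom R A B" "g \<in> mhom R A B"
  shows "(\<lambda>x. f x \<ominus>\<^bsub>B\<^esub> g x) \<in> mhom R A B"
proof -
  interpret B: lmodule R B by fact
  show ?thesis
    using mhom_add_map[OF assms(1,2) mhom_neg_map[OF assms(1,3)]] by (simp add: B.minus_eq)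
qed

lemma mhom_gsum_map:
  assumes "lmodule R B" "\<And>i. i < n \<Longrightarrow> f i \<in> mhom R A B"
  shows "(\<lambda>x. gsum B (\<lambda>i. f i x) n) \<in> mhom R A B"
  using assms(2) by (induction n) (auto intro: mhom_add_map[OF assms(1)] mhom_zero_map[OF assms(1)])

lemma misoD:
  assumes "f \<in> miso R A B"
  shows "f \<in> mhom R A B" "inj_on f (carrier A)" "f ` carrier A = carrier B"
  using assms by (auto simp: miso_def bij_betw_def)

lemma misoI: "f \<in> mhom R A B \<Longrightarrow> inj_on f (carrier A) \<Longrightarrow> f ` carrier A = carrier B \<Longrightarrow> f \<in> miso R A B"
  by (auto simp: miso_def bij_betw_def)

lemma inv_mhom:
  assumes "lmodule R A" "f \<in> mhom R A B" "inj_on f (carrier A)" "f ` carrier A = carrier B"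
  shows "inv_into (carrier A) f \<in> mhom R B A"
proof (rule mhomI)
  interpret A: lmodule R A by fact
  let ?g = "inv_into (carrier A) f"
  have g: "?g y \<in> carrier A" "f (?g y) = y" if "y \<in> carrier B" for y
    using that assms(4) by (metis inv_into_into, metis f_inv_into_f)
  have gf: "x \<in> carrier A \<Longrightarrow> ?g (f x) = x" for x
    using assms(3) by simp
  show "?g y \<in> carrier A" if "y \<in> carrier B" for y using g that by blast
  show "?g (x \<oplus>\<^bsub>B\<^esub> y) = ?g x \<oplus>\<^bsub>A\<^esub> ?g y" if "x \<in> carrier B" "y \<in> carrier B" for x y
    using that g gf[of "?g x \<oplus>\<^bsub>A\<^esub> ?g y"] mhom_add[OF assms(2)] by simp
  show "?g (r \<odot>\<^bsub>B\<^esub> x) = r \<odot>\<^bsub>A\<^esub> ?g x" if "r \<in> carrier R" "x \<in> carrier B" for r x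
    using that g gf[of "r \<odot>\<^bsub>A\<^esub> ?g x"] mhom_smult[OF assms(2)] by simp
qed

lemma miso_inv: "lmodule R A \<Longrightarrow> f \<in> miso R A B \<Longrightarrow> inv_into (carrier A) f \<in> miso R B A"
  using inv_mhom[of R A f B] misoD[of f R A B]
  by (metis inj_on_inv_into inv_into_image_cancel misoI subset_refl)

lemma miso_comp: "f \<in> miso R A B \<Longrightarrow> g \<in> miso R B D \<Longrightarrow> (\<lambda>x. g (f x)) \<in> miso R A D"
  unfolding miso_def
  by (auto intro: mhom_comp bij_betw_trans[unfolded comp_def])

lemma a_kernel_eq: "a_kernel A B f = {x \<in> carrier A. f x = \<zero>\<^bsub>B\<^esub>}"
  by (simp add: a_kernel_def kernel_def)

text \<open>Negatives come from the scalar \<open>-1\<close>, so closure under addition and scalars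
  already gives a subgroup.\<close>

lemma lmodule_sub:
  assumes "lmodule R M" "K \<subseteq> carrier M" "\<zero>\<^bsub>M\<^esub> \<in> K"
    and "\<And>x y. x \<in> K \<Longrightarrow> y \<in> K \<Longrightarrow> x \<oplus>\<^bsub>M\<^esub> y \<in> K"
    and "\<And>r x. r \<in> carrier R \<Longrightarrow> x \<in> K \<Longrightarrow> r \<odot>\<^bsub>M\<^esub> x \<in> K"
  shows "lmodule R (M\<lparr>carrier := K\<rparr>)"
proof -
  interpret M: lmodule R M by fact
  have K: "x \<in> carrier M" if "x \<in> K" for x using that assms(2) by blast
  have "abelian_group (M\<lparr>carrier := K\<rparr>)"
  proof (rule abelian_groupI; simp)
    fix x assume x: "x \<in> K"
    show "\<exists>y\<in>K. y \<oplus>\<^bsub>M\<^esub> x = \<zero>\<^bsub>M\<^esub>"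
    proof
      show "\<ominus>\<^bsub>M\<^esub> x \<in> K"
        using x K assms(5)[of "\<ominus>\<^bsub>R\<^esub> \<one>\<^bsub>R\<^esub>" x] by (simp add: M.neg_eq_smult)
      show "\<ominus>\<^bsub>M\<^esub> x \<oplus>\<^bsub>M\<^esub> x = \<zero>\<^bsub>M\<^esub>" using x K by (simp add: M.l_neg)
    qed
  qed (use assms(3,4) K M.a_ac in auto)
  then show ?thesis
    by (intro lmoduleI' M.ring_axioms)
      (use K assms(5) M.smult_l_distr M.smult_r_distr M.smult_assoc in auto)
qed

abbreviation sub :: "('r, 'a) module \<Rightarrow> 'a set \<Rightarrow> ('r, 'a) module"
  where "sub M K \<equiv> M\<lparr>carrier := K\<rparr>"

lemma lmodule_kernel:
  assumes "lmodule R A" "lmodule R B" "f \<in> mhom R A B"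
  shows "lmodule R (sub A {x \<in> carrier A. f x = \<zero>\<^bsub>B\<^esub>})"
proof -
  interpret A: lmodule R A by fact
  interpret B: lmodule R B by fact
  show ?thesis
    by (rule lmodule_sub[OF assms(1)])
      (auto simp: mhom_zero[OF assms] mhom_add[OF assms(3)] mhom_smult[OF assms(3)])
qed

lemma lmodule_image:
  assumes "lmodule R A" "lmodule R B" "f \<in> mhom R A B"
  shows "lmodule R (sub B (f ` carrier A))"
proof -
  interpret A: lmodule R A by fact
  interpret B: lmodule R B by fact
  show ?thesis
  proof (rule lmodule_sub[OF assms(2)])
    show "\<zero>\<^bsub>B\<^esub> \<in> f ` carrier A" using mhom_zero[OF assms] by (metis A.zero_closed imageI)
    show "x \<oplus>\<^bsub>B\<^esub> y \<in> f ` carrier A" if "x \<in> f ` carrier A" "y \<in> f ` carrier A" for x y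
      using that mhom_add[OF assms(3)] by (metis (no_types, lifting) A.a_closed image_iff)
    show "r \<odot>\<^bsub>B\<^esub> x \<in> f ` carrier A" if "r \<in> carrier R" "x \<in> f ` carrier A" for r x
      using that mhom_smult[OF assms(3)] by (metis (no_types, lifting) A.smult_closed image_iff)
  qed (use mhom_closed[OF assms(3)] in auto)
qed

lemma mhom_into_sub: "f \<in> mhom R A B \<Longrightarrow> (\<And>x. x \<in> carrier A \<Longrightarrow> f x \<in> K) \<Longrightarrow> f \<in> mhom R A (sub B K)"
  by (auto simp: mhom_def)

lemma mhom_restrict_sub: "f \<in> mhom R A B \<Longrightarrow> K \<subseteq> carrier A \<Longrightarrow> f \<in> mhom R (sub A K) B"
  by (simp add: mhom_def Pi_iff subset_iff)

section \<open>Short exact sequences\<close>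

text \<open>The three terms have unrelated carrier types because applying \<open>Hom(C, -)\<close>
  or \<open>C \<otimes> -\<close> changes the type of each term.\<close>

definition ses :: "'r ring \<Rightarrow> ('r, 'a) module \<Rightarrow> ('a \<Rightarrow> 'b) \<Rightarrow> ('r, 'b) module \<Rightarrow> ('b \<Rightarrow> 'd) \<Rightarrow> ('r, 'd) module \<Rightarrow> bool"
  where "ses R A f B g D \<longleftrightarrow> lmodule R A \<and> lmodule R B \<and> lmodule R D \<and>
    f \<in> mhom R A B \<and> g \<in> mhom R B D \<and> inj_on f (carrier A) \<and> g ` carrier B = carrier D \<and>
    f ` carrier A = {y \<in> carrier B. g y = \<zero>\<^bsub>D\<^esub>}"

lemma sesD:
  assumes "ses R A f B g D"
  shows "lmodule R A" "lmodule R B" "lmodule R D" "f \<in> mhom R A B" "g \<in> mhom R B D"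
    "inj_on f (carrier A)" "g ` carrier B = carrier D" "\<And>x. x \<in> carrier A \<Longrightarrow> g (f x) = \<zero>\<^bsub>D\<^esub>"
    "\<And>y. y \<in> carrier B \<Longrightarrow> g y = \<zero>\<^bsub>D\<^esub> \<Longrightarrow> \<exists>x\<in>carrier A. y = f x"
  using assms unfolding ses_def by auto

lemma sesI:
  assumes "lmodule R A" "lmodule R B" "lmodule R D" "f \<in> mhom R A B" "g \<in> mhom R B D"
    "inj_on f (carrier A)" "g ` carrier B = carrier D" "\<And>x. x \<in> carrier A \<Longrightarrow> g (f x) = \<zero>\<^bsub>D\<^esub>"
    "\<And>y. y \<in> carrier B \<Longrightarrow> g y = \<zero>\<^bsub>D\<^esub> \<Longrightarrow> \<exists>x\<in>carrier A. y = f x"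
  shows "ses R A f B g D"
proof -
  have "f ` carrier A = {y \<in> carrier B. g y = \<zero>\<^bsub>D\<^esub>}"
    using assms(8,9) mhom_closed[OF assms(4)] by blast
  then show ?thesis
    using assms(1-7) unfolding ses_def by blast
qed

lemma ses_kernel_image:
  assumes "lmodule R A" "lmodule R B" "f \<in> mhom R A B"
  shows "ses R (sub A {x \<in> carrier A. f x = \<zero>\<^bsub>B\<^esub>}) (\<lambda>x. x) A f (sub B (f ` carrier A))"
proof (rule sesI)
  show "f \<in> mhom R A (sub B (f ` carrier A))"
    by (rule mhom_into_sub[OF assms(3)]) simp
qed (auto intro: lmodule_kernel lmodule_image mhom_restrict_sub[OF mhom_id] assms)

text \<open>Views an isomorphism as a short exact sequence with third term zero, so that closure of
  a class under kernels of epimorphisms contains its closure under isomorphism.\<close>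

lemma ses_miso:
  assumes "lmodule R A" "lmodule R B" "lmodule R Z" "carrier Z = {\<zero>\<^bsub>Z\<^esub>}" "f \<in> miso R A B"
  shows "ses R A f B (\<lambda>_. \<zero>\<^bsub>Z\<^esub>) Z"
proof (rule sesI[OF assms(1-3)])
  note f = misoD[OF assms(5)]
  interpret B: lmodule R B by fact
  show "f \<in> mhom R A B" "inj_on f (carrier A)" using f by blast+
  show "(\<lambda>_. \<zero>\<^bsub>Z\<^esub>) \<in> mhom R B Z" by (rule mhom_zero_map[OF assms(3)])
  show "(\<lambda>_. \<zero>\<^bsub>Z\<^esub>) ` carrier B = carrier Z"
    using assms(4) B.zero_closed by auto
  show "\<exists>x\<in>carrier A. y = f x" if "y \<in> carrier B" for y
    using f(3) that by blast
qed simp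

lemma ses_factor:
  assumes s: "ses R A f B g D" and "lmodule R Q" "h \<in> mhom R Q B" "\<And>x. x \<in> carrier Q \<Longrightarrow> g (h x) = \<zero>\<^bsub>D\<^esub>"
  shows "\<exists>k\<in>mhom R Q A. \<forall>x\<in>carrier Q. f (k x) = h x"
proof -
  note S = sesD[OF s]
  have *: "h x \<in> f ` carrier A" if "x \<in> carrier Q" for x
    using S(9)[OF mhom_closed[OF assms(3) that] assms(4)[OF that]] by blast
  have h: "h \<in> mhom R Q (sub B (f ` carrier A))"
    by (rule mhom_into_sub[OF assms(3) *])
  have "f \<in> mhom R A (sub B (f ` carrier A))"
    by (rule mhom_into_sub[OF S(4)]) simp
  then have i: "inv_into (carrier A) f \<in> mhom R (sub B (f ` carrier A)) A"
    by (rule inv_mhom[OF S(1) _ S(6)]) simp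
  show ?thesis
  proof (rule bexI[OF _ mhom_comp[OF h i]], rule ballI)
    show "f (inv_into (carrier A) f (h x)) = h x" if "x \<in> carrier Q" for x
      by (rule f_inv_into_f[OF *[OF that]])
  qed
qed

text \<open>Two points of one fibre of \<open>e\<close> differ by an element of its kernel, on which
  \<open>z\<close> vanishes; so \<open>z\<close> after any choice of preimages is linear. This is
  how maps on a cover descend to the module covered.\<close>

lemma factor_onto:
  assumes P: "lmodule R P" and A: "lmodule R A" and B: "lmodule R B"
    and e: "e \<in> mhom R P A" "e ` carrier P = carrier A" and z: "z \<in> mhom R P B"
    and k: "\<And>x. x \<in> carrier P \<Longrightarrow> e x = \<zero>\<^bsub>A\<^esub> \<Longrightarrow> z x = \<zero>\<^bsub>B\<^esub>"
  shows "\<exists>h\<in>mhom R A B. \<forall>x\<in>carrier P. h (e x) = z x"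
proof -
  interpret P: lmodule R P by fact
  interpret A: lmodule R A by fact
  interpret B: lmodule R B by fact
  let ?i = "inv_into (carrier P) e"
  have i: "?i y \<in> carrier P" "e (?i y) = y" if "y \<in> carrier A" for y
    using that e(2) by (metis inv_into_into, metis f_inv_into_f)
  have ze: "z x = z y" if "x \<in> carrier P" "y \<in> carrier P" "e x = e y" for x y
  proof -
    have "e (x \<ominus>\<^bsub>P\<^esub> y) = \<zero>\<^bsub>A\<^esub>"
      using mhom_minus[OF P A e(1)] that mhom_closed[OF e(1)] by (simp add: A.minus_eq_zero_iff)
    then have "z (x \<ominus>\<^bsub>P\<^esub> y) = \<zero>\<^bsub>B\<^esub>" by (rule k[OF P.minus_closed[OF that(1,2)]])
    then show ?thesis
      using mhom_minus[OF P B z] that mhom_closed[OF z] by (simp add: B.minus_eq_zero_iff)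
  qed
  have "(\<lambda>y. z (?i y)) \<in> mhom R A B"
  proof (rule mhomI)
    show "z (?i y) \<in> carrier B" if "y \<in> carrier A" for y using i that mhom_closed[OF z] by blast
    show "z (?i (x \<oplus>\<^bsub>A\<^esub> y)) = z (?i x) \<oplus>\<^bsub>B\<^esub> z (?i y)" if "x \<in> carrier A" "y \<in> carrier A" for x y
    proof -
      have "z (?i (x \<oplus>\<^bsub>A\<^esub> y)) = z (?i x \<oplus>\<^bsub>P\<^esub> ?i y)"
        by (rule ze) (use i that mhom_add[OF e(1)] in auto)
      then show ?thesis using mhom_add[OF z] i that by simp
    qed
    show "z (?i (r \<odot>\<^bsub>A\<^esub> x)) = r \<odot>\<^bsub>B\<^esub> z (?i x)" if "r \<in> carrier R" "x \<in> carrier A" for r x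
    proof -
      have "z (?i (r \<odot>\<^bsub>A\<^esub> x)) = z (r \<odot>\<^bsub>P\<^esub> ?i x)"
        by (rule ze) (use i that mhom_smult[OF e(1)] in auto)
      then show ?thesis using mhom_smult[OF z] i that by simp
    qed
  qed
  moreover have "z (?i (e x)) = z x" if "x \<in> carrier P" for x
    by (rule ze) (use i that mhom_closed[OF e(1)] in auto)
  ultimately show ?thesis by (intro bexI[of _ "\<lambda>y. z (?i y)"]) simp_all
qed

section \<open>Regular modules and powers\<close>

definition reg :: "'r ring \<Rightarrow> ('r, 'r) module"
  where "reg R = \<lparr>carrier = carrier R, mult = mult R, one = one R, zero = zero R, add = add R, smult = mult R\<rparr>"

lemma reg_simps [simp]:
  "carrier (reg R) = carrier R" "zero (reg R) = zero R" "add (reg R) = add R" "smult (reg R) = mult R"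
  by (simp_all add: reg_def)

lemma lmodule_reg: "ring R \<Longrightarrow> lmodule R (reg R)"
proof -
  assume "ring R"
  then interpret ring R .
  show ?thesis
    by (rule lmoduleI'[OF \<open>ring R\<close>])
      (auto intro!: abelian_groupI simp: a_ac l_distr r_distr m_assoc intro: l_neg)
qed

text \<open>Finite powers as sequences padded with zero: the type does not depend on
  \<open>m\<close>, and M^m is literally a subset of M^(m+1), so that inclusions of powers and of
  syzygies are the identity function.\<close>

definition pw :: "('r, 'a) module \<Rightarrow> nat \<Rightarrow> ('r, nat \<Rightarrow> 'a) module"
  where "pw M m = \<lparr>carrier = {c. (\<forall>i<m. c i \<in> carrier M) \<and> (\<forall>i\<ge>m. c i = \<zero>\<^bsub>M\<^esub>)},
    mult = undefined, one = undefined, zero = (\<lambda>i. \<zero>\<^bsub>M\<^esub>), add = (\<lambda>c d i. c i \<oplus>\<^bsub>M\<^esub> d i),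
    smult = (\<lambda>r c i. r \<odot>\<^bsub>M\<^esub> c i)\<rparr>"

lemma pw_simps [simp]:
  "zero (pw M m) = (\<lambda>i. \<zero>\<^bsub>M\<^esub>)" "add (pw M m) = (\<lambda>c d i. c i \<oplus>\<^bsub>M\<^esub> d i)"
  "smult (pw M m) = (\<lambda>r c i. r \<odot>\<^bsub>M\<^esub> c i)"
  by (simp_all add: pw_def)

lemma pw_carrier: "c \<in> carrier (pw M m) \<longleftrightarrow> (\<forall>i<m. c i \<in> carrier M) \<and> (\<forall>i\<ge>m. c i = \<zero>\<^bsub>M\<^esub>)"
  by (simp add: pw_def)

lemma pw_closed: "abelian_group M \<Longrightarrow> c \<in> carrier (pw M m) \<Longrightarrow> c i \<in> carrier M"
  by (cases "i < m")
    (auto simp: pw_carrier abelian_monoid.zero_closed[OF abelian_group.axioms(1)])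

lemma lmodule_pw:
  assumes "lmodule R M"
  shows "lmodule R (pw M m)"
proof -
  interpret M: lmodule R M by fact
  have cl: "c i \<in> carrier M" if "c \<in> carrier (pw M m)" for c i
    using pw_closed[OF M.abelian_group_axioms that] .
  have "abelian_group (pw M m)"
  proof (rule abelian_groupI)
    fix x assume x: "x \<in> carrier (pw M m)"
    show "\<exists>y\<in>carrier (pw M m). y \<oplus>\<^bsub>pw M m\<^esub> x = \<zero>\<^bsub>pw M m\<^esub>"
      by (rule bexI[of _ "\<lambda>i. \<ominus>\<^bsub>M\<^esub> x i"]) (use x cl[OF x] in \<open>auto simp: M.l_neg pw_carrier\<close>)
  qed (use cl in \<open>auto simp: M.a_ac pw_carrier intro!: ext\<close>)
  then show ?thesis
    by (intro lmoduleI' M.ring_axioms)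
      (use cl in \<open>auto simp: M.smult_l_distr M.smult_r_distr M.smult_assoc pw_carrier intro!: ext\<close>)
qed

lemma gsum_pw: "gsum (pw M m) c n = (\<lambda>i. gsum M (\<lambda>j. c j i) n)"
  by (induction n) auto

section \<open>Quotients of abelian groups\<close>

text \<open>Repackages the factor group as a record with additive structure, so that it can be the
  target of \<open>ahom\<close> and \<open>tlift\<close>.\<close>

definition quo :: "('a, 'x) ring_scheme \<Rightarrow> 'a set \<Rightarrow> 'a set ring"
  where "quo G I = \<lparr>carrier = carrier (G A_Mod I), mult = undefined, one = undefined,
    zero = one (G A_Mod I), add = monoid.mult (G A_Mod I)\<rparr>"

lemma quo_facts:
  assumes "abelian_group G" "additive_subgroup I G"
  shows "abelian_group (quo G I)" "(\<lambda>x. I +>\<^bsub>G\<^esub> x) \<in> ahom G (quo G I)"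
    "\<And>x y. x \<in> carrier G \<Longrightarrow> y \<in> carrier G \<Longrightarrow> I +>\<^bsub>G\<^esub> x = I +>\<^bsub>G\<^esub> y \<longleftrightarrow> x \<ominus>\<^bsub>G\<^esub> y \<in> I"
proof -
  interpret G: abelian_group G by fact
  interpret I: abelian_subgroup I G by (rule abelian_subgroupI3[OF assms(2,1)])
  have eq: "add_monoid (quo G I) = G A_Mod I"
    by (simp add: quo_def)
  show "abelian_group (quo G I)"
    by (rule comm_group_abelian_groupI) (unfold eq, rule I.a_factorgroup_is_comm_group)
  show "(\<lambda>x. I +>\<^bsub>G\<^esub> x) \<in> ahom G (quo G I)"
    using I.a_r_coset_hom_A_Mod by (auto simp: ahom_def hom_def quo_def)
  fix x y assume xy: "x \<in> carrier G" "y \<in> carrier G"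
  show "I +>\<^bsub>G\<^esub> x = I +>\<^bsub>G\<^esub> y \<longleftrightarrow> x \<ominus>\<^bsub>G\<^esub> y \<in> I"
  proof
    assume "I +>\<^bsub>G\<^esub> x = I +>\<^bsub>G\<^esub> y"
    then have "I +>\<^bsub>G\<^esub> (x \<ominus>\<^bsub>G\<^esub> y) = I"
      using G.a_coset_add_inv2[of I x y] xy I.a_subset by (simp add: G.minus_eq)
    then show "x \<ominus>\<^bsub>G\<^esub> y \<in> I"
      using G.a_coset_join1 I.a_subgroup xy by blast
  next
    assume "x \<ominus>\<^bsub>G\<^esub> y \<in> I"
    then have "I +>\<^bsub>G\<^esub> (x \<ominus>\<^bsub>G\<^esub> y) = I"
      by (rule I.a_rcos_const)
    then show "I +>\<^bsub>G\<^esub> x = I +>\<^bsub>G\<^esub> y"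
      using G.a_coset_add_inv1[of I x y] xy I.a_subset by (simp add: G.minus_eq)
  qed
qed

section \<open>Tensor products\<close>

text \<open>Written with exactly the sum that occurs in \<open>eval_counit\<close>, so that the
  evaluation map becomes an instance of \<open>tlift\<close> by unfolding.\<close>

definition frag_ext :: "('b, 'x) ring_scheme \<Rightarrow> ('a \<Rightarrow> 'b) \<Rightarrow> ('a \<Rightarrow>\<^sub>0 int) \<Rightarrow> 'b"
  where "frag_ext G f u = (\<Oplus>\<^bsub>G\<^esub>p\<in>Poly_Mapping.keys u. [Poly_Mapping.lookup u p] \<cdot>\<^bsub>G\<^esub> (f p))"

lemma frag_ext_superset:
  assumes "abelian_group G" "finite K" "Poly_Mapping.keys u \<subseteq> K" "\<And>p. p \<in> K \<Longrightarrow> f p \<in> carrier G"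
  shows "frag_ext G f u = (\<Oplus>\<^bsub>G\<^esub>p\<in>K. [Poly_Mapping.lookup u p] \<cdot>\<^bsub>G\<^esub> (f p))"
proof -
  interpret G: abelian_group G by fact
  have z: "[(0::int)] \<cdot>\<^bsub>G\<^esub> x = \<zero>\<^bsub>G\<^esub>" for x by (simp add: add_pow_def)
  show ?thesis
    unfolding frag_ext_def
    by (rule G.add.finprod_mono_neutral_cong_left[OF assms(2,3)])
      (use assms(3,4) in \<open>auto simp: in_keys_iff z\<close>)
qed

lemma frag_ext_closed:
  assumes "abelian_group G" "\<And>p. p \<in> Poly_Mapping.keys u \<Longrightarrow> f p \<in> carrier G"
  shows "frag_ext G f u \<in> carrier G"
proof -
  interpret G: abelian_group G by fact
  show ?thesis unfolding frag_ext_def using assms(2) by (intro G.finsum_closed) auto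
qed

lemma frag_ext_add:
  assumes "abelian_group G" "\<And>p. p \<in> Poly_Mapping.keys u \<union> Poly_Mapping.keys v \<Longrightarrow> f p \<in> carrier G"
  shows "frag_ext G f (u + v) = frag_ext G f u \<oplus>\<^bsub>G\<^esub> frag_ext G f v"
proof -
  interpret G: abelian_group G by fact
  let ?K = "Poly_Mapping.keys u \<union> Poly_Mapping.keys v"
  have e: "frag_ext G f w = (\<Oplus>\<^bsub>G\<^esub>p\<in>?K. [Poly_Mapping.lookup w p] \<cdot>\<^bsub>G\<^esub> (f p))"
    if "Poly_Mapping.keys w \<subseteq> ?K" for w
    by (rule frag_ext_superset[OF assms(1) _ that]) (use assms(2) in auto)
  have "frag_ext G f (u + v) = (\<Oplus>\<^bsub>G\<^esub>p\<in>?K. [Poly_Mapping.lookup u p] \<cdot>\<^bsub>G\<^esub> (f p)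
      \<oplus>\<^bsub>G\<^esub> [Poly_Mapping.lookup v p] \<cdot>\<^bsub>G\<^esub> (f p))"
    unfolding e[OF Poly_Mapping.keys_add]
    by (rule G.finsum_cong') (use assms(2) in \<open>auto simp: lookup_add G.add.int_pow_mult\<close>)
  also have "\<dots> = frag_ext G f u \<oplus>\<^bsub>G\<^esub> frag_ext G f v"
    unfolding e[of u, OF Un_upper1] e[of v, OF Un_upper2]
    by (rule G.finsum_addf) (use assms(2) in auto)
  finally show ?thesis .
qed

lemma frag_ext_0: "abelian_group G \<Longrightarrow> frag_ext G f 0 = \<zero>\<^bsub>G\<^esub>"
  by (simp add: frag_ext_def abelian_monoid.finsum_empty abelian_group.axioms)

lemma frag_ext_of: "abelian_group G \<Longrightarrow> f p \<in> carrier G \<Longrightarrow> frag_ext G f (frag_of p) = f p"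
proof -
  assume G: "abelian_group G" "f p \<in> carrier G"
  then interpret G: abelian_group G by simp
  have "frag_ext G f (frag_of p) = (\<Oplus>\<^bsub>G\<^esub>q\<in>{p}. [Poly_Mapping.lookup (frag_of p) q] \<cdot>\<^bsub>G\<^esub> (f q))"
    by (rule frag_ext_superset[OF G(1)]) (auto simp: G keys_frag_of)
  also have "\<dots> = f p"
    using G(2) by (simp add: Pi_def)
  finally show ?thesis .
qed

lemma frag_ext_diff:
  assumes "abelian_group G" "\<And>p. p \<in> Poly_Mapping.keys u \<union> Poly_Mapping.keys v \<Longrightarrow> f p \<in> carrier G"
  shows "frag_ext G f (u - v) = frag_ext G f u \<ominus>\<^bsub>G\<^esub> frag_ext G f v"
proof -
  interpret G: abelian_group G by fact
  have k: "Poly_Mapping.keys (u - v) \<subseteq> Poly_Mapping.keys u \<union> Poly_Mapping.keys v"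
    by (rule Poly_Mapping.keys_diff)
  have "frag_ext G f u = frag_ext G f (u - v + v)" by simp
  also have "\<dots> = frag_ext G f (u - v) \<oplus>\<^bsub>G\<^esub> frag_ext G f v"
    by (rule frag_ext_add[OF assms(1)]) (use k assms(2) in blast)
  finally have "frag_ext G f u = frag_ext G f (u - v) \<oplus>\<^bsub>G\<^esub> frag_ext G f v" .
  moreover have "frag_ext G f (u - v) \<in> carrier G" "frag_ext G f v \<in> carrier G"
    using k assms by (auto intro!: frag_ext_closed)
  ultimately show ?thesis
    by (simp add: G.minus_eq G.a_assoc G.r_neg)
qed

abbreviation tfree :: "('r, 'a) module \<Rightarrow> ('r, 'b) module \<Rightarrow> ('a \<times> 'b \<Rightarrow>\<^sub>0 int) monoid"
  where "tfree A B \<equiv> free_Abelian_group (carrier A \<times> carrier B)"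

definition tgen :: "'r ring \<Rightarrow> ('r, 'a) module \<Rightarrow> ('r, 'b) module \<Rightarrow> ('a \<times> 'b \<Rightarrow>\<^sub>0 int) set"
  where "tgen R A B =
    {frag_of (a \<oplus>\<^bsub>A\<^esub> a', b) - frag_of (a, b) - frag_of (a', b) | a a' b.
        a \<in> carrier A \<and> a' \<in> carrier A \<and> b \<in> carrier B} \<union>
     {frag_of (a, b \<oplus>\<^bsub>B\<^esub> b') - frag_of (a, b) - frag_of (a, b') | a b b'.
        a \<in> carrier A \<and> b \<in> carrier B \<and> b' \<in> carrier B} \<union>
     {frag_of (r \<odot>\<^bsub>A\<^esub> a, b) - frag_of (a, r \<odot>\<^bsub>B\<^esub> b) | r a b.
        r \<in> carrier R \<and> a \<in> carrier A \<and> b \<in> carrier B}"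

lemma tensor_rel_eq: "tensor_rel R A B = generate (tfree A B) (tgen R A B)"
  by (simp add: tensor_rel_def tgen_def)

lemma opp_simps [simp]:
  "carrier (opp R) = carrier R" "zero (opp R) = zero R" "add (opp R) = add R" "one (opp R) = one R"
  "mult (opp R) = (\<lambda>a b. b \<otimes>\<^bsub>R\<^esub> a)" "opp (opp R) = R"
  by (simp_all add: opp_def)

lemma ring_opp: "ring R \<Longrightarrow> ring (opp R)"
proof -
  assume "ring R"
  then interpret ring R .
  show ?thesis
  proof (rule ringI)
    show "abelian_group (opp R)"
      by (rule abelian_groupI) (auto simp: a_ac intro: l_neg)
    show "monoid (opp R)"
      by (rule monoidI) (auto simp: m_assoc)
  qed (auto simp: l_distr r_distr)
qed

locale tensor_pair =
  fixes R :: "'r ring" and A :: "('r, 'a) module" and B :: "('r, 'b) module"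
  assumes A: "lmodule (opp R) A" and B: "lmodule R B"
begin

sublocale A: lmodule "opp R" A by (rule A)
sublocale B: lmodule R B by (rule B)

abbreviation "T \<equiv> tensor_rel R A B"
abbreviation "X \<equiv> carrier A \<times> carrier B"

lemma keys_diff_subset: "Poly_Mapping.keys u \<subseteq> Y \<Longrightarrow> Poly_Mapping.keys v \<subseteq> Y \<Longrightarrow> Poly_Mapping.keys (u - v) \<subseteq> Y"
  using Poly_Mapping.keys_diff[of u v] by blast

lemma tgen_carrier: "tgen R A B \<subseteq> carrier (tfree A B)"
  unfolding tgen_def
  by (auto simp: keys_frag_of dest!: subsetD[OF keys_diff])

lemma T_subgroup: "subgroup T (tfree A B)"
  unfolding tensor_rel_eq
  by (rule group.generate_is_subgroup[OF group_free_Abelian_group tgen_carrier])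

lemma T_keys: "x \<in> T \<Longrightarrow> Poly_Mapping.keys x \<subseteq> X"
  using subgroup.subset[OF T_subgroup] by (meson carrier_free_Abelian_group_iff subsetD)

lemma T_0: "0 \<in> T"
  using subgroup.one_closed[OF T_subgroup] by simp

lemma T_add: "x \<in> T \<Longrightarrow> y \<in> T \<Longrightarrow> x + y \<in> T"
  using subgroup.m_closed[OF T_subgroup, of x y] by simp

lemma T_neg: "x \<in> T \<Longrightarrow> - x \<in> T"
  using subgroup.m_inv_closed[OF T_subgroup, of x] T_keys by simp

lemma T_diff: "x \<in> T \<Longrightarrow> y \<in> T \<Longrightarrow> x - y \<in> T"
  using T_add[of x "- y"] T_neg by simp

definition coset :: "('a \<times> 'b \<Rightarrow>\<^sub>0 int) \<Rightarrow> ('a \<times> 'b \<Rightarrow>\<^sub>0 int) set"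
  where "coset x = (\<lambda>t. t + x) ` T"

lemma coset_eq: "coset x = T #>\<^bsub>tfree A B\<^esub> x"
  by (auto simp: coset_def r_coset_def)

lemma coset_eq_iff: "coset x = coset y \<longleftrightarrow> x - y \<in> T"
proof
  assume "coset x = coset y"
  then have "x \<in> coset y" unfolding coset_def using T_0 by (metis add_0 imageI)
  then show "x - y \<in> T" by (auto simp: coset_def)
next
  assume *: "x - y \<in> T"
  have "t + x \<in> coset y" if "t \<in> T" for t
    unfolding coset_def using T_add[OF that *] by (intro image_eqI[of _ _ "t + (x - y)"]) auto
  moreover have "t + y \<in> coset x" if "t \<in> T" for t
    unfolding coset_def using T_diff[OF that *] by (intro image_eqI[of _ _ "t - (x - y)"]) auto
  ultimately show "coset x = coset y" unfolding coset_def by blast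
qed

lemma tensor_carrier: "carrier (tensor R A B) = coset ` {x. Poly_Mapping.keys x \<subseteq> X}"
  by (simp add: tensor_def Let_def FactGroup_def RCOSETS_def coset_eq) (simp add: free_Abelian_group_def UNION_singleton_eq_range)

lemma tensor_zero: "\<zero>\<^bsub>tensor R A B\<^esub> = coset 0"
  by (simp add: tensor_def Let_def FactGroup_def coset_def)

lemma tensor_add: "coset x \<oplus>\<^bsub>tensor R A B\<^esub> coset y = coset (x + y)"
proof -
  have "coset x \<oplus>\<^bsub>tensor R A B\<^esub> coset y = {s + t | s t. s \<in> coset x \<and> t \<in> coset y}"
    by (auto simp: tensor_def Let_def FactGroup_def set_mult_def)
  also have "\<dots> = coset (x + y)"
  proof safe
    fix s t assume "s \<in> coset x" "t \<in> coset y"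
    then obtain u v where "u \<in> T" "v \<in> T" "s = u + x" "t = v + y" by (auto simp: coset_def)
    then show "s + t \<in> coset (x + y)"
      unfolding coset_def using T_add[of u v] by (intro image_eqI[of _ _ "u + v"]) auto
  next
    fix z assume "z \<in> coset (x + y)"
    then obtain u where "u \<in> T" "z = (u + x) + (0 + y)" by (auto simp: coset_def add.assoc)
    then show "\<exists>s t. z = s + t \<and> s \<in> coset x \<and> t \<in> coset y"
      unfolding coset_def using T_0 by blast
  qed
  finally show ?thesis .
qed

lemma abelian_tensor: "abelian_group (tensor R A B)"
proof (rule comm_group_abelian_groupI)
  have "add_monoid (tensor R A B) = tfree A B Mod T"
    by (simp add: tensor_def Let_def)
  then show "comm_group (add_monoid (tensor R A B))"
    using comm_group.abelian_FactGroup[OF abelian_free_Abelian_group T_subgroup] by simp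
qed

sublocale TT: abelian_group "tensor R A B" by (rule abelian_tensor)

abbreviation tp :: "'a \<Rightarrow> 'b \<Rightarrow> ('a \<times> 'b \<Rightarrow>\<^sub>0 int) set"
  where "tp \<equiv> pure_tensor R A B"

lemma tp_eq: "tp a b = coset (frag_of (a, b))"
  by (simp add: pure_tensor_def coset_eq)

lemma tp_closed [simp, intro]: "a \<in> carrier A \<Longrightarrow> b \<in> carrier B \<Longrightarrow> tp a b \<in> carrier (tensor R A B)"
  by (auto simp: tp_eq tensor_carrier keys_frag_of)

lemma tgen_T: "x \<in> tgen R A B \<Longrightarrow> x \<in> T"
  unfolding tensor_rel_eq by (rule generate.incl)

lemma tp_add_l: "a \<in> carrier A \<Longrightarrow> a' \<in> carrier A \<Longrightarrow> b \<in> carrier B \<Longrightarrow>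
    tp (a \<oplus>\<^bsub>A\<^esub> a') b = tp a b \<oplus>\<^bsub>tensor R A B\<^esub> tp a' b"
  unfolding tp_eq tensor_add coset_eq_iff diff_diff_add[symmetric]
  by (rule tgen_T) (auto simp: tgen_def)

lemma tp_add_r: "a \<in> carrier A \<Longrightarrow> b \<in> carrier B \<Longrightarrow> b' \<in> carrier B \<Longrightarrow>
    tp a (b \<oplus>\<^bsub>B\<^esub> b') = tp a b \<oplus>\<^bsub>tensor R A B\<^esub> tp a b'"
  unfolding tp_eq tensor_add coset_eq_iff diff_diff_add[symmetric]
  by (rule tgen_T) (auto simp: tgen_def)

lemma tp_bal: "r \<in> carrier R \<Longrightarrow> a \<in> carrier A \<Longrightarrow> b \<in> carrier B \<Longrightarrow>
    tp (r \<odot>\<^bsub>A\<^esub> a) b = tp a (r \<odot>\<^bsub>B\<^esub> b)"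
  unfolding tp_eq coset_eq_iff
  by (rule tgen_T) (auto simp: tgen_def)

lemma tp_ahom_l: "b \<in> carrier B \<Longrightarrow> (\<lambda>a. tp a b) \<in> ahom A (tensor R A B)"
  by (rule ahomI) (auto simp: tp_add_l)

lemma tp_ahom_r: "a \<in> carrier A \<Longrightarrow> tp a \<in> ahom B (tensor R A B)"
  by (rule ahomI) (auto simp: tp_add_r)

lemma tp_zero_l: "b \<in> carrier B \<Longrightarrow> tp \<zero>\<^bsub>A\<^esub> b = \<zero>\<^bsub>tensor R A B\<^esub>"
  using ahom_zero[OF A.abelian_group_axioms abelian_tensor tp_ahom_l] .

lemma tp_zero_r: "a \<in> carrier A \<Longrightarrow> tp a \<zero>\<^bsub>B\<^esub> = \<zero>\<^bsub>tensor R A B\<^esub>"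
  using ahom_zero[OF B.abelian_group_axioms abelian_tensor tp_ahom_r] .

text \<open>Differences instead of sums and negatives: the free abelian group on the pairs is
  obtained from zero and its basis by subtraction alone, so one closure case is enough.\<close>

lemma tensor_induct [consumes 1, case_names zero minus pure]:
  assumes "t \<in> carrier (tensor R A B)"
    and "P \<zero>\<^bsub>tensor R A B\<^esub>"
    and "\<And>s t. s \<in> carrier (tensor R A B) \<Longrightarrow> t \<in> carrier (tensor R A B) \<Longrightarrow> P s \<Longrightarrow> P t \<Longrightarrow>
      P (s \<ominus>\<^bsub>tensor R A B\<^esub> t)"
    and "\<And>a b. a \<in> carrier A \<Longrightarrow> b \<in> carrier B \<Longrightarrow> P (tp a b)"
  shows "P t"
proof -
  have *: "P (coset x)" if "Poly_Mapping.keys x \<subseteq> X" for x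
  proof (rule free_Abelian_group_induct[OF that])
    show "P (coset 0)" using assms(2) by (simp add: tensor_zero)
  next
    fix x y assume 2: "Poly_Mapping.keys x \<subseteq> X" "Poly_Mapping.keys y \<subseteq> X" "P (coset x)" "P (coset y)"
    then have c: "coset x \<in> carrier (tensor R A B)" "coset y \<in> carrier (tensor R A B)"
      "coset (x - y) \<in> carrier (tensor R A B)"
      using keys_diff_subset[of x X y] by (auto simp: tensor_carrier)
    have "coset x = coset (x - y) \<oplus>\<^bsub>tensor R A B\<^esub> coset y"
      by (simp add: tensor_add)
    then have "coset (x - y) = coset x \<ominus>\<^bsub>tensor R A B\<^esub> coset y"
      using c by (simp add: TT.minus_eq TT.a_assoc TT.r_neg)
    then show "P (coset (x - y))" using assms(3)[OF c(1,2)] 2 by simp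
  next
    fix p assume "p \<in> X"
    then show "P (coset (frag_of p))" using assms(4) by (cases p) (auto simp: tp_eq)
  qed
  then show ?thesis using assms(1) by (auto simp: tensor_carrier)
qed

lemma tensor_ahom_eq:
  assumes "abelian_group G" "f \<in> ahom (tensor R A B) G" "g \<in> ahom (tensor R A B) G"
    and "\<And>a b. a \<in> carrier A \<Longrightarrow> b \<in> carrier B \<Longrightarrow> f (tp a b) = g (tp a b)"
    and "t \<in> carrier (tensor R A B)"
  shows "f t = g t"
  using assms(5)
proof (induction t rule: tensor_induct)
  case zero
  show ?case using ahom_zero[OF abelian_tensor assms(1,2)] ahom_zero[OF abelian_tensor assms(1,3)] by simp
next
  case (minus s t)
  then show ?case
    using ahom_minus[OF abelian_tensor assms(1,2)] ahom_minus[OF abelian_tensor assms(1,3)] by simp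
qed (use assms(4) in auto)

end

definition tlift :: "('g, 'x) ring_scheme \<Rightarrow> ('a \<Rightarrow> 'b \<Rightarrow> 'g) \<Rightarrow> ('a \<times> 'b \<Rightarrow>\<^sub>0 int) set \<Rightarrow> 'g"
  where "tlift G \<beta> X = the_elem (frag_ext G (\<lambda>p. \<beta> (fst p) (snd p)) ` X)"

context tensor_pair
begin

text \<open>Each bilinearity relation lies in the subgroup \<open>N\<close> killed by the additive
  extension of \<open>\<beta>\<close>, hence so does the subgroup \<open>T\<close> generated by the
  relations. The extension is therefore constant on cosets of \<open>T\<close>, and
  \<open>the_elem\<close> picks its only value.\<close>

lemma tlift:
  assumes G: "abelian_group G" and \<beta>: "\<And>a b. a \<in> carrier A \<Longrightarrow> b \<in> carrier B \<Longrightarrow> \<beta> a b \<in> carrier G"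
    and l: "\<And>a a' b. a \<in> carrier A \<Longrightarrow> a' \<in> carrier A \<Longrightarrow> b \<in> carrier B \<Longrightarrow>
      \<beta> (a \<oplus>\<^bsub>A\<^esub> a') b = \<beta> a b \<oplus>\<^bsub>G\<^esub> \<beta> a' b"
    and r: "\<And>a b b'. a \<in> carrier A \<Longrightarrow> b \<in> carrier B \<Longrightarrow> b' \<in> carrier B \<Longrightarrow>
      \<beta> a (b \<oplus>\<^bsub>B\<^esub> b') = \<beta> a b \<oplus>\<^bsub>G\<^esub> \<beta> a b'"
    and m: "\<And>r a b. r \<in> carrier R \<Longrightarrow> a \<in> carrier A \<Longrightarrow> b \<in> carrier B \<Longrightarrow>
      \<beta> (r \<odot>\<^bsub>A\<^esub> a) b = \<beta> a (r \<odot>\<^bsub>B\<^esub> b)"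
  shows "tlift G \<beta> \<in> ahom (tensor R A B) G"
    "\<And>a b. a \<in> carrier A \<Longrightarrow> b \<in> carrier B \<Longrightarrow> tlift G \<beta> (tp a b) = \<beta> a b"
proof -
  interpret G: abelian_group G by fact
  let ?e = "frag_ext G (\<lambda>p. \<beta> (fst p) (snd p))"
  have cl: "?e x \<in> carrier G" if "Poly_Mapping.keys x \<subseteq> X" for x
    using that \<beta> by (intro frag_ext_closed G.abelian_group_axioms) auto
  have add: "?e (x + y) = ?e x \<oplus>\<^bsub>G\<^esub> ?e y" if "Poly_Mapping.keys x \<subseteq> X" "Poly_Mapping.keys y \<subseteq> X" for x y
    using that \<beta> by (intro frag_ext_add G.abelian_group_axioms) auto
  have diff: "?e (x - y) = ?e x \<ominus>\<^bsub>G\<^esub> ?e y" if "Poly_Mapping.keys x \<subseteq> X" "Poly_Mapping.keys y \<subseteq> X" for x y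
    using that \<beta> by (intro frag_ext_diff G.abelian_group_axioms) auto
  have of: "?e (frag_of (a, b)) = \<beta> a b" if "a \<in> carrier A" "b \<in> carrier B" for a b
    using frag_ext_of[OF G, of "\<lambda>p. \<beta> (fst p) (snd p)" "(a, b)"] that \<beta> by simp
  have kof: "Poly_Mapping.keys (frag_of (a, b)) \<subseteq> X" if "a \<in> carrier A" "b \<in> carrier B" for a b
    using that by (simp add: keys_frag_of)
  define N where "N = {x. Poly_Mapping.keys x \<subseteq> X \<and> ?e x = \<zero>\<^bsub>G\<^esub>}"
  have e0: "?e 0 = \<zero>\<^bsub>G\<^esub>" by (rule frag_ext_0[OF G])
  have N: "subgroup N (tfree A B)"
  proof (rule group.subgroupI[OF group_free_Abelian_group])
    show "N \<noteq> {}" using e0 by (auto simp: N_def intro!: exI[of _ 0])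
    show "inv\<^bsub>tfree A B\<^esub> x \<in> N" if "x \<in> N" for x
      using that diff[of 0 x] e0 by (auto simp: N_def G.minus_eq)
    show "x \<otimes>\<^bsub>tfree A B\<^esub> y \<in> N" if "x \<in> N" "y \<in> N" for x y
      using that add[of x y] Poly_Mapping.keys_add[of x y] by (auto simp: N_def)
  qed (auto simp: N_def)
  have "tgen R A B \<subseteq> N"
  proof
    fix x assume x: "x \<in> tgen R A B"
    then have "Poly_Mapping.keys x \<subseteq> X" using tgen_carrier by (meson carrier_free_Abelian_group_iff subsetD)
    moreover have "?e x = \<zero>\<^bsub>G\<^esub>"
    proof -
      have *: "(u \<oplus>\<^bsub>G\<^esub> v) \<ominus>\<^bsub>G\<^esub> u \<ominus>\<^bsub>G\<^esub> v = \<zero>\<^bsub>G\<^esub>" if "u \<in> carrier G" "v \<in> carrier G" for u v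
        using that G.a_lcomm[of v "\<ominus>\<^bsub>G\<^esub> u" "\<ominus>\<^bsub>G\<^esub> v"] by (simp add: G.minus_eq G.a_assoc G.r_neg)
      have **: "u \<ominus>\<^bsub>G\<^esub> u = \<zero>\<^bsub>G\<^esub>" if "u \<in> carrier G" for u
        using that by (simp add: G.minus_eq G.r_neg)
      show ?thesis
        using x unfolding tgen_def by (auto simp: diff of kof keys_diff_subset l r m \<beta> * **)
    qed
    ultimately show "x \<in> N" by (simp add: N_def)
  qed
  then have TN: "T \<subseteq> N"
    unfolding tensor_rel_eq by (rule group.generate_subgroup_incl[OF group_free_Abelian_group _ N])
  have co: "tlift G \<beta> (coset x) = ?e x" if x: "Poly_Mapping.keys x \<subseteq> X" for x
  proof -
    have "?e ` coset x = {?e x}"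
    proof -
      have "?e (t + x) = ?e x" if "t \<in> T" for t
        using add[OF T_keys[OF that] x] TN that cl[OF x] by (auto simp: N_def)
      then show ?thesis using T_0 by (auto simp: coset_def image_image)
    qed
    then show ?thesis by (simp add: tlift_def)
  qed
  show "tlift G \<beta> \<in> ahom (tensor R A B) G"
  proof (rule ahomI)
    show "tlift G \<beta> s \<in> carrier G" if "s \<in> carrier (tensor R A B)" for s
      using that co cl by (auto simp: tensor_carrier)
    fix s t assume "s \<in> carrier (tensor R A B)" "t \<in> carrier (tensor R A B)"
    then obtain x y where *: "s = coset x" "t = coset y" "Poly_Mapping.keys x \<subseteq> X" "Poly_Mapping.keys y \<subseteq> X"
      by (auto simp: tensor_carrier)
    then have "Poly_Mapping.keys (x + y) \<subseteq> X" using Poly_Mapping.keys_add[of x y] by blast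
    then show "tlift G \<beta> (s \<oplus>\<^bsub>tensor R A B\<^esub> t) = tlift G \<beta> s \<oplus>\<^bsub>G\<^esub> tlift G \<beta> t"
      using * co add by (simp add: tensor_add)
  qed
  show "tlift G \<beta> (tp a b) = \<beta> a b" if "a \<in> carrier A" "b \<in> carrier B" for a b
    using co[OF kof[OF that]] of[OF that] by (simp add: tp_eq)
qed

end

section \<open>Induced maps on tensor products and right exactness\<close>

text \<open>The induced map of free groups sends generating relations to generating relations; hence
  the product set in the definition of \<open>tensor_map\<close> is the single coset of the image of
  any representative, as \<open>co\<close> records.\<close>

lemma tensor_map:
  assumes A: "lmodule (opp R) A" and A': "lmodule (opp R) A'" and B: "lmodule R B"
    and f: "f \<in> mhom (opp R) A A'"
  shows "tensor_map R A A' B f \<in> ahom (tensor R A B) (tensor R A' B)"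
    "\<And>a b. a \<in> carrier A \<Longrightarrow> b \<in> carrier B \<Longrightarrow>
      tensor_map R A A' B f (pure_tensor R A B a b) = pure_tensor R A' B (f a) b"
proof -
  interpret P: tensor_pair R A B by (rule tensor_pair.intro) (fact A B)+
  interpret Q: tensor_pair R A' B by (rule tensor_pair.intro) (fact A' B)+
  let ?F = "frag_extend (\<lambda>(a, b). frag_of (f a, b))"
  have kF: "Poly_Mapping.keys (?F x) \<subseteq> Q.X" if "Poly_Mapping.keys x \<subseteq> P.X" for x
  proof -
    have "Poly_Mapping.keys (case p of (a, b) \<Rightarrow> frag_of (f a, b)) \<subseteq> Q.X" if "p \<in> Poly_Mapping.keys x" for p
      using that \<open>Poly_Mapping.keys x \<subseteq> P.X\<close> mhom_closed[OF f] by (cases p) (auto simp: keys_frag_of)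
    then show ?thesis using keys_frag_extend[of "\<lambda>(a, b). frag_of (f a, b)" x] by blast
  qed
  define N where "N = {x. Poly_Mapping.keys x \<subseteq> P.X \<and> ?F x \<in> Q.T}"
  have N: "subgroup N (tfree A B)"
  proof (rule group.subgroupI[OF group_free_Abelian_group])
    show "N \<noteq> {}" using Q.T_0 by (auto simp: N_def intro!: exI[of _ 0])
    show "inv\<^bsub>tfree A B\<^esub> x \<in> N" if "x \<in> N" for x
      using that Q.T_neg by (auto simp: N_def frag_extend_minus)
    show "x \<otimes>\<^bsub>tfree A B\<^esub> y \<in> N" if "x \<in> N" "y \<in> N" for x y
      using that Q.T_add Poly_Mapping.keys_add[of x y] by (auto simp: N_def frag_extend_add)
  qed (auto simp: N_def)
  have "tgen R A B \<subseteq> N"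
  proof
    fix x assume x: "x \<in> tgen R A B"
    then have "Poly_Mapping.keys x \<subseteq> P.X" using P.tgen_carrier by (meson carrier_free_Abelian_group_iff subsetD)
    moreover have "?F x \<in> tgen R A' B"
      using x unfolding tgen_def[of R A B]
    proof (elim UnE CollectE exE conjE)
      fix a a' b assume *: "x = frag_of (a \<oplus>\<^bsub>A\<^esub> a', b) - frag_of (a, b) - frag_of (a', b)"
        "a \<in> carrier A" "a' \<in> carrier A" "b \<in> carrier B"
      then have "?F x = frag_of (f a \<oplus>\<^bsub>A'\<^esub> f a', b) - frag_of (f a, b) - frag_of (f a', b)"
        by (simp add: frag_extend_diff mhom_add[OF f])
      then show ?thesis using * mhom_closed[OF f] unfolding tgen_def by blast
    next
      fix a b b' assume *: "x = frag_of (a, b \<oplus>\<^bsub>B\<^esub> b') - frag_of (a, b) - frag_of (a, b')"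
        "a \<in> carrier A" "b \<in> carrier B" "b' \<in> carrier B"
      then have "?F x = frag_of (f a, b \<oplus>\<^bsub>B\<^esub> b') - frag_of (f a, b) - frag_of (f a, b')"
        by (simp add: frag_extend_diff)
      then show ?thesis using * mhom_closed[OF f] unfolding tgen_def by blast
    next
      fix r a b assume *: "x = frag_of (r \<odot>\<^bsub>A\<^esub> a, b) - frag_of (a, r \<odot>\<^bsub>B\<^esub> b)"
        "r \<in> carrier R" "a \<in> carrier A" "b \<in> carrier B"
      then have "?F x = frag_of (r \<odot>\<^bsub>A'\<^esub> f a, b) - frag_of (f a, r \<odot>\<^bsub>B\<^esub> b)"
        using mhom_smult[OF f, of r a] by (simp add: frag_extend_diff)
      then show ?thesis using * mhom_closed[OF f] unfolding tgen_def by blast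
    qed
    ultimately show "x \<in> N" using Q.tgen_T by (simp add: N_def)
  qed
  then have TN: "P.T \<subseteq> N"
    unfolding tensor_rel_eq[of R A B]
    by (rule group.generate_subgroup_incl[OF group_free_Abelian_group _ N])
  have co: "tensor_map R A A' B f (P.coset x) = Q.coset (?F x)" if x: "Poly_Mapping.keys x \<subseteq> P.X" for x
  proof -
    have "tensor_map R A A' B f (P.coset x) = {t + ?F (u + x) | t u. t \<in> Q.T \<and> u \<in> P.T}"
      by (auto simp: tensor_map_def set_mult_def P.coset_def)
    also have "\<dots> = Q.coset (?F x)"
    proof safe
      fix t u assume "t \<in> Q.T" "u \<in> P.T"
      then have "t + ?F u \<in> Q.T" using TN Q.T_add by (auto simp: N_def)
      then show "t + ?F (u + x) \<in> Q.coset (?F x)"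
        unfolding Q.coset_def frag_extend_add by (intro image_eqI[of _ _ "t + ?F u"]) (auto simp: add.assoc)
    next
      fix z assume "z \<in> Q.coset (?F x)"
      then obtain t where "t \<in> Q.T" "z = t + ?F (0 + x)" by (auto simp: Q.coset_def)
      then show "\<exists>t u. z = t + ?F (u + x) \<and> t \<in> Q.T \<and> u \<in> P.T" using P.T_0 by blast
    qed
    finally show ?thesis .
  qed
  show "tensor_map R A A' B f \<in> ahom (tensor R A B) (tensor R A' B)"
  proof (rule ahomI)
    show "tensor_map R A A' B f s \<in> carrier (tensor R A' B)" if "s \<in> carrier (tensor R A B)" for s
      using that co kF by (auto simp: P.tensor_carrier Q.tensor_carrier)
    fix s t assume "s \<in> carrier (tensor R A B)" "t \<in> carrier (tensor R A B)"
    then obtain x y where *: "s = P.coset x" "t = P.coset y" "Poly_Mapping.keys x \<subseteq> P.X" "Poly_Mapping.keys y \<subseteq> P.X"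
      by (auto simp: P.tensor_carrier)
    then have "Poly_Mapping.keys (x + y) \<subseteq> P.X" using Poly_Mapping.keys_add[of x y] by blast
    then show "tensor_map R A A' B f (s \<oplus>\<^bsub>tensor R A B\<^esub> t) =
        tensor_map R A A' B f s \<oplus>\<^bsub>tensor R A' B\<^esub> tensor_map R A A' B f t"
      using * co by (simp add: P.tensor_add Q.tensor_add frag_extend_add)
  qed
  show "tensor_map R A A' B f (P.tp a b) = Q.tp (f a) b" if "a \<in> carrier A" "b \<in> carrier B" for a b
    using co[of "frag_of (a, b)"] that by (simp add: P.tp_eq Q.tp_eq keys_frag_of)
qed

text \<open>The induced map in the second variable. It occurs in no definition of the statement, so
  it can be taken straight from the universal property.\<close>

definition tmap2 :: "'r ring \<Rightarrow> ('r, 'a) module \<Rightarrow> ('r, 'b2) module \<Rightarrow> ('b \<Rightarrow> 'b2) \<Rightarrow>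
    ('a \<times> 'b \<Rightarrow>\<^sub>0 int) set \<Rightarrow> ('a \<times> 'b2 \<Rightarrow>\<^sub>0 int) set"
  where "tmap2 R A B' g = tlift (tensor R A B') (\<lambda>a b. pure_tensor R A B' a (g b))"

lemma tmap2:
  assumes A: "lmodule (opp R) A" and B: "lmodule R B" and B': "lmodule R B'"
    and g: "g \<in> mhom R B B'"
  shows "tmap2 R A B' g \<in> ahom (tensor R A B) (tensor R A B')"
    "\<And>a b. a \<in> carrier A \<Longrightarrow> b \<in> carrier B \<Longrightarrow>
      tmap2 R A B' g (pure_tensor R A B a b) = pure_tensor R A B' a (g b)"
proof -
  interpret P: tensor_pair R A B by (rule tensor_pair.intro) (fact A B)+
  interpret Q: tensor_pair R A B' by (rule tensor_pair.intro) (fact A B')+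
  note L = P.tlift[OF Q.abelian_tensor, of "\<lambda>a b. Q.tp a (g b)"]
  note [simp] = mhom_closed[OF g] mhom_add[OF g] mhom_smult[OF g] Q.tp_add_l Q.tp_add_r Q.tp_bal
  show "tmap2 R A B' g \<in> ahom (tensor R A B) (tensor R A B')"
    unfolding tmap2_def by (rule L(1)) auto
  show "tmap2 R A B' g (P.tp a b) = Q.tp a (g b)" if "a \<in> carrier A" "b \<in> carrier B" for a b
    unfolding tmap2_def by (rule L(2)) (use that in auto)
qed

text \<open>Right exactness in both variables at once: the kernel of \<open>g \<otimes> h\<close> is the smallest subgroup
  modulo which \<open>a \<otimes> b\<close> depends only on \<open>g a\<close> and \<open>h b\<close>.\<close>

lemma tensor_kernel:
  assumes A: "lmodule (opp R) A" and B: "lmodule R B" and A': "lmodule (opp R) A'" and B': "lmodule R B'"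
    and \<tau>: "\<tau> \<in> ahom (tensor R A B) (tensor R A' B')"
    and \<tau>p: "\<And>a b. a \<in> carrier A \<Longrightarrow> b \<in> carrier B \<Longrightarrow>
      \<tau> (pure_tensor R A B a b) = pure_tensor R A' B' (g a) (h b)"
    and g: "g \<in> mhom (opp R) A A'" "g ` carrier A = carrier A'"
    and h: "h \<in> mhom R B B'" "h ` carrier B = carrier B'"
    and I: "additive_subgroup I (tensor R A B)"
    and d: "\<And>a a' b b'. a \<in> carrier A \<Longrightarrow> a' \<in> carrier A \<Longrightarrow> b \<in> carrier B \<Longrightarrow> b' \<in> carrier B \<Longrightarrow>
      g a = g a' \<Longrightarrow> h b = h b' \<Longrightarrow>
      pure_tensor R A B a b \<ominus>\<^bsub>tensor R A B\<^esub> pure_tensor R A B a' b' \<in> I"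
    and t: "t \<in> carrier (tensor R A B)" "\<tau> t = \<zero>\<^bsub>tensor R A' B'\<^esub>"
  shows "t \<in> I"
proof -
  interpret P: tensor_pair R A B by (rule tensor_pair.intro) (fact A B)+
  interpret Q: tensor_pair R A' B' by (rule tensor_pair.intro) (fact A' B')+
  let ?T = "tensor R A B"
  let ?q = "\<lambda>x. I +>\<^bsub>?T\<^esub> x"
  note q = quo_facts[OF P.abelian_tensor I]
  interpret K: abelian_group "quo ?T I" by (rule q(1))
  let ?g = "inv_into (carrier A) g" and ?h = "inv_into (carrier B) h"
  have gi: "?g x \<in> carrier A" "g (?g x) = x" if "x \<in> carrier A'" for x
    using that g(2) by (metis inv_into_into, metis f_inv_into_f)
  have hi: "?h x \<in> carrier B" "h (?h x) = x" if "x \<in> carrier B'" for x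
    using that h(2) by (metis inv_into_into, metis f_inv_into_f)
  have qd: "?q (P.tp a b) = ?q (P.tp a' b')"
    if "a \<in> carrier A" "a' \<in> carrier A" "b \<in> carrier B" "b' \<in> carrier B" "g a = g a'" "h b = h b'" for a a' b b'
    using q(3) d[OF that] that by simp
  \<comment> \<open>Preimages under \<open>g\<close> and \<open>h\<close> are chosen arbitrarily;
    modulo \<open>I\<close> the pure tensor does not depend on the choice, and this independence
    makes \<open>\<beta>\<close> biadditive and balanced.\<close>
  define \<beta> where "\<beta> = (\<lambda>x y. ?q (P.tp (?g x) (?h y)))"
  have \<beta>: "\<beta> (g a) (h b) = ?q (P.tp a b)" if "a \<in> carrier A" "b \<in> carrier B" for a b
    unfolding \<beta>_def using that gi[of "g a"] hi[of "h b"] mhom_closed[OF g(1)] mhom_closed[OF h(1)]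
    by (intro qd) auto
  have qadd: "?q (s \<oplus>\<^bsub>?T\<^esub> t) = ?q s \<oplus>\<^bsub>quo ?T I\<^esub> ?q t" if "s \<in> carrier ?T" "t \<in> carrier ?T" for s t
    using ahom_add[OF q(2)] that by simp
  have qcl: "?q s \<in> carrier (quo ?T I)" if "s \<in> carrier ?T" for s
    using ahom_closed[OF q(2)] that by simp
  have L: "tlift (quo ?T I) \<beta> \<in> ahom (tensor R A' B') (quo ?T I)"
    "\<And>a b. a \<in> carrier A' \<Longrightarrow> b \<in> carrier B' \<Longrightarrow> tlift (quo ?T I) \<beta> (Q.tp a b) = \<beta> a b"
  proof -
    have 1: "\<beta> a b \<in> carrier (quo ?T I)" if "a \<in> carrier A'" "b \<in> carrier B'" for a b
      unfolding \<beta>_def using that gi hi by (intro qcl) auto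
    have 2: "\<beta> (a \<oplus>\<^bsub>A'\<^esub> a') b = \<beta> a b \<oplus>\<^bsub>quo ?T I\<^esub> \<beta> a' b"
      if "a \<in> carrier A'" "a' \<in> carrier A'" "b \<in> carrier B'" for a a' b
    proof -
      have "\<beta> (g (?g a \<oplus>\<^bsub>A\<^esub> ?g a')) (h (?h b)) = \<beta> (g (?g a)) (h (?h b)) \<oplus>\<^bsub>quo ?T I\<^esub> \<beta> (g (?g a')) (h (?h b))"
        using that gi(1) hi(1) by (simp add: \<beta> P.tp_add_l qadd)
      then show ?thesis using that gi hi mhom_add[OF g(1)] by simp
    qed
    have 3: "\<beta> a (b \<oplus>\<^bsub>B'\<^esub> b') = \<beta> a b \<oplus>\<^bsub>quo ?T I\<^esub> \<beta> a b'"
      if "a \<in> carrier A'" "b \<in> carrier B'" "b' \<in> carrier B'" for a b b'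
    proof -
      have "\<beta> (g (?g a)) (h (?h b \<oplus>\<^bsub>B\<^esub> ?h b')) = \<beta> (g (?g a)) (h (?h b)) \<oplus>\<^bsub>quo ?T I\<^esub> \<beta> (g (?g a)) (h (?h b'))"
        using that gi(1) hi(1) by (simp add: \<beta> P.tp_add_r qadd)
      then show ?thesis using that gi hi mhom_add[OF h(1)] by simp
    qed
    have 4: "\<beta> (r \<odot>\<^bsub>A'\<^esub> a) b = \<beta> a (r \<odot>\<^bsub>B'\<^esub> b)"
      if "r \<in> carrier R" "a \<in> carrier A'" "b \<in> carrier B'" for r a b
    proof -
      have "\<beta> (g (r \<odot>\<^bsub>A\<^esub> ?g a)) (h (?h b)) = \<beta> (g (?g a)) (h (r \<odot>\<^bsub>B\<^esub> ?h b))"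
        using that gi(1) hi(1) P.A.smult_closed[of r] by (simp add: \<beta> P.tp_bal)
      then show ?thesis using that gi hi mhom_smult[OF g(1)] mhom_smult[OF h(1)] by simp
    qed
    show "tlift (quo ?T I) \<beta> \<in> ahom (tensor R A' B') (quo ?T I)"
      by (rule Q.tlift(1)[OF q(1), of \<beta>]) (fact 1 2 3 4)+
    show "tlift (quo ?T I) \<beta> (Q.tp a b) = \<beta> a b" if "a \<in> carrier A'" "b \<in> carrier B'" for a b
      by (rule Q.tlift(2)[OF q(1), of \<beta>]) (fact 1 2 3 4 that)+
  qed
  \<comment> \<open>The projection modulo \<open>I\<close> factors through \<open>\<tau>\<close>, so
    an element killed by \<open>\<tau>\<close> is killed by the projection.\<close>
  have "?q t = tlift (quo ?T I) \<beta> (\<tau> t)"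
  proof (rule P.tensor_ahom_eq[OF q(1) q(2) ahom_comp[OF \<tau> L(1)] _ t(1)])
    show "?q (P.tp a b) = tlift (quo ?T I) \<beta> (\<tau> (P.tp a b))" if "a \<in> carrier A" "b \<in> carrier B" for a b
      using that L(2) \<beta> \<tau>p mhom_closed[OF g(1)] mhom_closed[OF h(1)] by simp
  qed
  also have "\<dots> = ?q \<zero>\<^bsub>?T\<^esub>"
    using t(2) ahom_zero[OF Q.abelian_tensor q(1) L(1)] ahom_zero[OF P.abelian_tensor q(1,2)] by simp
  finally have "t \<ominus>\<^bsub>?T\<^esub> \<zero>\<^bsub>?T\<^esub> \<in> I" using q(3) t(1) by simp
  moreover have "t \<ominus>\<^bsub>?T\<^esub> \<zero>\<^bsub>?T\<^esub> = t"
    using t(1) P.TT.minus_add_cancel[of t "\<zero>\<^bsub>?T\<^esub>"] by simp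
  ultimately show ?thesis by simp
qed

lemma ahom_zero_map: "abelian_group H \<Longrightarrow> (\<lambda>x. \<zero>\<^bsub>H\<^esub>) \<in> ahom G H"
  by (rule ahomI) (simp_all add: abelian_monoid.zero_closed abelian_monoid.l_zero abelian_group.axioms)

lemma ahom_add_map:
  assumes "abelian_group H" "f \<in> ahom G H" "g \<in> ahom G H"
  shows "(\<lambda>x. f x \<oplus>\<^bsub>H\<^esub> g x) \<in> ahom G H"
proof -
  interpret H: abelian_group H by fact
  show ?thesis
    using assms(2,3) by (intro ahomI) (auto simp: ahom_closed ahom_add H.a_ac)
qed

lemma ahom_id: "(\<lambda>x. x) \<in> ahom G G"
  by (auto simp: ahom_def)

lemma tensor_pairI: "lmodule (opp R) A \<Longrightarrow> lmodule R B \<Longrightarrow> tensor_pair R A B"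
  by (rule tensor_pair.intro)

lemma tensor_map_closed:
  "lmodule (opp R) A \<Longrightarrow> lmodule (opp R) A' \<Longrightarrow> lmodule R B \<Longrightarrow> f \<in> mhom (opp R) A A' \<Longrightarrow>
    t \<in> carrier (tensor R A B) \<Longrightarrow> tensor_map R A A' B f t \<in> carrier (tensor R A' B)"
  by (rule ahom_closed[OF tensor_map(1)])

lemma tensor_map_zero_elt:
  "lmodule (opp R) A \<Longrightarrow> lmodule (opp R) A' \<Longrightarrow> lmodule R B \<Longrightarrow> f \<in> mhom (opp R) A A' \<Longrightarrow>
    tensor_map R A A' B f \<zero>\<^bsub>tensor R A B\<^esub> = \<zero>\<^bsub>tensor R A' B\<^esub>"
  by (rule ahom_zero[OF tensor_pair.abelian_tensor tensor_pair.abelian_tensor tensor_map(1)])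
    (auto intro: tensor_pairI)

lemma tensor_map_comp:
  assumes A: "lmodule (opp R) A" and A': "lmodule (opp R) A'" and A'': "lmodule (opp R) A''" and B: "lmodule R B"
    and f: "f \<in> mhom (opp R) A A'" and g: "g \<in> mhom (opp R) A' A''" and t: "t \<in> carrier (tensor R A B)"
  shows "tensor_map R A' A'' B g (tensor_map R A A' B f t) = tensor_map R A A'' B (\<lambda>x. g (f x)) t"
  by (rule tensor_pair.tensor_ahom_eq[OF tensor_pairI[OF A B] tensor_pair.abelian_tensor[OF tensor_pairI[OF A'' B]]
        ahom_comp[OF tensor_map(1)[OF A A' B f] tensor_map(1)[OF A' A'' B g]]
        tensor_map(1)[OF A A'' B mhom_comp[OF f g]] _ t])
    (simp add: tensor_map(2) assms mhom_closed[OF f] mhom_comp[OF f g])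

lemma tensor_map_cong:
  assumes A: "lmodule (opp R) A" and A': "lmodule (opp R) A'" and B: "lmodule R B"
    and f: "f \<in> mhom (opp R) A A'" and g: "g \<in> mhom (opp R) A A'"
    and e: "\<And>x. x \<in> carrier A \<Longrightarrow> f x = g x" and t: "t \<in> carrier (tensor R A B)"
  shows "tensor_map R A A' B f t = tensor_map R A A' B g t"
  by (rule tensor_pair.tensor_ahom_eq[OF tensor_pairI[OF A B] tensor_pair.abelian_tensor[OF tensor_pairI[OF A' B]]
        tensor_map(1)[OF A A' B f] tensor_map(1)[OF A A' B g] _ t])
    (simp add: tensor_map(2) assms)

lemma tensor_map_id:
  assumes A: "lmodule (opp R) A" and B: "lmodule R B" and t: "t \<in> carrier (tensor R A B)"
  shows "tensor_map R A A B (\<lambda>x. x) t = t"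
  by (rule tensor_pair.tensor_ahom_eq[OF tensor_pairI[OF A B] tensor_pair.abelian_tensor[OF tensor_pairI[OF A B]]
        tensor_map(1)[OF A A B mhom_id] ahom_id _ t])
    (simp add: tensor_map(2) assms mhom_id)

lemma tensor_map_add:
  assumes A: "lmodule (opp R) A" and A': "lmodule (opp R) A'" and B: "lmodule R B"
    and f: "f \<in> mhom (opp R) A A'" and g: "g \<in> mhom (opp R) A A'" and t: "t \<in> carrier (tensor R A B)"
  shows "tensor_map R A A' B (\<lambda>x. f x \<oplus>\<^bsub>A'\<^esub> g x) t =
    tensor_map R A A' B f t \<oplus>\<^bsub>tensor R A' B\<^esub> tensor_map R A A' B g t"
proof -
  interpret P: tensor_pair R A' B by (rule tensor_pairI[OF A' B])
  show ?thesis
    by (rule tensor_pair.tensor_ahom_eq[OF tensor_pairI[OF A B] P.abelian_tensor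
        tensor_map(1)[OF A A' B mhom_add_map[OF A' f g]]
        ahom_add_map[OF P.abelian_tensor tensor_map(1)[OF A A' B f] tensor_map(1)[OF A A' B g]] _ t])
      (simp add: tensor_map(2) assms mhom_add_map mhom_closed[OF f] mhom_closed[OF g] P.tp_add_l)
qed

lemma tensor_map_zero:
  assumes A: "lmodule (opp R) A" and A': "lmodule (opp R) A'" and B: "lmodule R B"
    and f: "f \<in> mhom (opp R) A A'" and e: "\<And>x. x \<in> carrier A \<Longrightarrow> f x = \<zero>\<^bsub>A'\<^esub>"
    and t: "t \<in> carrier (tensor R A B)"
  shows "tensor_map R A A' B f t = \<zero>\<^bsub>tensor R A' B\<^esub>"
proof -
  interpret P: tensor_pair R A' B by (rule tensor_pairI[OF A' B])
  show ?thesis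
    by (rule tensor_pair.tensor_ahom_eq[OF tensor_pairI[OF A B] P.abelian_tensor
        tensor_map(1)[OF A A' B f] ahom_zero_map[OF P.abelian_tensor] _ t])
      (simp add: tensor_map(2) assms P.tp_zero_l)
qed

lemma tmap2_comp:
  assumes A: "lmodule (opp R) A" and B: "lmodule R B" and B': "lmodule R B'" and B'': "lmodule R B''"
    and f: "f \<in> mhom R B B'" and g: "g \<in> mhom R B' B''" and t: "t \<in> carrier (tensor R A B)"
  shows "tmap2 R A B'' g (tmap2 R A B' f t) = tmap2 R A B'' (\<lambda>x. g (f x)) t"
  by (rule tensor_pair.tensor_ahom_eq[OF tensor_pairI[OF A B] tensor_pair.abelian_tensor[OF tensor_pairI[OF A B'']]
        ahom_comp[OF tmap2(1)[OF A B B' f] tmap2(1)[OF A B' B'' g]]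
        tmap2(1)[OF A B B'' mhom_comp[OF f g]] _ t])
    (simp add: tmap2(2)[OF A B B' f] tmap2(2)[OF A B' B'' g] tmap2(2)[OF A B B'' mhom_comp[OF f g]] mhom_closed[OF f])

lemma tmap2_cong:
  assumes A: "lmodule (opp R) A" and B: "lmodule R B" and B': "lmodule R B'"
    and f: "f \<in> mhom R B B'" and g: "g \<in> mhom R B B'"
    and e: "\<And>x. x \<in> carrier B \<Longrightarrow> f x = g x" and t: "t \<in> carrier (tensor R A B)"
  shows "tmap2 R A B' f t = tmap2 R A B' g t"
  by (rule tensor_pair.tensor_ahom_eq[OF tensor_pairI[OF A B] tensor_pair.abelian_tensor[OF tensor_pairI[OF A B']]
        tmap2(1)[OF A B B' f] tmap2(1)[OF A B B' g] _ t])
    (simp add: tmap2(2)[OF A B B' f] tmap2(2)[OF A B B' g] e)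

lemma tmap2_id:
  assumes A: "lmodule (opp R) A" and B: "lmodule R B" and t: "t \<in> carrier (tensor R A B)"
  shows "tmap2 R A B (\<lambda>x. x) t = t"
  by (rule tensor_pair.tensor_ahom_eq[OF tensor_pairI[OF A B] tensor_pair.abelian_tensor[OF tensor_pairI[OF A B]]
        tmap2(1)[OF A B B mhom_id] ahom_id _ t])
    (simp add: tmap2(2)[OF A B B mhom_id])

lemma tmap2_zero:
  assumes A: "lmodule (opp R) A" and B: "lmodule R B" and B': "lmodule R B'"
    and f: "f \<in> mhom R B B'" and e: "\<And>x. x \<in> carrier B \<Longrightarrow> f x = \<zero>\<^bsub>B'\<^esub>"
    and t: "t \<in> carrier (tensor R A B)"
  shows "tmap2 R A B' f t = \<zero>\<^bsub>tensor R A B'\<^esub>"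
proof -
  interpret P: tensor_pair R A B' by (rule tensor_pairI[OF A B'])
  show ?thesis
    by (rule tensor_pair.tensor_ahom_eq[OF tensor_pairI[OF A B] P.abelian_tensor
        tmap2(1)[OF A B B' f] ahom_zero_map[OF P.abelian_tensor] _ t])
      (simp add: tmap2(2)[OF A B B' f] e P.tp_zero_r)
qed

lemma tensor_map_tmap2:
  assumes A: "lmodule (opp R) A" and A': "lmodule (opp R) A'" and B: "lmodule R B" and B': "lmodule R B'"
    and f: "f \<in> mhom (opp R) A A'" and g: "g \<in> mhom R B B'" and t: "t \<in> carrier (tensor R A B)"
  shows "tmap2 R A' B' g (tensor_map R A A' B f t) = tensor_map R A A' B' f (tmap2 R A B' g t)"
  by (rule tensor_pair.tensor_ahom_eq[OF tensor_pairI[OF A B] tensor_pair.abelian_tensor[OF tensor_pairI[OF A' B']]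
        ahom_comp[OF tensor_map(1)[OF A A' B f] tmap2(1)[OF A' B B' g]]
        ahom_comp[OF tmap2(1)[OF A B B' g] tensor_map(1)[OF A A' B' f]] _ t])
    (simp add: tmap2(2)[OF A B B' g] tmap2(2)[OF A' B B' g] tensor_map(2) assms mhom_closed[OF f] mhom_closed[OF g])

lemma additive_subgroup_ahom_image:
  assumes "abelian_group G" "abelian_group H" "f \<in> ahom G H"
  shows "additive_subgroup (f ` carrier G) H"
proof (rule additive_subgroupI, rule group.subgroupI)
  interpret G: abelian_group G by fact
  interpret H: abelian_group H by fact
  show "group (add_monoid H)" by (rule H.a_group)
  show "f ` carrier G \<subseteq> carrier (add_monoid H)" using ahom_closed[OF assms(3)] by auto
  show "f ` carrier G \<noteq> {}" using G.zero_closed by blast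
  fix x y assume "x \<in> f ` carrier G" "y \<in> f ` carrier G"
  then obtain u v where uv: "x = f u" "y = f v" "u \<in> carrier G" "v \<in> carrier G" by blast
  then have "f (u \<oplus>\<^bsub>G\<^esub> v) = x \<oplus>\<^bsub>H\<^esub> y" using ahom_add[OF assms(3)] by simp
  then show "x \<otimes>\<^bsub>add_monoid H\<^esub> y \<in> f ` carrier G" using uv by (metis G.a_closed image_eqI monoid.select_convs(1))
next
  interpret G: abelian_group G by fact
  fix x assume "x \<in> f ` carrier G"
  then obtain u where u: "x = f u" "u \<in> carrier G" by blast
  then have "f (\<ominus>\<^bsub>G\<^esub> u) = inv\<^bsub>add_monoid H\<^esub> x" using ahom_neg[OF assms] by (simp add: a_inv_def)
  then show "inv\<^bsub>add_monoid H\<^esub> x \<in> f ` carrier G" using u by (metis G.a_inv_closed imageI)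
qed

text \<open>Apply \<open>tensor_kernel\<close> with \<open>I\<close> the image of the map induced by
  \<open>f\<close>: if \<open>g a = g a'\<close> then \<open>a - a' = f c\<close> for some
  \<open>c\<close>, and the difference of the two pure tensors is the image of
  \<open>c \<otimes> b\<close>.\<close>

lemma tensor_right_exact1:
  assumes A: "lmodule (opp R) A" and A': "lmodule (opp R) A'" and A'': "lmodule (opp R) A''" and B: "lmodule R B"
    and f: "f \<in> mhom (opp R) A A'" and g: "g \<in> mhom (opp R) A' A''" and on: "g ` carrier A' = carrier A''"
    and ex: "\<And>x. x \<in> carrier A' \<Longrightarrow> g x = \<zero>\<^bsub>A''\<^esub> \<Longrightarrow> \<exists>a\<in>carrier A. x = f a"
    and t: "t \<in> carrier (tensor R A' B)" "tensor_map R A' A'' B g t = \<zero>\<^bsub>tensor R A'' B\<^esub>"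
  shows "\<exists>u\<in>carrier (tensor R A B). t = tensor_map R A A' B f u"
proof -
  interpret P: tensor_pair R A B by (rule tensor_pairI[OF A B])
  interpret P': tensor_pair R A' B by (rule tensor_pairI[OF A' B])
  interpret A'': lmodule "opp R" A'' by fact
  note fm = tensor_map[OF A A' B f]
  have "t \<in> tensor_map R A A' B f ` carrier (tensor R A B)"
  proof (rule tensor_kernel[OF A' B A'' B tensor_map[OF A' A'' B g] g on])
    show "additive_subgroup (tensor_map R A A' B f ` carrier (tensor R A B)) (tensor R A' B)"
      by (rule additive_subgroup_ahom_image[OF P.abelian_tensor P'.abelian_tensor fm(1)])
    fix a a' b b' assume *: "a \<in> carrier A'" "a' \<in> carrier A'" "b \<in> carrier B" "b' \<in> carrier B" "g a = g a'" "b = b'"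
    then have "g (a \<ominus>\<^bsub>A'\<^esub> a') = \<zero>\<^bsub>A''\<^esub>"
      using mhom_minus[OF A' A'' g] mhom_closed[OF g] by (simp add: A''.minus_eq_zero_iff)
    then obtain c where c: "c \<in> carrier A" "a \<ominus>\<^bsub>A'\<^esub> a' = f c" using ex[of "a \<ominus>\<^bsub>A'\<^esub> a'"] * by auto
    have "P'.tp a b \<ominus>\<^bsub>tensor R A' B\<^esub> P'.tp a' b = P'.tp (f c) b"
      using ahom_minus[OF P'.A.abelian_group_axioms P'.abelian_tensor P'.tp_ahom_l[OF *(3)] *(1,2)] c by simp
    also have "\<dots> = tensor_map R A A' B f (P.tp c b)" using fm(2) c * by simp
    finally show "P'.tp a b \<ominus>\<^bsub>tensor R A' B\<^esub> P'.tp a' b' \<in> tensor_map R A A' B f ` carrier (tensor R A B)"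
      using c * by auto
  qed (use t mhom_id in auto)
  then show ?thesis by blast
qed

lemma tensor_right_exact2:
  assumes A: "lmodule (opp R) A" and B: "lmodule R B" and B': "lmodule R B'" and B'': "lmodule R B''"
    and f: "f \<in> mhom R B B'" and g: "g \<in> mhom R B' B''" and on: "g ` carrier B' = carrier B''"
    and ex: "\<And>x. x \<in> carrier B' \<Longrightarrow> g x = \<zero>\<^bsub>B''\<^esub> \<Longrightarrow> \<exists>a\<in>carrier B. x = f a"
    and t: "t \<in> carrier (tensor R A B')" "tmap2 R A B'' g t = \<zero>\<^bsub>tensor R A B''\<^esub>"
  shows "\<exists>u\<in>carrier (tensor R A B). t = tmap2 R A B' f u"
proof -
  interpret P: tensor_pair R A B by (rule tensor_pairI[OF A B])
  interpret P': tensor_pair R A B' by (rule tensor_pairI[OF A B'])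
  interpret B'': lmodule R B'' by fact
  note fm = tmap2[OF A B B' f]
  have "t \<in> tmap2 R A B' f ` carrier (tensor R A B)"
  proof (rule tensor_kernel[OF A B' A B'' tmap2[OF A B' B'' g]])
    show "additive_subgroup (tmap2 R A B' f ` carrier (tensor R A B)) (tensor R A B')"
      by (rule additive_subgroup_ahom_image[OF P.abelian_tensor P'.abelian_tensor fm(1)])
    fix a a' b b' assume *: "a \<in> carrier A" "a' \<in> carrier A" "b \<in> carrier B'" "b' \<in> carrier B'" "a = a'" "g b = g b'"
    then have "g (b \<ominus>\<^bsub>B'\<^esub> b') = \<zero>\<^bsub>B''\<^esub>"
      using mhom_minus[OF B' B'' g] mhom_closed[OF g] by (simp add: B''.minus_eq_zero_iff)
    then obtain c where c: "c \<in> carrier B" "b \<ominus>\<^bsub>B'\<^esub> b' = f c" using ex[of "b \<ominus>\<^bsub>B'\<^esub> b'"] * by auto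
    have "P'.tp a b \<ominus>\<^bsub>tensor R A B'\<^esub> P'.tp a b' = P'.tp a (f c)"
      using ahom_minus[OF P'.B.abelian_group_axioms P'.abelian_tensor P'.tp_ahom_r[OF *(1)] *(3,4)] c by simp
    also have "\<dots> = tmap2 R A B' f (P.tp a c)" using fm(2) c * by simp
    finally show "P'.tp a b \<ominus>\<^bsub>tensor R A B'\<^esub> P'.tp a' b' \<in> tmap2 R A B' f ` carrier (tensor R A B)"
      using c * by auto
  qed (use t mhom_id g on in auto)
  then show ?thesis by blast
qed

lemma tensor_map_onto:
  assumes A: "lmodule (opp R) A" and A': "lmodule (opp R) A'" and B: "lmodule R B"
    and f: "f \<in> mhom (opp R) A A'" and on: "f ` carrier A = carrier A'"
    and t: "t \<in> carrier (tensor R A' B)"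
  shows "\<exists>u\<in>carrier (tensor R A B). t = tensor_map R A A' B f u"
proof -
  interpret P: tensor_pair R A B by (rule tensor_pairI[OF A B])
  interpret P': tensor_pair R A' B by (rule tensor_pairI[OF A' B])
  note fm = tensor_map[OF A A' B f]
  show ?thesis using t
  proof (induction t rule: P'.tensor_induct)
    case zero
    show ?case
      by (rule bexI[OF _ P.TT.zero_closed]) (simp add: ahom_zero[OF P.abelian_tensor P'.abelian_tensor fm(1)])
  next
    case (minus s t)
    then obtain u v where "u \<in> carrier (tensor R A B)" "s = tensor_map R A A' B f u"
      "v \<in> carrier (tensor R A B)" "t = tensor_map R A A' B f v" by blast
    then show ?case
      by (intro bexI[of _ "u \<ominus>\<^bsub>tensor R A B\<^esub> v"])
        (simp_all add: ahom_minus[OF P.abelian_tensor P'.abelian_tensor fm(1)])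
  next
    case (pure a b)
    then obtain c where "c \<in> carrier A" "a = f c" using on by blast
    then show ?case using pure by (intro bexI[of _ "P.tp c b"]) (simp_all add: fm(2))
  qed
qed

lemma tmap2_onto:
  assumes A: "lmodule (opp R) A" and B: "lmodule R B" and B': "lmodule R B'"
    and f: "f \<in> mhom R B B'" and on: "f ` carrier B = carrier B'"
    and t: "t \<in> carrier (tensor R A B')"
  shows "\<exists>u\<in>carrier (tensor R A B). t = tmap2 R A B' f u"
proof -
  interpret P: tensor_pair R A B by (rule tensor_pairI[OF A B])
  interpret P': tensor_pair R A B' by (rule tensor_pairI[OF A B'])
  note fm = tmap2[OF A B B' f]
  show ?thesis using t
  proof (induction t rule: P'.tensor_induct)
    case zero
    show ?case
      by (rule bexI[OF _ P.TT.zero_closed]) (simp add: ahom_zero[OF P.abelian_tensor P'.abelian_tensor fm(1)])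
  next
    case (minus s t)
    then obtain u v where "u \<in> carrier (tensor R A B)" "s = tmap2 R A B' f u"
      "v \<in> carrier (tensor R A B)" "t = tmap2 R A B' f v" by blast
    then show ?case
      by (intro bexI[of _ "u \<ominus>\<^bsub>tensor R A B\<^esub> v"])
        (simp_all add: ahom_minus[OF P.abelian_tensor P'.abelian_tensor fm(1)])
  next
    case (pure a b)
    then obtain c where "c \<in> carrier B" "b = f c" using on by blast
    then show ?case using pure by (intro bexI[of _ "P.tp a c"]) (simp_all add: fm(2))
  qed
qed

section \<open>Modules with a dual basis\<close>

text \<open>The dual basis criterion replaces projectivity together with finite generation. Unlike
  \<open>projective\<close> it mentions no test modules, so it lifts maps into modules of arbitrary
  type, and it supplies explicit inverses of the natural maps used later.\<close>

definition dual_basis :: "'r ring \<Rightarrow> ('r, 'a) module \<Rightarrow> nat \<Rightarrow> (nat \<Rightarrow> 'a) \<Rightarrow> (nat \<Rightarrow> 'a \<Rightarrow> 'r) \<Rightarrow> bool"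
  where "dual_basis R P m v \<xi> \<longleftrightarrow> lmodule R P \<and> (\<forall>i<m. v i \<in> carrier P) \<and>
    (\<forall>i<m. \<xi> i \<in> mhom R P (reg R)) \<and> (\<forall>x\<in>carrier P. gsum P (\<lambda>i. \<xi> i x \<odot>\<^bsub>P\<^esub> v i) m = x)"

lemma dual_basisD:
  assumes "dual_basis R P m v \<xi>"
  shows "lmodule R P" "\<And>i. i < m \<Longrightarrow> v i \<in> carrier P" "\<And>i. i < m \<Longrightarrow> \<xi> i \<in> mhom R P (reg R)"
    "\<And>x. x \<in> carrier P \<Longrightarrow> gsum P (\<lambda>i. \<xi> i x \<odot>\<^bsub>P\<^esub> v i) m = x"
    "\<And>i x. i < m \<Longrightarrow> x \<in> carrier P \<Longrightarrow> \<xi> i x \<in> carrier R"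
proof -
  show "lmodule R P" "\<And>i. i < m \<Longrightarrow> v i \<in> carrier P" "\<And>x. x \<in> carrier P \<Longrightarrow> gsum P (\<lambda>i. \<xi> i x \<odot>\<^bsub>P\<^esub> v i) m = x"
    and x: "\<And>i. i < m \<Longrightarrow> \<xi> i \<in> mhom R P (reg R)"
    using assms unfolding dual_basis_def by simp_all
  show "\<And>i x. i < m \<Longrightarrow> x \<in> carrier P \<Longrightarrow> \<xi> i x \<in> carrier R"
    using mhom_closed[OF x] by simp
qed

lemma dual_basis_hom:
  assumes "dual_basis R P m v \<xi>" "lmodule R B" "f \<in> mhom R P B" "x \<in> carrier P"
  shows "f x = gsum B (\<lambda>i. \<xi> i x \<odot>\<^bsub>B\<^esub> f (v i)) m"
proof -
  note D = dual_basisD[OF assms(1)]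
  interpret P: lmodule R P by (rule D(1))
  have "f x = f (gsum P (\<lambda>i. \<xi> i x \<odot>\<^bsub>P\<^esub> v i) m)" using D(4)[OF assms(4)] by simp
  also have "\<dots> = gsum B (\<lambda>i. f (\<xi> i x \<odot>\<^bsub>P\<^esub> v i)) m"
    by (rule mhom_gsum[OF D(1) assms(2,3)]) (use D(2,5) assms(4) in auto)
  also have "\<dots> = gsum B (\<lambda>i. \<xi> i x \<odot>\<^bsub>B\<^esub> f (v i)) m"
    by (rule gsum_cong) (use D(2,5) assms(4) mhom_smult[OF assms(3)] in auto)
  finally show ?thesis .
qed

lemma smult_mhom_reg:
  assumes "lmodule R B" "b \<in> carrier B" "\<xi> \<in> mhom R P (reg R)"
  shows "(\<lambda>x. \<xi> x \<odot>\<^bsub>B\<^esub> b) \<in> mhom R P B"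
proof -
  interpret B: lmodule R B by fact
  show ?thesis
    using assms(2) mhom_closed[OF assms(3)] mhom_add[OF assms(3)] mhom_smult[OF assms(3)]
    by (intro mhomI) (auto simp: B.smult_l_distr B.smult_assoc)
qed

text \<open>Preimages of the elements \<open>f (v i)\<close> are combined with the coordinates
  \<open>\<xi> i\<close>; no restriction on the types of \<open>A\<close> and \<open>B\<close>
  arises.\<close>

lemma dual_basis_lift:
  assumes db: "dual_basis R P m v \<xi>" and A: "lmodule R A" and B: "lmodule R B"
    and g: "g \<in> mhom R A B" "g ` carrier A = carrier B" and f: "f \<in> mhom R P B"
  shows "\<exists>h\<in>mhom R P A. \<forall>x\<in>carrier P. g (h x) = f x"
proof -
  note D = dual_basisD[OF db]
  interpret A: lmodule R A by fact
  let ?w = "\<lambda>i. inv_into (carrier A) g (f (v i))"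
  have w: "?w i \<in> carrier A" "g (?w i) = f (v i)" if "i < m" for i
    using g(2) mhom_closed[OF f D(2)[OF that]] by (metis inv_into_into, metis f_inv_into_f)
  let ?h = "\<lambda>x. gsum A (\<lambda>i. \<xi> i x \<odot>\<^bsub>A\<^esub> ?w i) m"
  have "?h \<in> mhom R P A"
    by (rule mhom_gsum_map[OF A]) (use w D(3) in \<open>auto intro: smult_mhom_reg[OF A]\<close>)
  moreover have "g (?h x) = f x" if x: "x \<in> carrier P" for x
  proof -
    have "g (?h x) = gsum B (\<lambda>i. g (\<xi> i x \<odot>\<^bsub>A\<^esub> ?w i)) m"
      by (rule mhom_gsum[OF A B g(1)]) (use w D(5) x in auto)
    also have "\<dots> = gsum B (\<lambda>i. \<xi> i x \<odot>\<^bsub>B\<^esub> f (v i)) m"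
      by (rule gsum_cong) (use w D(5) x mhom_smult[OF g(1)] in auto)
    also have "\<dots> = f x" using dual_basis_hom[OF db B f x] by simp
    finally show ?thesis .
  qed
  ultimately show ?thesis by (intro bexI[of _ ?h]) simp_all
qed

section \<open>Homomorphism modules\<close>

lemma hom_group_simps [simp]:
  "carrier (hom_group R A B) = mhom R A B \<inter> extensional (carrier A)"
  "zero (hom_group R A B) = (\<lambda>x\<in>carrier A. \<zero>\<^bsub>B\<^esub>)"
  "add (hom_group R A B) = (\<lambda>f g. \<lambda>x\<in>carrier A. f x \<oplus>\<^bsub>B\<^esub> g x)"
  by (simp_all add: hom_group_def)

lemma mhom_restrict:
  assumes "lmodule R A" "f \<in> mhom R A B"
  shows "restrict f (carrier A) \<in> mhom R A B"
  by (rule mhom_cong[OF assms]) simp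

lemma abelian_hom_group:
  assumes "lmodule R A" "lmodule R B"
  shows "abelian_group (hom_group R A B)"
proof (rule abelian_groupI; simp)
  interpret A: lmodule R A by fact
  interpret B: lmodule R B by fact
  note r = mhom_restrict[OF assms(1)]
  note cl = mhom_closed[of _ R A B]
  {
    fix f g assume f: "f \<in> mhom R A B \<and> f \<in> extensional (carrier A)" and g: "g \<in> mhom R A B \<and> g \<in> extensional (carrier A)"
    show "(\<lambda>x\<in>carrier A. f x \<oplus>\<^bsub>B\<^esub> g x) \<in> mhom R A B"
      using f g by (intro r mhom_add_map[OF assms(2)]) auto
    show "(\<lambda>x\<in>carrier A. f x \<oplus>\<^bsub>B\<^esub> g x) = (\<lambda>x\<in>carrier A. g x \<oplus>\<^bsub>B\<^esub> f x)"
      using f g cl by (intro restrict_ext) (auto intro: B.a_comm)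
    fix h assume h: "h \<in> mhom R A B \<and> h \<in> extensional (carrier A)"
    show "(\<lambda>x\<in>carrier A. (if x \<in> carrier A then f x \<oplus>\<^bsub>B\<^esub> g x else undefined) \<oplus>\<^bsub>B\<^esub> h x) =
      (\<lambda>x\<in>carrier A. f x \<oplus>\<^bsub>B\<^esub> (if x \<in> carrier A then g x \<oplus>\<^bsub>B\<^esub> h x else undefined))"
      using f g h cl by (intro restrict_ext) (auto intro: B.a_assoc)
  next
    show "(\<lambda>x\<in>carrier A. \<zero>\<^bsub>B\<^esub>) \<in> mhom R A B" by (intro r mhom_zero_map[OF assms(2)])
  next
    fix f assume f: "f \<in> mhom R A B \<and> f \<in> extensional (carrier A)"
    show "(\<lambda>x\<in>carrier A. (if x \<in> carrier A then \<zero>\<^bsub>B\<^esub> else undefined) \<oplus>\<^bsub>B\<^esub> f x) = f"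
      using f cl by (intro extensionalityI[of _ "carrier A"]) auto
    show "\<exists>g\<in>mhom R A B \<inter> extensional (carrier A). (\<lambda>x\<in>carrier A. g x \<oplus>\<^bsub>B\<^esub> f x) = (\<lambda>x\<in>carrier A. \<zero>\<^bsub>B\<^esub>)"
      by (rule bexI[of _ "\<lambda>x\<in>carrier A. \<ominus>\<^bsub>B\<^esub> f x"])
        (use f cl in \<open>auto intro!: r mhom_neg_map[OF assms(2)] simp: B.l_neg cong: restrict_cong\<close>)
  }
qed

section \<open>Bimodules\<close>

lemma left_mod_simps [simp]:
  "carrier (left_mod C) = carrier C" "add (left_mod C) = add C" "zero (left_mod C) = zero C"
  "smult (left_mod C) = smult C"
  by (simp_all add: left_mod_def module.defs)

lemma right_mod_simps [simp]:
  "carrier (right_mod C) = carrier C" "add (right_mod C) = add C" "zero (right_mod C) = zero C"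
  "smult (right_mod C) = (\<lambda>r x. rsmult C x r)"
  by (simp_all add: right_mod_def)

lemma hom_mod_simps [simp]:
  "carrier (hom_mod S C N) = mhom S (left_mod C) N \<inter> extensional (carrier C)"
  "add (hom_mod S C N) = (\<lambda>f g. \<lambda>x\<in>carrier C. f x \<oplus>\<^bsub>N\<^esub> g x)"
  "zero (hom_mod S C N) = (\<lambda>x\<in>carrier C. \<zero>\<^bsub>N\<^esub>)"
  "smult (hom_mod S C N) = (\<lambda>r f. \<lambda>x\<in>carrier C. f (rsmult C x r))"
  by (simp_all add: hom_mod_def ring.defs module.defs hom_group_def)

lemma tensor_mod_simps [simp]:
  "carrier (tensor_mod R C M) = carrier (tensor R (right_mod C) M)"
  "add (tensor_mod R C M) = add (tensor R (right_mod C) M)"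
  "zero (tensor_mod R C M) = zero (tensor R (right_mod C) M)"
  "smult (tensor_mod R C M) = (\<lambda>s. tensor_map R (right_mod C) (right_mod C) M (\<lambda>x. s \<odot>\<^bsub>C\<^esub> x))"
  by (simp_all add: tensor_mod_def ring.defs module.defs)

lemma ahom_tensor_mod:
  "ahom (tensor_mod R C M) G = ahom (tensor R (right_mod C) M) G"
  "ahom H (tensor_mod R C M) = ahom H (tensor R (right_mod C) M)"
  by (simp_all add: ahom_def)

lemma abelian_group_cong:
  assumes "abelian_group G" "carrier H = carrier G" "add H = add G" "zero H = zero G"
  shows "abelian_group H"
proof -
  interpret abelian_group G by fact
  show ?thesis
    by (rule abelian_groupI) (use assms(2-4) in \<open>auto simp: a_ac intro: l_neg\<close>)
qed

section \<open>Commuting actions of two rings on one additive group\<close>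

text \<open>A bimodule written as two left modules with the same additive structure. The description
  is symmetric (see \<open>swap\<close>), so that the duals into C of left and of right modules are
  instances of one theory.\<close>

locale two_mod =
  fixes A :: "'a ring" and CA :: "('a, 'c) module" and B :: "'b ring" and CB :: "('b, 'c) module"
  assumes CA: "lmodule A CA" and CB: "lmodule B CB"
    and same: "carrier CB = carrier CA" "add CB = add CA" "zero CB = zero CA"
    and commute: "\<And>a b x. a \<in> carrier A \<Longrightarrow> b \<in> carrier B \<Longrightarrow> x \<in> carrier CA \<Longrightarrow>
      a \<odot>\<^bsub>CA\<^esub> (b \<odot>\<^bsub>CB\<^esub> x) = b \<odot>\<^bsub>CB\<^esub> (a \<odot>\<^bsub>CA\<^esub> x)"

text \<open>\<open>Hom\<^sub>B(P, C)\<close> with the remaining action of \<open>A\<close>.\<close>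

definition homL :: "('a, 'c) module \<Rightarrow> 'b ring \<Rightarrow> ('b, 'p) module \<Rightarrow> ('b, 'c) module \<Rightarrow> ('a, 'p \<Rightarrow> 'c) module"
  where "homL CA B P CB = \<lparr>carrier = mhom B P CB \<inter> extensional (carrier P), mult = undefined, one = undefined,
    zero = (\<lambda>x\<in>carrier P. \<zero>\<^bsub>CB\<^esub>), add = (\<lambda>f g. \<lambda>x\<in>carrier P. f x \<oplus>\<^bsub>CB\<^esub> g x),
    smult = (\<lambda>a f. \<lambda>x\<in>carrier P. a \<odot>\<^bsub>CA\<^esub> f x)\<rparr>"

lemma homL_simps [simp]:
  "carrier (homL CA B P CB) = mhom B P CB \<inter> extensional (carrier P)"
  "zero (homL CA B P CB) = (\<lambda>x\<in>carrier P. \<zero>\<^bsub>CB\<^esub>)"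
  "add (homL CA B P CB) = (\<lambda>f g. \<lambda>x\<in>carrier P. f x \<oplus>\<^bsub>CB\<^esub> g x)"
  "smult (homL CA B P CB) = (\<lambda>a f. \<lambda>x\<in>carrier P. a \<odot>\<^bsub>CA\<^esub> f x)"
  by (simp_all add: homL_def)

definition precomp :: "('b, 'p) module \<Rightarrow> ('p \<Rightarrow> 'q) \<Rightarrow> ('q \<Rightarrow> 'c) \<Rightarrow> 'p \<Rightarrow> 'c"
  where "precomp P d f = (\<lambda>x\<in>carrier P. f (d x))"

lemma ext_eqI:
  "f \<in> extensional X \<Longrightarrow> g \<in> extensional X \<Longrightarrow> (\<And>x. x \<in> X \<Longrightarrow> f x = g x) \<Longrightarrow> f = g"
  by (rule extensionalityI)

context two_mod
begin

sublocale CA: lmodule A CA by (rule CA)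
sublocale CB: lmodule B CB by (rule CB)

lemma smult_mhom: "a \<in> carrier A \<Longrightarrow> (\<lambda>x. a \<odot>\<^bsub>CA\<^esub> x) \<in> mhom B CB CB"
  by (rule mhomI) (auto simp: same CA.smult_r_distr commute)

lemma swap: "two_mod B CB A CA"
  by (rule two_mod.intro[OF CB CA]) (simp_all add: same commute)

lemma homL_smult_mem: "a \<in> carrier A \<Longrightarrow> f \<in> mhom B P CB \<Longrightarrow> (\<lambda>x. a \<odot>\<^bsub>CA\<^esub> f x) \<in> mhom B P CB"
  using mhom_comp[OF _ smult_mhom] .

lemma lmodule_homL:
  assumes P: "lmodule B P"
  shows "lmodule A (homL CA B P CB)"
proof (rule lmoduleI'[OF CA.ring_axioms])
  interpret P: lmodule B P by fact
  show "abelian_group (homL CA B P CB)"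
    by (rule abelian_group_cong[OF abelian_hom_group[OF P CB]]) simp_all
  note cl = mhom_closed[of _ B P CB, unfolded same]
  fix a b f g
  assume a: "a \<in> carrier A"
  assume f: "f \<in> carrier (homL CA B P CB)"
  then have f': "f \<in> mhom B P CB" "f \<in> extensional (carrier P)" by auto
  show "a \<odot>\<^bsub>homL CA B P CB\<^esub> f \<in> carrier (homL CA B P CB)"
    using mhom_restrict[OF P homL_smult_mem[OF a f'(1)]] by simp
  {
    assume b: "b \<in> carrier A"
    show "(a \<oplus>\<^bsub>A\<^esub> b) \<odot>\<^bsub>homL CA B P CB\<^esub> f =
        a \<odot>\<^bsub>homL CA B P CB\<^esub> f \<oplus>\<^bsub>homL CA B P CB\<^esub> b \<odot>\<^bsub>homL CA B P CB\<^esub> f"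
      using a b cl[OF f'(1)] by (auto simp: same CA.smult_l_distr intro!: restrict_ext)
    show "(a \<otimes>\<^bsub>A\<^esub> b) \<odot>\<^bsub>homL CA B P CB\<^esub> f = a \<odot>\<^bsub>homL CA B P CB\<^esub> (b \<odot>\<^bsub>homL CA B P CB\<^esub> f)"
      using a b cl[OF f'(1)] by (auto simp: same CA.smult_assoc intro!: restrict_ext)
  }
  {
    assume g: "g \<in> carrier (homL CA B P CB)"
    show "a \<odot>\<^bsub>homL CA B P CB\<^esub> (f \<oplus>\<^bsub>homL CA B P CB\<^esub> g) =
        a \<odot>\<^bsub>homL CA B P CB\<^esub> f \<oplus>\<^bsub>homL CA B P CB\<^esub> a \<odot>\<^bsub>homL CA B P CB\<^esub> g"
      using a g cl[OF f'(1)] cl[of g] by (auto simp: same CA.smult_r_distr intro!: restrict_ext)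
  }
next
  fix f assume "f \<in> carrier (homL CA B P CB)"
  then show "\<one>\<^bsub>A\<^esub> \<odot>\<^bsub>homL CA B P CB\<^esub> f = f"
    using mhom_closed[of f B P CB, unfolded same] by (auto intro!: ext_eqI[of _ "carrier P"])
qed

lemma precomp_mem:
  assumes P: "lmodule B P" and d: "d \<in> mhom B P Q" and f: "f \<in> mhom B Q CB"
  shows "precomp P d f \<in> carrier (homL CA B P CB)"
  unfolding precomp_def using mhom_restrict[OF P mhom_comp[OF d f]] by simp

lemma precomp_mhom:
  assumes P: "lmodule B P" and d: "d \<in> mhom B P Q"
  shows "precomp P d \<in> mhom A (homL CA B Q CB) (homL CA B P CB)"
proof (rule mhomI)
  fix f assume "f \<in> carrier (homL CA B Q CB)"
  then have f: "f \<in> mhom B Q CB" by simp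
  show "precomp P d f \<in> carrier (homL CA B P CB)" by (rule precomp_mem[OF P d f])
qed (use mhom_closed[OF d] in \<open>auto simp: precomp_def intro!: restrict_ext\<close>)

end

lemma hom_mod_eq_hom_group:
  assumes "lmodule S (left_mod C)" "lmodule S N"
  shows "abelian_group (hom_mod S C N)"
  by (rule abelian_group_cong[OF abelian_hom_group[OF assms]]) simp_all

definition hmap :: "('s, 'r, 'c) bimodule \<Rightarrow> ('b \<Rightarrow> 'd) \<Rightarrow> ('c \<Rightarrow> 'b) \<Rightarrow> 'c \<Rightarrow> 'd"
  where "hmap C g f = (\<lambda>x\<in>carrier C. g (f x))"

locale bimod =
  fixes S :: "'s ring" and R :: "'r ring" and C :: "('s, 'r, 'c) bimodule"
  assumes bimod: "bimodule S R C" and ringR: "ring R"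
begin

lemma CL: "lmodule S (left_mod C)" and CR: "lmodule (opp R) (right_mod C)"
  and comm: "\<And>s r x. s \<in> carrier S \<Longrightarrow> r \<in> carrier R \<Longrightarrow> x \<in> carrier C \<Longrightarrow>
    s \<odot>\<^bsub>C\<^esub> rsmult C x r = rsmult C (s \<odot>\<^bsub>C\<^esub> x) r"
  using bimod unfolding bimodule_def by blast+

sublocale CL: lmodule S "left_mod C" by (rule CL)
sublocale CR: lmodule "opp R" "right_mod C" by (rule CR)

lemma ringS: "ring S" by (rule CL.ring_axioms)

lemma two_mod_LR: "two_mod S (left_mod C) (opp R) (right_mod C)"
  by (rule two_mod.intro[OF CL CR]) (simp_all add: comm)

lemma two_mod_RL: "two_mod (opp R) (right_mod C) S (left_mod C)"
  by (rule two_mod.swap[OF two_mod_LR])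

lemma rsmult_mhom: "r \<in> carrier R \<Longrightarrow> (\<lambda>x. rsmult C x r) \<in> mhom S (left_mod C) (left_mod C)"
  using two_mod.smult_mhom[OF two_mod_RL, of r] by simp

lemma smult_mhom: "s \<in> carrier S \<Longrightarrow> (\<lambda>x. s \<odot>\<^bsub>C\<^esub> x) \<in> mhom (opp R) (right_mod C) (right_mod C)"
  using two_mod.smult_mhom[OF two_mod_LR, of s] by simp

lemma rsmult_closed: "x \<in> carrier C \<Longrightarrow> r \<in> carrier R \<Longrightarrow> rsmult C x r \<in> carrier C"
  using CR.smult_closed[of r x] by simp

lemma smultC_closed: "x \<in> carrier C \<Longrightarrow> s \<in> carrier S \<Longrightarrow> s \<odot>\<^bsub>C\<^esub> x \<in> carrier C"
  using CL.smult_closed[of s x] by simp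

lemma lmodule_hom_mod:
  assumes N: "lmodule S N"
  shows "lmodule R (hom_mod S C N)"
proof (rule lmoduleI'[OF ringR hom_mod_eq_hom_group[OF CL N]])
  interpret N: lmodule S N by fact
  interpret R: ring R by (rule ringR)
  note cl = mhom_closed[of _ S "left_mod C" N, simplified]
  fix a b f g
  assume a: "a \<in> carrier R"
  assume "f \<in> carrier (hom_mod S C N)"
  then have f: "f \<in> mhom S (left_mod C) N" "f \<in> extensional (carrier C)" by auto
  show "a \<odot>\<^bsub>hom_mod S C N\<^esub> f \<in> carrier (hom_mod S C N)"
    using mhom_restrict[OF CL mhom_comp[OF rsmult_mhom[OF a] f(1)]] by simp
  {
    assume b: "b \<in> carrier R"
    show "(a \<oplus>\<^bsub>R\<^esub> b) \<odot>\<^bsub>hom_mod S C N\<^esub> f =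
        a \<odot>\<^bsub>hom_mod S C N\<^esub> f \<oplus>\<^bsub>hom_mod S C N\<^esub> b \<odot>\<^bsub>hom_mod S C N\<^esub> f"
      using a b CR.smult_l_distr[of a b] mhom_add[OF f(1)] rsmult_closed
      by (auto intro!: restrict_ext)
    show "(a \<otimes>\<^bsub>R\<^esub> b) \<odot>\<^bsub>hom_mod S C N\<^esub> f = a \<odot>\<^bsub>hom_mod S C N\<^esub> (b \<odot>\<^bsub>hom_mod S C N\<^esub> f)"
      using a b CR.smult_assoc[of b a] rsmult_closed by (auto intro!: restrict_ext)
  }
  {
    assume g: "g \<in> carrier (hom_mod S C N)"
    show "a \<odot>\<^bsub>hom_mod S C N\<^esub> (f \<oplus>\<^bsub>hom_mod S C N\<^esub> g) =
        a \<odot>\<^bsub>hom_mod S C N\<^esub> f \<oplus>\<^bsub>hom_mod S C N\<^esub> a \<odot>\<^bsub>hom_mod S C N\<^esub> g"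
      using a rsmult_closed by (auto intro!: restrict_ext)
  }
next
  fix f assume f: "f \<in> carrier (hom_mod S C N)"
  have "\<And>x. x \<in> carrier C \<Longrightarrow> rsmult C x \<one>\<^bsub>R\<^esub> = x"
    using CR.smult_one by simp
  then show "\<one>\<^bsub>R\<^esub> \<odot>\<^bsub>hom_mod S C N\<^esub> f = f"
    using f by (auto intro!: ext_eqI[of _ "carrier C"])
qed

lemma tpair: "lmodule R M \<Longrightarrow> tensor_pair R (right_mod C) M"
  by (rule tensor_pairI[OF CR])

text \<open>Scalars act through induced maps, so the module laws are additivity, composition and
  identity of \<open>tensor_map\<close> in its map argument.\<close>

lemma lmodule_tensor_mod:
  assumes M: "lmodule R M"
  shows "lmodule S (tensor_mod R C M)"
proof -
  interpret P: tensor_pair R "right_mod C" M by (rule tpair[OF M])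
  note tm = tensor_map[OF CR CR M smult_mhom]
  let ?T = "tensor R (right_mod C) M"
  show ?thesis
  proof (rule lmoduleI'[OF ringS])
    show "abelian_group (tensor_mod R C M)"
      by (rule abelian_group_cong[OF P.abelian_tensor]) simp_all
    fix a b s t
    assume a: "a \<in> carrier S"
    assume "s \<in> carrier (tensor_mod R C M)"
    then have s: "s \<in> carrier ?T" by simp
    show "a \<odot>\<^bsub>tensor_mod R C M\<^esub> s \<in> carrier (tensor_mod R C M)"
      using ahom_closed[OF tm(1)[OF a] s] by simp
    {
      assume b: "b \<in> carrier S"
      have ab: "a \<oplus>\<^bsub>S\<^esub> b \<in> carrier S" using a b by simp
      have "tensor_map R (right_mod C) (right_mod C) M (\<lambda>x. (a \<oplus>\<^bsub>S\<^esub> b) \<odot>\<^bsub>C\<^esub> x) s =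
          tensor_map R (right_mod C) (right_mod C) M (\<lambda>x. a \<odot>\<^bsub>C\<^esub> x \<oplus>\<^bsub>right_mod C\<^esub> b \<odot>\<^bsub>C\<^esub> x) s"
        using CL.smult_l_distr[OF a b]
        by (intro tensor_map_cong[OF CR CR M smult_mhom[OF ab] mhom_add_map[OF CR smult_mhom[OF a] smult_mhom[OF b]] _ s]) simp
      then show "(a \<oplus>\<^bsub>S\<^esub> b) \<odot>\<^bsub>tensor_mod R C M\<^esub> s =
          a \<odot>\<^bsub>tensor_mod R C M\<^esub> s \<oplus>\<^bsub>tensor_mod R C M\<^esub> b \<odot>\<^bsub>tensor_mod R C M\<^esub> s"
        using tensor_map_add[OF CR CR M smult_mhom[OF a] smult_mhom[OF b] s] by simp
      have ab: "a \<otimes>\<^bsub>S\<^esub> b \<in> carrier S" using a b by simp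
      have "tensor_map R (right_mod C) (right_mod C) M (\<lambda>x. (a \<otimes>\<^bsub>S\<^esub> b) \<odot>\<^bsub>C\<^esub> x) s =
          tensor_map R (right_mod C) (right_mod C) M (\<lambda>x. a \<odot>\<^bsub>C\<^esub> (b \<odot>\<^bsub>C\<^esub> x)) s"
        using CL.smult_assoc[OF a b]
        by (intro tensor_map_cong[OF CR CR M smult_mhom[OF ab] mhom_comp[OF smult_mhom[OF b] smult_mhom[OF a]] _ s]) simp
      then show "(a \<otimes>\<^bsub>S\<^esub> b) \<odot>\<^bsub>tensor_mod R C M\<^esub> s = a \<odot>\<^bsub>tensor_mod R C M\<^esub> (b \<odot>\<^bsub>tensor_mod R C M\<^esub> s)"
        using tensor_map_comp[OF CR CR CR M smult_mhom[OF b] smult_mhom[OF a] s] by simp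
    }
    assume t: "t \<in> carrier (tensor_mod R C M)"
    show "a \<odot>\<^bsub>tensor_mod R C M\<^esub> (s \<oplus>\<^bsub>tensor_mod R C M\<^esub> t) =
        a \<odot>\<^bsub>tensor_mod R C M\<^esub> s \<oplus>\<^bsub>tensor_mod R C M\<^esub> a \<odot>\<^bsub>tensor_mod R C M\<^esub> t"
      using ahom_add[OF tm(1)[OF a] s] t by simp
  next
    fix s assume "s \<in> carrier (tensor_mod R C M)"
    then have s: "s \<in> carrier ?T" by simp
    show "\<one>\<^bsub>S\<^esub> \<odot>\<^bsub>tensor_mod R C M\<^esub> s = s"
      using tensor_map_cong[OF CR CR M smult_mhom[OF CL.one_closed] mhom_id _ s] CL.smult_one
        tensor_map_id[OF CR M s] by simp
  qed
qed

lemma smult_tp: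
  assumes "lmodule R M" "s \<in> carrier S" "x \<in> carrier C" "m \<in> carrier M"
  shows "s \<odot>\<^bsub>tensor_mod R C M\<^esub> pure_tensor R (right_mod C) M x m = pure_tensor R (right_mod C) M (s \<odot>\<^bsub>C\<^esub> x) m"
  using tensor_map(2)[OF CR CR assms(1) smult_mhom[OF assms(2)]] assms(3,4) by simp

text \<open>Both sides of the law for scalars are additive in the tensor, so it only has to be
  checked on pure tensors.\<close>

lemma tensor_mod_mhomI:
  assumes M: "lmodule R M" and N: "lmodule S N" and f: "f \<in> ahom (tensor R (right_mod C) M) N"
    and p: "\<And>s x m. s \<in> carrier S \<Longrightarrow> x \<in> carrier C \<Longrightarrow> m \<in> carrier M \<Longrightarrow>
      f (pure_tensor R (right_mod C) M (s \<odot>\<^bsub>C\<^esub> x) m) = s \<odot>\<^bsub>N\<^esub> f (pure_tensor R (right_mod C) M x m)"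
  shows "f \<in> mhom S (tensor_mod R C M) N"
proof (rule mhomI)
  interpret P: tensor_pair R "right_mod C" M by (rule tpair[OF M])
  interpret N: lmodule S N by fact
  show "f (s \<odot>\<^bsub>tensor_mod R C M\<^esub> t) = s \<odot>\<^bsub>N\<^esub> f t" if s: "s \<in> carrier S" and t: "t \<in> carrier (tensor_mod R C M)" for s t
    using P.tensor_ahom_eq[OF N.abelian_group_axioms
        ahom_comp[OF tensor_map(1)[OF CR CR M smult_mhom[OF s]] f]
        ahom_comp[OF f N.smult_ahom[OF s]], of t] t p[OF s] smult_tp[OF M s] by simp
qed (use ahom_closed[OF f] ahom_add[OF f] in auto)

lemma tmap2_mhom:
  assumes M: "lmodule R M" and M': "lmodule R M'" and g: "g \<in> mhom R M M'"
  shows "tmap2 R (right_mod C) M' g \<in> mhom S (tensor_mod R C M) (tensor_mod R C M')"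
proof (rule tensor_mod_mhomI[OF M lmodule_tensor_mod[OF M']])
  show "tmap2 R (right_mod C) M' g \<in> ahom (tensor R (right_mod C) M) (tensor_mod R C M')"
    using tmap2(1)[OF CR M M' g] by (simp add: ahom_tensor_mod)
  show "tmap2 R (right_mod C) M' g (pure_tensor R (right_mod C) M (s \<odot>\<^bsub>C\<^esub> x) m) =
      s \<odot>\<^bsub>tensor_mod R C M'\<^esub> tmap2 R (right_mod C) M' g (pure_tensor R (right_mod C) M x m)"
    if "s \<in> carrier S" "x \<in> carrier C" "m \<in> carrier M" for s x m
    using that tmap2(2)[OF CR M M' g] smult_tp[OF M'] mhom_closed[OF g] smultC_closed
    by (simp del: tensor_mod_simps(4))
qed

lemma hmap_mem: "f \<in> mhom S (left_mod C) N \<Longrightarrow> g \<in> mhom S N N' \<Longrightarrow> hmap C g f \<in> carrier (hom_mod S C N')"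
  unfolding hmap_def using mhom_restrict[OF CL mhom_comp] by simp

lemma hmap_mhom:
  assumes N: "lmodule S N" and g: "g \<in> mhom S N N'"
  shows "hmap C g \<in> mhom R (hom_mod S C N) (hom_mod S C N')"
proof (rule mhomI)
  note cl = mhom_closed[of _ S "left_mod C" N, simplified]
  show "hmap C g f \<in> carrier (hom_mod S C N')" if "f \<in> carrier (hom_mod S C N)" for f
    by (rule hmap_mem[OF _ g]) (use that in simp)
  show "hmap C g (f \<oplus>\<^bsub>hom_mod S C N\<^esub> h) = hmap C g f \<oplus>\<^bsub>hom_mod S C N'\<^esub> hmap C g h"
    if "f \<in> carrier (hom_mod S C N)" "h \<in> carrier (hom_mod S C N)" for f h
    using that cl[of f] cl[of h] mhom_add[OF g] by (auto simp: hmap_def intro!: restrict_ext)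
  show "hmap C g (r \<odot>\<^bsub>hom_mod S C N\<^esub> f) = r \<odot>\<^bsub>hom_mod S C N'\<^esub> hmap C g f"
    if "r \<in> carrier R" "f \<in> carrier (hom_mod S C N)" for r f
    using that rsmult_closed by (auto simp: hmap_def intro!: restrict_ext)
qed

lemma eval_unit_mhom:
  assumes M: "lmodule R M"
  shows "eval_unit R C M \<in> mhom R M (hom_mod S C (tensor_mod R C M))"
proof (rule mhomI)
  interpret P: tensor_pair R "right_mod C" M by (rule tpair[OF M])
  show "eval_unit R C M m \<in> carrier (hom_mod S C (tensor_mod R C M))" if m: "m \<in> carrier M" for m
  proof -
    have "(\<lambda>x. P.tp x m) \<in> mhom S (left_mod C) (tensor_mod R C M)"
      by (rule mhomI) (use m P.tp_add_l smult_tp[OF M] in \<open>simp_all del: tensor_mod_simps(4)\<close>)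
    then show ?thesis unfolding eval_unit_def using mhom_restrict[OF CL] by simp
  qed
  show "eval_unit R C M (m \<oplus>\<^bsub>M\<^esub> m') = eval_unit R C M m \<oplus>\<^bsub>hom_mod S C (tensor_mod R C M)\<^esub> eval_unit R C M m'"
    if "m \<in> carrier M" "m' \<in> carrier M" for m m'
    using that P.tp_add_r by (auto simp: eval_unit_def intro!: restrict_ext)
  show "eval_unit R C M (r \<odot>\<^bsub>M\<^esub> m) = r \<odot>\<^bsub>hom_mod S C (tensor_mod R C M)\<^esub> eval_unit R C M m"
    if "r \<in> carrier R" "m \<in> carrier M" for r m
    using that P.tp_bal[symmetric] rsmult_closed by (auto simp: eval_unit_def intro!: restrict_ext)
qed

lemma eval_counit_eq: "eval_counit N = tlift N (\<lambda>x f. f x)"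
  unfolding eval_counit_def tlift_def frag_ext_def by (simp add: fun_eq_iff)

lemma eval_counit:
  assumes N: "lmodule S N"
  shows "eval_counit N \<in> mhom S (tensor_mod R C (hom_mod S C N)) N"
    "\<And>x f. x \<in> carrier C \<Longrightarrow> f \<in> carrier (hom_mod S C N) \<Longrightarrow>
      eval_counit N (pure_tensor R (right_mod C) (hom_mod S C N) x f) = f x"
proof -
  interpret N: lmodule S N by fact
  have H: "lmodule R (hom_mod S C N)" by (rule lmodule_hom_mod[OF N])
  interpret P: tensor_pair R "right_mod C" "hom_mod S C N" by (rule tpair[OF H])
  note cl = mhom_closed[of _ S "left_mod C" N, simplified]
  note ad = mhom_add[of _ S "left_mod C" N, simplified]
  note L = P.tlift[OF N.abelian_group_axioms, of "\<lambda>x f. f x"]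
  have L1: "eval_counit N \<in> ahom (tensor R (right_mod C) (hom_mod S C N)) N"
    unfolding eval_counit_eq by (rule L(1)) (auto simp: cl ad)
  have L2: "eval_counit N (P.tp x f) = f x" if "x \<in> carrier C" "f \<in> carrier (hom_mod S C N)" for x f
    unfolding eval_counit_eq by (rule L(2)) (use that in \<open>auto simp: cl ad\<close>)
  show "eval_counit N \<in> mhom S (tensor_mod R C (hom_mod S C N)) N"
  proof (rule tensor_mod_mhomI[OF H N L1])
    show "eval_counit N (P.tp (s \<odot>\<^bsub>C\<^esub> x) m) = s \<odot>\<^bsub>N\<^esub> eval_counit N (P.tp x m)"
      if "s \<in> carrier S" "x \<in> carrier C" "m \<in> carrier (hom_mod S C N)" for s x m
      using that L2 smultC_closed mhom_smult[of m S "left_mod C" N s x] by simp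
  qed
  show "eval_counit N (P.tp x f) = f x" if "x \<in> carrier C" "f \<in> carrier (hom_mod S C N)" for x f
    by (rule L2[OF that])
qed

end

lemma (in abelian_group) minus_zero_right [simp]: "x \<in> carrier G \<Longrightarrow> x \<ominus> \<zero> = x"
  using minus_add_cancel[of x \<zero>] by simp

section \<open>Projective resolutions\<close>

text \<open>The part of \<open>proj_resolution\<close> that remains when projectivity of the terms
  is expressed by dual bases.\<close>

definition exact_res ::
    "'r ring \<Rightarrow> ('r, 'u) module \<Rightarrow> (nat \<Rightarrow> ('r, 'u) module) \<Rightarrow> (nat \<Rightarrow> 'u \<Rightarrow> 'u) \<Rightarrow> ('u \<Rightarrow> 'u) \<Rightarrow> bool"
  where "exact_res R A P d e \<longleftrightarrow> (\<forall>n. left_exact_seq R n P d e A)"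

lemma exact_resD:
  assumes "exact_res R A P d e"
  shows "lmodule R A" "\<And>i. lmodule R (P i)" "e \<in> mhom R (P 0) A" "\<And>i. d i \<in> mhom R (P (Suc i)) (P i)"
    "e ` carrier (P 0) = carrier A" "\<And>x. x \<in> carrier (P (Suc 0)) \<Longrightarrow> e (d 0 x) = \<zero>\<^bsub>A\<^esub>"
    "\<And>i x. x \<in> carrier (P (Suc (Suc i))) \<Longrightarrow> d i (d (Suc i) x) = \<zero>\<^bsub>P i\<^esub>"
    "\<And>y. y \<in> carrier (P 0) \<Longrightarrow> e y = \<zero>\<^bsub>A\<^esub> \<Longrightarrow> \<exists>x\<in>carrier (P (Suc 0)). y = d 0 x"
    "\<And>i y. y \<in> carrier (P (Suc i)) \<Longrightarrow> d i y = \<zero>\<^bsub>P i\<^esub> \<Longrightarrow> \<exists>x\<in>carrier (P (Suc (Suc i))). y = d (Suc i) x"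
proof -
  have *: "left_exact_seq R n P d e A" for n using assms by (simp add: exact_res_def)
  show "lmodule R A" "lmodule R (P i)" "e \<in> mhom R (P 0) A" "d i \<in> mhom R (P (Suc i)) (P i)"
    "e ` carrier (P 0) = carrier A" for i
    using *[of 0, unfolded left_exact_seq_def] *[of i, unfolded left_exact_seq_def]
      *[of "Suc i", unfolded left_exact_seq_def] by simp_all
  have 0: "d 0 ` carrier (P (Suc 0)) = {x \<in> carrier (P 0). e x = \<zero>\<^bsub>A\<^esub>}"
    using *[of 1] unfolding left_exact_seq_def a_kernel_eq by simp
  have 1: "d (Suc i) ` carrier (P (Suc (Suc i))) = {x \<in> carrier (P (Suc i)). d i x = \<zero>\<^bsub>P i\<^esub>}" for i
    using *[of "Suc (Suc i)"] unfolding left_exact_seq_def a_kernel_eq by simp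
  show "\<And>x. x \<in> carrier (P (Suc 0)) \<Longrightarrow> e (d 0 x) = \<zero>\<^bsub>A\<^esub>"
    "\<And>y. y \<in> carrier (P 0) \<Longrightarrow> e y = \<zero>\<^bsub>A\<^esub> \<Longrightarrow> \<exists>x\<in>carrier (P (Suc 0)). y = d 0 x"
    using 0 by blast+
  show "\<And>i x. x \<in> carrier (P (Suc (Suc i))) \<Longrightarrow> d i (d (Suc i) x) = \<zero>\<^bsub>P i\<^esub>"
    "\<And>i y. y \<in> carrier (P (Suc i)) \<Longrightarrow> d i y = \<zero>\<^bsub>P i\<^esub> \<Longrightarrow> \<exists>x\<in>carrier (P (Suc (Suc i))). y = d (Suc i) x"
    using 1 by blast+
qed

lemma proj_resolutionD:
  "proj_resolution R A P d e \<Longrightarrow> exact_res R A P d e"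
  "proj_resolution R A P d e \<Longrightarrow> projective R (P i)"
  by (auto simp: proj_resolution_def exact_res_def)

text \<open>Projectivity is applied to the corestriction of \<open>\<alpha>\<close> to its image, a
  module whose elements are still in \<open>'u\<close>. This is the form in which exactness of a
  resolution offers a lifting problem.\<close>

lemma projective_lift:
  fixes P :: "('r, 'u) module" and X Y :: "('r, 'u) module"
  assumes P: "projective R P" and X: "lmodule R X" and Y: "lmodule R Y" and a: "\<alpha> \<in> mhom R X Y"
    and f: "f \<in> mhom R P Y" and im: "\<And>p. p \<in> carrier P \<Longrightarrow> f p \<in> \<alpha> ` carrier X"
  shows "\<exists>h\<in>mhom R P X. \<forall>p\<in>carrier P. \<alpha> (h p) = f p"
proof -
  let ?Z = "sub Y (\<alpha> ` carrier X)"
  have "lmodule R ?Z" by (rule lmodule_image[OF X Y a])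
  moreover have "\<alpha> \<in> mhom R X ?Z" by (rule mhom_into_sub[OF a]) simp
  moreover have "f \<in> mhom R P ?Z" by (rule mhom_into_sub[OF f im])
  moreover have "\<alpha> ` carrier X = carrier ?Z" by simp
  ultimately show ?thesis using P X unfolding projective_def by blast
qed

section \<open>Comparison of projective resolutions up to homotopy\<close>

text \<open>The recursion carries along that \<open>\<phi> n\<close> maps boundaries of
  \<open>P\<close> to boundaries of \<open>P'\<close>, exactly what the next lift needs. In the next
  degree it follows from exactness of \<open>P'\<close>, because
  \<open>d' \<phi> d = \<phi> d d = 0\<close>.\<close>

lemma chain_map_exists:
  fixes P P' :: "nat \<Rightarrow> ('r, 'u) module"
  assumes r: "exact_res R A P d e" and p: "\<And>i. projective R (P i)" and r': "exact_res R A P' d' e'"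
  shows "\<exists>\<phi>. (\<forall>i. \<phi> i \<in> mhom R (P i) (P' i)) \<and> (\<forall>x\<in>carrier (P 0). e' (\<phi> 0 x) = e x) \<and>
    (\<forall>i. \<forall>x\<in>carrier (P (Suc i)). d' i (\<phi> (Suc i) x) = \<phi> i (d i x))"
proof -
  note D = exact_resD[OF r] and D' = exact_resD[OF r']
  let ?I = "\<lambda>n \<phi>. \<phi> \<in> mhom R (P n) (P' n) \<and> (\<forall>y\<in>carrier (P (Suc n)). \<phi> (d n y) \<in> d' n ` carrier (P' (Suc n))) \<and>
    (n = 0 \<longrightarrow> (\<forall>x\<in>carrier (P 0). e' (\<phi> x) = e x))"
  let ?Q = "\<lambda>n \<phi> \<phi>'. \<forall>x\<in>carrier (P (Suc n)). d' n (\<phi>' x) = \<phi> (d n x)"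
  have "\<exists>\<phi>. \<forall>n. ?I n (\<phi> n) \<and> ?Q n (\<phi> n) (\<phi> (Suc n))"
  proof (rule dependent_nat_choice)
    have "\<exists>h\<in>mhom R (P 0) (P' 0). \<forall>x\<in>carrier (P 0). e' (h x) = e x"
      by (rule projective_lift[OF p D'(2) D'(1) D'(3) D(3)]) (use D'(5) mhom_closed[OF D(3)] in blast)
    then obtain h where h: "h \<in> mhom R (P 0) (P' 0)" "\<And>x. x \<in> carrier (P 0) \<Longrightarrow> e' (h x) = e x" by blast
    have "h (d 0 y) \<in> d' 0 ` carrier (P' (Suc 0))" if "y \<in> carrier (P (Suc 0))" for y
      using D'(8)[of "h (d 0 y)"] h(2)[of "d 0 y"] D(6)[OF that] mhom_closed[OF D(4) that] mhom_closed[OF h(1)] by auto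
    then show "\<exists>\<phi>. ?I 0 \<phi>" using h by blast
  next
    fix n \<phi> assume I: "?I n \<phi>"
    have "\<exists>h\<in>mhom R (P (Suc n)) (P' (Suc n)). \<forall>x\<in>carrier (P (Suc n)). d' n (h x) = \<phi> (d n x)"
      by (rule projective_lift[OF p D'(2) D'(2) D'(4) mhom_comp[OF D(4)]]) (use I in auto)
    then obtain h where h: "h \<in> mhom R (P (Suc n)) (P' (Suc n))"
      "\<And>x. x \<in> carrier (P (Suc n)) \<Longrightarrow> d' n (h x) = \<phi> (d n x)" by blast
    have "h (d (Suc n) y) \<in> d' (Suc n) ` carrier (P' (Suc (Suc n)))" if y: "y \<in> carrier (P (Suc (Suc n)))" for y
    proof -
      have "d' n (h (d (Suc n) y)) = \<zero>\<^bsub>P' n\<^esub>"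
        using h(2) mhom_closed[OF D(4) y] D(7)[OF y] mhom_zero[OF D(2) D'(2)] I by simp
      then show ?thesis using D'(9) mhom_closed[OF h(1) mhom_closed[OF D(4) y]] by blast
    qed
    then show "\<exists>\<phi>'. ?I (Suc n) \<phi>' \<and> ?Q n \<phi> \<phi>'" using h by (intro exI[of _ h]) simp
  qed
  then obtain \<phi> where *: "\<forall>n. ?I n (\<phi> n) \<and> ?Q n (\<phi> n) (\<phi> (Suc n))" ..
  have \<phi>: "?I n (\<phi> n)" "?Q n (\<phi> n) (\<phi> (Suc n))" for n
    using *[rule_format, of n] by (rule conjunct1, rule conjunct2)
  have 1: "\<And>i. \<phi> i \<in> mhom R (P i) (P' i)" and 2: "\<And>x. x \<in> carrier (P 0) \<Longrightarrow> e' (\<phi> 0 x) = e x"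
    subgoal for i using \<phi>(1)[of i] by (rule conjunct1)
    subgoal for x using \<phi>(1)[of 0] by simp
    done
  show ?thesis
    by (rule exI[of _ \<phi>], intro conjI allI ballI) (rule 1, rule 2, assumption, rule \<phi>(2)[rule_format])
qed

text \<open>Each new \<open>s\<close> lifts \<open>\<theta> - s d\<close> along \<open>d\<close>,
  which is possible because this difference is a cycle; the invariant \<open>?I\<close> says so one
  degree ahead. The homotopy identity is recorded in positive degrees, the ones that decide
  vanishing of Ext and Tor.\<close>

lemma null_homotopy_exists:
  fixes P :: "nat \<Rightarrow> ('r, 'u) module"
  assumes r: "exact_res R A P d e" and p: "\<And>i. projective R (P i)"
    and \<theta>: "\<And>i. \<theta> i \<in> mhom R (P i) (P i)" and \<theta>0: "\<And>x. x \<in> carrier (P 0) \<Longrightarrow> e (\<theta> 0 x) = \<zero>\<^bsub>A\<^esub>"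
    and \<theta>d: "\<And>i x. x \<in> carrier (P (Suc i)) \<Longrightarrow> d i (\<theta> (Suc i) x) = \<theta> i (d i x)"
  shows "\<exists>s. (\<forall>i. s i \<in> mhom R (P i) (P (Suc i))) \<and>
    (\<forall>i. \<forall>y\<in>carrier (P (Suc i)). \<theta> (Suc i) y = d (Suc i) (s (Suc i) y) \<oplus>\<^bsub>P (Suc i)\<^esub> s i (d i y))"
proof -
  note D = exact_resD[OF r]
  let ?I = "\<lambda>n s. s \<in> mhom R (P n) (P (Suc n)) \<and>
    (\<forall>y\<in>carrier (P (Suc n)). d n (\<theta> (Suc n) y \<ominus>\<^bsub>P (Suc n)\<^esub> s (d n y)) = \<zero>\<^bsub>P n\<^esub>)"
  let ?Q = "\<lambda>n s s'. \<forall>x\<in>carrier (P (Suc n)). d (Suc n) (s' x) = \<theta> (Suc n) x \<ominus>\<^bsub>P (Suc n)\<^esub> s (d n x)"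
  have m: "d n (\<theta> (Suc n) y \<ominus>\<^bsub>P (Suc n)\<^esub> z) = \<theta> n (d n y) \<ominus>\<^bsub>P n\<^esub> d n z"
    if "y \<in> carrier (P (Suc n))" "z \<in> carrier (P (Suc n))" for n y z
    using mhom_minus[OF D(2) D(2) D(4) mhom_closed[OF \<theta> that(1)] that(2)] \<theta>d that by simp
  have "\<exists>s. \<forall>n. ?I n (s n) \<and> ?Q n (s n) (s (Suc n))"
  proof (rule dependent_nat_choice)
    have "\<exists>h\<in>mhom R (P 0) (P (Suc 0)). \<forall>x\<in>carrier (P 0). d 0 (h x) = \<theta> 0 x"
      by (rule projective_lift[OF p D(2) D(2) D(4) \<theta>]) (use D(8) \<theta>0 mhom_closed[OF \<theta>] in blast)
    then obtain h where h: "h \<in> mhom R (P 0) (P (Suc 0))" "\<And>x. x \<in> carrier (P 0) \<Longrightarrow> d 0 (h x) = \<theta> 0 x" by blast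
    have "d 0 (\<theta> (Suc 0) y \<ominus>\<^bsub>P (Suc 0)\<^esub> h (d 0 y)) = \<zero>\<^bsub>P 0\<^esub>" if y: "y \<in> carrier (P (Suc 0))" for y
    proof -
      have dy: "d 0 y \<in> carrier (P 0)" by (rule mhom_closed[OF D(4) y])
      then show ?thesis
        using m[OF y mhom_closed[OF h(1) dy]] h(2) mhom_closed[OF \<theta> dy]
          abelian_group.minus_eq_zero_iff[OF lmodule_ab[OF D(2)]] by simp
    qed
    then show "\<exists>s. ?I 0 s" using h by blast
  next
    fix n s assume I: "?I n s"
    then have s: "s \<in> mhom R (P n) (P (Suc n))" by blast
    have f: "(\<lambda>x. \<theta> (Suc n) x \<ominus>\<^bsub>P (Suc n)\<^esub> s (d n x)) \<in> mhom R (P (Suc n)) (P (Suc n))"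
      by (rule mhom_diff_map[OF D(2) \<theta> mhom_comp[OF D(4) s]])
    have "\<exists>h\<in>mhom R (P (Suc n)) (P (Suc (Suc n))). \<forall>x\<in>carrier (P (Suc n)).
        d (Suc n) (h x) = \<theta> (Suc n) x \<ominus>\<^bsub>P (Suc n)\<^esub> s (d n x)"
      by (rule projective_lift[OF p D(2) D(2) D(4) f]) (use D(9)[of _ n] I mhom_closed[OF f] in blast)
    then obtain h where h: "h \<in> mhom R (P (Suc n)) (P (Suc (Suc n)))"
      "\<And>x. x \<in> carrier (P (Suc n)) \<Longrightarrow> d (Suc n) (h x) = \<theta> (Suc n) x \<ominus>\<^bsub>P (Suc n)\<^esub> s (d n x)" by blast
    have "d (Suc n) (\<theta> (Suc (Suc n)) y \<ominus>\<^bsub>P (Suc (Suc n))\<^esub> h (d (Suc n) y)) = \<zero>\<^bsub>P (Suc n)\<^esub>"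
      if y: "y \<in> carrier (P (Suc (Suc n)))" for y
    proof -
      interpret Q: lmodule R "P (Suc n)" by (rule D(2))
      have dy: "d (Suc n) y \<in> carrier (P (Suc n))" by (rule mhom_closed[OF D(4) y])
      then have "d (Suc n) (h (d (Suc n) y)) = \<theta> (Suc n) (d (Suc n) y)"
        using h(2) D(7)[OF y] mhom_zero[OF D(2) D(2) s] mhom_closed[OF \<theta> dy] by simp
      then show ?thesis
        using m[OF y mhom_closed[OF h(1) dy]] mhom_closed[OF \<theta> dy] by (simp add: Q.minus_eq Q.r_neg)
    qed
    then show "\<exists>s'. ?I (Suc n) s' \<and> ?Q n s s'" using h by (intro exI[of _ h]) simp
  qed
  then obtain s where s: "\<And>n. ?I n (s n)" "\<And>n. ?Q n (s n) (s (Suc n))" by blast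
  have "\<theta> (Suc i) y = d (Suc i) (s (Suc i) y) \<oplus>\<^bsub>P (Suc i)\<^esub> s i (d i y)" if y: "y \<in> carrier (P (Suc i))" for i y
  proof -
    interpret Q: lmodule R "P (Suc i)" by (rule D(2))
    have "s i \<in> mhom R (P i) (P (Suc i))" using s(1) by blast
    then have "s i (d i y) \<in> carrier (P (Suc i))" by (rule mhom_closed[OF _ mhom_closed[OF D(4) y]])
    then show ?thesis using s(2)[of i] y mhom_closed[OF \<theta> y] by simp
  qed
  then show ?thesis using s(1) by (intro exI[of _ s]) blast
qed

text \<open>Only the composite on \<open>P'\<close> is related to the identity: this one-sided datum
  carries vanishing from \<open>P\<close> to \<open>P'\<close>, and exchanging the resolutions gives
  the other direction.\<close>

definition homotopic_over ::
    "'r ring \<Rightarrow> (nat \<Rightarrow> ('r, 'u) module) \<Rightarrow> (nat \<Rightarrow> 'u \<Rightarrow> 'u) \<Rightarrow> (nat \<Rightarrow> ('r, 'u) module) \<Rightarrow> (nat \<Rightarrow> 'u \<Rightarrow> 'u) \<Rightarrow>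
     (nat \<Rightarrow> 'u \<Rightarrow> 'u) \<Rightarrow> (nat \<Rightarrow> 'u \<Rightarrow> 'u) \<Rightarrow> (nat \<Rightarrow> 'u \<Rightarrow> 'u) \<Rightarrow> bool"
  where "homotopic_over R P d P' d' \<phi> \<psi> s \<longleftrightarrow>
    (\<forall>i. \<phi> i \<in> mhom R (P i) (P' i)) \<and> (\<forall>i. \<psi> i \<in> mhom R (P' i) (P i)) \<and> (\<forall>i. s i \<in> mhom R (P' i) (P' (Suc i))) \<and>
    (\<forall>i. \<forall>x\<in>carrier (P (Suc i)). d' i (\<phi> (Suc i) x) = \<phi> i (d i x)) \<and>
    (\<forall>i. \<forall>x\<in>carrier (P' (Suc i)). d i (\<psi> (Suc i) x) = \<psi> i (d' i x)) \<and>
    (\<forall>i. \<forall>y\<in>carrier (P' (Suc i)). y = \<phi> (Suc i) (\<psi> (Suc i) y) \<oplus>\<^bsub>P' (Suc i)\<^esub>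
      (d' (Suc i) (s (Suc i) y) \<oplus>\<^bsub>P' (Suc i)\<^esub> s i (d' i y)))"

lemma resolutions_homotopic:
  fixes P P' :: "nat \<Rightarrow> ('r, 'u) module"
  assumes r: "proj_resolution R A P d e" and r': "proj_resolution R A P' d' e'"
  shows "\<exists>\<phi> \<psi> s. homotopic_over R P d P' d' \<phi> \<psi> s"
proof -
  note D = exact_resD[OF proj_resolutionD(1)[OF r]] and D' = exact_resD[OF proj_resolutionD(1)[OF r']]
  obtain \<phi> where \<phi>: "\<And>i. \<phi> i \<in> mhom R (P i) (P' i)" "\<And>x. x \<in> carrier (P 0) \<Longrightarrow> e' (\<phi> 0 x) = e x"
    "\<And>i x. x \<in> carrier (P (Suc i)) \<Longrightarrow> d' i (\<phi> (Suc i) x) = \<phi> i (d i x)"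
    using chain_map_exists[OF proj_resolutionD(1)[OF r] proj_resolutionD(2)[OF r] proj_resolutionD(1)[OF r']] by metis
  obtain \<psi> where \<psi>: "\<And>i. \<psi> i \<in> mhom R (P' i) (P i)" "\<And>x. x \<in> carrier (P' 0) \<Longrightarrow> e (\<psi> 0 x) = e' x"
    "\<And>i x. x \<in> carrier (P' (Suc i)) \<Longrightarrow> d i (\<psi> (Suc i) x) = \<psi> i (d' i x)"
    using chain_map_exists[OF proj_resolutionD(1)[OF r'] proj_resolutionD(2)[OF r'] proj_resolutionD(1)[OF r]] by metis
  \<comment> \<open>The identity minus the round trip is a chain map over the zero map of
    \<open>A\<close>, so it is null-homotopic.\<close>
  define \<theta> where "\<theta> i y = y \<ominus>\<^bsub>P' i\<^esub> \<phi> i (\<psi> i y)" for i y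
  have th: "\<theta> i \<in> mhom R (P' i) (P' i)" for i
    unfolding \<theta>_def by (rule mhom_diff_map[OF D'(2) mhom_id mhom_comp[OF \<psi>(1) \<phi>(1)]])
  have "\<exists>s. (\<forall>i. s i \<in> mhom R (P' i) (P' (Suc i))) \<and>
    (\<forall>i. \<forall>y\<in>carrier (P' (Suc i)). \<theta> (Suc i) y = d' (Suc i) (s (Suc i) y) \<oplus>\<^bsub>P' (Suc i)\<^esub> s i (d' i y))"
  proof (rule null_homotopy_exists[OF proj_resolutionD[OF r'] th])
    fix x assume x: "x \<in> carrier (P' 0)"
    note c = mhom_closed[OF \<phi>(1) mhom_closed[OF \<psi>(1) x]]
    have "e' (\<theta> 0 x) = e' x \<ominus>\<^bsub>A\<^esub> e' (\<phi> 0 (\<psi> 0 x))"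
      unfolding \<theta>_def by (rule mhom_minus[OF D'(2) D'(1) D'(3) x c])
    also have "\<dots> = \<zero>\<^bsub>A\<^esub>"
      using \<phi>(2)[OF mhom_closed[OF \<psi>(1) x]] \<psi>(2)[OF x] mhom_closed[OF D'(3) x]
        abelian_group.minus_eq_zero_iff[OF lmodule_ab[OF D'(1)]] by simp
    finally show "e' (\<theta> 0 x) = \<zero>\<^bsub>A\<^esub>" .
  next
    fix i x assume x: "x \<in> carrier (P' (Suc i))"
    note c = mhom_closed[OF \<phi>(1) mhom_closed[OF \<psi>(1) x]]
    have "d' i (\<theta> (Suc i) x) = d' i x \<ominus>\<^bsub>P' i\<^esub> d' i (\<phi> (Suc i) (\<psi> (Suc i) x))"
      unfolding \<theta>_def by (rule mhom_minus[OF D'(2) D'(2) D'(4) x c])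
    then show "d' i (\<theta> (Suc i) x) = \<theta> i (d' i x)"
      using \<phi>(3)[OF mhom_closed[OF \<psi>(1) x]] \<psi>(3)[OF x] by (simp add: \<theta>_def)
  qed
  then obtain s where s: "\<And>i. s i \<in> mhom R (P' i) (P' (Suc i))"
    "\<And>i y. y \<in> carrier (P' (Suc i)) \<Longrightarrow> \<theta> (Suc i) y = d' (Suc i) (s (Suc i) y) \<oplus>\<^bsub>P' (Suc i)\<^esub> s i (d' i y)" by blast
  have "y = \<phi> (Suc i) (\<psi> (Suc i) y) \<oplus>\<^bsub>P' (Suc i)\<^esub> (d' (Suc i) (s (Suc i) y) \<oplus>\<^bsub>P' (Suc i)\<^esub> s i (d' i y))"
    if y: "y \<in> carrier (P' (Suc i))" for i y
  proof -
    interpret Q: lmodule R "P' (Suc i)" by (rule D'(2))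
    note c = mhom_closed[OF \<phi>(1) mhom_closed[OF \<psi>(1) y]]
    show ?thesis
      unfolding s(2)[OF y, symmetric] \<theta>_def
      using Q.minus_add_cancel[OF y c] Q.a_comm[OF c Q.minus_closed[OF y c]] by simp
  qed
  then show ?thesis
    unfolding homotopic_over_def using \<phi>(1,3) \<psi>(1,3) s(1) by blast
qed

section \<open>Vanishing of Ext and Tor\<close>

text \<open>Exactness of \<open>Hom(P, B)\<close> in positive degrees, stated by elements and for a
  given resolution: no choice, no quotient group and no extensionality of maps is involved.\<close>

definition Ext_vanish ::
    "'r ring \<Rightarrow> (nat \<Rightarrow> ('r, 'u) module) \<Rightarrow> (nat \<Rightarrow> 'u \<Rightarrow> 'u) \<Rightarrow> ('r, 'b) module \<Rightarrow> bool"
  where "Ext_vanish R P d B \<longleftrightarrow> (\<forall>i. \<forall>f\<in>mhom R (P (Suc i)) B.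
    (\<forall>x\<in>carrier (P (Suc (Suc i))). f (d (Suc i) x) = \<zero>\<^bsub>B\<^esub>) \<longrightarrow>
    (\<exists>g\<in>mhom R (P i) B. \<forall>x\<in>carrier (P (Suc i)). f x = g (d i x)))"

definition Tor_vanish ::
    "'r ring \<Rightarrow> (nat \<Rightarrow> ('r, 'u) module) \<Rightarrow> (nat \<Rightarrow> 'u \<Rightarrow> 'u) \<Rightarrow> ('r, 'b) module \<Rightarrow> bool"
  where "Tor_vanish R P d B \<longleftrightarrow> (\<forall>i. \<forall>t\<in>carrier (tensor R (P (Suc i)) B).
    tensor_map R (P (Suc i)) (P i) B (d i) t = \<zero>\<^bsub>tensor R (P i) B\<^esub> \<longrightarrow>
    (\<exists>u\<in>carrier (tensor R (P (Suc (Suc i))) B). t = tensor_map R (P (Suc (Suc i))) (P (Suc i)) B (d (Suc i)) u))"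

text \<open>If \<open>f\<close> is a cocycle on \<open>P'\<close>, then \<open>f \<phi>\<close> is
  one on \<open>P\<close>, say \<open>f \<phi> = g d\<close>. Inserting the homotopy into
  \<open>f\<close> gives \<open>f = (g \<psi> + f s) d'\<close>, since \<open>f d' = 0\<close> and
  \<open>d \<psi> = \<psi> d'\<close>.\<close>

lemma Ext_vanish_transfer:
  assumes r: "exact_res R A P d e" and r': "exact_res R A P' d' e'" and h: "homotopic_over R P d P' d' \<phi> \<psi> s"
    and B: "lmodule R B" and v: "Ext_vanish R P d B"
  shows "Ext_vanish R P' d' B"
  unfolding Ext_vanish_def
proof (intro allI ballI impI)
  interpret B: lmodule R B by fact
  note D = exact_resD[OF r] and D' = exact_resD[OF r']
  have \<phi>: "\<And>i. \<phi> i \<in> mhom R (P i) (P' i)" and \<psi>: "\<And>i. \<psi> i \<in> mhom R (P' i) (P i)"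
    and s: "\<And>i. s i \<in> mhom R (P' i) (P' (Suc i))"
    and \<phi>d: "\<And>i x. x \<in> carrier (P (Suc i)) \<Longrightarrow> d' i (\<phi> (Suc i) x) = \<phi> i (d i x)"
    and \<psi>d: "\<And>i x. x \<in> carrier (P' (Suc i)) \<Longrightarrow> d i (\<psi> (Suc i) x) = \<psi> i (d' i x)"
    and H: "\<And>i y. y \<in> carrier (P' (Suc i)) \<Longrightarrow> y = \<phi> (Suc i) (\<psi> (Suc i) y) \<oplus>\<^bsub>P' (Suc i)\<^esub>
      (d' (Suc i) (s (Suc i) y) \<oplus>\<^bsub>P' (Suc i)\<^esub> s i (d' i y))"
    using h unfolding homotopic_over_def by blast+
  fix i f assume f: "f \<in> mhom R (P' (Suc i)) B" and f0: "\<forall>x\<in>carrier (P' (Suc (Suc i))). f (d' (Suc i) x) = \<zero>\<^bsub>B\<^esub>"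
  interpret Q: lmodule R "P' (Suc i)" by (rule D'(2))
  have "\<forall>x\<in>carrier (P (Suc (Suc i))). f (\<phi> (Suc i) (d (Suc i) x)) = \<zero>\<^bsub>B\<^esub>"
    using f0 \<phi>d[of _ "Suc i"] mhom_closed[OF \<phi>] by metis
  then obtain g where g: "g \<in> mhom R (P i) B" "\<And>x. x \<in> carrier (P (Suc i)) \<Longrightarrow> f (\<phi> (Suc i) x) = g (d i x)"
    using v mhom_comp[OF \<phi> f] unfolding Ext_vanish_def by metis
  have "(\<lambda>y. g (\<psi> i y) \<oplus>\<^bsub>B\<^esub> f (s i y)) \<in> mhom R (P' i) B"
    by (rule mhom_add_map[OF B mhom_comp[OF \<psi> g(1)] mhom_comp[OF s f]])
  moreover have "f y = g (\<psi> i (d' i y)) \<oplus>\<^bsub>B\<^esub> f (s i (d' i y))" if y: "y \<in> carrier (P' (Suc i))" for y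
  proof -
    note c1 = mhom_closed[OF \<phi> mhom_closed[OF \<psi> y]]
    note c2 = mhom_closed[OF D'(4) mhom_closed[OF s y]]
    note c3 = mhom_closed[OF s mhom_closed[OF D'(4) y]]
    have "f y = f (\<phi> (Suc i) (\<psi> (Suc i) y) \<oplus>\<^bsub>P' (Suc i)\<^esub> (d' (Suc i) (s (Suc i) y) \<oplus>\<^bsub>P' (Suc i)\<^esub> s i (d' i y)))"
      using H[OF y] by simp
    also have "\<dots> = f (\<phi> (Suc i) (\<psi> (Suc i) y)) \<oplus>\<^bsub>B\<^esub> (f (d' (Suc i) (s (Suc i) y)) \<oplus>\<^bsub>B\<^esub> f (s i (d' i y)))"
      using c1 c2 c3 mhom_add[OF f] by simp
    also have "\<dots> = g (\<psi> i (d' i y)) \<oplus>\<^bsub>B\<^esub> f (s i (d' i y))"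
      using g(2)[OF mhom_closed[OF \<psi> y]] \<psi>d[OF y] f0 mhom_closed[OF s y] mhom_closed[OF f c3] by simp
    finally show ?thesis .
  qed
  ultimately show "\<exists>g\<in>mhom R (P' i) B. \<forall>x\<in>carrier (P' (Suc i)). f x = g (d' i x)"
    by (intro bexI[of _ "\<lambda>y. g (\<psi> i y) \<oplus>\<^bsub>B\<^esub> f (s i y)"]) auto
qed

text \<open>For a cycle \<open>t\<close> the homotopy gives
  \<open>t = \<phi> \<psi> t + d' s t\<close>. The cycle \<open>\<psi> t\<close> is a boundary
  \<open>d u\<close>, so \<open>t\<close> is the boundary of \<open>\<phi> u + s t\<close>; all maps
  are the induced ones on tensor products.\<close>

lemma Tor_vanish_transfer:
  assumes r: "exact_res (opp R) A P d e" and r': "exact_res (opp R) A P' d' e'"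
    and h: "homotopic_over (opp R) P d P' d' \<phi> \<psi> s" and B: "lmodule R B" and v: "Tor_vanish R P d B"
  shows "Tor_vanish R P' d' B"
  unfolding Tor_vanish_def
proof (intro allI ballI impI)
  interpret B: lmodule R B by fact
  note D = exact_resD[OF r] and D' = exact_resD[OF r']
  have \<phi>: "\<And>i. \<phi> i \<in> mhom (opp R) (P i) (P' i)" and \<psi>: "\<And>i. \<psi> i \<in> mhom (opp R) (P' i) (P i)"
    and s: "\<And>i. s i \<in> mhom (opp R) (P' i) (P' (Suc i))"
    and \<phi>d: "\<And>i x. x \<in> carrier (P (Suc i)) \<Longrightarrow> d' i (\<phi> (Suc i) x) = \<phi> i (d i x)"
    and \<psi>d: "\<And>i x. x \<in> carrier (P' (Suc i)) \<Longrightarrow> d i (\<psi> (Suc i) x) = \<psi> i (d' i x)"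
    and H: "\<And>i y. y \<in> carrier (P' (Suc i)) \<Longrightarrow> y = \<phi> (Suc i) (\<psi> (Suc i) y) \<oplus>\<^bsub>P' (Suc i)\<^esub>
      (d' (Suc i) (s (Suc i) y) \<oplus>\<^bsub>P' (Suc i)\<^esub> s i (d' i y))"
    using h unfolding homotopic_over_def by blast+
  note tc = tensor_map_comp[OF _ _ _ B] and tcl = tensor_map_closed[OF _ _ B]
  fix i t assume t: "t \<in> carrier (tensor R (P' (Suc i)) B)"
    and t0: "tensor_map R (P' (Suc i)) (P' i) B (d' i) t = \<zero>\<^bsub>tensor R (P' i) B\<^esub>"
  let ?T = "\<lambda>i. tensor R (P' i) B" and ?m = "\<lambda>i j. tensor_map R (P' i) (P' j) B"
  interpret T1: tensor_pair R "P' (Suc i)" B by (rule tensor_pairI[OF D'(2) B])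
  interpret T2: tensor_pair R "P' (Suc (Suc i))" B by (rule tensor_pairI[OF D'(2) B])
  let ?\<psi>t = "tensor_map R (P' (Suc i)) (P (Suc i)) B (\<psi> (Suc i)) t"
  have \<psi>t: "?\<psi>t \<in> carrier (tensor R (P (Suc i)) B)" by (rule tcl[OF D'(2) D(2) \<psi> t])
  have "tensor_map R (P (Suc i)) (P i) B (d i) ?\<psi>t = tensor_map R (P' (Suc i)) (P i) B (\<lambda>x. d i (\<psi> (Suc i) x)) t"
    by (rule tc[OF D'(2) D(2) D(2) \<psi> D(4) t])
  also have "\<dots> = tensor_map R (P' (Suc i)) (P i) B (\<lambda>x. \<psi> i (d' i x)) t"
    by (rule tensor_map_cong[OF D'(2) D(2) B mhom_comp[OF \<psi> D(4)] mhom_comp[OF D'(4) \<psi>] \<psi>d t])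
  also have "\<dots> = tensor_map R (P' i) (P i) B (\<psi> i) (?m (Suc i) i (d' i) t)"
    by (rule tc[OF D'(2) D'(2) D(2) D'(4) \<psi> t, symmetric])
  also have "\<dots> = \<zero>\<^bsub>tensor R (P i) B\<^esub>"
    unfolding t0 by (rule tensor_map_zero_elt[OF D'(2) D(2) B \<psi>])
  finally obtain u where u: "u \<in> carrier (tensor R (P (Suc (Suc i))) B)"
    "?\<psi>t = tensor_map R (P (Suc (Suc i))) (P (Suc i)) B (d (Suc i)) u"
    using v \<psi>t unfolding Tor_vanish_def by blast
  let ?\<phi>u = "tensor_map R (P (Suc (Suc i))) (P' (Suc (Suc i))) B (\<phi> (Suc (Suc i))) u"
  have \<phi>u: "?\<phi>u \<in> carrier (?T (Suc (Suc i)))" by (rule tcl[OF D(2) D'(2) \<phi> u(1)])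
  let ?st = "?m (Suc i) (Suc (Suc i)) (s (Suc i)) t"
  have st: "?st \<in> carrier (?T (Suc (Suc i)))" by (rule tcl[OF D'(2) D'(2) s t])
  have 1: "?m (Suc i) (Suc i) (\<lambda>x. \<phi> (Suc i) (\<psi> (Suc i) x)) t = ?m (Suc (Suc i)) (Suc i) (d' (Suc i)) ?\<phi>u"
  proof -
    have "?m (Suc i) (Suc i) (\<lambda>x. \<phi> (Suc i) (\<psi> (Suc i) x)) t = tensor_map R (P (Suc i)) (P' (Suc i)) B (\<phi> (Suc i)) ?\<psi>t"
      by (rule tc[OF D'(2) D(2) D'(2) \<psi> \<phi> t, symmetric])
    also have "\<dots> = tensor_map R (P (Suc (Suc i))) (P' (Suc i)) B (\<lambda>x. \<phi> (Suc i) (d (Suc i) x)) u"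
      unfolding u(2) by (rule tc[OF D(2) D(2) D'(2) D(4) \<phi> u(1)])
    also have "\<dots> = tensor_map R (P (Suc (Suc i))) (P' (Suc i)) B (\<lambda>x. d' (Suc i) (\<phi> (Suc (Suc i)) x)) u"
      by (rule tensor_map_cong[OF D(2) D'(2) B mhom_comp[OF D(4) \<phi>] mhom_comp[OF \<phi> D'(4)] \<phi>d[symmetric] u(1)])
    also have "\<dots> = ?m (Suc (Suc i)) (Suc i) (d' (Suc i)) ?\<phi>u"
      by (rule tc[OF D(2) D'(2) D'(2) \<phi> D'(4) u(1), symmetric])
    finally show ?thesis .
  qed
  have 2: "?m (Suc i) (Suc i) (\<lambda>x. d' (Suc i) (s (Suc i) x)) t = ?m (Suc (Suc i)) (Suc i) (d' (Suc i)) ?st"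
    by (rule tc[OF D'(2) D'(2) D'(2) s D'(4) t, symmetric])
  have 3: "?m (Suc i) (Suc i) (\<lambda>x. s i (d' i x)) t = \<zero>\<^bsub>?T (Suc i)\<^esub>"
    using tc[OF D'(2) D'(2) D'(2) D'(4) s t] tensor_map_zero_elt[OF D'(2) D'(2) B s] t0 by metis
  have a: "(\<lambda>x. d' (Suc i) (s (Suc i) x) \<oplus>\<^bsub>P' (Suc i)\<^esub> s i (d' i x)) \<in> mhom (opp R) (P' (Suc i)) (P' (Suc i))"
    by (rule mhom_add_map[OF D'(2) mhom_comp[OF s D'(4)] mhom_comp[OF D'(4) s]])
  have b: "(\<lambda>x. \<phi> (Suc i) (\<psi> (Suc i) x)) \<in> mhom (opp R) (P' (Suc i)) (P' (Suc i))"
    by (rule mhom_comp[OF \<psi> \<phi>])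
  have "t = ?m (Suc i) (Suc i) (\<lambda>x. x) t"
    by (rule tensor_map_id[OF D'(2) B t, symmetric])
  also have "\<dots> = ?m (Suc i) (Suc i) (\<lambda>x. \<phi> (Suc i) (\<psi> (Suc i) x) \<oplus>\<^bsub>P' (Suc i)\<^esub>
      (d' (Suc i) (s (Suc i) x) \<oplus>\<^bsub>P' (Suc i)\<^esub> s i (d' i x))) t"
    by (rule tensor_map_cong[OF D'(2) D'(2) B mhom_id mhom_add_map[OF D'(2) b a] H t])
  also have "\<dots> = ?m (Suc (Suc i)) (Suc i) (d' (Suc i)) ?\<phi>u \<oplus>\<^bsub>?T (Suc i)\<^esub>
      (?m (Suc (Suc i)) (Suc i) (d' (Suc i)) ?st \<oplus>\<^bsub>?T (Suc i)\<^esub> \<zero>\<^bsub>?T (Suc i)\<^esub>)"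
    unfolding tensor_map_add[OF D'(2) D'(2) B b a t]
      tensor_map_add[OF D'(2) D'(2) B mhom_comp[OF s D'(4)] mhom_comp[OF D'(4) s] t] 1 2 3 ..
  also have "\<dots> = ?m (Suc (Suc i)) (Suc i) (d' (Suc i)) (?\<phi>u \<oplus>\<^bsub>?T (Suc (Suc i))\<^esub> ?st)"
    using ahom_add[OF tensor_map(1)[OF D'(2) D'(2) B D'(4)] \<phi>u st] tcl[OF D'(2) D'(2) D'(4) st] by simp
  finally show "\<exists>u\<in>carrier (?T (Suc (Suc i))). t = ?m (Suc (Suc i)) (Suc i) (d' (Suc i)) u"
    using \<phi>u st by blast
qed

section \<open>Ext and Tor groups against the vanishing conditions\<close>

lemma trivial_homology_iff:
  assumes A: "abelian_group A" and Z: "additive_subgroup Z A" and B: "additive_subgroup B A" and BZ: "B \<subseteq> Z"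
  shows "trivial_group (homology_at A Z B) \<longleftrightarrow> Z \<subseteq> B"
proof -
  interpret A: abelian_group A by fact
  interpret Z: additive_subgroup Z A by fact
  interpret B: additive_subgroup B A by fact
  let ?G = "A\<lparr>carrier := Z\<rparr>"
  have eq: "add_monoid ?G = (add_monoid A)\<lparr>carrier := Z\<rparr>" by simp
  have Zc: "x \<in> Z \<Longrightarrow> x \<in> carrier A" for x using Z.a_subset by blast
  interpret G: abelian_group ?G
  proof (rule abelian_groupI; simp)
    show "\<exists>y\<in>Z. y \<oplus>\<^bsub>A\<^esub> x = \<zero>\<^bsub>A\<^esub>" if "x \<in> Z" for x
      by (rule bexI[OF _ Z.a_inv_closed[OF that]]) (use Zc[OF that] in \<open>simp add: A.l_neg\<close>)
  qed (use A.a_ac Zc in auto)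
  have "subgroup B (add_monoid ?G)"
    unfolding eq using A.add.subgroup_incl[OF B.a_subgroup Z.a_subgroup BZ] by simp
  then have BG: "additive_subgroup B ?G" by (rule additive_subgroupI)
  interpret BG: abelian_subgroup B ?G by (rule abelian_subgroupI3[OF BG G.abelian_group_axioms])
  have grp: "group (?G A_Mod B)"
    using BG.a_factorgroup_is_comm_group by (simp add: comm_group_def)
  have car: "carrier (?G A_Mod B) = (\<lambda>z. B +>\<^bsub>?G\<^esub> z) ` Z"
    by (auto simp: A_FactGroup_def FactGroup_def RCOSETS_def a_r_coset_def)
  have one: "\<one>\<^bsub>?G A_Mod B\<^esub> = B" by (simp add: A_FactGroup_def FactGroup_def)
  have "trivial_group (homology_at A Z B) \<longleftrightarrow> (\<lambda>z. B +>\<^bsub>?G\<^esub> z) ` Z = {B}"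
    unfolding homology_at_def trivial_group_def car one using grp by blast
  also have "\<dots> \<longleftrightarrow> Z \<subseteq> B"
  proof
    assume *: "(\<lambda>z. B +>\<^bsub>?G\<^esub> z) ` Z = {B}"
    show "Z \<subseteq> B"
    proof
      fix z assume z: "z \<in> Z"
      then have "B +>\<^bsub>?G\<^esub> z = B" using * by blast
      then show "z \<in> B" using G.a_coset_join1[OF _ _ BG.a_subgroup, of z] z by simp
    qed
  next
    assume "Z \<subseteq> B"
    then have "B +>\<^bsub>?G\<^esub> z = B" if "z \<in> Z" for z using BG.a_rcos_const that by blast
    then have "(\<lambda>z. B +>\<^bsub>?G\<^esub> z) ` Z = (\<lambda>z. B) ` Z" by (rule image_cong[OF refl])
    then show "(\<lambda>z. B +>\<^bsub>?G\<^esub> z) ` Z = {B}" using Z.zero_closed by (auto simp only: image_constant_conv split: if_splits)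
  qed
  finally show ?thesis .
qed

lemma additive_subgroup_kernel:
  assumes "abelian_group G" "abelian_group H" "f \<in> ahom G H"
  shows "additive_subgroup (a_kernel G H f) G"
proof (rule additive_subgroupI, rule group.subgroupI)
  interpret G: abelian_group G by fact
  interpret H: abelian_group H by fact
  show "group (add_monoid G)" by (rule G.a_group)
  show "a_kernel G H f \<subseteq> carrier (add_monoid G)" by (auto simp: a_kernel_eq)
  show "a_kernel G H f \<noteq> {}" using G.zero_closed ahom_zero[OF assms] by (auto simp: a_kernel_eq)
  show "inv\<^bsub>add_monoid G\<^esub> x \<in> a_kernel G H f" if "x \<in> a_kernel G H f" for x
    using that ahom_neg[OF assms, of x] G.a_inv_closed[of x] H.minus_equality[of "\<zero>\<^bsub>H\<^esub>" "\<zero>\<^bsub>H\<^esub>"]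
    by (simp add: a_kernel_eq a_inv_def)
  show "x \<otimes>\<^bsub>add_monoid G\<^esub> y \<in> a_kernel G H f" if "x \<in> a_kernel G H f" "y \<in> a_kernel G H f" for x y
    using that ahom_add[OF assms(3)] by (simp add: a_kernel_eq)
qed

text \<open>\<open>SOME\<close> is meaningful as soon as one resolution exists, and the given one
  guarantees that. Nothing beyond being a projective resolution is ever known of the choice.\<close>

lemma chosen_resolution:
  assumes "proj_resolution R A P d e"
  obtains e' where "proj_resolution R A (fst (chosen_resolution R A)) (snd (chosen_resolution R A)) e'"
proof -
  have "\<exists>x. case x of (P, d) \<Rightarrow> \<exists>e. proj_resolution R A P d e"
    using assms by blast
  then have "case chosen_resolution R A of (P, d) \<Rightarrow> \<exists>e. proj_resolution R A P d e"
    unfolding chosen_resolution_def by (rule someI_ex)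
  then show ?thesis using that by (auto simp: case_prod_unfold)
qed

text \<open>The chosen resolution and the given one are homotopy equivalent, so vanishing passes
  between them and a resolution by finitely generated modules may be used for computing.\<close>

lemma Ext_vanish_iff:
  assumes r: "proj_resolution R A P d e" and B: "lmodule R B"
  shows "(\<forall>i\<ge>1. trivial_group (Ext R i A B)) \<longleftrightarrow> Ext_vanish R P d B"
proof -
  define Q where "Q = fst (chosen_resolution R A)"
  define \<delta> where "\<delta> = snd (chosen_resolution R A)"
  obtain e' where r': "proj_resolution R A Q \<delta> e'"
    using chosen_resolution[OF r] unfolding Q_def \<delta>_def by blast
  note D = exact_resD[OF proj_resolutionD(1)[OF r']]
  interpret B: lmodule R B by fact
  have "Ext_vanish R P d B \<longleftrightarrow> Ext_vanish R Q \<delta> B"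
    using resolutions_homotopic[OF r r'] resolutions_homotopic[OF r' r]
      Ext_vanish_transfer[OF proj_resolutionD(1)[OF r] proj_resolutionD(1)[OF r'] _ B]
      Ext_vanish_transfer[OF proj_resolutionD(1)[OF r'] proj_resolutionD(1)[OF r] _ B] by blast
  moreover have "trivial_group (Ext R (Suc i) A B) \<longleftrightarrow>
    (\<forall>f\<in>mhom R (Q (Suc i)) B. (\<forall>x\<in>carrier (Q (Suc (Suc i))). f (\<delta> (Suc i) x) = \<zero>\<^bsub>B\<^esub>) \<longrightarrow>
    (\<exists>g\<in>mhom R (Q i) B. \<forall>x\<in>carrier (Q (Suc i)). f x = g (\<delta> i x)))" (is "_ \<longleftrightarrow> ?V") for i
  proof -
    let ?H = "\<lambda>j. hom_group R (Q j) B"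
    let ?c = "\<lambda>j. precomp (Q (Suc j)) (\<delta> j)"
    let ?Z = "a_kernel (?H (Suc i)) (?H (Suc (Suc i))) (?c (Suc i))"
    let ?B = "?c i ` carrier (?H i)"
    have E: "Ext R (Suc i) A B = homology_at (?H (Suc i)) ?Z ?B"
      by (simp add: Ext_def Let_def case_prod_unfold Q_def[symmetric] \<delta>_def[symmetric] precomp_def[abs_def])
    have c: "?c j \<in> ahom (?H j) (?H (Suc j))" for j
    proof (rule ahomI)
      fix f assume "f \<in> carrier (?H j)"
      then have "f \<in> mhom R (Q j) B" by simp
      then show "?c j f \<in> carrier (?H (Suc j))"
        unfolding precomp_def using mhom_restrict[OF D(2) mhom_comp[OF D(4)], of f] by simp
    qed (auto simp: precomp_def mhom_closed[OF D(4)] intro!: restrict_ext)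
    note ab = abelian_hom_group[OF D(2) B]
    have BZ: "?B \<subseteq> ?Z"
    proof
      fix f assume "f \<in> ?B"
      then obtain g where g: "g \<in> mhom R (Q i) B" "f = ?c i g" "g \<in> carrier (?H i)" by auto
      have "?c (Suc i) f = \<zero>\<^bsub>?H (Suc (Suc i))\<^esub>"
        using g D(7) mhom_zero[OF D(2) B g(1)] mhom_closed[OF D(4)]
        by (auto simp: precomp_def intro!: restrict_ext)
      then show "f \<in> ?Z" using ahom_closed[OF c g(3)] g(2) unfolding a_kernel_eq by blast
    qed
    have "trivial_group (Ext R (Suc i) A B) \<longleftrightarrow> ?Z \<subseteq> ?B"
      unfolding E by (rule trivial_homology_iff[OF ab additive_subgroup_kernel[OF ab ab c]
            additive_subgroup_ahom_image[OF ab ab c] BZ])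
    also have "\<dots> \<longleftrightarrow> ?V"
    proof
      assume *: "?Z \<subseteq> ?B"
      show ?V
      proof (intro ballI impI)
        fix f assume f: "f \<in> mhom R (Q (Suc i)) B" "\<forall>x\<in>carrier (Q (Suc (Suc i))). f (\<delta> (Suc i) x) = \<zero>\<^bsub>B\<^esub>"
        \<comment> \<open>Elements of \<open>hom_group\<close> are extensional while
          \<open>?V\<close> speaks of arbitrary maps; restriction to the carrier passes from one to
          the other.\<close>
        let ?f = "restrict f (carrier (Q (Suc i)))"
        have "?f \<in> ?Z"
          using mhom_restrict[OF D(2) f(1)] f(2) mhom_closed[OF D(4)]
          by (auto simp: a_kernel_eq precomp_def intro!: restrict_ext)
        then obtain g where g: "g \<in> carrier (?H i)" "?f = ?c i g" using * by blast
        have "f x = g (\<delta> i x)" if "x \<in> carrier (Q (Suc i))" for x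
          using fun_cong[OF g(2), of x] that by (simp add: precomp_def)
        then show "\<exists>g\<in>mhom R (Q i) B. \<forall>x\<in>carrier (Q (Suc i)). f x = g (\<delta> i x)" using g(1) by auto
      qed
    next
      assume *: ?V
      show "?Z \<subseteq> ?B"
      proof
        fix f assume "f \<in> ?Z"
        then have f: "f \<in> mhom R (Q (Suc i)) B" "f \<in> extensional (carrier (Q (Suc i)))"
          and 0: "?c (Suc i) f = (\<lambda>x\<in>carrier (Q (Suc (Suc i))). \<zero>\<^bsub>B\<^esub>)"
          by (auto simp: a_kernel_eq)
        have "f (\<delta> (Suc i) x) = \<zero>\<^bsub>B\<^esub>" if "x \<in> carrier (Q (Suc (Suc i)))" for x
          using fun_cong[OF 0, of x] that by (simp add: precomp_def)
        then obtain g where g: "g \<in> mhom R (Q i) B" "\<forall>x\<in>carrier (Q (Suc i)). f x = g (\<delta> i x)"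
          using * f by blast
        have "f = ?c i (restrict g (carrier (Q i)))"
          using f(2) g(2) mhom_closed[OF D(4)] by (auto simp: precomp_def intro!: ext_eqI)
        then show "f \<in> ?B" using mhom_restrict[OF D(2) g(1)] by auto
      qed
    qed
    finally show ?thesis .
  qed
  moreover have "(\<forall>i\<ge>1. trivial_group (Ext R i A B)) \<longleftrightarrow> (\<forall>i. trivial_group (Ext R (Suc i) A B))"
    by (metis One_nat_def Suc_le_D Suc_le_mono le0)
  ultimately show ?thesis unfolding Ext_vanish_def by simp
qed

lemma Tor_vanish_iff:
  assumes r: "proj_resolution (opp R) A P d e" and B: "lmodule R B"
  shows "(\<forall>i\<ge>1. trivial_group (Tor R i A B)) \<longleftrightarrow> Tor_vanish R P d B"
proof -
  define Q where "Q = fst (chosen_resolution (opp R) A)"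
  define \<delta> where "\<delta> = snd (chosen_resolution (opp R) A)"
  obtain e' where r': "proj_resolution (opp R) A Q \<delta> e'"
    using chosen_resolution[OF r] unfolding Q_def \<delta>_def by blast
  note D = exact_resD[OF proj_resolutionD(1)[OF r']]
  have "Tor_vanish R P d B \<longleftrightarrow> Tor_vanish R Q \<delta> B"
    using resolutions_homotopic[OF r r'] resolutions_homotopic[OF r' r]
      Tor_vanish_transfer[OF proj_resolutionD(1)[OF r] proj_resolutionD(1)[OF r'] _ B]
      Tor_vanish_transfer[OF proj_resolutionD(1)[OF r'] proj_resolutionD(1)[OF r] _ B] by blast
  moreover have "trivial_group (Tor R (Suc i) A B) \<longleftrightarrow>
    (\<forall>t\<in>carrier (tensor R (Q (Suc i)) B). tensor_map R (Q (Suc i)) (Q i) B (\<delta> i) t = \<zero>\<^bsub>tensor R (Q i) B\<^esub> \<longrightarrow>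
    (\<exists>u\<in>carrier (tensor R (Q (Suc (Suc i))) B). t = tensor_map R (Q (Suc (Suc i))) (Q (Suc i)) B (\<delta> (Suc i)) u))"
    (is "_ \<longleftrightarrow> ?V") for i
  proof -
    let ?T = "\<lambda>j. tensor R (Q j) B"
    let ?m = "\<lambda>j. tensor_map R (Q (Suc j)) (Q j) B (\<delta> j)"
    let ?Z = "a_kernel (?T (Suc i)) (?T i) (?m i)"
    let ?B = "?m (Suc i) ` carrier (?T (Suc (Suc i)))"
    have E: "Tor R (Suc i) A B = homology_at (?T (Suc i)) ?Z ?B"
      by (simp add: Tor_def Let_def case_prod_unfold Q_def[symmetric] \<delta>_def[symmetric])
    have m: "?m j \<in> ahom (?T (Suc j)) (?T j)" for j by (rule tensor_map(1)[OF D(2) D(2) B D(4)])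
    have ab: "abelian_group (?T j)" for j by (rule tensor_pair.abelian_tensor[OF tensor_pairI[OF D(2) B]])
    have BZ: "?B \<subseteq> ?Z"
    proof
      fix t assume "t \<in> ?B"
      then obtain u where u: "u \<in> carrier (?T (Suc (Suc i)))" "t = ?m (Suc i) u" by blast
      have "?m i t = tensor_map R (Q (Suc (Suc i))) (Q i) B (\<lambda>x. \<delta> i (\<delta> (Suc i) x)) u"
        unfolding u(2) by (rule tensor_map_comp[OF D(2) D(2) D(2) B D(4) D(4) u(1)])
      also have "\<dots> = \<zero>\<^bsub>?T i\<^esub>"
        by (rule tensor_map_zero[OF D(2) D(2) B mhom_comp[OF D(4) D(4)] D(7) u(1)])
      finally show "t \<in> ?Z" using ahom_closed[OF m u(1)] u(2) unfolding a_kernel_eq by blast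
    qed
    have "trivial_group (Tor R (Suc i) A B) \<longleftrightarrow> ?Z \<subseteq> ?B"
      unfolding E by (rule trivial_homology_iff[OF ab additive_subgroup_kernel[OF ab ab m]
            additive_subgroup_ahom_image[OF ab ab m] BZ])
    also have "\<dots> \<longleftrightarrow> ?V" unfolding a_kernel_eq by blast
    finally show ?thesis .
  qed
  moreover have "(\<forall>i\<ge>1. trivial_group (Tor R i A B)) \<longleftrightarrow> (\<forall>i. trivial_group (Tor R (Suc i) A B))"
    by (metis One_nat_def Suc_le_D Suc_le_mono le0)
  ultimately show ?thesis unfolding Tor_vanish_def by simp
qed

section \<open>Finitely presented modules\<close>

definition lincomb :: "('r, 'a) module \<Rightarrow> nat \<Rightarrow> (nat \<Rightarrow> 'a) \<Rightarrow> (nat \<Rightarrow> 'r) \<Rightarrow> 'a"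
  where "lincomb M m v c = gsum M (\<lambda>i. c i \<odot>\<^bsub>M\<^esub> v i) m"

definition gens :: "'r ring \<Rightarrow> ('r, 'a) module \<Rightarrow> nat \<Rightarrow> (nat \<Rightarrow> 'a) \<Rightarrow> bool"
  where "gens R M m v \<longleftrightarrow> (\<forall>i<m. v i \<in> carrier M) \<and>
    lincomb M m v ` carrier (pw (reg R) m) = carrier M"

definition syz :: "'r ring \<Rightarrow> ('r, 'a) module \<Rightarrow> nat \<Rightarrow> (nat \<Rightarrow> 'a) \<Rightarrow> ('r, nat \<Rightarrow> 'r) module"
  where "syz R M m v = sub (pw (reg R) m) {c \<in> carrier (pw (reg R) m). lincomb M m v c = \<zero>\<^bsub>M\<^esub>}"

lemma lincomb_mhom:
  assumes "lmodule R M" "\<And>i. i < m \<Longrightarrow> v i \<in> carrier M"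
  shows "lincomb M m v \<in> mhom R (pw (reg R) m) M"
  unfolding lincomb_def[abs_def]
proof (rule mhom_gsum_map[OF assms(1)])
  fix i assume i: "i < m"
  have "(\<lambda>c. c i) \<in> mhom R (pw (reg R) m) (reg R)"
    by (rule mhomI) (use i in \<open>auto simp: pw_carrier\<close>)
  then show "(\<lambda>c. c i \<odot>\<^bsub>M\<^esub> v i) \<in> mhom R (pw (reg R) m) M"
    by (rule smult_mhom_reg[OF assms(1) assms(2)[OF i]])
qed

lemma lmodule_pw_reg: "ring R \<Longrightarrow> lmodule R (pw (reg R) m)"
  by (intro lmodule_pw lmodule_reg)

lemma lmodule_syz:
  assumes "lmodule R M" "\<And>i. i < m \<Longrightarrow> v i \<in> carrier M"
  shows "lmodule R (syz R M m v)"
  unfolding syz_def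
  by (rule lmodule_kernel[OF lmodule_pw_reg[OF lmodule_ring[OF assms(1)]] assms(1) lincomb_mhom[OF assms]]) 

lemma lincomb_hom:
  assumes "lmodule R A" "lmodule R B" "f \<in> mhom R A B" "\<And>i. i < m \<Longrightarrow> v i \<in> carrier A"
    "\<And>i. i < m \<Longrightarrow> c i \<in> carrier R"
  shows "f (lincomb A m v c) = lincomb B m (\<lambda>i. f (v i)) c"
proof -
  interpret A: lmodule R A by fact
  have "f (lincomb A m v c) = gsum B (\<lambda>i. f (c i \<odot>\<^bsub>A\<^esub> v i)) m"
    unfolding lincomb_def by (rule mhom_gsum[OF assms(1-3)]) (use assms in auto)
  also have "\<dots> = lincomb B m (\<lambda>i. f (v i)) c"
    unfolding lincomb_def by (rule gsum_cong) (use assms mhom_smult[OF assms(3)] in auto)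
  finally show ?thesis .
qed

lemma syz_carrier: "c \<in> carrier (syz R M m v) \<longleftrightarrow> c \<in> carrier (pw (reg R) m) \<and> lincomb M m v c = \<zero>\<^bsub>M\<^esub>"
  by (simp add: syz_def)

lemma syz_simps [simp]:
  "zero (syz R M m v) = (\<lambda>i. \<zero>\<^bsub>R\<^esub>)" "add (syz R M m v) = (\<lambda>c d i. c i \<oplus>\<^bsub>R\<^esub> d i)"
  "smult (syz R M m v) = (\<lambda>r c i. r \<otimes>\<^bsub>R\<^esub> c i)"
  by (simp_all add: syz_def)

lemma gensD:
  assumes "gens R M m v"
  shows "\<And>i. i < m \<Longrightarrow> v i \<in> carrier M" "\<And>y. y \<in> carrier M \<Longrightarrow> \<exists>c\<in>carrier (pw (reg R) m). y = lincomb M m v c"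
  using assms unfolding gens_def by blast+

lemma gensI:
  assumes "lmodule R M" "\<And>i. i < m \<Longrightarrow> v i \<in> carrier M"
    "\<And>y. y \<in> carrier M \<Longrightarrow> \<exists>c\<in>carrier (pw (reg R) m). y = lincomb M m v c"
  shows "gens R M m v"
proof -
  have "lincomb M m v ` carrier (pw (reg R) m) = carrier M"
    using mhom_closed[OF lincomb_mhom[OF assms(1,2)]] assms(3) by (auto simp only: image_iff)
  then show ?thesis using assms(2) unfolding gens_def by blast
qed

text \<open>Level \<open>n\<close> asks for finite generation of the module and of \<open>n\<close>
  successive syzygies, which corresponds to finitely generated free terms \<open>F_0\<close>, ...,
  \<open>F_n\<close>.\<close>

primrec fps :: "'r ring \<Rightarrow> nat \<Rightarrow> ('r, nat \<Rightarrow> 'r) module \<Rightarrow> bool"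
  where
    "fps R 0 K \<longleftrightarrow> (\<exists>m v. gens R K m v)"
  | "fps R (Suc n) K \<longleftrightarrow> (\<exists>m v. gens R K m v \<and> fps R n (syz R K m v))"

text \<open>Finite \<open>n\<close>-presentation without a universe: the syzygies of generators all live in one type,
  so the recursion runs over that type and \<open>M\<close> itself may be of any type.\<close>

definition fpg :: "'r ring \<Rightarrow> nat \<Rightarrow> ('r, 'a) module \<Rightarrow> bool"
  where "fpg R n M \<longleftrightarrow> lmodule R M \<and>
    (\<exists>m v. gens R M m v \<and> (case n of 0 \<Rightarrow> True | Suc k \<Rightarrow> fps R k (syz R M m v)))"

lemma fps_iff_fpg: "lmodule R K \<Longrightarrow> fps R n K \<longleftrightarrow> fpg R n K"
  by (cases n) (simp_all add: fpg_def)

lemma fpg_0: "fpg R 0 M \<longleftrightarrow> lmodule R M \<and> (\<exists>m v. gens R M m v)"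
  by (simp add: fpg_def)

lemma fpg_Suc: "fpg R (Suc n) M \<longleftrightarrow> lmodule R M \<and> (\<exists>m v. gens R M m v \<and> fpg R n (syz R M m v))"
proof -
  have "fps R n (syz R M m v) \<longleftrightarrow> fpg R n (syz R M m v)" if "lmodule R M" "gens R M m v" for m v
    by (rule fps_iff_fpg[OF lmodule_syz[OF that(1) gensD(1)[OF that(2)]]])
  then show ?thesis unfolding fpg_def[of R "Suc n"] by auto
qed

lemma fpg_lmodule: "fpg R n M \<Longrightarrow> lmodule R M"
  by (simp add: fpg_def)

lemma fpg_gens: "fpg R n M \<Longrightarrow> \<exists>m v. gens R M m v"
  unfolding fpg_def by blast

text \<open>A linear combination vanishes in \<open>N\<close> iff it does in \<open>M\<close>, so
  the syzygy modules are equal and not merely isomorphic; invariance of \<open>fpg\<close> under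
  isomorphisms between different types is then immediate.\<close>

lemma gens_miso:
  assumes "lmodule R M" "lmodule R N" "f \<in> miso R M N" "gens R M m v"
  shows "gens R N m (\<lambda>i. f (v i))" "syz R N m (\<lambda>i. f (v i)) = syz R M m v"
proof -
  note f = misoD[OF assms(3)] and G = gensD[OF assms(4)]
  note r = lmodule_ab[OF lmodule_reg[OF lmodule_ring[OF assms(1)]]]
  have l: "lincomb N m (\<lambda>i. f (v i)) c = f (lincomb M m v c)" if "c \<in> carrier (pw (reg R) m)" for c
    by (rule lincomb_hom[OF assms(1,2) f(1), symmetric]) (use G that pw_closed[OF r] in auto)
  show "gens R N m (\<lambda>i. f (v i))"
  proof (rule gensI[OF assms(2)])
    fix y assume "y \<in> carrier N"
    then obtain x where x: "x \<in> carrier M" "y = f x" using f(3) by blast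
    then obtain c where "c \<in> carrier (pw (reg R) m)" "x = lincomb M m v c" using G(2) by blast
    then show "\<exists>c\<in>carrier (pw (reg R) m). y = lincomb N m (\<lambda>i. f (v i)) c" using l x by auto
  qed (use G(1) mhom_closed[OF f(1)] in auto)
  interpret M: lmodule R M by fact
  have "f x = \<zero>\<^bsub>N\<^esub> \<longleftrightarrow> x = \<zero>\<^bsub>M\<^esub>" if "x \<in> carrier M" for x
    using inj_on_eq_iff[OF f(2) that M.zero_closed] mhom_zero[OF assms(1,2) f(1)] by simp
  then have "lincomb N m (\<lambda>i. f (v i)) c = \<zero>\<^bsub>N\<^esub> \<longleftrightarrow> lincomb M m v c = \<zero>\<^bsub>M\<^esub>"
    if "c \<in> carrier (pw (reg R) m)" for c
    using l[OF that] mhom_closed[OF lincomb_mhom[OF assms(1) G(1)] that] by simp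
  then show "syz R N m (\<lambda>i. f (v i)) = syz R M m v" 
    unfolding syz_def by (intro arg_cong[where f = "sub (pw (reg R) m)"] Collect_cong) auto
qed

lemma fpg_miso:
  assumes "lmodule R N" "f \<in> miso R M N" "fpg R n M"
  shows "fpg R n N"
  using assms(3) gens_miso[OF fpg_lmodule[OF assms(3)] assms(1,2)] assms(1)
  by (cases n) (fastforce simp: fpg_0 fpg_Suc)+

section \<open>Finite presentation along short exact sequences\<close>

lemma lincomb_cong:
  "(\<And>i. i < m \<Longrightarrow> v i = w i) \<Longrightarrow> (\<And>i. i < m \<Longrightarrow> c i = d i) \<Longrightarrow> lincomb M m v c = lincomb M m w d"
  unfolding lincomb_def by (rule gsum_cong) simp

lemma lincomb_append:
  assumes "lmodule R M" "\<And>i. i < a + d \<Longrightarrow> v i \<in> carrier M" "\<And>i. i < a + d \<Longrightarrow> c i \<in> carrier R"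
  shows "lincomb M (a + d) v c = lincomb M a v c \<oplus>\<^bsub>M\<^esub> lincomb M d (\<lambda>i. v (a + i)) (\<lambda>i. c (a + i))"
proof -
  interpret M: lmodule R M by fact
  show ?thesis
    unfolding lincomb_def by (rule M.gsum_append) (use assms in auto)
qed

text \<open>The horseshoe construction: images of the generators of \<open>A\<close>, followed by
  preimages of those of \<open>D\<close>. Splitting coefficient vectors into the two blocks yields a
  short exact sequence of syzygies again.\<close>

lemma gens_extension:
  assumes s: "ses R A f B g D" and u: "gens R A a u" and w: "gens R D d w"
  shows "\<exists>v. gens R B (a + d) v \<and>
    ses R (syz R A a u) (\<lambda>c. c) (syz R B (a + d) v) (\<lambda>c i. c (a + i)) (syz R D d w)"
proof -
  note S = sesD[OF s] and U = gensD[OF u] and W = gensD[OF w]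
  interpret A: lmodule R A by (rule S)
  interpret B: lmodule R B by (rule S)
  interpret D: lmodule R D by (rule S)
  define w' where "w' i = inv_into (carrier B) g (w i)" for i
  have w': "w' i \<in> carrier B" "g (w' i) = w i" if "i < d" for i
    using S(7) W(1)[OF that] unfolding w'_def by (metis inv_into_into, metis f_inv_into_f)
  define v where "v i = (if i < a then f (u i) else w' (i - a))" for i
  have v: "v i \<in> carrier B" if "i < a + d" for i
    using that U(1) w'(1) mhom_closed[OF S(4)] by (auto simp: v_def)
  have rc: "\<And>m c i. c \<in> carrier (pw (reg R) m) \<Longrightarrow> c i \<in> carrier R"
    using pw_closed[OF lmodule_ab[OF lmodule_reg[OF A.ring_axioms]]] by simp
  have sp: "lincomb B (a + d) v c = f (lincomb A a u c) \<oplus>\<^bsub>B\<^esub> lincomb B d w' (\<lambda>i. c (a + i))"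
    if "\<And>i. i < a + d \<Longrightarrow> c i \<in> carrier R" for c
  proof -
    have "lincomb B (a + d) v c = lincomb B a v c \<oplus>\<^bsub>B\<^esub> lincomb B d (\<lambda>i. v (a + i)) (\<lambda>i. c (a + i))"
      by (rule lincomb_append[OF S(2)]) (use v that in auto)
    moreover have "lincomb B a v c = lincomb B a (\<lambda>i. f (u i)) c"
      by (rule lincomb_cong) (simp_all add: v_def)
    moreover have "lincomb B a (\<lambda>i. f (u i)) c = f (lincomb A a u c)"
      by (rule lincomb_hom[OF S(1,2,4), symmetric]) (use U that in auto)
    moreover have "lincomb B d (\<lambda>i. v (a + i)) (\<lambda>i. c (a + i)) = lincomb B d w' (\<lambda>i. c (a + i))"
      by (rule lincomb_cong) (simp_all add: v_def)
    ultimately show ?thesis by simp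
  qed
  have gw: "g (lincomb B d w' c) = lincomb D d w c" if "\<And>i. i < d \<Longrightarrow> c i \<in> carrier R" for c
    using lincomb_hom[OF S(2,3,5), of d w' c] w' that lincomb_cong[of d "\<lambda>i. g (w' i)" w c c D] by simp
  have lA: "lincomb A a u c \<in> carrier A" if "\<And>i. i < a \<Longrightarrow> c i \<in> carrier R" for c
    unfolding lincomb_def using U(1) that by auto
  have lB: "lincomb B d w' c \<in> carrier B" if "\<And>i. i < d \<Longrightarrow> c i \<in> carrier R" for c
    unfolding lincomb_def using w' that by auto
  let ?j = "\<lambda>b c i. if i < a then b i else c (i - a)"
  have jc: "?j b c \<in> carrier (pw (reg R) (a + d))" if "b \<in> carrier (pw (reg R) a)" "c \<in> carrier (pw (reg R) d)" for b c
    using that by (auto simp: pw_carrier)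
  have sj: "lincomb B (a + d) v (?j b c) = f (lincomb A a u b) \<oplus>\<^bsub>B\<^esub> lincomb B d w' c"
    if "b \<in> carrier (pw (reg R) a)" "c \<in> carrier (pw (reg R) d)" for b c
    using sp[of "?j b c"] that rc lincomb_cong[of a u u "?j b c" b A] by simp
  have g1: "gens R B (a + d) v"
  proof (rule gensI[OF S(2) v])
    fix y assume y: "y \<in> carrier B"
    obtain c where c: "c \<in> carrier (pw (reg R) d)" "g y = lincomb D d w c"
      using W(2) mhom_closed[OF S(5) y] by blast
    let ?z = "lincomb B d w' c"
    have z: "?z \<in> carrier B" using lB rc[OF c(1)] by blast
    have "g (y \<ominus>\<^bsub>B\<^esub> ?z) = \<zero>\<^bsub>D\<^esub>"
      using mhom_minus[OF S(2,3,5) y z] gw[of c] rc[OF c(1)] c(2) mhom_closed[OF S(5) y]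
      by (simp add: D.minus_eq_zero_iff)
    then obtain x where x: "x \<in> carrier A" "y \<ominus>\<^bsub>B\<^esub> ?z = f x" using S(9) y z by blast
    then obtain b where b: "b \<in> carrier (pw (reg R) a)" "x = lincomb A a u b" using U(2) by blast
    have "y = lincomb B (a + d) v (?j b c)"
      using sj[OF b(1) c(1)] x(2) b(2) B.minus_add_cancel[OF y z] by simp
    then show "\<exists>c\<in>carrier (pw (reg R) (a + d)). y = lincomb B (a + d) v c" using jc[OF b(1) c(1)] by blast
  qed
  have "ses R (syz R A a u) (\<lambda>c. c) (syz R B (a + d) v) (\<lambda>c i. c (a + i)) (syz R D d w)"
  proof (rule sesI)
    show "lmodule R (syz R A a u)" "lmodule R (syz R B (a + d) v)" "lmodule R (syz R D d w)"
      by (intro lmodule_syz S U(1) v W(1); assumption)+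
    show "inj_on (\<lambda>c. c) (carrier (syz R A a u))" by simp
    \<comment> \<open>Thanks to the padding, a vector of coefficients for \<open>A\<close> is
      already one for \<open>B\<close>, with coefficient zero at each lifted generator of
      \<open>D\<close>.\<close>
    have pad: "lincomb B (a + d) v c = f (lincomb A a u c)" if "c \<in> carrier (pw (reg R) a)" for c
    proof -
      have "lincomb B d w' (\<lambda>i. c (a + i)) = lincomb B d w' (\<lambda>i. \<zero>\<^bsub>R\<^esub>)"
        by (rule lincomb_cong) (use that in \<open>auto simp: pw_carrier\<close>)
      also have "\<dots> = \<zero>\<^bsub>B\<^esub>"
        unfolding lincomb_def by (subst gsum_cong[of d _ "\<lambda>i. \<zero>\<^bsub>B\<^esub>"]) (use w' in auto)
      finally show ?thesis
        using sp[of c] rc[OF that] mhom_closed[OF S(4) lA] by simp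
    qed
    have padc: "x i \<in> carrier R" if "\<forall>i<a. x i \<in> carrier R" "\<forall>i\<ge>a. x i = \<zero>\<^bsub>R\<^esub>" for x i
      using that A.zero_closed by (cases "i < a") auto
    show "(\<lambda>c. c) \<in> mhom R (syz R A a u) (syz R B (a + d) v)"
      by (rule mhomI) (auto simp: syz_carrier pad mhom_zero[OF S(1,2,4)] pw_carrier intro: padc)
    have gc: "lincomb D d w (\<lambda>i. c (a + i)) = \<zero>\<^bsub>D\<^esub>" if "c \<in> carrier (syz R B (a + d) v)" for c
    proof -
      have c: "\<And>i. c i \<in> carrier R" using that rc by (auto simp: syz_carrier)
      have "g (lincomb B (a + d) v c) = g (f (lincomb A a u c)) \<oplus>\<^bsub>D\<^esub> g (lincomb B d w' (\<lambda>i. c (a + i)))"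
        using sp[of c] c mhom_add[OF S(5) mhom_closed[OF S(4) lA] lB] by simp
      then have "g (lincomb B (a + d) v c) = lincomb D d w (\<lambda>i. c (a + i))"
        using S(8)[OF lA] c gw[of "\<lambda>i. c (a + i)"] mhom_closed[OF S(5) lB[of "\<lambda>i. c (a + i)"]] by simp
      then show ?thesis using that mhom_zero[OF S(2,3,5)] by (simp add: syz_carrier)
    qed
    show "(\<lambda>c i. c (a + i)) \<in> mhom R (syz R B (a + d) v) (syz R D d w)"
    proof (rule mhomI)
      fix c assume "c \<in> carrier (syz R B (a + d) v)"
      then show "(\<lambda>i. c (a + i)) \<in> carrier (syz R D d w)" using gc[of c] by (simp add: syz_carrier pw_carrier)
    qed simp_all
    have on: "\<exists>e\<in>carrier (syz R B (a + d) v). (\<lambda>i. e (a + i)) = c" if c: "c \<in> carrier (syz R D d w)" for c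
    proof -
      have c': "c \<in> carrier (pw (reg R) d)" "lincomb D d w c = \<zero>\<^bsub>D\<^esub>" using c by (auto simp: syz_carrier)
      let ?z = "lincomb B d w' c"
      have z: "?z \<in> carrier B" using lB rc[OF c'(1)] by blast
      obtain x where x: "x \<in> carrier A" "?z = f x" using S(9)[OF z] gw[of c] c'(2) rc[OF c'(1)] by auto
      \<comment> \<open>A syzygy of \<open>D\<close>, used as coefficients of the lifted generators,
        gives a value \<open>f x\<close>; coefficients of \<open>-x\<close> in the first block
        cancel it.\<close>
      obtain b where b: "b \<in> carrier (pw (reg R) a)" "\<ominus>\<^bsub>A\<^esub> x = lincomb A a u b" using U(2) x(1) by blast
      have "lincomb B (a + d) v (?j b c) = f (\<ominus>\<^bsub>A\<^esub> x) \<oplus>\<^bsub>B\<^esub> f x"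
        using sj[OF b(1) c'(1)] x(2) b(2) by simp
      also have "\<dots> = \<zero>\<^bsub>B\<^esub>"
        using mhom_neg[OF S(1,2,4) x(1)] mhom_closed[OF S(4) x(1)] by (simp add: B.l_neg)
      finally have "?j b c \<in> carrier (syz R B (a + d) v)"
        using jc[OF b(1) c'(1)] by (simp add: syz_carrier)
      moreover have "(\<lambda>i. ?j b c (a + i)) = c" by simp
      ultimately show ?thesis by (intro bexI[of _ "?j b c"])
    qed
    show "(\<lambda>c i. c (a + i)) ` carrier (syz R B (a + d) v) = carrier (syz R D d w)"
    proof
      show "(\<lambda>c i. c (a + i)) ` carrier (syz R B (a + d) v) \<subseteq> carrier (syz R D d w)"
        using gc by (auto simp: syz_carrier pw_carrier)
      show "carrier (syz R D d w) \<subseteq> (\<lambda>c i. c (a + i)) ` carrier (syz R B (a + d) v)"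
      proof
        fix c assume "c \<in> carrier (syz R D d w)"
        then obtain e where "e \<in> carrier (syz R B (a + d) v)" "(\<lambda>i. e (a + i)) = c" using on by blast
        then show "c \<in> (\<lambda>c i. c (a + i)) ` carrier (syz R B (a + d) v)" by (intro image_eqI[of _ _ e]) simp_all
      qed
    qed
    show "(\<lambda>i. c (a + i)) = \<zero>\<^bsub>syz R D d w\<^esub>" if "c \<in> carrier (syz R A a u)" for c
      using that by (simp add: syz_carrier pw_carrier)
    show "\<exists>x\<in>carrier (syz R A a u). c = x"
      if c: "c \<in> carrier (syz R B (a + d) v)" "(\<lambda>i. c (a + i)) = \<zero>\<^bsub>syz R D d w\<^esub>" for c
    proof -
      have "c i = \<zero>\<^bsub>R\<^esub>" if "i \<ge> a" for i
        using fun_cong[OF c(2), of "i - a"] that by simp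
      then have c': "c \<in> carrier (pw (reg R) a)" using c(1) by (auto simp: syz_carrier pw_carrier)
      then have "f (lincomb A a u c) = f \<zero>\<^bsub>A\<^esub>" using pad c(1) mhom_zero[OF S(1,2,4)] by (simp add: syz_carrier)
      then have "lincomb A a u c = \<zero>\<^bsub>A\<^esub>"
        using inj_onD[OF S(6)] lA rc[OF c'] A.zero_closed by blast
      then show ?thesis using c' by (simp add: syz_carrier)
    qed
  qed
  with g1 show ?thesis by blast
qed

text \<open>The horseshoe is iterated inside the single type of syzygies, because an induction
  cannot change the types of its modules; \<open>fpg_extension\<close> adds the first step, where
  the types are free.\<close>

lemma fps_extension:
  "ses R A f B g D \<Longrightarrow> fps R n A \<Longrightarrow> fps R n D \<Longrightarrow> fps R n B"
proof (induction n arbitrary: A f B g D)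
  case 0
  then show ?case using gens_extension[OF 0(1)] by (simp only: fps.simps) blast
next
  case (Suc n)
  obtain a u where u: "gens R A a u" "fps R n (syz R A a u)" using Suc.prems(2) by auto
  obtain d w where w: "gens R D d w" "fps R n (syz R D d w)" using Suc.prems(3) by auto
  obtain v where v: "gens R B (a + d) v"
    "ses R (syz R A a u) (\<lambda>c. c) (syz R B (a + d) v) (\<lambda>c i. c (a + i)) (syz R D d w)"
    using gens_extension[OF Suc.prems(1) u(1) w(1)] by blast
  show ?case using v(1) Suc.IH[OF v(2) u(2) w(2)] by auto
qed

lemma fpg_extension:
  assumes s: "ses R A f B g D" and A: "fpg R n A" and D: "fpg R n D"
  shows "fpg R n B"
proof (cases n)
  case 0
  then show ?thesis
    using gens_extension[OF s] A D sesD(2)[OF s] unfolding 0 fpg_0 by blast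
next
  case (Suc k)
  obtain a u where u: "gens R A a u" "fps R k (syz R A a u)" using A unfolding fpg_def Suc by auto
  obtain d w where w: "gens R D d w" "fps R k (syz R D d w)" using D unfolding fpg_def Suc by auto
  obtain v where v: "gens R B (a + d) v"
    "ses R (syz R A a u) (\<lambda>c. c) (syz R B (a + d) v) (\<lambda>c i. c (a + i)) (syz R D d w)"
    using gens_extension[OF s u(1) w(1)] by blast
  show ?thesis using v(1) fps_extension[OF v(2) u(2) w(2)] sesD(2)[OF s] unfolding fpg_def Suc by auto
qed

lemma gens_image:
  assumes B: "lmodule R B" and D: "lmodule R D" and g: "g \<in> mhom R B D" "g ` carrier B = carrier D"
    and v: "gens R B m v"
  shows "gens R D m (\<lambda>i. g (v i))"
proof (rule gensI[OF D])
  note G = gensD[OF v]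
  fix y assume "y \<in> carrier D"
  then obtain x where x: "x \<in> carrier B" "y = g x" using g(2) by blast
  then obtain c where c: "c \<in> carrier (pw (reg R) m)" "x = lincomb B m v c" using G(2) by blast
  have "y = lincomb D m (\<lambda>i. g (v i)) c"
    unfolding x(2) c(2) using G(1) c(1) pw_closed[OF lmodule_ab[OF lmodule_reg[OF lmodule_ring[OF B]]] c(1)]
    by (intro lincomb_hom[OF B D g(1)]) auto
  then show "\<exists>c\<in>carrier (pw (reg R) m). y = lincomb D m (\<lambda>i. g (v i)) c" using c(1) by blast
qed (use gensD(1)[OF v] mhom_closed[OF g(1)] in auto)

lemma fpg_0_image:
  assumes "lmodule R D" "g \<in> mhom R B D" "g ` carrier B = carrier D" "fpg R n B"
  shows "fpg R 0 D"
  using gens_image[OF fpg_lmodule[OF assms(4)] assms(1-3)] fpg_gens[OF assms(4)] assms(1)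
  unfolding fpg_0 by blast

text \<open>Generators of \<open>B\<close> are mapped to generators of \<open>D\<close>. A syzygy of
  \<open>D\<close> gives a combination in \<open>B\<close> that lies in the image of
  \<open>A\<close>, and this makes the syzygies of \<open>D\<close> an extension of \<open>A\<close>
  by the syzygies of \<open>B\<close>.\<close>

lemma fpg_cokernel:
  assumes s: "ses R A f B g D" and A: "fpg R n A" and B: "fpg R (Suc n) B"
  shows "fpg R (Suc n) D"
proof -
  note S = sesD[OF s]
  interpret A: lmodule R A by (rule S)
  obtain m v where v: "gens R B m v" "fpg R n (syz R B m v)" using B unfolding fpg_Suc by blast
  note G = gensD[OF v(1)]
  have rc: "\<And>m c i. c \<in> carrier (pw (reg R) m) \<Longrightarrow> c i \<in> carrier R"
    using pw_closed[OF lmodule_ab[OF lmodule_reg[OF A.ring_axioms]]] by simp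
  have gD: "gens R D m (\<lambda>i. g (v i))" by (rule gens_image[OF S(2,3,5,7) v(1)])
  note lB = lincomb_mhom[OF S(2) G(1)]
  have gl: "lincomb D m (\<lambda>i. g (v i)) c = g (lincomb B m v c)" if "c \<in> carrier (pw (reg R) m)" for c
    by (rule lincomb_hom[OF S(2,3,5), symmetric]) (use G(1) rc that in auto)
  have sD: "lmodule R (syz R D m (\<lambda>i. g (v i)))" by (rule lmodule_syz[OF S(3) gensD(1)[OF gD]])
  have l: "lincomb B m v \<in> mhom R (syz R D m (\<lambda>i. g (v i))) B"
    unfolding syz_def by (rule mhom_restrict_sub[OF lB]) auto
  have "g (lincomb B m v c) = \<zero>\<^bsub>D\<^esub>" if "c \<in> carrier (syz R D m (\<lambda>i. g (v i)))" for c
    using that gl[of c] by (simp add: syz_carrier)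
  \<comment> \<open>\<open>k\<close> sends a syzygy of \<open>D\<close> to the element of
    \<open>A\<close> that the corresponding combination in \<open>B\<close> comes from; its kernel
    consists of the syzygies of \<open>B\<close>.\<close>
  from ses_factor[OF s sD l this] obtain k where k: "k \<in> mhom R (syz R D m (\<lambda>i. g (v i))) A"
    "\<And>c. c \<in> carrier (syz R D m (\<lambda>i. g (v i))) \<Longrightarrow> f (k c) = lincomb B m v c"
    by blast
  have "ses R (syz R B m v) (\<lambda>c. c) (syz R D m (\<lambda>i. g (v i))) k A"
  proof (rule sesI[OF lmodule_syz[OF S(2) G(1)] sD S(1)])
    have sub: "c \<in> carrier (syz R D m (\<lambda>i. g (v i)))" if "c \<in> carrier (syz R B m v)" for c
      using that gl[of c] mhom_zero[OF S(2,3,5)] by (simp add: syz_carrier)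
    show "(\<lambda>c. c) \<in> mhom R (syz R B m v) (syz R D m (\<lambda>i. g (v i)))"
      by (rule mhomI) (use sub in auto)
    show "k \<in> mhom R (syz R D m (\<lambda>i. g (v i))) A" by (rule k)
    have fk: "k c = \<zero>\<^bsub>A\<^esub> \<longleftrightarrow> lincomb B m v c = \<zero>\<^bsub>B\<^esub>" if c: "c \<in> carrier (syz R D m (\<lambda>i. g (v i)))" for c
      using k(2)[OF c] inj_onD[OF S(6) _ mhom_closed[OF k(1) c] A.zero_closed] mhom_zero[OF S(1,2,4)] by metis
    show "k c = \<zero>\<^bsub>A\<^esub>" if "c \<in> carrier (syz R B m v)" for c
      using fk[OF sub[OF that]] that by (simp add: syz_carrier)
    show "\<exists>x\<in>carrier (syz R B m v). c = x"
      if "c \<in> carrier (syz R D m (\<lambda>i. g (v i)))" "k c = \<zero>\<^bsub>A\<^esub>" for c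
      using fk[OF that(1)] that by (simp add: syz_carrier)
    show "k ` carrier (syz R D m (\<lambda>i. g (v i))) = carrier A"
    proof
      show "k ` carrier (syz R D m (\<lambda>i. g (v i))) \<subseteq> carrier A" using mhom_closed[OF k(1)] by blast
      show "carrier A \<subseteq> k ` carrier (syz R D m (\<lambda>i. g (v i)))"
      proof
        fix x assume x: "x \<in> carrier A"
        obtain c where c: "c \<in> carrier (pw (reg R) m)" "f x = lincomb B m v c" using G(2) mhom_closed[OF S(4) x] by blast
        have cs: "c \<in> carrier (syz R D m (\<lambda>i. g (v i)))" using c gl[OF c(1)] S(8)[OF x] by (simp add: syz_carrier)
        have "f (k c) = f x" using k(2)[OF cs] c(2) by simp
        then have "k c = x" using inj_onD[OF S(6) _ mhom_closed[OF k(1) cs] x] by blast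
        then show "x \<in> k ` carrier (syz R D m (\<lambda>i. g (v i)))" using cs by blast
      qed
    qed
    show "inj_on (\<lambda>c. c) (carrier (syz R B m v))" by (rule inj_onI)
  qed
  from fpg_extension[OF this v(2) A] show ?thesis using gD S(3) unfolding fpg_Suc by blast
qed

section \<open>Finite presentation of projectives, retracts and resolved modules\<close>

lemma dual_basis_gens:
  assumes "dual_basis R P m v \<xi>"
  shows "gens R P m v"
proof (rule gensI)
  note D = dual_basisD[OF assms]
  show "lmodule R P" "\<And>i. i < m \<Longrightarrow> v i \<in> carrier P" by (rule D, rule D, assumption)
  fix y assume y: "y \<in> carrier P"
  let ?c = "\<lambda>i. if i < m then \<xi> i y else \<zero>\<^bsub>R\<^esub>"
  have "y = lincomb P m v ?c"
    unfolding lincomb_def using D(4)[OF y] gsum_cong[of m "\<lambda>i. \<xi> i y \<odot>\<^bsub>P\<^esub> v i" "\<lambda>i. ?c i \<odot>\<^bsub>P\<^esub> v i" P] by simp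
  moreover have "?c \<in> carrier (pw (reg R) m)" using D(5) y by (simp add: pw_carrier)
  ultimately show "\<exists>c\<in>carrier (pw (reg R) m). y = lincomb P m v c" by blast
qed

text \<open>The syzygies of a dual basis form a complement of the module in a free module.\<close>

lemma dual_basis_syz:
  assumes "dual_basis R P m v \<xi>"
  shows "\<exists>v' \<xi>'. dual_basis R (syz R P m v) m v' \<xi>'"
proof -
  note D = dual_basisD[OF assms]
  interpret R: ring R by (rule lmodule_ring[OF D(1)])
  interpret P: lmodule R P by (rule D)
  have rc: "\<And>m c i. c \<in> carrier (pw (reg R) m) \<Longrightarrow> c i \<in> carrier R"
    using pw_closed[OF lmodule_ab[OF lmodule_reg[OF R.ring_axioms]]] by simp
  \<comment> \<open>\<open>v' i\<close> is the \<open>i\<close>-th unit vector minus the coordinate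
    vector of \<open>v i\<close>: the image of the unit vector under the projection of the free
    module onto the syzygies.\<close>
  define v' where "v' i j = (if j < m then (if j = i then \<one>\<^bsub>R\<^esub> else \<zero>\<^bsub>R\<^esub>) \<ominus>\<^bsub>R\<^esub> \<xi> j (v i) else \<zero>\<^bsub>R\<^esub>)" for i j
  have v'c: "v' i \<in> carrier (pw (reg R) m)" if "i < m" for i
    using D(2,5) that by (auto simp: pw_carrier v'_def)
  have neg: "(x \<ominus>\<^bsub>R\<^esub> y) \<odot>\<^bsub>P\<^esub> z = x \<odot>\<^bsub>P\<^esub> z \<ominus>\<^bsub>P\<^esub> y \<odot>\<^bsub>P\<^esub> z" if "x \<in> carrier R" "y \<in> carrier R" "z \<in> carrier P" for x y z
    using ahom_minus[OF R.abelian_group_axioms P.abelian_group_axioms P.smult_l_ahom[OF that(3)] that(1,2)] .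
  have gminus: "gsum G (\<lambda>i. x i \<ominus>\<^bsub>G\<^esub> y i) m = gsum G x m \<ominus>\<^bsub>G\<^esub> gsum G y m"
    if G: "abelian_group G" and "\<And>i. i < m \<Longrightarrow> x i \<in> carrier G" "\<And>i. i < m \<Longrightarrow> y i \<in> carrier G" for G :: "('g, 'x) ring_scheme" and x y
  proof -
    interpret G: abelian_group G by fact
    have "gsum G x m = gsum G (\<lambda>i. (x i \<ominus>\<^bsub>G\<^esub> y i) \<oplus>\<^bsub>G\<^esub> y i) m"
      by (rule gsum_cong) (use that in simp)
    also have "\<dots> = gsum G (\<lambda>i. x i \<ominus>\<^bsub>G\<^esub> y i) m \<oplus>\<^bsub>G\<^esub> gsum G y m"
      by (rule G.gsum_add) (use that in auto)
    finally show ?thesis using that G.gsum_closed[of m y] G.gsum_closed[of m "\<lambda>i. x i \<ominus>\<^bsub>G\<^esub> y i"]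
      by (simp add: G.minus_eq G.a_assoc G.r_neg)
  qed
  have v's: "v' i \<in> carrier (syz R P m v)" if i: "i < m" for i
  proof -
    have "lincomb P m v (v' i) = gsum P (\<lambda>j. (if j = i then v i else \<zero>\<^bsub>P\<^esub>) \<ominus>\<^bsub>P\<^esub> \<xi> j (v i) \<odot>\<^bsub>P\<^esub> v j) m"
      unfolding lincomb_def by (rule gsum_cong) (use D(2,5) i in \<open>auto simp: v'_def neg\<close>)
    also have "\<dots> = v i \<ominus>\<^bsub>P\<^esub> v i"
      using gminus[OF P.abelian_group_axioms, of "\<lambda>j. if j = i then v i else \<zero>\<^bsub>P\<^esub>" "\<lambda>j. \<xi> j (v i) \<odot>\<^bsub>P\<^esub> v j"]
        D(2,5) i P.gsum_single[OF i D(2)[OF i]] D(4)[OF D(2)[OF i]] by simp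
    also have "\<dots> = \<zero>\<^bsub>P\<^esub>" using D(2)[OF i] P.minus_eq_zero_iff by blast
    finally show ?thesis using v'c[OF i] by (simp add: syz_carrier)
  qed
  \<comment> \<open>The sum of the \<open>c i\<close> times \<open>v' i\<close> is \<open>c\<close>
    minus the coordinates of \<open>lincomb P m v c\<close>, and the latter is zero for a syzygy. So
    the ordinary coordinate functions form the dual family.\<close>
  have comb: "gsum (syz R P m v) (\<lambda>i. c i \<odot>\<^bsub>syz R P m v\<^esub> v' i) m = c" if c: "c \<in> carrier (syz R P m v)" for c
  proof
    fix j
    have c': "c \<in> carrier (pw (reg R) m)" "lincomb P m v c = \<zero>\<^bsub>P\<^esub>" using c by (auto simp: syz_carrier)
    note cr = rc[OF c'(1)]
    have gs: "gsum (syz R P m v) x n = (\<lambda>j. gsum R (\<lambda>i. x i j) n)" for x n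
      by (induction n) auto
    have "gsum (syz R P m v) (\<lambda>i. c i \<odot>\<^bsub>syz R P m v\<^esub> v' i) m j = gsum R (\<lambda>i. c i \<otimes>\<^bsub>R\<^esub> v' i j) m"
      by (simp add: gs)
    also have "\<dots> = c j"
    proof (cases "j < m")
      case False
      then have "gsum R (\<lambda>i. c i \<otimes>\<^bsub>R\<^esub> v' i j) m = gsum R (\<lambda>i. \<zero>\<^bsub>R\<^esub>) m"
        by (intro gsum_cong) (simp add: v'_def cr)
      then show ?thesis using False c'(1) by (simp add: pw_carrier)
    next
      case True
      have "gsum R (\<lambda>i. c i \<otimes>\<^bsub>R\<^esub> v' i j) m = gsum R (\<lambda>i. (if i = j then c j else \<zero>\<^bsub>R\<^esub>) \<ominus>\<^bsub>R\<^esub> c i \<otimes>\<^bsub>R\<^esub> \<xi> j (v i)) m"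
        by (rule gsum_cong)
          (use True cr D(2,5) in \<open>auto simp: v'_def R.minus_eq R.r_distr R.r_minus\<close>)
      also have "\<dots> = c j \<ominus>\<^bsub>R\<^esub> gsum R (\<lambda>i. c i \<otimes>\<^bsub>R\<^esub> \<xi> j (v i)) m"
        using gminus[OF R.abelian_group_axioms, of "\<lambda>i. if i = j then c j else \<zero>\<^bsub>R\<^esub>" "\<lambda>i. c i \<otimes>\<^bsub>R\<^esub> \<xi> j (v i)"]
          True cr D(2,5) R.gsum_single[OF True, of "c j"] by simp
      also have "gsum R (\<lambda>i. c i \<otimes>\<^bsub>R\<^esub> \<xi> j (v i)) m = \<xi> j (lincomb P m v c)"
      proof -
        have e: "gsum (reg R) x n = gsum R x n" for x n by (induction n) auto
        show ?thesis
          using lincomb_hom[OF D(1) lmodule_reg[OF R.ring_axioms] D(3)[OF True], of m v c] D(2) cr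
          by (simp add: lincomb_def e)
      qed
      also have "\<dots> = \<zero>\<^bsub>R\<^esub>"
        using c'(2) mhom_zero[OF D(1) lmodule_reg[OF R.ring_axioms] D(3)[OF True]] by simp
      finally show ?thesis using cr by simp
    qed
    finally show "gsum (syz R P m v) (\<lambda>i. c i \<odot>\<^bsub>syz R P m v\<^esub> v' i) m j = c j" .
  qed
  have "(\<lambda>c. c i) \<in> mhom R (syz R P m v) (reg R)" if "i < m" for i
    by (rule mhomI) (use rc in \<open>auto simp: syz_carrier\<close>)
  then have "dual_basis R (syz R P m v) m v' (\<lambda>i c. c i)"
    unfolding dual_basis_def using lmodule_syz[OF D(1,2)] v's comb by simp
  then show ?thesis by blast
qed

lemma dual_basis_fps: "dual_basis R K m v \<xi> \<Longrightarrow> fps R n K"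
proof (induction n arbitrary: K m v \<xi>)
  case 0
  show ?case using dual_basis_gens[OF 0] by auto
next
  case (Suc n)
  obtain v' \<xi>' where "dual_basis R (syz R K m v) m v' \<xi>'" using dual_basis_syz[OF Suc.prems] by blast
  then have "fps R n (syz R K m v)" by (rule Suc.IH)
  then show ?case using dual_basis_gens[OF Suc.prems] unfolding fps.simps by blast
qed

lemma dual_basis_fpg:
  assumes "dual_basis R P m v \<xi>"
  shows "fpg R n P"
proof (cases n)
  case 0
  then show ?thesis using dual_basis_gens[OF assms] dual_basisD(1)[OF assms] by (auto simp: fpg_0)
next
  case (Suc k)
  then show ?thesis
    using dual_basis_gens[OF assms] dual_basisD(1)[OF assms] dual_basis_syz[OF assms] dual_basis_fps
    unfolding fpg_def by fastforce
qed

lemma dual_basis_reg: "ring R \<Longrightarrow> dual_basis R (reg R) 1 (\<lambda>_. \<one>\<^bsub>R\<^esub>) (\<lambda>_ x. x)"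
proof -
  assume R: "ring R"
  then interpret R: ring R .
  show ?thesis unfolding dual_basis_def using lmodule_reg[OF R] mhom_id by auto
qed

lemma dual_basis_zero:
  assumes "lmodule R Z" "carrier Z = {\<zero>\<^bsub>Z\<^esub>}"
  shows "dual_basis R Z 0 v \<xi>"
  using assms unfolding dual_basis_def by simp

text \<open>M^(m+1) is an extension of M by M^m, with the identity as inclusion; the empty power is
  zero and has an empty dual basis.\<close>

lemma fpg_pw:
  assumes "\<And>n. fpg R n M"
  shows "fpg R n (pw M m)"
proof (induction m)
  interpret M: lmodule R M by (rule fpg_lmodule[OF assms])
  case 0
  show ?case
    by (rule dual_basis_fpg[OF dual_basis_zero[OF lmodule_pw[OF M.lmodule_axioms]]])
      (auto simp: pw_carrier)
next
  interpret M: lmodule R M by (rule fpg_lmodule[OF assms])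
  case (Suc m)
  have "ses R (pw M m) (\<lambda>c. c) (pw M (Suc m)) (\<lambda>c. c m) M"
  proof (rule sesI[OF lmodule_pw[OF M.lmodule_axioms] lmodule_pw[OF M.lmodule_axioms] M.lmodule_axioms])
    show "(\<lambda>c. c) \<in> mhom R (pw M m) (pw M (Suc m))"
    proof (rule mhomI)
      fix c assume "c \<in> carrier (pw M m)"
      then show "c \<in> carrier (pw M (Suc m))"
        unfolding pw_carrier by (metis M.zero_closed Suc_leD linorder_not_le)
    qed auto
    show "(\<lambda>c. c m) \<in> mhom R (pw M (Suc m)) M" by (rule mhomI) (auto simp: pw_carrier)
    show "(\<lambda>c. c m) ` carrier (pw M (Suc m)) = carrier M"
    proof
      show "carrier M \<subseteq> (\<lambda>c. c m) ` carrier (pw M (Suc m))"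
      proof
        fix x assume "x \<in> carrier M"
        then have "(\<lambda>i. if i = m then x else \<zero>\<^bsub>M\<^esub>) \<in> carrier (pw M (Suc m))" by (auto simp: pw_carrier)
        then show "x \<in> (\<lambda>c. c m) ` carrier (pw M (Suc m))" by (intro image_eqI[of _ _ "\<lambda>i. if i = m then x else \<zero>\<^bsub>M\<^esub>"]) auto
      qed
    qed (auto simp: pw_carrier)
    show "\<exists>x\<in>carrier (pw M m). c = x" if "c \<in> carrier (pw M (Suc m))" "c m = \<zero>\<^bsub>M\<^esub>" for c
    proof -
      have "c i = \<zero>\<^bsub>M\<^esub>" if "i \<ge> m" for i
        using that \<open>c \<in> carrier (pw M (Suc m))\<close> \<open>c m = \<zero>\<^bsub>M\<^esub>\<close> by (cases "i = m") (auto simp: pw_carrier)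
      then show ?thesis using that(1) by (simp add: pw_carrier)
    qed
  qed (auto simp: pw_carrier)
  from fpg_extension[OF this Suc.IH assms] show ?case .
qed

text \<open>A retract is the image of an idempotent \<open>\<pi>\<close> of \<open>B\<close>. The
  kernel of \<open>\<pi>\<close> is the image of the complementary idempotent
  \<open>1 - \<pi>\<close>, so \<open>fpg_cokernel\<close> turns level \<open>n\<close> for
  \<open>1 - \<pi>\<close> into level \<open>n + 1\<close> for \<open>\<pi>\<close>. The induction
  therefore treats all idempotents at once.\<close>

lemma fpg_retract:
  assumes B: "\<And>n. fpg R n B" and M: "lmodule R M" and i: "\<iota> \<in> mhom R M B" and p: "p \<in> mhom R B M"
    and pi: "\<And>x. x \<in> carrier M \<Longrightarrow> p (\<iota> x) = x"
  shows "fpg R n M"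
proof -
  interpret B: lmodule R B by (rule fpg_lmodule[OF B])
  note Bm = B.lmodule_axioms
  have idem: "fpg R n (sub B (\<pi> ` carrier B))" if "\<pi> \<in> mhom R B B" "\<And>x. x \<in> carrier B \<Longrightarrow> \<pi> (\<pi> x) = \<pi> x" for \<pi> n
    using that
  proof (induction n arbitrary: \<pi>)
    case 0
    show ?case
      by (rule fpg_0_image[OF lmodule_image[OF Bm Bm 0(1)] mhom_into_sub[OF 0(1)] _ B[of 0]]) auto
  next
    case (Suc n)
    let ?k = "\<lambda>x. x \<ominus>\<^bsub>B\<^esub> \<pi> x"
    have k: "?k \<in> mhom R B B" by (rule mhom_diff_map[OF Bm mhom_id Suc.prems(1)])
    have pk: "\<pi> (?k x) = \<zero>\<^bsub>B\<^esub>" if "x \<in> carrier B" for x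
      using mhom_minus[OF Bm Bm Suc.prems(1) that mhom_closed[OF Suc.prems(1) that]] Suc.prems(2)[OF that]
        mhom_closed[OF Suc.prems(1) that] B.minus_eq_zero_iff by simp
    have kk: "?k x = x" if "x \<in> carrier B" "\<pi> x = \<zero>\<^bsub>B\<^esub>" for x using that by simp
    have im: "?k ` carrier B = {x \<in> carrier B. \<pi> x = \<zero>\<^bsub>B\<^esub>}"
    proof
      show "?k ` carrier B \<subseteq> {x \<in> carrier B. \<pi> x = \<zero>\<^bsub>B\<^esub>}" using pk mhom_closed[OF k] by auto
      show "{x \<in> carrier B. \<pi> x = \<zero>\<^bsub>B\<^esub>} \<subseteq> ?k ` carrier B" using kk[symmetric] by blast
    qed
    have "fpg R n (sub B (?k ` carrier B))"
      by (rule Suc.IH[OF k]) (use kk[OF mhom_closed[OF k] pk] in blast)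
    then have "fpg R n (sub B {x \<in> carrier B. \<pi> x = \<zero>\<^bsub>B\<^esub>})" unfolding im .
    from fpg_cokernel[OF ses_kernel_image[OF Bm Bm Suc.prems(1)] this B] show ?case .
  qed
  let ?\<pi> = "\<lambda>x. \<iota> (p x)"
  have \<pi>: "?\<pi> \<in> mhom R B B" by (rule mhom_comp[OF p i])
  have f: "fpg R n (sub B (?\<pi> ` carrier B))"
    by (rule idem[OF \<pi>]) (use pi mhom_closed[OF p] in simp)
  have "p \<in> miso R (sub B (?\<pi> ` carrier B)) M"
  proof (rule misoI)
    show "p \<in> mhom R (sub B (?\<pi> ` carrier B)) M"
      by (rule mhom_restrict_sub[OF p]) (use mhom_closed[OF \<pi>] in auto)
    show "inj_on p (carrier (sub B (?\<pi> ` carrier B)))"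
      by (rule inj_onI) (use pi mhom_closed[OF p] in auto)
    show "p ` carrier (sub B (?\<pi> ` carrier B)) = carrier M"
    proof
      show "p ` carrier (sub B (?\<pi> ` carrier B)) \<subseteq> carrier M" using mhom_closed[OF \<pi>] mhom_closed[OF p] by auto
      show "carrier M \<subseteq> p ` carrier (sub B (?\<pi> ` carrier B))"
      proof
        fix x assume x: "x \<in> carrier M"
        have "?\<pi> (\<iota> x) \<in> carrier (sub B (?\<pi> ` carrier B))" using mhom_closed[OF i x] by simp
        moreover have "p (?\<pi> (\<iota> x)) = x" using pi x by simp
        ultimately show "x \<in> p ` carrier (sub B (?\<pi> ` carrier B))" by (metis image_eqI)
      qed
    qed
  qed
  then show ?thesis by (rule fpg_miso[OF M _ f])
qed

text \<open>The image of \<open>d i\<close> is the cokernel of the image of \<open>d (Suc i)\<close>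
  in \<open>P (Suc i)\<close>. So level \<open>n + 1\<close> at \<open>i\<close> follows from level
  \<open>n\<close> at \<open>Suc i\<close>, and the induction on \<open>n\<close> has to leave
  \<open>i\<close> arbitrary.\<close>

lemma fpg_exact_res:
  assumes r: "exact_res R A P d e" and P: "\<And>i n. fpg R n (P i)"
  shows "fpg R n A" "fpg R n (sub (P i) (d i ` carrier (P (Suc i))))"
proof -
  note D = exact_resD[OF r]
  have z: "fpg R n (sub (P i) (d i ` carrier (P (Suc i))))" for n i
  proof (induction n arbitrary: i)
    case 0
    show ?case
      by (rule fpg_0_image[OF lmodule_image[OF D(2) D(2) D(4)] mhom_into_sub[OF D(4)] _ P[of 0 "Suc i"]]) auto
  next
    case (Suc n)
    have "d (Suc i) ` carrier (P (Suc (Suc i))) = {x \<in> carrier (P (Suc i)). d i x = \<zero>\<^bsub>P i\<^esub>}"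
      using D(7)[of _ i] D(9)[of _ i] mhom_closed[OF D(4)] by blast
    then show ?case
      using fpg_cokernel[OF ses_kernel_image[OF D(2) D(2) D(4)] _ P] Suc.IH[of "Suc i"] by simp
  qed
  show "fpg R n (sub (P i) (d i ` carrier (P (Suc i))))" by (rule z)
  have s: "ses R (sub (P 0) (d 0 ` carrier (P (Suc 0)))) (\<lambda>x. x) (P 0) e A"
    by (rule sesI[OF lmodule_image[OF D(2) D(2) D(4)] D(2) D(1) mhom_restrict_sub[OF mhom_id] D(3)])
      (use D(5,6,8) mhom_closed[OF D(4)] in \<open>auto simp: image_iff\<close>)
  have "fpg R (Suc n) A" for n by (rule fpg_cokernel[OF s z P])
  moreover have "fpg R 0 A" by (rule fpg_0_image[OF D(1) D(3) D(5) P[of 0]])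
  ultimately show "fpg R n A" by (cases n) auto
qed

section \<open>The universe\<close>

text \<open>The classes of modules are defined by quantifying over modules with elements in \<open>'u\<close>, while
  Hom modules and tensor products live in other types. Since \<open>'u\<close> is infinite and at least as large
  as the ring, every finitely generated module has an isomorphic copy in \<open>'u\<close>.\<close>

lemma transport_module:
  fixes M :: "('r, 'a) module"
  assumes M: "lmodule R M" and small: "carrier M \<lesssim> (UNIV :: 'u set)"
  shows "\<exists>(M' :: ('r, 'u) module) \<phi>. lmodule R M' \<and> \<phi> \<in> miso R M M'"
proof -
  interpret M: lmodule R M by fact
  obtain \<phi> :: "'a \<Rightarrow> 'u" where \<phi>: "inj_on \<phi> (carrier M)" using small unfolding lepoll_def by blast
  let ?\<psi> = "inv_into (carrier M) \<phi>"
  define M' :: "('r, 'u) module" where "M' = \<lparr>carrier = \<phi> ` carrier M, mult = undefined, one = undefined, zero = \<phi> \<zero>\<^bsub>M\<^esub>,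
    add = (\<lambda>x y. \<phi> (?\<psi> x \<oplus>\<^bsub>M\<^esub> ?\<psi> y)), smult = (\<lambda>r x. \<phi> (r \<odot>\<^bsub>M\<^esub> ?\<psi> x))\<rparr>"
  have s: "carrier M' = \<phi> ` carrier M" "zero M' = \<phi> \<zero>\<^bsub>M\<^esub>"
    "\<And>x y. x \<in> carrier M \<Longrightarrow> y \<in> carrier M \<Longrightarrow> \<phi> x \<oplus>\<^bsub>M'\<^esub> \<phi> y = \<phi> (x \<oplus>\<^bsub>M\<^esub> y)"
    "\<And>r x. x \<in> carrier M \<Longrightarrow> r \<odot>\<^bsub>M'\<^esub> \<phi> x = \<phi> (r \<odot>\<^bsub>M\<^esub> x)"
    unfolding M'_def using \<phi> by simp_all
  have "abelian_group M'"
  proof (rule abelian_groupI)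
    show "\<exists>y\<in>carrier M'. y \<oplus>\<^bsub>M'\<^esub> x = \<zero>\<^bsub>M'\<^esub>" if x: "x \<in> carrier M'" for x
    proof -
      obtain u where u: "u \<in> carrier M" "x = \<phi> u" using x s(1) by blast
      then show ?thesis by (intro bexI[of _ "\<phi> (\<ominus>\<^bsub>M\<^esub> u)"]) (simp_all add: s M.l_neg)
    qed
  qed (auto simp: s M.a_ac)
  then have "lmodule R M'"
    by (rule lmoduleI'[OF M.ring_axioms]) (auto simp: s M.smult_l_distr M.smult_r_distr M.smult_assoc)
  moreover have "\<phi> \<in> miso R M M'"
    by (rule misoI[OF mhomI \<phi>]) (simp_all add: s)
  ultimately show ?thesis by blast
qed

text \<open>Tuples inject into lists, and an infinite type has as many lists as elements.\<close>

lemma small_pw: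
  assumes inf: "infinite (UNIV :: 'u set)" and M: "carrier M \<lesssim> (UNIV :: 'u set)"
  shows "carrier (pw M m) \<lesssim> (UNIV :: 'u set)"
proof -
  have "inj_on (\<lambda>c. map c [0..<m]) (carrier (pw M m))"
  proof (rule inj_onI)
    fix c d assume *: "c \<in> carrier (pw M m)" "d \<in> carrier (pw M m)" "map c [0..<m] = map d [0..<m]"
    show "c = d"
    proof
      show "c i = d i" for i using * by (cases "i < m") (auto simp: pw_carrier)
    qed
  qed
  moreover have "(\<lambda>c. map c [0..<m]) ` carrier (pw M m) \<subseteq> lists (carrier M)" by (auto simp: pw_carrier)
  ultimately have "carrier (pw M m) \<lesssim> lists (carrier M)" unfolding lepoll_def by blast
  also have "lists (carrier M) \<lesssim> lists (UNIV :: 'u set)" by (rule lists_lepoll_mono[OF M])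
  also have "lists (UNIV :: 'u set) \<lesssim> (UNIV :: 'u set)"
    unfolding lepoll_def card_of_ordLeq
    by (rule ordIso_imp_ordLeq[OF card_of_lists_infinite[OF inf]])
  finally show ?thesis .
qed

lemma small_image: "A \<lesssim> (UNIV :: 'u set) \<Longrightarrow> B \<subseteq> f ` A \<Longrightarrow> B \<lesssim> (UNIV :: 'u set)"
  by (meson image_lepoll lepoll_trans subset_imp_lepoll)

lemma small_gens:
  assumes inf: "infinite (UNIV :: 'u set)" and R: "carrier R \<lesssim> (UNIV :: 'u set)" and g: "gens R M m v"
  shows "carrier M \<lesssim> (UNIV :: 'u set)"
  by (rule small_image[OF small_pw[OF inf, of "reg R" m]]) (use R g in \<open>auto simp: gens_def\<close>)

section \<open>Free covers with elements in the universe\<close>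

lemma lincomb_unit:
  assumes R: "ring R" and c: "c \<in> carrier (pw (reg R) m)"
  shows "lincomb (pw (reg R) m) m (\<lambda>i j. if j = i then \<one>\<^bsub>R\<^esub> else \<zero>\<^bsub>R\<^esub>) c = c"
proof
  interpret R: ring R by fact
  have rc: "c i \<in> carrier R" for i using pw_closed[OF lmodule_ab[OF lmodule_reg[OF R]] c] by simp
  have e: "gsum (reg R) x n = gsum R x n" for x n by (induction n) auto
  fix j
  have "lincomb (pw (reg R) m) m (\<lambda>i j. if j = i then \<one>\<^bsub>R\<^esub> else \<zero>\<^bsub>R\<^esub>) c j =
      gsum R (\<lambda>i. if i = j then c j else \<zero>\<^bsub>R\<^esub>) m"
    unfolding lincomb_def gsum_pw e by (rule gsum_cong) (use rc in auto)
  also have "\<dots> = c j"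
  proof (cases "j < m")
    case False
    then have "gsum R (\<lambda>i. if i = j then c j else \<zero>\<^bsub>R\<^esub>) m = gsum R (\<lambda>i. \<zero>\<^bsub>R\<^esub>) m"
      by (intro gsum_cong) auto
    then show ?thesis using False c by (simp add: pw_carrier)
  qed (rule R.gsum_single[OF _ rc])
  finally show "lincomb (pw (reg R) m) m (\<lambda>i j. if j = i then \<one>\<^bsub>R\<^esub> else \<zero>\<^bsub>R\<^esub>) c j = c j" .
qed

lemma finsum_lincomb:
  assumes M: "lmodule R M" and v: "inj_on v {..<m}" "\<And>i. i < m \<Longrightarrow> v i \<in> carrier M"
    and c: "\<And>x. x \<in> v ` {..<m} \<Longrightarrow> c x \<in> carrier R"
  shows "(\<Oplus>\<^bsub>M\<^esub>x\<in>v ` {..<m}. c x \<odot>\<^bsub>M\<^esub> x) = lincomb M m v (\<lambda>i. if i < m then c (v i) else \<zero>\<^bsub>R\<^esub>)"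
proof -
  interpret M: lmodule R M by fact
  have "(\<Oplus>\<^bsub>M\<^esub>x\<in>v ` {..<m}. c x \<odot>\<^bsub>M\<^esub> x) = (\<Oplus>\<^bsub>M\<^esub>i\<in>{..<m}. c (v i) \<odot>\<^bsub>M\<^esub> v i)"
    by (rule M.finsum_reindex[OF _ v(1)]) (use v(2) c in auto)
  also have "\<dots> = gsum M (\<lambda>i. c (v i) \<odot>\<^bsub>M\<^esub> v i) m"
    by (rule gsum_eq_finsum[OF M.abelian_group_axioms, symmetric]) (use v(2) c in auto)
  also have "\<dots> = lincomb M m v (\<lambda>i. if i < m then c (v i) else \<zero>\<^bsub>R\<^esub>)"
    unfolding lincomb_def by (rule gsum_cong) simp
  finally show ?thesis .
qed

lemma fin_free_pw:
  assumes R: "ring R" and F: "lmodule R F" and \<phi>: "\<phi> \<in> miso R (pw (reg R) m) F"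
  shows "fin_free R F"
proof -
  interpret R: ring R by fact
  interpret F: lmodule R F by fact
  note f = misoD[OF \<phi>]
  show ?thesis
  \<comment> \<open>Over the zero ring all unit vectors coincide, so the count of basis vectors
    breaks down; every module is zero there and the empty set is a basis.\<close>
  proof (cases "\<one>\<^bsub>R\<^esub> = \<zero>\<^bsub>R\<^esub>")
    case True
    have F0: "x = \<zero>\<^bsub>F\<^esub>" if "x \<in> carrier F" for x
      using F.smult_one[OF that] F.zero_smult[OF that] True by simp
    show ?thesis
      unfolding fin_free_def
      by (intro conjI F exI[of _ "{}"]) (use F0 in auto)
  next
    case False
    define v where "v i = \<phi> (\<lambda>j. if j = i then \<one>\<^bsub>R\<^esub> else \<zero>\<^bsub>R\<^esub>)" for i
    have ec: "(\<lambda>j. if j = i then \<one>\<^bsub>R\<^esub> else \<zero>\<^bsub>R\<^esub>) \<in> carrier (pw (reg R) m)" if "i < m" for i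
      using that by (simp add: pw_carrier)
    have vc: "v i \<in> carrier F" if "i < m" for i
      unfolding v_def by (rule mhom_closed[OF f(1) ec[OF that]])
    have vinj: "inj_on v {..<m}"
    proof (rule inj_onI)
      fix i k assume ik: "i \<in> {..<m}" "k \<in> {..<m}" "v i = v k"
      then have "(\<lambda>j. if j = i then \<one>\<^bsub>R\<^esub> else \<zero>\<^bsub>R\<^esub>) = (\<lambda>j. if j = k then \<one>\<^bsub>R\<^esub> else \<zero>\<^bsub>R\<^esub>)"
        unfolding v_def using inj_onD[OF f(2)] ec by blast
      from fun_cong[OF this, of i] show "i = k" using False by (simp split: if_splits)
    qed
    have l: "lincomb F m v c = \<phi> c" if c: "c \<in> carrier (pw (reg R) m)" for c
    proof -
      have "\<phi> (lincomb (pw (reg R) m) m (\<lambda>i j. if j = i then \<one>\<^bsub>R\<^esub> else \<zero>\<^bsub>R\<^esub>) c) = lincomb F m v c"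
        unfolding v_def
        by (rule lincomb_hom[OF lmodule_pw_reg[OF R] F f(1) ec])
          (use pw_closed[OF lmodule_ab[OF lmodule_reg[OF R]] c] in auto)
      then show ?thesis using lincomb_unit[OF R c] by simp
    qed
    let ?X = "v ` {..<m}"
    let ?r = "\<lambda>c i. if i < m then c (v i) else \<zero>\<^bsub>R\<^esub>"
    have s: "(\<Oplus>\<^bsub>F\<^esub>x\<in>?X. c x \<odot>\<^bsub>F\<^esub> x) = \<phi> (?r c)" "?r c \<in> carrier (pw (reg R) m)"
      if c: "c \<in> ?X \<rightarrow>\<^sub>E carrier R" for c
    proof -
      have c': "c x \<in> carrier R" if "x \<in> ?X" for x using PiE_mem[OF c that] .
      show r: "?r c \<in> carrier (pw (reg R) m)" using c' by (auto simp: pw_carrier)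
      show "(\<Oplus>\<^bsub>F\<^esub>x\<in>?X. c x \<odot>\<^bsub>F\<^esub> x) = \<phi> (?r c)"
        using finsum_lincomb[OF F vinj vc c'] l[OF r] by simp
    qed
    have "\<exists>!c. c \<in> ?X \<rightarrow>\<^sub>E carrier R \<and> y = (\<Oplus>\<^bsub>F\<^esub>x\<in>?X. c x \<odot>\<^bsub>F\<^esub> x)" if "y \<in> carrier F" for y
    proof -
      obtain d where d: "d \<in> carrier (pw (reg R) m)" "y = \<phi> d" using f(3) \<open>y \<in> carrier F\<close> by blast
      let ?c = "\<lambda>x\<in>?X. d (inv_into {..<m} v x)"
      have cE: "?c \<in> ?X \<rightarrow>\<^sub>E carrier R"
        using d(1) vinj by (auto simp: pw_carrier)
      have "?r ?c = d" using vinj d(1) by (auto simp: pw_carrier fun_eq_iff)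
      then have 1: "y = (\<Oplus>\<^bsub>F\<^esub>x\<in>?X. ?c x \<odot>\<^bsub>F\<^esub> x)" using s(1)[OF cE] d(2) by simp
      have 2: "c = ?c" if c: "c \<in> ?X \<rightarrow>\<^sub>E carrier R" "y = (\<Oplus>\<^bsub>F\<^esub>x\<in>?X. c x \<odot>\<^bsub>F\<^esub> x)" for c
      proof -
        have "\<phi> (?r c) = \<phi> d" using s(1)[OF c(1)] c(2) d(2) by simp
        then have "?r c = d" using inj_onD[OF f(2) _ s(2)[OF c(1)] d(1)] by blast
        then have "c (v i) = d i" if "i < m" for i using fun_cong[of "?r c" d i] that by simp
        then have "c x = ?c x" if "x \<in> ?X" for x using that vinj by auto
        then show ?thesis using c(1) cE by (intro ext_eqI[of _ ?X]) (auto simp: PiE_def)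
      qed
      show ?thesis
        by (rule ex1I[of _ ?c], intro conjI cE 1) (use 2 in blast)
    qed
    then show ?thesis
      unfolding fin_free_def using F vc by (intro conjI exI[of _ ?X]) auto
  qed
qed

lemma fin_gen_gens:
  assumes "fin_gen R M"
  shows "\<exists>m v. gens R M m v"
proof -
  have M: "lmodule R M" using assms by (simp add: fin_gen_def)
  obtain X where X: "finite X" "X \<subseteq> carrier M"
    "\<And>y. y \<in> carrier M \<Longrightarrow> \<exists>c \<in> X \<rightarrow>\<^sub>E carrier R. y = (\<Oplus>\<^bsub>M\<^esub>x\<in>X. c x \<odot>\<^bsub>M\<^esub> x)"
    using assms unfolding fin_gen_def by blast
  obtain v where v: "bij_betw v {0..<card X} X" using ex_bij_betw_nat_finite[OF X(1)] by blast
  then have vi: "inj_on v {..<card X}" "v ` {..<card X} = X"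
    by (auto simp: bij_betw_def atLeast0LessThan)
  then have vc: "v i \<in> carrier M" if "i < card X" for i using that X(2) by blast
  have "gens R M (card X) v"
  proof (rule gensI[OF M vc])
    fix y assume "y \<in> carrier M"
    then obtain c where c: "c \<in> X \<rightarrow>\<^sub>E carrier R" "y = (\<Oplus>\<^bsub>M\<^esub>x\<in>X. c x \<odot>\<^bsub>M\<^esub> x)" using X(3) by blast
    have "(\<lambda>i. if i < card X then c (v i) else \<zero>\<^bsub>R\<^esub>) \<in> carrier (pw (reg R) (card X))"
      using c(1) vi(2) by (auto simp: pw_carrier)
    moreover have "y = lincomb M (card X) v (\<lambda>i. if i < card X then c (v i) else \<zero>\<^bsub>R\<^esub>)"
      using finsum_lincomb[OF M vi(1) vc, of c] c vi(2) by auto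
    ultimately show "\<exists>c\<in>carrier (pw (reg R) (card X)). y = lincomb M (card X) v c" by blast
  qed
  then show ?thesis by blast
qed

text \<open>\<open>projective\<close> can only be tested on modules in \<open>'u\<close>, so the
  free module R^m is first copied there. The cover of \<open>P\<close> by this copy splits, and the
  coordinates of the splitting are the functionals.\<close>

lemma projective_dual_basis:
  fixes P :: "('r, 'u) module"
  assumes inf: "infinite (UNIV :: 'u set)" and R: "carrier R \<lesssim> (UNIV :: 'u set)"
    and P: "projective R P" "fin_gen R P"
  shows "\<exists>m v \<xi>. dual_basis R P m v \<xi>"
proof -
  have Pm: "lmodule R P" using P(1) by (simp add: projective_def)
  have ring: "ring R" by (rule lmodule_ring[OF Pm])
  obtain m v where v: "gens R P m v" using fin_gen_gens[OF P(2)] by blast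
  note G = gensD[OF v] and pwm = lmodule_pw_reg[OF ring]
  obtain F :: "('r, 'u) module" and \<phi> where F: "lmodule R F" "\<phi> \<in> miso R (pw (reg R) m) F"
    using transport_module[OF pwm small_pw[OF inf]] R by (metis reg_simps(1))
  note f = misoD[OF F(2)]
  let ?\<psi> = "inv_into (carrier (pw (reg R) m)) \<phi>"
  have \<psi>: "?\<psi> \<in> mhom R F (pw (reg R) m)" by (rule inv_mhom[OF pwm f])
  let ?\<alpha> = "\<lambda>x. lincomb P m v (?\<psi> x)"
  have \<alpha>: "?\<alpha> \<in> mhom R F P" by (rule mhom_comp[OF \<psi> lincomb_mhom[OF Pm G(1)]])
  have on: "?\<alpha> ` carrier F = carrier P"
  proof
    show "?\<alpha> ` carrier F \<subseteq> carrier P" using mhom_closed[OF \<alpha>] by blast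
    show "carrier P \<subseteq> ?\<alpha> ` carrier F"
    proof
      fix y assume "y \<in> carrier P"
      then obtain c where c: "c \<in> carrier (pw (reg R) m)" "y = lincomb P m v c" using G(2) by blast
      then have "y = ?\<alpha> (\<phi> c)" using f(2) by simp
      then show "y \<in> ?\<alpha> ` carrier F" using mhom_closed[OF f(1) c(1)] by blast
    qed
  qed
  obtain h where h: "h \<in> mhom R P F" "\<And>x. x \<in> carrier P \<Longrightarrow> ?\<alpha> (h x) = x"
    using P(1) F(1) Pm \<alpha> on mhom_id[of R P] unfolding projective_def by meson
  have \<psi>h: "(\<lambda>x. ?\<psi> (h x)) \<in> mhom R P (pw (reg R) m)" by (rule mhom_comp[OF h(1) \<psi>])
  have "dual_basis R P m v (\<lambda>i x. ?\<psi> (h x) i)"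
    unfolding dual_basis_def
  proof (intro conjI allI impI ballI Pm G(1))
    fix i assume "i < m"
    show "(\<lambda>x. ?\<psi> (h x) i) \<in> mhom R P (reg R)"
      by (rule mhomI) (use mhom_closed[OF \<psi>h] \<open>i < m\<close> mhom_add[OF \<psi>h] mhom_smult[OF \<psi>h] in \<open>auto simp: pw_carrier\<close>)
  next
    fix x assume "x \<in> carrier P"
    then show "gsum P (\<lambda>i. ?\<psi> (h x) i \<odot>\<^bsub>P\<^esub> v i) m = x" using h(2) by (simp add: lincomb_def)
  qed
  then show ?thesis by blast
qed

lemma fin_presented_0:
  fixes F M :: "('r, 'u) module"
  shows "fin_free R F \<Longrightarrow> lmodule R M \<Longrightarrow> e \<in> mhom R F M \<Longrightarrow> e ` carrier F = carrier M \<Longrightarrow>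
    fin_presented R 0 M"
  unfolding fin_presented_def left_exact_seq_def
  by (rule exI[of _ "\<lambda>_. F"], rule exI[of _ "\<lambda>_ x. x"], rule exI[of _ e]) (auto simp: fin_free_def)

text \<open>Splicing: \<open>case_nat\<close> puts a new term in front and shifts the old sequence
  by one. It builds free presentations here and finite left resolutions later.\<close>

lemma left_exact_seq_Suc:
  assumes F: "lmodule R G" and M: "lmodule R M" and e: "e \<in> mhom R G M" "e ` carrier G = carrier M"
    and k: "k \<in> mhom R K G" "inj_on k (carrier K)" "k ` carrier K = a_kernel G M e"
    and s: "left_exact_seq R n F d eK K"
  shows "left_exact_seq R (Suc n) (case_nat G F) (case_nat (\<lambda>x. k (eK x)) d) e M"
proof -
  have L: "lmodule R K" "\<And>i. i \<le> n \<Longrightarrow> lmodule R (F i)" "eK \<in> mhom R (F 0) K"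
    "\<And>i. i < n \<Longrightarrow> d i \<in> mhom R (F (Suc i)) (F i)" "eK ` carrier (F 0) = carrier K"
    "0 < n \<Longrightarrow> d 0 ` carrier (F 1) = a_kernel (F 0) K eK"
    "\<And>i. Suc i < n \<Longrightarrow> d (Suc i) ` carrier (F (Suc (Suc i))) = a_kernel (F (Suc i)) (F i) (d i)"
    using s unfolding left_exact_seq_def by simp_all
  have ke: "(\<lambda>x. k (eK x)) \<in> mhom R (F 0) G" by (rule mhom_comp[OF L(3) k(1)])
  interpret K: lmodule R K by (rule L(1))
  have ker: "a_kernel (F 0) G (\<lambda>x. k (eK x)) = a_kernel (F 0) K eK"
    unfolding a_kernel_eq
    using mhom_zero[OF L(1) F k(1)] inj_onD[OF k(2)] mhom_closed[OF L(3)] K.zero_closed by metis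
  have im: "(\<lambda>x. k (eK x)) ` carrier (F 0) = a_kernel G M e"
    using k(3) L(5) by (simp add: image_image[symmetric])
  show ?thesis
    unfolding left_exact_seq_def
  proof (intro conjI allI impI)
    show "lmodule R M" "e \<in> mhom R (case_nat G F 0) M" "e ` carrier (case_nat G F 0) = carrier M"
      using M e by simp_all
    show "lmodule R (case_nat G F i)" if "i \<le> Suc n" for i using that F L(2) by (cases i) auto
    show "case_nat (\<lambda>x. k (eK x)) d i \<in> mhom R (case_nat G F (Suc i)) (case_nat G F i)" if "i < Suc n" for i
      using that ke L(4) by (cases i) auto
    show "case_nat (\<lambda>x. k (eK x)) d 0 ` carrier (case_nat G F 1) = a_kernel (case_nat G F 0) M e" using im by simp
    show "case_nat (\<lambda>x. k (eK x)) d (Suc i) ` carrier (case_nat G F (Suc (Suc i))) =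
        a_kernel (case_nat G F (Suc i)) (case_nat G F i) (case_nat (\<lambda>x. k (eK x)) d i)" if "Suc i < Suc n" for i
      using that L(6,7) ker by (cases i) auto
  qed
qed

text \<open>\<open>fin_presented\<close> wants its free modules in \<open>'u\<close>, while syzygies
  are modules of sequences. The kernel of the copied cover is isomorphic to the syzygies, which lets
  the induction on \<open>n\<close> run inside \<open>'u\<close>.\<close>

lemma free_cover:
  fixes M :: "('r, 'u) module"
  assumes inf: "infinite (UNIV :: 'u set)" and R: "carrier R \<lesssim> (UNIV :: 'u set)"
    and Mm: "lmodule R M" and v: "gens R M m v"
  shows "\<exists>(F :: ('r, 'u) module) e \<psi>. fin_free R F \<and> lmodule R F \<and> e \<in> mhom R F M \<and> e ` carrier F = carrier M \<and>
      \<psi> \<in> miso R (syz R M m v) (sub F (a_kernel F M e))"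
proof -
    have ring: "ring R" by (rule lmodule_ring[OF Mm])
    note G = gensD[OF v] and pwm = lmodule_pw_reg[OF ring]
    obtain F :: "('r, 'u) module" and \<phi> where F: "lmodule R F" "\<phi> \<in> miso R (pw (reg R) m) F"
      using transport_module[OF pwm small_pw[OF inf]] R by (metis reg_simps(1))
    note f = misoD[OF F(2)] and l = lincomb_mhom[OF Mm G(1)]
    let ?\<psi> = "inv_into (carrier (pw (reg R) m)) \<phi>"
    have \<psi>: "?\<psi> \<in> mhom R F (pw (reg R) m)" by (rule inv_mhom[OF pwm f])
    have \<psi>\<phi>: "?\<psi> (\<phi> c) = c" if "c \<in> carrier (pw (reg R) m)" for c using f(2) that by simp
    let ?e = "\<lambda>x. lincomb M m v (?\<psi> x)"
    have e: "?e \<in> mhom R F M" by (rule mhom_comp[OF \<psi> l])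
    have "?e ` carrier F = lincomb M m v ` carrier (pw (reg R) m)"
      using \<psi>\<phi> f(3) by (metis (no_types, lifting) image_cong image_image)
    then have on: "?e ` carrier F = carrier M" using v by (simp add: gens_def)
    have im: "\<phi> ` carrier (syz R M m v) = a_kernel F M ?e"
    proof
      show "\<phi> ` carrier (syz R M m v) \<subseteq> a_kernel F M ?e"
        using mhom_closed[OF f(1)] \<psi>\<phi> by (auto simp: a_kernel_eq syz_carrier)
      show "a_kernel F M ?e \<subseteq> \<phi> ` carrier (syz R M m v)"
      proof
        fix x assume "x \<in> a_kernel F M ?e"
        then have x: "x \<in> carrier F" "?e x = \<zero>\<^bsub>M\<^esub>" by (auto simp: a_kernel_eq)
        then obtain c where "c \<in> carrier (pw (reg R) m)" "x = \<phi> c" using f(3) by blast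
        then show "x \<in> \<phi> ` carrier (syz R M m v)" using x \<psi>\<phi> by (auto simp: syz_carrier)
      qed
    qed
    have "\<phi> \<in> mhom R (syz R M m v) F" unfolding syz_def by (rule mhom_restrict_sub[OF f(1)]) auto
    then have "\<phi> \<in> mhom R (syz R M m v) (sub F (a_kernel F M ?e))"
      by (rule mhom_into_sub) (use im in blast)
    then have "\<phi> \<in> miso R (syz R M m v) (sub F (a_kernel F M ?e))"
    proof (rule misoI)
      show "inj_on \<phi> (carrier (syz R M m v))"
        by (rule inj_on_subset[OF f(2)]) (auto simp: syz_carrier)
    qed (use im in simp)
    then show ?thesis using fin_free_pw[OF ring F] F(1) e on by blast
qed

lemma fpg_fin_presented:
  fixes M :: "('r, 'u) module"
  assumes inf: "infinite (UNIV :: 'u set)" and R: "carrier R \<lesssim> (UNIV :: 'u set)" and M: "fpg R n M"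
  shows "fin_presented R n M"
  using M
proof (induction n arbitrary: M)
  case 0
  then obtain m v where Mm: "lmodule R M" and v: "gens R M m v" unfolding fpg_0 by blast
  from free_cover[OF inf R this] show ?case using fin_presented_0 Mm by blast
next
  case (Suc n)
  then obtain m v where Mm: "lmodule R M" and v: "gens R M m v" and s: "fpg R n (syz R M m v)"
    unfolding fpg_Suc by blast
  obtain F :: "('r, 'u) module" and e \<psi> where F: "fin_free R F" "lmodule R F" "e \<in> mhom R F M"
    "e ` carrier F = carrier M" "\<psi> \<in> miso R (syz R M m v) (sub F (a_kernel F M e))"
    using free_cover[OF inf R Mm v] by blast
  let ?K = "sub F (a_kernel F M e)"
  have K: "lmodule R ?K" unfolding a_kernel_eq by (rule lmodule_kernel[OF F(2) Mm F(3)])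
  have "fin_presented R n ?K" by (rule Suc.IH[OF fpg_miso[OF K F(5) s]])
  then obtain G :: "nat \<Rightarrow> ('r, 'u) module" and d eK where G: "left_exact_seq R n G d eK ?K" "\<forall>i\<le>n. fin_free R (G i)"
    unfolding fin_presented_def by blast
  have "left_exact_seq R (Suc n) (case_nat F G) (case_nat (\<lambda>x. (\<lambda>x. x) (eK x)) d) e M"
    by (rule left_exact_seq_Suc[OF F(2) Mm F(3,4) mhom_restrict_sub[OF mhom_id] _ _ G(1)])
      (auto simp: a_kernel_eq)
  moreover have "\<forall>i\<le>Suc n. fin_free R (case_nat F G i)"
    using G(2) F(1) by (auto split: nat.split)
  ultimately show ?case unfolding fin_presented_def by blast
qed

text \<open>Finite generation bounds the size of the carrier, so a copy in \<open>'u\<close> exists,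
  and \<open>fpg\<close> passes to it by invariance under isomorphism.\<close>

lemma fpg_transport:
  fixes M :: "('r, 'a) module"
  assumes inf: "infinite (UNIV :: 'u set)" and R: "carrier R \<lesssim> (UNIV :: 'u set)" and M: "fpg R n M"
  shows "\<exists>(M' :: ('r, 'u) module) \<phi>. lmodule R M' \<and> \<phi> \<in> miso R M M' \<and> fin_presented R n M'"
proof -
  obtain m v where v: "gens R M m v" using fpg_gens[OF M] by blast
  obtain M' :: "('r, 'u) module" and \<phi> where M': "lmodule R M'" "\<phi> \<in> miso R M M'"
    using transport_module[OF fpg_lmodule[OF M] small_gens[OF inf R v]] by blast
  then show ?thesis using fpg_fin_presented[OF inf R fpg_miso[OF M' M]] by blast
qed

section \<open>Relative injectivity and flatness against modules of any type\<close>

text \<open>The test pair is replaced by isomorphic copies in \<open>'u\<close>, where the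
  definition applies, and the extension is carried back.\<close>

lemma fp_injective_extend:
  fixes X :: "('r, 'u) module" and K :: "('r, 'a) module" and L :: "('r, 'b) module"
  assumes inf: "infinite (UNIV :: 'u set)" and R: "carrier R \<lesssim> (UNIV :: 'u set)"
    and X: "fp_injective n R X" and K: "fpg R n K" and L: "fpg R n L"
    and j: "j \<in> mhom R K L" "inj_on j (carrier K)" and f: "f \<in> mhom R K X"
  shows "\<exists>g\<in>mhom R L X. \<forall>x\<in>carrier K. g (j x) = f x"
proof -
  obtain K' :: "('r, 'u) module" and \<phi> where K': "lmodule R K'" "\<phi> \<in> miso R K K'" "fin_presented R n K'"
    using fpg_transport[OF inf R K] by blast
  obtain L' :: "('r, 'u) module" and \<psi> where L': "lmodule R L'" "\<psi> \<in> miso R L L'" "fin_presented R n L'"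
    using fpg_transport[OF inf R L] by blast
  note k = misoD[OF K'(2)] and l = misoD[OF L'(2)]
  let ?k = "inv_into (carrier K) \<phi>"
  note k' = misoD[OF miso_inv[OF fpg_lmodule[OF K] K'(2)]]
  have kk: "?k (\<phi> x) = x" if "x \<in> carrier K" for x using k(2) that by simp
  let ?j = "\<lambda>x. \<psi> (j (?k x))"
  have j': "?j \<in> mhom R K' L'" by (rule mhom_comp[OF k'(1) mhom_comp[OF j(1) l(1)]])
  have inj: "inj_on ?j (carrier K')"
  proof (rule inj_onI)
    fix x y assume *: "x \<in> carrier K'" "y \<in> carrier K'" "?j x = ?j y"
    note c = mhom_closed[OF k'(1) *(1)] mhom_closed[OF k'(1) *(2)]
    have "j (?k x) = j (?k y)" using inj_onD[OF l(2) *(3)] c mhom_closed[OF j(1)] by blast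
    then have "?k x = ?k y" using inj_onD[OF j(2)] c by blast
    then show "x = y" using inj_onD[OF k'(2)] * by blast
  qed
  have "\<exists>g\<in>mhom R L' X. \<forall>x\<in>carrier K'. g (?j x) = f (?k x)"
    by (rule X[unfolded fp_injective_def, THEN conjunct2, rule_format, OF _ mhom_comp[OF k'(1) f]])
      (intro conjI K'(3) L'(3) j' inj)
  then obtain g where g: "g \<in> mhom R L' X" "\<And>x. x \<in> carrier K' \<Longrightarrow> g (?j x) = f (?k x)" by blast
  show ?thesis
  proof (rule bexI[OF _ mhom_comp[OF l(1) g(1)]], rule ballI)
    show "g (\<psi> (j x)) = f x" if "x \<in> carrier K" for x
      using g(2)[OF mhom_closed[OF k(1) that]] kk[OF that] by simp
  qed
qed

text \<open>Again the test pair is copied into \<open>'u\<close>; functoriality of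
  \<open>tensor_map\<close> moves injectivity along the two isomorphisms, here in the form of a
  trivial kernel.\<close>

lemma fp_flat_inj:
  fixes Y :: "('r, 'u) module" and K :: "('r, 'a) module" and L :: "('r, 'b) module"
  assumes inf: "infinite (UNIV :: 'u set)" and R: "carrier R \<lesssim> (UNIV :: 'u set)"
    and Y: "fp_flat n R Y" and K: "fpg (opp R) n K" and L: "fpg (opp R) n L"
    and j: "j \<in> mhom (opp R) K L" "inj_on j (carrier K)"
    and t: "t \<in> carrier (tensor R K Y)" "tensor_map R K L Y j t = \<zero>\<^bsub>tensor R L Y\<^esub>"
  shows "t = \<zero>\<^bsub>tensor R K Y\<^esub>"
proof -
  have oR: "carrier (opp R) \<lesssim> (UNIV :: 'u set)" using R by simp
  have Ym: "lmodule R Y" using Y by (simp add: fp_flat_def)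
  note Km = fpg_lmodule[OF K] and Lm = fpg_lmodule[OF L]
  obtain K' :: "('r, 'u) module" and \<phi> where K': "lmodule (opp R) K'" "\<phi> \<in> miso (opp R) K K'" "fin_presented (opp R) n K'"
    using fpg_transport[OF inf oR K] by blast
  obtain L' :: "('r, 'u) module" and \<psi> where L': "lmodule (opp R) L'" "\<psi> \<in> miso (opp R) L L'" "fin_presented (opp R) n L'"
    using fpg_transport[OF inf oR L] by blast
  note k = misoD[OF K'(2)] and l = misoD[OF L'(2)]
  let ?k = "inv_into (carrier K) \<phi>"
  note k' = misoD[OF miso_inv[OF Km K'(2)]]
  have kk: "?k (\<phi> x) = x" if "x \<in> carrier K" for x using k(2) that by simp
  let ?j = "\<lambda>x. \<psi> (j (?k x))"
  have j': "?j \<in> mhom (opp R) K' L'" by (rule mhom_comp[OF k'(1) mhom_comp[OF j(1) l(1)]])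
  have "inj_on ?j (carrier K')"
  proof (rule inj_onI)
    fix x y assume *: "x \<in> carrier K'" "y \<in> carrier K'" "?j x = ?j y"
    note c = mhom_closed[OF k'(1) *(1)] mhom_closed[OF k'(1) *(2)]
    have "j (?k x) = j (?k y)" using inj_onD[OF l(2) *(3)] c mhom_closed[OF j(1)] by blast
    then have "?k x = ?k y" using inj_onD[OF j(2)] c by blast
    then show "x = y" using inj_onD[OF k'(2)] * by blast
  qed
  then have inj: "inj_on (tensor_map R K' L' Y ?j) (carrier (tensor R K' Y))"
    using Y K'(3) L'(3) j' unfolding fp_flat_def by blast
  interpret PK: tensor_pair R K Y by (rule tensor_pairI[OF Km Ym])
  interpret PK': tensor_pair R K' Y by (rule tensor_pairI[OF K'(1) Ym])
  interpret PL': tensor_pair R L' Y by (rule tensor_pairI[OF L'(1) Ym])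
  let ?t = "tensor_map R K K' Y \<phi> t"
  have t': "?t \<in> carrier (tensor R K' Y)" by (rule tensor_map_closed[OF Km K'(1) Ym k(1) t(1)])
  have "tensor_map R K' L' Y ?j ?t = tensor_map R K L' Y (\<lambda>x. ?j (\<phi> x)) t"
    by (rule tensor_map_comp[OF Km K'(1) L'(1) Ym k(1) j' t(1)])
  also have "\<dots> = tensor_map R K L' Y (\<lambda>x. \<psi> (j x)) t"
    by (rule tensor_map_cong[OF Km L'(1) Ym mhom_comp[OF k(1) j'] mhom_comp[OF j(1) l(1)] _ t(1)]) (simp add: kk)
  also have "\<dots> = tensor_map R L L' Y \<psi> (tensor_map R K L Y j t)"
    by (rule tensor_map_comp[OF Km Lm L'(1) Ym j(1) l(1) t(1), symmetric])
  also have "\<dots> = tensor_map R K' L' Y ?j \<zero>\<^bsub>tensor R K' Y\<^esub>"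
    unfolding t(2) tensor_map_zero_elt[OF Lm L'(1) Ym l(1)] tensor_map_zero_elt[OF K'(1) L'(1) Ym j'] ..
  finally have t0: "?t = \<zero>\<^bsub>tensor R K' Y\<^esub>" using inj_onD[OF inj _ t' PK'.TT.zero_closed] by blast
  have "t = tensor_map R K K Y (\<lambda>x. x) t" by (rule tensor_map_id[OF Km Ym t(1), symmetric])
  also have "\<dots> = tensor_map R K K Y (\<lambda>x. ?k (\<phi> x)) t"
    by (rule tensor_map_cong[OF Km Km Ym mhom_id mhom_comp[OF k(1) k'(1)] _ t(1)]) (simp add: kk)
  also have "\<dots> = tensor_map R K' K Y ?k ?t"
    by (rule tensor_map_comp[OF Km K'(1) Km Ym k(1) k'(1) t(1), symmetric])
  also have "\<dots> = \<zero>\<^bsub>tensor R K Y\<^esub>"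
    unfolding t0 by (rule tensor_map_zero_elt[OF K'(1) Km Ym k'(1)])
  finally show ?thesis .
qed

text \<open>A map that kills the kernel of \<open>g\<close> lives on the image of \<open>g\<close>,
  and from there injectivity extends it to \<open>A''\<close>. In this form \<open>Hom(-, X)\<close>
  keeps a complex exact once its terms and images are finitely presented.\<close>

lemma fp_injective_factor:
  fixes X :: "('r, 'u) module"
  assumes inf: "infinite (UNIV :: 'u set)" and R: "carrier R \<lesssim> (UNIV :: 'u set)"
    and X: "fp_injective n R X" and A': "lmodule R A'" and A'': "fpg R n A''" and im: "fpg R n (sub A'' (g ` carrier A'))"
    and g: "g \<in> mhom R A' A''" and h: "h \<in> mhom R A' X"
    and ker: "\<And>x. x \<in> carrier A' \<Longrightarrow> g x = \<zero>\<^bsub>A''\<^esub> \<Longrightarrow> h x = \<zero>\<^bsub>X\<^esub>"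
  shows "\<exists>k\<in>mhom R A'' X. \<forall>x\<in>carrier A'. k (g x) = h x"
proof -
  have Xm: "lmodule R X" using X by (simp add: fp_injective_def)
  note A''m = fpg_lmodule[OF A'']
  let ?I = "sub A'' (g ` carrier A')"
  have gI: "g \<in> mhom R A' ?I" by (rule mhom_into_sub[OF g]) simp
  have "\<exists>l\<in>mhom R ?I X. \<forall>x\<in>carrier A'. l (g x) = h x"
    by (rule factor_onto[OF A' fpg_lmodule[OF im] Xm gI _ h]) (simp_all add: ker)
  then obtain l where l: "l \<in> mhom R ?I X" "\<And>x. x \<in> carrier A' \<Longrightarrow> l (g x) = h x" by blast
  have "(\<lambda>x. x) \<in> mhom R ?I A''"
    by (rule mhom_restrict_sub[OF mhom_id]) (use mhom_closed[OF g] in blast)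
  then obtain k where "k \<in> mhom R A'' X" "\<And>y. y \<in> carrier ?I \<Longrightarrow> k y = l y"
    using fp_injective_extend[OF inf R X im A'', of "\<lambda>x. x" l] l(1) by (auto simp: inj_on_def)
  then show ?thesis using l(2) by (intro bexI[of _ k]) auto
qed

text \<open>Right exactness settles the matter with the image of \<open>g\<close> in place of
  \<open>A''\<close>; flatness makes the tensored inclusion of this image into \<open>A''\<close>
  injective.\<close>

lemma fp_flat_exact:
  fixes Y :: "('r, 'u) module"
  assumes inf: "infinite (UNIV :: 'u set)" and R: "carrier R \<lesssim> (UNIV :: 'u set)"
    and Y: "fp_flat n R Y" and A: "lmodule (opp R) A" and A': "lmodule (opp R) A'"
    and A'': "fpg (opp R) n A''" and im: "fpg (opp R) n (sub A'' (g ` carrier A'))"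
    and f: "f \<in> mhom (opp R) A A'" and g: "g \<in> mhom (opp R) A' A''"
    and ex: "\<And>x. x \<in> carrier A' \<Longrightarrow> g x = \<zero>\<^bsub>A''\<^esub> \<Longrightarrow> \<exists>a\<in>carrier A. x = f a"
    and t: "t \<in> carrier (tensor R A' Y)" "tensor_map R A' A'' Y g t = \<zero>\<^bsub>tensor R A'' Y\<^esub>"
  shows "\<exists>u\<in>carrier (tensor R A Y). t = tensor_map R A A' Y f u"
proof -
  have Ym: "lmodule R Y" using Y by (simp add: fp_flat_def)
  let ?I = "sub A'' (g ` carrier A')"
  note I = fpg_lmodule[OF im] and A''m = fpg_lmodule[OF A'']
  have i: "(\<lambda>x. x) \<in> mhom (opp R) ?I A''"
    by (rule mhom_restrict_sub[OF mhom_id]) (use mhom_closed[OF g] in blast)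
  have gI: "g \<in> mhom (opp R) A' ?I" by (rule mhom_into_sub[OF g]) simp
  have "tensor_map R ?I A'' Y (\<lambda>x. x) (tensor_map R A' ?I Y g t) = \<zero>\<^bsub>tensor R A'' Y\<^esub>"
    using tensor_map_comp[OF A' I A''m Ym gI i t(1)] t(2) by simp
  then have "tensor_map R A' ?I Y g t = \<zero>\<^bsub>tensor R ?I Y\<^esub>"
    by (intro fp_flat_inj[OF inf R Y im A'' i _ tensor_map_closed[OF A' I Ym gI t(1)]]) simp
  then show ?thesis
    by (intro tensor_right_exact1[OF A A' I Ym f gI _ _ t(1)]) (use ex in auto)
qed

section \<open>The dual complex of a resolution\<close>

context two_mod
begin

text \<open>The homothety by \<open>a\<close>, composed with \<open>e\<close>. For
  \<open>P 0\<close> and the augmentation this is the map by which the ring enters the dual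
  complex.\<close>

definition \<rho> :: "('b, 'p) module \<Rightarrow> ('p \<Rightarrow> 'c) \<Rightarrow> 'a \<Rightarrow> 'p \<Rightarrow> 'c"
  where "\<rho> P e a = (\<lambda>x\<in>carrier P. a \<odot>\<^bsub>CA\<^esub> e x)"

lemma \<rho>_mhom:
  assumes P: "lmodule B P" and e: "e \<in> mhom B P CB"
  shows "\<rho> P e \<in> mhom A (reg A) (homL CA B P CB)"
proof (rule mhomI)
  note ec = mhom_closed[OF e, unfolded same]
  show "\<rho> P e a \<in> carrier (homL CA B P CB)" if "a \<in> carrier (reg A)" for a
    unfolding \<rho>_def using mhom_restrict[OF P homL_smult_mem[OF _ e]] that by simp
qed (auto simp: \<rho>_def same CA.smult_l_distr CA.smult_assoc mhom_closed[OF e, unfolded same] intro!: restrict_ext)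

text \<open>Evaluation at the \<open>v j\<close> embeds \<open>Hom(P, C)\<close> in C^m, and the
  functionals \<open>\<xi> j\<close> give a retraction; so finite presentation passes from C to C^m
  and on to its retract.\<close>

lemma fpg_homL:
  assumes db: "dual_basis B P m v \<xi>" and C: "\<And>n. fpg A n CA"
  shows "fpg A n (homL CA B P CB)"
proof -
  note D = dual_basisD[OF db]
  let ?Q = "homL CA B P CB"
  have Q: "lmodule A ?Q" by (rule lmodule_homL[OF D(1)])
  let ?i = "\<lambda>f j. if j < m then f (v j) else \<zero>\<^bsub>CA\<^esub>"
  let ?p = "\<lambda>c. \<lambda>x\<in>carrier P. gsum CB (\<lambda>j. \<xi> j x \<odot>\<^bsub>CB\<^esub> c j) m"
  have cl: "f x \<in> carrier CA" if "f \<in> mhom B P CB" "x \<in> carrier P" for f x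
    using mhom_closed[OF that] same by simp
  show ?thesis
  proof (rule fpg_retract[OF fpg_pw[OF C] Q, of ?i m ?p])
    show "?i \<in> mhom A ?Q (pw CA m)"
      by (rule mhomI) (use D(2) cl in \<open>auto simp: pw_carrier same intro!: ext\<close>)
    show "?p \<in> mhom A (pw CA m) ?Q"
    proof (rule mhomI)
      have in1: "(\<lambda>x. gsum CB (\<lambda>j. \<xi> j x \<odot>\<^bsub>CB\<^esub> c j) m) \<in> mhom B P CB" if "c \<in> carrier (pw CA m)" for c
        by (rule mhom_gsum_map[OF CB])
          (use that D(3) same in \<open>auto simp: pw_carrier intro!: smult_mhom_reg[OF CB]\<close>)
      show "?p c \<in> carrier ?Q" if "c \<in> carrier (pw CA m)" for c
        using mhom_restrict[OF D(1) in1[OF that]] by simp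
      show "?p (c \<oplus>\<^bsub>pw CA m\<^esub> c') = ?p c \<oplus>\<^bsub>?Q\<^esub> ?p c'"
        if "c \<in> carrier (pw CA m)" "c' \<in> carrier (pw CA m)" for c c'
      proof -
        have "gsum CB (\<lambda>j. \<xi> j x \<odot>\<^bsub>CB\<^esub> (c j \<oplus>\<^bsub>CA\<^esub> c' j)) m =
          gsum CB (\<lambda>j. \<xi> j x \<odot>\<^bsub>CB\<^esub> c j) m \<oplus>\<^bsub>CB\<^esub> gsum CB (\<lambda>j. \<xi> j x \<odot>\<^bsub>CB\<^esub> c' j) m" if x: "x \<in> carrier P" for x
        proof -
          have cc: "c j \<in> carrier CB" "c' j \<in> carrier CB" if "j < m" for j
            using \<open>c \<in> _\<close> \<open>c' \<in> _\<close> that same by (auto simp: pw_carrier)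
          have "gsum CB (\<lambda>j. \<xi> j x \<odot>\<^bsub>CB\<^esub> (c j \<oplus>\<^bsub>CA\<^esub> c' j)) m =
            gsum CB (\<lambda>j. \<xi> j x \<odot>\<^bsub>CB\<^esub> c j \<oplus>\<^bsub>CB\<^esub> \<xi> j x \<odot>\<^bsub>CB\<^esub> c' j) m"
            by (rule gsum_cong) (use cc D(5) x CB.smult_r_distr same in auto)
          then show ?thesis using CB.gsum_add[of m "\<lambda>j. \<xi> j x \<odot>\<^bsub>CB\<^esub> c j" "\<lambda>j. \<xi> j x \<odot>\<^bsub>CB\<^esub> c' j"] cc D(5) x by simp
        qed
        then show ?thesis by (auto intro!: restrict_ext)
      qed
      show "?p (a \<odot>\<^bsub>pw CA m\<^esub> c) = a \<odot>\<^bsub>?Q\<^esub> ?p c" if a: "a \<in> carrier A" and c: "c \<in> carrier (pw CA m)" for a c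
      proof -
        have "gsum CB (\<lambda>j. \<xi> j x \<odot>\<^bsub>CB\<^esub> (a \<odot>\<^bsub>CA\<^esub> c j)) m = a \<odot>\<^bsub>CA\<^esub> gsum CB (\<lambda>j. \<xi> j x \<odot>\<^bsub>CB\<^esub> c j) m"
          if x: "x \<in> carrier P" for x
        proof -
          have cc: "c j \<in> carrier CA" if "j < m" for j using c that by (auto simp: pw_carrier)
          have "a \<odot>\<^bsub>CA\<^esub> gsum CB (\<lambda>j. \<xi> j x \<odot>\<^bsub>CB\<^esub> c j) m = gsum CB (\<lambda>j. a \<odot>\<^bsub>CA\<^esub> (\<xi> j x \<odot>\<^bsub>CB\<^esub> c j)) m"
            by (rule mhom_gsum[OF CB CB smult_mhom[OF a]]) (rule CB.smult_closed, use cc D(5) x same in auto)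
          also have "\<dots> = gsum CB (\<lambda>j. \<xi> j x \<odot>\<^bsub>CB\<^esub> (a \<odot>\<^bsub>CA\<^esub> c j)) m"
            by (rule gsum_cong) (use cc D(5) x a commute in auto)
          finally show ?thesis by simp
        qed
        then show ?thesis by (auto intro!: restrict_ext)
      qed
    qed
    show "?p (?i f) = f" if f: "f \<in> carrier ?Q" for f
    proof (rule ext_eqI[of _ "carrier P"])
      fix x assume x: "x \<in> carrier P"
      have "gsum CB (\<lambda>j. \<xi> j x \<odot>\<^bsub>CB\<^esub> ?i f j) m = gsum CB (\<lambda>j. \<xi> j x \<odot>\<^bsub>CB\<^esub> f (v j)) m"
        by (rule gsum_cong) simp
      then show "?p (?i f) x = f x" using dual_basis_hom[OF db CB _ x, of f] f x by simp
    qed (use f in auto)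
  qed
qed

end

text \<open>Instantiated twice: \<open>dcr\<close> has \<open>A = S\<close> and resolves the right
  module C, \<open>dcl\<close> has \<open>A = opp R\<close> and resolves the left module. The
  homothety conditions are stated by elements, so that no group of extensional maps enters.\<close>

locale dual_complex = two_mod A CA B CB
  for A :: "'a ring" and CA :: "('a, 'u) module" and B :: "'b ring" and CB :: "('b, 'u) module" +
  fixes P :: "nat \<Rightarrow> ('b, 'u) module" and d :: "nat \<Rightarrow> 'u \<Rightarrow> 'u" and e :: "'u \<Rightarrow> 'u"
    and m :: "nat \<Rightarrow> nat" and v :: "nat \<Rightarrow> nat \<Rightarrow> 'u" and \<xi> :: "nat \<Rightarrow> nat \<Rightarrow> 'u \<Rightarrow> 'b"
  assumes res: "exact_res B CB P d e" and db: "\<And>i. dual_basis B (P i) (m i) (v i) (\<xi> i)"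
    and van: "Ext_vanish B P d CB" and fpgC: "\<And>n. fpg A n CA"
    and homothety_onto: "\<And>h. h \<in> mhom B CB CB \<Longrightarrow> \<exists>a\<in>carrier A. \<forall>x\<in>carrier CA. h x = a \<odot>\<^bsub>CA\<^esub> x"
    and homothety_inj: "\<And>a. a \<in> carrier A \<Longrightarrow> (\<And>x. x \<in> carrier CA \<Longrightarrow> a \<odot>\<^bsub>CA\<^esub> x = \<zero>\<^bsub>CA\<^esub>) \<Longrightarrow> a = \<zero>\<^bsub>A\<^esub>"
begin

lemmas D = exact_resD[OF res]

abbreviation "Q i \<equiv> homL CA B (P i) CB"
abbreviation "\<delta> i \<equiv> precomp (P (Suc i)) (d i)"
abbreviation "\<rho>0 \<equiv> \<rho> (P 0) e"

lemma Q: "lmodule A (Q i)" by (rule lmodule_homL[OF D(2)])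
lemma \<delta>: "\<delta> i \<in> mhom A (Q i) (Q (Suc i))" by (rule precomp_mhom[OF D(2) D(4)])
lemma \<rho>0: "\<rho>0 \<in> mhom A (reg A) (Q 0)" by (rule \<rho>_mhom[OF D(2) D(3)])
lemma regA: "lmodule A (reg A)" by (rule lmodule_reg[OF CA.ring_axioms])
lemma fpgQ: "fpg A n (Q i)" by (rule fpg_homL[OF db fpgC])

lemma \<delta>_zero_iff:
  assumes "f \<in> carrier (Q i)"
  shows "\<delta> i f = \<zero>\<^bsub>Q (Suc i)\<^esub> \<longleftrightarrow> (\<forall>x\<in>carrier (P (Suc i)). f (d i x) = \<zero>\<^bsub>CB\<^esub>)"
  by (auto simp: precomp_def fun_eq_iff restrict_def)

lemma \<delta>\<delta>: "f \<in> carrier (Q i) \<Longrightarrow> \<delta> (Suc i) (\<delta> i f) = \<zero>\<^bsub>Q (Suc (Suc i))\<^esub>"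
  using \<delta>_zero_iff[of "\<delta> i f" "Suc i"] mhom_closed[OF \<delta>, of f i] mhom_closed[OF D(4)] D(7)
    mhom_zero[OF D(2) CB, of f i] by (auto simp: precomp_def)

lemma \<delta>\<rho>: "a \<in> carrier A \<Longrightarrow> \<delta> 0 (\<rho>0 a) = \<zero>\<^bsub>Q (Suc 0)\<^esub>"
  using \<delta>_zero_iff[of "\<rho>0 a" 0] mhom_closed[OF \<rho>0, of a] mhom_closed[OF D(4)] D(6)
  by (auto simp: \<rho>_def same)

lemma exact_\<delta>:
  assumes f: "f \<in> carrier (Q (Suc i))" "\<delta> (Suc i) f = \<zero>\<^bsub>Q (Suc (Suc i))\<^esub>"
  shows "\<exists>g\<in>carrier (Q i). f = \<delta> i g"
proof -
  have "f \<in> mhom B (P (Suc i)) CB" using f by simp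
  moreover have "\<forall>x\<in>carrier (P (Suc (Suc i))). f (d (Suc i) x) = \<zero>\<^bsub>CB\<^esub>" using f \<delta>_zero_iff by blast
  ultimately obtain g where g: "g \<in> mhom B (P i) CB" "\<forall>x\<in>carrier (P (Suc i)). f x = g (d i x)"
    using van unfolding Ext_vanish_def by blast
  have "f = \<delta> i (restrict g (carrier (P i)))"
    using f(1) g(2) mhom_closed[OF D(4)] by (auto simp: precomp_def intro!: ext_eqI)
  then show ?thesis using mhom_restrict[OF D(2) g(1)] by (intro bexI[of _ "restrict g (carrier (P i))"]) auto
qed

text \<open>A map on \<open>P 0\<close> that kills the boundaries descends along \<open>e\<close> to
  an endomorphism of C, and every endomorphism is a homothety.\<close>

lemma exact_\<rho>:
  assumes f: "f \<in> carrier (Q 0)" "\<delta> 0 f = \<zero>\<^bsub>Q (Suc 0)\<^esub>"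
  shows "\<exists>a\<in>carrier A. f = \<rho>0 a"
proof -
  have f': "f \<in> mhom B (P 0) CB" using f by simp
  have k: "f (d 0 x) = \<zero>\<^bsub>CB\<^esub>" if "x \<in> carrier (P (Suc 0))" for x using f \<delta>_zero_iff that by blast
  have "f x = \<zero>\<^bsub>CB\<^esub>" if "x \<in> carrier (P 0)" "e x = \<zero>\<^bsub>CB\<^esub>" for x
    using D(8)[OF that] k by auto
  then obtain h where h: "h \<in> mhom B CB CB" "\<And>x. x \<in> carrier (P 0) \<Longrightarrow> h (e x) = f x"
    using factor_onto[OF D(2) D(1) D(1) D(3) D(5) f'] by blast
  obtain a where a: "a \<in> carrier A" "\<forall>x\<in>carrier CA. h x = a \<odot>\<^bsub>CA\<^esub> x" using homothety_onto h(1) by blast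
  have "f = \<rho>0 a"
  proof (rule ext_eqI[of _ "carrier (P 0)"])
    fix x assume x: "x \<in> carrier (P 0)"
    have "e x \<in> carrier CA" using mhom_closed[OF D(3) x] same by simp
    then show "f x = \<rho>0 a x" using a(2) h(2)[OF x] x by (simp add: \<rho>_def)
  qed (use f in \<open>auto simp: \<rho>_def\<close>)
  then show ?thesis using a(1) by blast
qed

lemma inj_\<rho>: "inj_on \<rho>0 (carrier (reg A))"
proof (rule ahom_inj[OF lmodule_ab[OF regA] lmodule_ab[OF Q] mhom_ahom[OF \<rho>0]])
  fix a assume a: "a \<in> carrier (reg A)" "\<rho>0 a = \<zero>\<^bsub>Q 0\<^esub>"
  have "a \<odot>\<^bsub>CA\<^esub> x = \<zero>\<^bsub>CA\<^esub>" if x: "x \<in> carrier CA" for x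
  proof -
    obtain y where "y \<in> carrier (P 0)" "x = e y" using D(5) x same by blast
    then show ?thesis using fun_cong[OF a(2), of y] by (simp add: \<rho>_def same)
  qed
  then show "a = \<zero>\<^bsub>reg A\<^esub>" using homothety_inj a(1) by simp
qed

lemma fpg_reg: "fpg A n (reg A)"
  by (rule dual_basis_fpg[OF dual_basis_reg[OF CA.ring_axioms]])

lemma fpg_image_\<rho>: "fpg A n (sub (Q 0) (\<rho>0 ` carrier (reg A)))"
proof (rule fpg_miso[OF lmodule_image[OF regA Q \<rho>0] _ fpg_reg])
  show "\<rho>0 \<in> miso A (reg A) (sub (Q 0) (\<rho>0 ` carrier (reg A)))"
    by (rule misoI[OF mhom_into_sub[OF \<rho>0] inj_\<rho>]) auto
qed

text \<open>This complex begins on the left, so presentations propagate upwards in \<open>i\<close>: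
  the kernel of each \<open>\<delta> i\<close> is the previous image, at the start a copy of the
  ring, and the cokernel rule applies. All levels \<open>n\<close> are carried together, since level
  \<open>n + 1\<close> of an image needs level \<open>n\<close> of the kernel.\<close>

lemma fpg_image_\<delta>: "fpg A n (sub (Q (Suc i)) (\<delta> i ` carrier (Q i)))"
proof (induction i arbitrary: n)
  have n: "fpg A n (sub (Q (Suc i)) (\<delta> i ` carrier (Q i)))"
    if "\<And>n. fpg A n (sub (Q i) {x \<in> carrier (Q i). \<delta> i x = \<zero>\<^bsub>Q (Suc i)\<^esub>})" for i n
  proof (cases n)
    case 0
    show ?thesis
      unfolding 0 by (rule fpg_0_image[OF lmodule_image[OF Q Q \<delta>] mhom_into_sub[OF \<delta>] _ fpgQ[of 0 i]]) auto
  next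
    case (Suc k)
    show ?thesis unfolding Suc by (rule fpg_cokernel[OF ses_kernel_image[OF Q Q \<delta>] that fpgQ])
  qed
  {
    case 0
    have "{x \<in> carrier (Q 0). \<delta> 0 x = \<zero>\<^bsub>Q (Suc 0)\<^esub>} = \<rho>0 ` carrier (reg A)"
      using exact_\<rho> \<delta>\<rho> mhom_closed[OF \<rho>0] by (intro equalityI subsetI) (auto simp del: homL_simps)
    then show ?case using n[of 0] fpg_image_\<rho> by simp
  next
    case (Suc i)
    have "{x \<in> carrier (Q (Suc i)). \<delta> (Suc i) x = \<zero>\<^bsub>Q (Suc (Suc i))\<^esub>} = \<delta> i ` carrier (Q i)"
      using exact_\<delta>[of _ i] \<delta>\<delta>[of _ i] mhom_closed[OF \<delta>] by (intro equalityI subsetI) (auto simp del: homL_simps)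
    then show ?case using n[of "Suc i"] Suc.IH by simp
  }
qed

end

section \<open>The Foxby setting\<close>

text \<open>Everything is expressed by two fixed resolutions with dual bases; Ext enters as
  \<open>Ext_vanish\<close>, so that neither projectivity nor the chosen resolution occurs before
  the final theorem.\<close>

locale foxby = bimod S R C
  for S :: "'s ring" and R :: "'r ring" and C :: "('s, 'r, 'u) bimodule" +
  fixes Pl :: "nat \<Rightarrow> ('s, 'u) module" and dl :: "nat \<Rightarrow> 'u \<Rightarrow> 'u" and el :: "'u \<Rightarrow> 'u"
    and ml :: "nat \<Rightarrow> nat" and vl :: "nat \<Rightarrow> nat \<Rightarrow> 'u" and \<xi>l :: "nat \<Rightarrow> nat \<Rightarrow> 'u \<Rightarrow> 's"
    and Pr :: "nat \<Rightarrow> ('r, 'u) module" and dr :: "nat \<Rightarrow> 'u \<Rightarrow> 'u" and er :: "'u \<Rightarrow> 'u"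
    and mr :: "nat \<Rightarrow> nat" and vr :: "nat \<Rightarrow> nat \<Rightarrow> 'u" and \<xi>r :: "nat \<Rightarrow> nat \<Rightarrow> 'u \<Rightarrow> 'r"
  assumes inf: "infinite (UNIV :: 'u set)"
    and smallR: "carrier R \<lesssim> (UNIV :: 'u set)" and smallS: "carrier S \<lesssim> (UNIV :: 'u set)"
    and resl: "exact_res S (left_mod C) Pl dl el" and dbl: "\<And>i. dual_basis S (Pl i) (ml i) (vl i) (\<xi>l i)"
    and resr: "exact_res (opp R) (right_mod C) Pr dr er"
    and dbr: "\<And>i. dual_basis (opp R) (Pr i) (mr i) (vr i) (\<xi>r i)"
    and vanl: "Ext_vanish S Pl dl (left_mod C)" and vanr: "Ext_vanish (opp R) Pr dr (right_mod C)"
    and homS: "(\<lambda>s. \<lambda>x\<in>carrier C. s \<odot>\<^bsub>C\<^esub> x)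
      \<in> iso (add_monoid S) (add_monoid (hom_group (opp R) (right_mod C) (right_mod C)))"
    and homR: "(\<lambda>r. \<lambda>x\<in>carrier C. rsmult C x r)
      \<in> iso (add_monoid R) (add_monoid (hom_group S (left_mod C) (left_mod C)))"
begin

lemmas Dl = exact_resD[OF resl] and Dr = exact_resD[OF resr]

lemma fpgl: "fpg S n (left_mod C)"
  by (rule fpg_exact_res(1)[OF resl dual_basis_fpg[OF dbl]])

lemma fpgr: "fpg (opp R) n (right_mod C)"
  by (rule fpg_exact_res(1)[OF resr dual_basis_fpg[OF dbr]])

text \<open>The action is a parameter, so that the homotheties of \<open>S\<close> and of
  \<open>R\<close> are both instances; on the right the scalar is the second argument of
  \<open>rsmult\<close>.\<close>

lemma homothety:
  assumes A: "ring A" and two: "lmodule B CB"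
    and iso: "(\<lambda>a. \<lambda>x\<in>carrier CB. act a x) \<in> iso (add_monoid A) (add_monoid (hom_group B CB CB))"
  shows "\<And>h. h \<in> mhom B CB CB \<Longrightarrow> \<exists>a\<in>carrier A. \<forall>x\<in>carrier CB. h x = act a x"
    "\<And>a. a \<in> carrier A \<Longrightarrow> (\<And>x. x \<in> carrier CB \<Longrightarrow> act a x = \<zero>\<^bsub>CB\<^esub>) \<Longrightarrow>
      (\<And>x. x \<in> carrier CB \<Longrightarrow> act \<zero>\<^bsub>A\<^esub> x = \<zero>\<^bsub>CB\<^esub>) \<Longrightarrow> a = \<zero>\<^bsub>A\<^esub>"
proof -
  interpret A: ring A by fact
  let ?h = "\<lambda>a. \<lambda>x\<in>carrier CB. act a x"
  have b: "inj_on ?h (carrier A)" "?h ` carrier A = mhom B CB CB \<inter> extensional (carrier CB)"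
    using iso by (auto simp: iso_def bij_betw_def)
  show "\<exists>a\<in>carrier A. \<forall>x\<in>carrier CB. h x = act a x" if "h \<in> mhom B CB CB" for h
  proof -
    have "restrict h (carrier CB) \<in> ?h ` carrier A"
      unfolding b(2) using mhom_restrict[OF two that] by simp
    then obtain a where a: "a \<in> carrier A" "restrict h (carrier CB) = ?h a" by blast
    have "h x = act a x" if "x \<in> carrier CB" for x using fun_cong[OF a(2), of x] that by simp
    then show ?thesis using a(1) by blast
  qed
  show "a = \<zero>\<^bsub>A\<^esub>" if "a \<in> carrier A" "\<And>x. x \<in> carrier CB \<Longrightarrow> act a x = \<zero>\<^bsub>CB\<^esub>"
    "\<And>x. x \<in> carrier CB \<Longrightarrow> act \<zero>\<^bsub>A\<^esub> x = \<zero>\<^bsub>CB\<^esub>" for a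
  proof -
    have "?h a = ?h \<zero>\<^bsub>A\<^esub>" using that by (intro restrict_ext) simp
    then show ?thesis using inj_onD[OF b(1)] that(1) by blast
  qed
qed

lemma dcr: "dual_complex S (left_mod C) (opp R) (right_mod C) Pr dr er mr vr \<xi>r"
proof (intro dual_complex.intro two_mod_LR dual_complex_axioms.intro resr dbr vanr fpgl)
  note h = homothety[OF ringS CR, of "\<lambda>s x. s \<odot>\<^bsub>C\<^esub> x", unfolded right_mod_simps(1), OF homS]
  show "\<exists>a\<in>carrier S. \<forall>x\<in>carrier (left_mod C). h x = a \<odot>\<^bsub>left_mod C\<^esub> x"
    if "h \<in> mhom (opp R) (right_mod C) (right_mod C)" for h using h(1)[OF that] by simp
  show "a = \<zero>\<^bsub>S\<^esub>" if "a \<in> carrier S" "\<And>x. x \<in> carrier (left_mod C) \<Longrightarrow> a \<odot>\<^bsub>left_mod C\<^esub> x = \<zero>\<^bsub>left_mod C\<^esub>" for a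
    by (rule h(2)[OF that(1)]) (use that CL.zero_smult in auto)
qed

lemma dcl: "dual_complex (opp R) (right_mod C) S (left_mod C) Pl dl el ml vl \<xi>l"
proof (intro dual_complex.intro two_mod_RL dual_complex_axioms.intro resl dbl vanl fpgr)
  note h = homothety[OF ringR CL, of "\<lambda>r x. rsmult C x r", unfolded left_mod_simps(1), OF homR]
  show "\<exists>a\<in>carrier (opp R). \<forall>x\<in>carrier (right_mod C). h x = a \<odot>\<^bsub>right_mod C\<^esub> x"
    if "h \<in> mhom S (left_mod C) (left_mod C)" for h using h(1)[OF that] by simp
  show "a = \<zero>\<^bsub>opp R\<^esub>" if "a \<in> carrier (opp R)" "\<And>x. x \<in> carrier (right_mod C) \<Longrightarrow> a \<odot>\<^bsub>right_mod C\<^esub> x = \<zero>\<^bsub>right_mod C\<^esub>" for a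
    unfolding opp_simps by (rule h(2)) (use that CR.zero_smult in auto)
qed

end

section \<open>\<open>fp\<^sub>n\<close>-injective modules lie in the Bass class\<close>

text \<open>\<open>\<theta>\<close> is the map \<open>P \<otimes>\<^sub>R Hom\<^sub>S(C, X) \<rightarrow> Hom\<^sub>S(Hom\<^sub>R(P, C), X)\<close>, \<open>p \<otimes> f \<mapsto> (g \<mapsto> f (g p))\<close>.\<close>

definition \<theta> :: "('s, 'b) module \<Rightarrow> ('p \<times> ('c \<Rightarrow> 'b) \<Rightarrow>\<^sub>0 int) set \<Rightarrow> ('p \<Rightarrow> 'c) \<Rightarrow> 'b"
  where "\<theta> X t g = tlift X (\<lambda>p f. f (g p)) t"

context bimod
begin

abbreviation "QP P \<equiv> homL (left_mod C) (opp R) P (right_mod C)"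

lemma \<theta>_ahom:
  assumes X: "lmodule S X" and P: "lmodule (opp R) P" and g: "g \<in> mhom (opp R) P (right_mod C)"
  shows "(\<lambda>t. \<theta> X t g) \<in> ahom (tensor R P (hom_mod S C X)) X"
    "\<And>p f. p \<in> carrier P \<Longrightarrow> f \<in> carrier (hom_mod S C X) \<Longrightarrow>
      \<theta> X (pure_tensor R P (hom_mod S C X) p f) g = f (g p)"
proof -
  interpret X: lmodule S X by fact
  interpret T: tensor_pair R P "hom_mod S C X" by (rule tensor_pairI[OF P lmodule_hom_mod[OF X]])
  note L = T.tlift[OF X.abelian_group_axioms, of "\<lambda>p f. f (g p)"]
  note gc = mhom_closed[OF g, simplified]
  have 1: "f (g p) \<in> carrier X" if "p \<in> carrier P" "f \<in> carrier (hom_mod S C X)" for p f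
    using that mhom_closed[of f S "left_mod C" X "g p"] gc by simp
  have 2: "f (g (p \<oplus>\<^bsub>P\<^esub> p')) = f (g p) \<oplus>\<^bsub>X\<^esub> f (g p')"
    if "p \<in> carrier P" "p' \<in> carrier P" "f \<in> carrier (hom_mod S C X)" for p p' f
    using that mhom_add[OF g] mhom_add[of f S "left_mod C" X "g p" "g p'"] gc by simp
  have 3: "(f \<oplus>\<^bsub>hom_mod S C X\<^esub> f') (g p) = f (g p) \<oplus>\<^bsub>X\<^esub> f' (g p)" if "p \<in> carrier P" "f \<in> carrier (hom_mod S C X)" "f' \<in> carrier (hom_mod S C X)" for p f f'
    using gc[OF that(1)] by simp
  have 4: "f (g (r \<odot>\<^bsub>P\<^esub> p)) = (r \<odot>\<^bsub>hom_mod S C X\<^esub> f) (g p)" if "r \<in> carrier R" "p \<in> carrier P" "f \<in> carrier (hom_mod S C X)" for r p f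
    using gc[OF that(2)] mhom_smult[OF g, of r p] that by simp
  show "(\<lambda>t. \<theta> X t g) \<in> ahom (tensor R P (hom_mod S C X)) X"
    unfolding \<theta>_def by (rule L(1)) (fact 1 2 3 4)+
  show "\<theta> X (T.tp p f) g = f (g p)" if "p \<in> carrier P" "f \<in> carrier (hom_mod S C X)" for p f
    unfolding \<theta>_def by (rule L(2)) (fact 1 2 3 4 that)+
qed

lemma \<theta>_mhom:
  assumes X: "lmodule S X" and P: "lmodule (opp R) P" and t: "t \<in> carrier (tensor R P (hom_mod S C X))"
  shows "\<theta> X t \<in> mhom S (QP P) X"
proof (rule mhomI)
  interpret X: lmodule S X by fact
  interpret P: lmodule "opp R" P by fact
  interpret T: tensor_pair R P "hom_mod S C X" by (rule tensor_pairI[OF P lmodule_hom_mod[OF X]])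
  interpret W: two_mod S "left_mod C" "opp R" "right_mod C" by (rule two_mod_LR)
  interpret Q: lmodule S "QP P" by (rule W.lmodule_homL[OF P])
  have Qm: "g \<in> mhom (opp R) P (right_mod C)" if "g \<in> carrier (QP P)" for g using that by simp
  note th = \<theta>_ahom[OF X P Qm]
  have gc: "g p \<in> carrier C" if "g \<in> carrier (QP P)" "p \<in> carrier P" for g p
    using mhom_closed[OF Qm[OF that(1)] that(2)] by simp
  show "\<theta> X t g \<in> carrier X" if "g \<in> carrier (QP P)" for g by (rule ahom_closed[OF th(1)[OF that] t])
  show "\<theta> X t (g \<oplus>\<^bsub>QP P\<^esub> g') = \<theta> X t g \<oplus>\<^bsub>X\<^esub> \<theta> X t g'" if g: "g \<in> carrier (QP P)" "g' \<in> carrier (QP P)" for g g'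
  proof (rule T.tensor_ahom_eq[OF X.abelian_group_axioms th(1)[OF Q.a_closed[OF g]]
        ahom_add_map[OF X.abelian_group_axioms th(1)[OF g(1)] th(1)[OF g(2)]] _ t])
    fix p f assume pf: "p \<in> carrier P" "f \<in> carrier (hom_mod S C X)"
    then have "f (g p \<oplus>\<^bsub>C\<^esub> g' p) = f (g p) \<oplus>\<^bsub>X\<^esub> f (g' p)"
      using mhom_add[of f S "left_mod C" X "g p" "g' p"] gc g by simp
    then show "\<theta> X (T.tp p f) (g \<oplus>\<^bsub>QP P\<^esub> g') = \<theta> X (T.tp p f) g \<oplus>\<^bsub>X\<^esub> \<theta> X (T.tp p f) g'"
      unfolding th(2)[OF Q.a_closed[OF g] pf] th(2)[OF g(1) pf] th(2)[OF g(2) pf] using pf by simp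
  qed
  show "\<theta> X t (s \<odot>\<^bsub>QP P\<^esub> g) = s \<odot>\<^bsub>X\<^esub> \<theta> X t g" if s: "s \<in> carrier S" and g: "g \<in> carrier (QP P)" for s g
  proof (rule T.tensor_ahom_eq[OF X.abelian_group_axioms th(1)[OF Q.smult_closed[OF s g]]
        ahom_comp[OF th(1)[OF g] X.smult_ahom[OF s]] _ t])
    fix p f assume pf: "p \<in> carrier P" "f \<in> carrier (hom_mod S C X)"
    then have "f (s \<odot>\<^bsub>C\<^esub> g p) = s \<odot>\<^bsub>X\<^esub> f (g p)"
      using mhom_smult[of f S "left_mod C" X s "g p"] gc g s by simp
    then show "\<theta> X (T.tp p f) (s \<odot>\<^bsub>QP P\<^esub> g) = s \<odot>\<^bsub>X\<^esub> \<theta> X (T.tp p f) g"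
      unfolding th(2)[OF Q.smult_closed[OF s g] pf] th(2)[OF g pf] using pf by simp
  qed
qed

text \<open>A functional \<open>\<zeta>\<close> on \<open>P\<close> turns an element of C into a map
  of rank one. With a dual basis every \<open>g\<close> is the sum of the maps
  \<open>\<mu> P (\<xi> j) (g (v j))\<close>, the identity behind
  \<open>\<theta>_inv\<close>.\<close>

definition \<mu> :: "('r, 'p) module \<Rightarrow> ('p \<Rightarrow> 'r) \<Rightarrow> 'c \<Rightarrow> 'p \<Rightarrow> 'c"
  where "\<mu> P \<zeta> c = (\<lambda>p\<in>carrier P. rsmult C c (\<zeta> p))"

lemma \<mu>_mhom:
  assumes P: "lmodule (opp R) P" and z: "\<zeta> \<in> mhom (opp R) P (reg (opp R))"
  shows "\<mu> P \<zeta> \<in> mhom S (left_mod C) (QP P)"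
proof (rule mhomI)
  have zc: "\<zeta> p \<in> carrier R" if "p \<in> carrier P" for p using mhom_closed[OF z that] by simp
  show "\<mu> P \<zeta> c \<in> carrier (QP P)" if "c \<in> carrier (left_mod C)" for c
    unfolding \<mu>_def using mhom_restrict[OF P smult_mhom_reg[OF CR _ z]] that by simp
  show "\<mu> P \<zeta> (c \<oplus>\<^bsub>left_mod C\<^esub> c') = \<mu> P \<zeta> c \<oplus>\<^bsub>QP P\<^esub> \<mu> P \<zeta> c'"
    if "c \<in> carrier (left_mod C)" "c' \<in> carrier (left_mod C)" for c c'
    using that zc CR.smult_r_distr by (auto simp: \<mu>_def intro!: restrict_ext)
  show "\<mu> P \<zeta> (s \<odot>\<^bsub>left_mod C\<^esub> c) = s \<odot>\<^bsub>QP P\<^esub> \<mu> P \<zeta> c" if "s \<in> carrier S" "c \<in> carrier (left_mod C)" for s c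
    using that zc comm by (auto simp: \<mu>_def intro!: restrict_ext)
qed

text \<open>Forced by the decomposition of \<open>g\<close> into rank one maps: a linear
  \<open>F\<close> is known from its composites with the maps \<open>\<mu> P (\<xi> j)\<close>, and
  these composites are elements of \<open>Hom(C, X)\<close>.\<close>

definition \<theta>_inv :: "('s, 'b) module \<Rightarrow> ('r, 'p) module \<Rightarrow> nat \<Rightarrow> (nat \<Rightarrow> 'p) \<Rightarrow> (nat \<Rightarrow> 'p \<Rightarrow> 'r) \<Rightarrow>
    (('p \<Rightarrow> 'c) \<Rightarrow> 'b) \<Rightarrow> ('p \<times> ('c \<Rightarrow> 'b) \<Rightarrow>\<^sub>0 int) set"
  where "\<theta>_inv X P m v \<xi> F = gsum (tensor R P (hom_mod S C X))
    (\<lambda>j. pure_tensor R P (hom_mod S C X) (v j) (\<lambda>c\<in>carrier C. F (\<mu> P (\<xi> j) c))) m"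

text \<open>On a pure tensor the coefficients move across: the sum of
  \<open>v j \<otimes> (\<xi> j p) f\<close> is the sum of
  \<open>v j (\<xi> j p) \<otimes> f\<close>, which is \<open>p \<otimes> f\<close>. In the other
  direction linearity of \<open>F\<close> meets the decomposition of \<open>g\<close> by
  \<open>\<mu>\<close>; agreement with \<open>F\<close> is claimed on the carrier only.\<close>

lemma \<theta>_bij:
  assumes X: "lmodule S X" and db: "dual_basis (opp R) P m v \<xi>"
  shows "\<And>t. t \<in> carrier (tensor R P (hom_mod S C X)) \<Longrightarrow> \<theta>_inv X P m v \<xi> (\<theta> X t) = t"
    "\<And>F. F \<in> mhom S (QP P) X \<Longrightarrow> \<theta>_inv X P m v \<xi> F \<in> carrier (tensor R P (hom_mod S C X))"
    "\<And>F g. F \<in> mhom S (QP P) X \<Longrightarrow> g \<in> carrier (QP P) \<Longrightarrow> \<theta> X (\<theta>_inv X P m v \<xi> F) g = F g"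
proof -
  note D = dual_basisD[OF db]
  let ?H = "hom_mod S C X"
  have H: "lmodule R ?H" by (rule lmodule_hom_mod[OF X])
  interpret X: lmodule S X by fact
  interpret H: lmodule R ?H by fact
  interpret P: lmodule "opp R" P by (rule D(1))
  interpret T: tensor_pair R P ?H by (rule tensor_pairI[OF D(1) H])
  interpret W: two_mod S "left_mod C" "opp R" "right_mod C" by (rule two_mod_LR)
  interpret Q: lmodule S "QP P" by (rule W.lmodule_homL[OF D(1)])
  let ?f = "\<lambda>j F. \<lambda>c\<in>carrier C. F (\<mu> P (\<xi> j) c)"
  have f: "?f j F \<in> carrier ?H" if F: "F \<in> mhom S (QP P) X" and j: "j < m" for j F
    using mhom_restrict[OF CL mhom_comp[OF \<mu>_mhom[OF D(1) D(3)[OF j]] F]] by simp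
  show 2: "\<theta>_inv X P m v \<xi> F \<in> carrier (tensor R P ?H)" if "F \<in> mhom S (QP P) X" for F
    unfolding \<theta>_inv_def by (rule T.TT.gsum_closed) (use f[OF that] D(2) in auto)
  have \<mu>c: "\<mu> P (\<xi> j) c \<in> carrier (QP P)" if "j < m" "c \<in> carrier C" for j c
    using mhom_closed[OF \<mu>_mhom[OF D(1) D(3)[OF that(1)]]] that(2) by simp
  have Qm: "g \<in> mhom (opp R) P (right_mod C)" if "g \<in> carrier (QP P)" for g using that by simp
  note th = \<theta>_ahom[OF X D(1) Qm]
  \<comment> \<open>Additivity of the round trip allows its comparison with the identity on pure
    tensors alone.\<close>
  have ad: "(\<lambda>t. \<theta>_inv X P m v \<xi> (\<theta> X t)) \<in> ahom (tensor R P ?H) (tensor R P ?H)"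
  proof (rule ahomI)
    show "\<theta>_inv X P m v \<xi> (\<theta> X t) \<in> carrier (tensor R P ?H)" if "t \<in> carrier (tensor R P ?H)" for t
      by (rule 2[OF \<theta>_mhom[OF X D(1) that]])
    fix s t assume st: "s \<in> carrier (tensor R P ?H)" "t \<in> carrier (tensor R P ?H)"
    note fs = f[OF \<theta>_mhom[OF X D(1) st(1)]] and ft = f[OF \<theta>_mhom[OF X D(1) st(2)]]
    have e: "?f j (\<theta> X (s \<oplus>\<^bsub>tensor R P ?H\<^esub> t)) = ?f j (\<theta> X s) \<oplus>\<^bsub>?H\<^esub> ?f j (\<theta> X t)" if "j < m" for j
      using ahom_add[OF th(1)[OF \<mu>c[OF that]] st] by (auto intro!: restrict_ext)
    have "\<theta>_inv X P m v \<xi> (\<theta> X (s \<oplus>\<^bsub>tensor R P ?H\<^esub> t)) =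
        gsum (tensor R P ?H) (\<lambda>j. T.tp (v j) (?f j (\<theta> X s)) \<oplus>\<^bsub>tensor R P ?H\<^esub> T.tp (v j) (?f j (\<theta> X t))) m"
      unfolding \<theta>_inv_def by (rule gsum_cong) (use e T.tp_add_r[OF D(2) fs ft] in auto)
    also have "\<dots> = \<theta>_inv X P m v \<xi> (\<theta> X s) \<oplus>\<^bsub>tensor R P ?H\<^esub> \<theta>_inv X P m v \<xi> (\<theta> X t)"
      unfolding \<theta>_inv_def by (rule T.TT.gsum_add) (use D(2) fs ft in auto)
    finally show "\<theta>_inv X P m v \<xi> (\<theta> X (s \<oplus>\<^bsub>tensor R P ?H\<^esub> t)) =
        \<theta>_inv X P m v \<xi> (\<theta> X s) \<oplus>\<^bsub>tensor R P ?H\<^esub> \<theta>_inv X P m v \<xi> (\<theta> X t)" .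
  qed
  show "\<theta>_inv X P m v \<xi> (\<theta> X t) = t" if t: "t \<in> carrier (tensor R P ?H)" for t
  proof (rule T.tensor_ahom_eq[OF T.abelian_tensor ad ahom_id _ t])
    fix p f assume pf: "p \<in> carrier P" "f \<in> carrier ?H"
    have xc: "\<xi> j p \<in> carrier R" if "j < m" for j using D(5)[OF that pf(1)] by simp
    have "?f j (\<theta> X (T.tp p f)) = \<xi> j p \<odot>\<^bsub>?H\<^esub> f" if "j < m" for j
      using th(2)[OF \<mu>c[OF that] pf] pf(1) by (auto simp: \<mu>_def intro!: restrict_ext)
    then have "\<theta>_inv X P m v \<xi> (\<theta> X (T.tp p f)) = gsum (tensor R P ?H) (\<lambda>j. T.tp (\<xi> j p \<odot>\<^bsub>P\<^esub> v j) f) m"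
      unfolding \<theta>_inv_def using T.tp_bal[OF xc D(2) pf(2)] by (intro gsum_cong) auto
    also have "\<dots> = T.tp (gsum P (\<lambda>j. \<xi> j p \<odot>\<^bsub>P\<^esub> v j) m) f"
      by (rule ahom_gsum[OF P.abelian_group_axioms T.abelian_tensor T.tp_ahom_l[OF pf(2)], symmetric])
        (use xc D(2) in auto)
    also have "\<dots> = T.tp p f" using D(4)[OF pf(1)] by simp
    finally show "\<theta>_inv X P m v \<xi> (\<theta> X (T.tp p f)) = T.tp p f" .
  qed
  show "\<theta> X (\<theta>_inv X P m v \<xi> F) g = F g" if F: "F \<in> mhom S (QP P) X" and g: "g \<in> carrier (QP P)" for F g
  proof -
    have gv: "g (v j) \<in> carrier C" if "j < m" for j using mhom_closed[OF Qm[OF g] D(2)[OF that]] by simp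
    have "\<theta> X (\<theta>_inv X P m v \<xi> F) g = gsum X (\<lambda>j. \<theta> X (T.tp (v j) (?f j F)) g) m"
      unfolding \<theta>_inv_def
      by (rule ahom_gsum[OF T.abelian_tensor X.abelian_group_axioms th(1)[OF g]]) (use D(2) f[OF F] in auto)
    also have "\<dots> = gsum X (\<lambda>j. F (\<mu> P (\<xi> j) (g (v j)))) m"
      by (rule gsum_cong) (use th(2)[OF g D(2) f[OF F]] gv in simp)
    also have "\<dots> = F (gsum (QP P) (\<lambda>j. \<mu> P (\<xi> j) (g (v j))) m)"
      by (rule mhom_gsum[OF Q.lmodule_axioms X F, symmetric]) (use \<mu>c gv in auto)
    also have "gsum (QP P) (\<lambda>j. \<mu> P (\<xi> j) (g (v j))) m = g"
    proof (rule ext_eqI[of _ "carrier P"])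
      have gs: "gsum (QP P) h n p = gsum (right_mod C) (\<lambda>j. h j p) n" if "p \<in> carrier P" for h n p
        using that by (induction n) auto
      show "gsum (QP P) (\<lambda>j. \<mu> P (\<xi> j) (g (v j))) m p = g p" if p: "p \<in> carrier P" for p
        unfolding gs[OF p] using dual_basis_hom[OF db CR Qm[OF g] p] p by (simp add: \<mu>_def)
      have "gsum (QP P) (\<lambda>j. \<mu> P (\<xi> j) (g (v j))) m \<in> carrier (QP P)" by (rule Q.gsum_closed) (use \<mu>c gv in auto)
      then show "gsum (QP P) (\<lambda>j. \<mu> P (\<xi> j) (g (v j))) m \<in> extensional (carrier P)" by simp
    qed (use g in simp)
    finally show ?thesis .
  qed
qed

text \<open>Agreement is known only on the carrier of the dual, so the inverse formula is compared
  summand by summand: it evaluates only at elements \<open>\<mu> P (\<xi> j) c\<close> of that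
  carrier.\<close>

lemma \<theta>_inject:
  assumes X: "lmodule S X" and db: "dual_basis (opp R) P m v \<xi>"
    and s: "s \<in> carrier (tensor R P (hom_mod S C X))" and t: "t \<in> carrier (tensor R P (hom_mod S C X))"
    and e: "\<And>g. g \<in> carrier (QP P) \<Longrightarrow> \<theta> X s g = \<theta> X t g"
  shows "s = t"
proof -
  have "\<theta>_inv X P m v \<xi> (\<theta> X s) = \<theta>_inv X P m v \<xi> (\<theta> X t)"
    unfolding \<theta>_inv_def
  proof (rule gsum_cong)
    fix j assume j: "j < m"
    have "\<mu> P (\<xi> j) c \<in> carrier (QP P)" if "c \<in> carrier C" for c
      using mhom_closed[OF \<mu>_mhom[OF dual_basisD(1)[OF db] dual_basisD(3)[OF db j]], of c] that by simp
    then have "(\<lambda>c\<in>carrier C. \<theta> X s (\<mu> P (\<xi> j) c)) = (\<lambda>c\<in>carrier C. \<theta> X t (\<mu> P (\<xi> j) c))"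
      using e by (intro restrict_ext) blast
    then show "pure_tensor R P (hom_mod S C X) (v j) (\<lambda>c\<in>carrier C. \<theta> X s (\<mu> P (\<xi> j) c)) =
        pure_tensor R P (hom_mod S C X) (v j) (\<lambda>c\<in>carrier C. \<theta> X t (\<mu> P (\<xi> j) c))" by simp
  qed
  then show ?thesis using \<theta>_bij(1)[OF X db s] \<theta>_bij(1)[OF X db t] by simp
qed

lemma \<theta>_natural:
  assumes X: "lmodule S X" and P: "lmodule (opp R) P" and P': "lmodule (opp R) P'"
    and d: "d \<in> mhom (opp R) P P'" and t: "t \<in> carrier (tensor R P (hom_mod S C X))"
    and g: "g \<in> carrier (QP P')"
  shows "\<theta> X (tensor_map R P P' (hom_mod S C X) d t) g = \<theta> X t (precomp P d g)"
proof -
  have H: "lmodule R (hom_mod S C X)" by (rule lmodule_hom_mod[OF X])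
  interpret T: tensor_pair R P "hom_mod S C X" by (rule tensor_pairI[OF P H])
  have g': "g \<in> mhom (opp R) P' (right_mod C)" using g by simp
  have pg: "precomp P d g \<in> mhom (opp R) P (right_mod C)"
    using two_mod.precomp_mem[OF two_mod_LR P d g'] by simp
  show ?thesis
  proof (rule T.tensor_ahom_eq[OF lmodule_ab[OF X] ahom_comp[OF tensor_map(1)[OF P P' H d] \<theta>_ahom(1)[OF X P' g']]
        \<theta>_ahom(1)[OF X P pg] _ t])
    fix p f assume pf: "p \<in> carrier P" "f \<in> carrier (hom_mod S C X)"
    show "\<theta> X (tensor_map R P P' (hom_mod S C X) d (T.tp p f)) g = \<theta> X (T.tp p f) (precomp P d g)"
      unfolding tensor_map(2)[OF P P' H d pf] \<theta>_ahom(2)[OF X P' g' mhom_closed[OF d pf(1)] pf(2)]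
        \<theta>_ahom(2)[OF X P pg pf] using pf(1) by (simp add: precomp_def)
  qed
qed

end

context foxby
begin

text \<open>The terms of the left resolution and the images of its differentials are finitely
  presented, so \<open>Hom(-, X)\<close> keeps it exact.\<close>

theorem fp_injective_Ext_vanish:
  fixes X :: "('s, 'u) module"
  assumes X: "fp_injective n S X"
  shows "Ext_vanish S Pl dl X"
  unfolding Ext_vanish_def
proof (intro allI ballI impI)
  have Xm: "lmodule S X" using X by (simp add: fp_injective_def)
  fix i f assume f: "f \<in> mhom S (Pl (Suc i)) X" "\<forall>x\<in>carrier (Pl (Suc (Suc i))). f (dl (Suc i) x) = \<zero>\<^bsub>X\<^esub>"
  have "\<exists>k\<in>mhom S (Pl i) X. \<forall>x\<in>carrier (Pl (Suc i)). k (dl i x) = f x"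
    by (rule fp_injective_factor[OF inf smallS X Dl(2) dual_basis_fpg[OF dbl]
          fpg_exact_res(2)[OF resl dual_basis_fpg[OF dbl]] Dl(4) f(1)])
      (use f(2) Dl(9) in metis)
  then show "\<exists>g\<in>mhom S (Pl i) X. \<forall>x\<in>carrier (Pl (Suc i)). f x = g (dl i x)" by (metis (no_types))
qed

text \<open>Under \<open>\<theta>\<close> a cycle \<open>t\<close> becomes a map on the dual of
  \<open>Pr (Suc i)\<close> that kills the image of \<open>\<delta> i\<close>, hence the kernel of
  \<open>\<delta> (Suc i)\<close>. Such a map factors through \<open>\<delta> (Suc i)\<close>, and
  the factor comes from a tensor whose boundary is \<open>t\<close>.\<close>

theorem fp_injective_Tor_vanish:
  fixes X :: "('s, 'u) module"
  assumes X: "fp_injective n S X"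
  shows "Tor_vanish R Pr dr (hom_mod S C X)"
  unfolding Tor_vanish_def
proof (intro allI ballI impI)
  interpret K: dual_complex S "left_mod C" "opp R" "right_mod C" Pr dr er mr vr \<xi>r by (rule dcr)
  have Xm: "lmodule S X" using X by (simp add: fp_injective_def)
  let ?H = "hom_mod S C X"
  have H: "lmodule R ?H" by (rule lmodule_hom_mod[OF Xm])
  fix i t assume t: "t \<in> carrier (tensor R (Pr (Suc i)) ?H)"
    and t0: "tensor_map R (Pr (Suc i)) (Pr i) ?H (dr i) t = \<zero>\<^bsub>tensor R (Pr i) ?H\<^esub>"
  \<comment> \<open>By naturality the value at a coboundary is the value of \<open>\<theta>\<close>
    at the boundary of \<open>t\<close>, which is zero.\<close>
  have z: "\<theta> X t (K.\<delta> i g) = \<zero>\<^bsub>X\<^esub>" if "g \<in> carrier (K.Q i)" for g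
    using \<theta>_natural[OF Xm Dr(2) Dr(2) Dr(4) t that] t0 that
      ahom_zero[OF tensor_pair.abelian_tensor[OF tensor_pairI[OF Dr(2) H]] lmodule_ab[OF Xm] \<theta>_ahom(1)[OF Xm Dr(2), of g]]
    by simp
  have "\<exists>k\<in>mhom S (K.Q (Suc (Suc i))) X. \<forall>g\<in>carrier (K.Q (Suc i)). k (K.\<delta> (Suc i) g) = \<theta> X t g"
    by (rule fp_injective_factor[OF inf smallS X K.Q K.fpgQ K.fpg_image_\<delta> K.\<delta> \<theta>_mhom[OF Xm Dr(2) t]])
      (use K.exact_\<delta> z in metis)
  then obtain k where k: "k \<in> mhom S (K.Q (Suc (Suc i))) X"
    "\<And>g. g \<in> carrier (K.Q (Suc i)) \<Longrightarrow> k (K.\<delta> (Suc i) g) = \<theta> X t g" by blast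
  note b2 = \<theta>_bij[OF Xm dbr[of "Suc (Suc i)"]] and b1 = \<theta>_bij[OF Xm dbr[of "Suc i"]]
  let ?u = "\<theta>_inv X (Pr (Suc (Suc i))) (mr (Suc (Suc i))) (vr (Suc (Suc i))) (\<xi>r (Suc (Suc i))) k"
  let ?t = "tensor_map R (Pr (Suc (Suc i))) (Pr (Suc i)) ?H (dr (Suc i)) ?u"
  have u: "?u \<in> carrier (tensor R (Pr (Suc (Suc i))) ?H)" by (rule b2(2)[OF k(1)])
  have t': "?t \<in> carrier (tensor R (Pr (Suc i)) ?H)" by (rule tensor_map_closed[OF Dr(2) Dr(2) H Dr(4) u])
  have eq: "\<theta> X ?t g = \<theta> X t g" if g: "g \<in> carrier (K.Q (Suc i))" for g
    using \<theta>_natural[OF Xm Dr(2) Dr(2) Dr(4) u g] b2(3)[OF k(1) mhom_closed[OF K.\<delta> g]] k(2)[OF g] by simp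
  show "\<exists>u\<in>carrier (tensor R (Pr (Suc (Suc i))) ?H).
      t = tensor_map R (Pr (Suc (Suc i))) (Pr (Suc i)) ?H (dr (Suc i)) u"
    by (rule bexI[OF _ u], rule \<theta>_inject[OF Xm dbr t t' eq[symmetric]])
qed

end

context foxby
begin

text \<open>After lifting a tensor to \<open>Pr 0\<close>, the evaluation map becomes evaluation of
  \<open>\<theta> X u\<close> at \<open>\<rho>0 \<one>\<close>, which is the augmentation.
  Injectivity is then exactness of the dual complex at its term of index 0, and surjectivity is the
  extension of \<open>s \<mapsto> s y\<close> along the embedding \<open>\<rho>0\<close>.\<close>

theorem fp_injective_counit:
  fixes X :: "('s, 'u) module"
  assumes X: "fp_injective n S X"
  shows "eval_counit X \<in> miso S (tensor_mod R C (hom_mod S C X)) X"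
proof -
  interpret K: dual_complex S "left_mod C" "opp R" "right_mod C" Pr dr er mr vr \<xi>r by (rule dcr)
  have Xm: "lmodule S X" using X by (simp add: fp_injective_def)
  interpret X: lmodule S X by fact
  let ?H = "hom_mod S C X"
  have H: "lmodule R ?H" by (rule lmodule_hom_mod[OF Xm])
  interpret P0: tensor_pair R "Pr 0" ?H by (rule tensor_pairI[OF Dr(2) H])
  interpret TC: tensor_pair R "right_mod C" ?H by (rule tensor_pairI[OF CR H])
  note c = eval_counit[OF Xm]
  note ca = mhom_ahom[OF c(1), unfolded ahom_tensor_mod]
  let ?E = "tensor_map R (Pr 0) (right_mod C) ?H er"
  note E = tensor_map[OF Dr(2) CR H Dr(3)]
  have one: "K.\<rho>0 \<one>\<^bsub>S\<^esub> \<in> carrier (K.Q 0)" using mhom_closed[OF K.\<rho>0] by simp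
  have \<rho>s: "K.\<rho>0 s = s \<odot>\<^bsub>K.Q 0\<^esub> K.\<rho>0 \<one>\<^bsub>S\<^esub>" if "s \<in> carrier S" for s
    using mhom_smult[OF K.\<rho>0, of s "\<one>\<^bsub>S\<^esub>"] that by simp
  have cE1: "eval_counit X (?E u) = \<theta> X u (K.\<rho>0 \<one>\<^bsub>S\<^esub>)" if u: "u \<in> carrier (tensor R (Pr 0) ?H)" for u
  proof -
    have o: "K.\<rho>0 \<one>\<^bsub>S\<^esub> \<in> mhom (opp R) (Pr 0) (right_mod C)" using one by simp
    show ?thesis
    proof (rule P0.tensor_ahom_eq[OF X.abelian_group_axioms ahom_comp[OF E(1) ca] \<theta>_ahom(1)[OF Xm Dr(2) o] _ u])
      fix p f assume pf: "p \<in> carrier (Pr 0)" "f \<in> carrier ?H"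
      have ep: "er p \<in> carrier C" using mhom_closed[OF Dr(3) pf(1)] by simp
      have "K.\<rho>0 \<one>\<^bsub>S\<^esub> p = er p" using pf(1) CL.smult_one ep by (simp add: K.\<rho>_def)
      then show "eval_counit X (?E (P0.tp p f)) = \<theta> X (P0.tp p f) (K.\<rho>0 \<one>\<^bsub>S\<^esub>)"
        unfolding E(2)[OF pf] \<theta>_ahom(2)[OF Xm Dr(2) o pf] using c(2)[OF ep pf(2)] by simp
    qed
  qed
  \<comment> \<open>By linearity the value at \<open>\<rho>0 \<one>\<close> determines
    \<open>\<theta> X u\<close> on the whole image of \<open>\<rho>0\<close>, and this image is the
    kernel of \<open>\<delta> 0\<close>.\<close>
  have cE: "\<theta> X u (K.\<rho>0 s) = s \<odot>\<^bsub>X\<^esub> eval_counit X (?E u)"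
    if u: "u \<in> carrier (tensor R (Pr 0) ?H)" and s: "s \<in> carrier S" for u s
    unfolding cE1[OF u] \<rho>s[OF s] by (rule mhom_smult[OF \<theta>_mhom[OF Xm Dr(2) u] s one])
  show ?thesis
  proof (rule misoI[OF c(1)])
    show "inj_on (eval_counit X) (carrier (tensor_mod R C ?H))"
    proof (rule ahom_inj[OF lmodule_ab[OF lmodule_tensor_mod[OF H]] X.abelian_group_axioms mhom_ahom[OF c(1)]])
      fix t assume "t \<in> carrier (tensor_mod R C ?H)" and t0: "eval_counit X t = \<zero>\<^bsub>X\<^esub>"
      then have t: "t \<in> carrier (tensor R (right_mod C) ?H)" by simp
      obtain u where u: "u \<in> carrier (tensor R (Pr 0) ?H)" "t = ?E u"
        using tensor_map_onto[OF Dr(2) CR H Dr(3) Dr(5) t] by blast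
      have z: "\<theta> X u (K.\<rho>0 s) = \<zero>\<^bsub>X\<^esub>" if "s \<in> carrier S" for s
        unfolding cE[OF u(1) that] u(2)[symmetric] t0 using that by simp
      have "\<exists>k\<in>mhom S (K.Q (Suc 0)) X. \<forall>g\<in>carrier (K.Q 0). k (K.\<delta> 0 g) = \<theta> X u g"
        by (rule fp_injective_factor[OF inf smallS X K.Q K.fpgQ K.fpg_image_\<delta> K.\<delta> \<theta>_mhom[OF Xm Dr(2) u(1)]])
          (use K.exact_\<rho> z in metis)
      then obtain k where k: "k \<in> mhom S (K.Q (Suc 0)) X"
        "\<And>g. g \<in> carrier (K.Q 0) \<Longrightarrow> k (K.\<delta> 0 g) = \<theta> X u g" by blast
      note b1 = \<theta>_bij[OF Xm dbr[of "Suc 0"]]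
      let ?w = "\<theta>_inv X (Pr (Suc 0)) (mr (Suc 0)) (vr (Suc 0)) (\<xi>r (Suc 0)) k"
      let ?u = "tensor_map R (Pr (Suc 0)) (Pr 0) ?H (dr 0) ?w"
      have w: "?w \<in> carrier (tensor R (Pr (Suc 0)) ?H)" by (rule b1(2)[OF k(1)])
      have u': "?u \<in> carrier (tensor R (Pr 0) ?H)" by (rule tensor_map_closed[OF Dr(2) Dr(2) H Dr(4) w])
      have "\<theta> X ?u g = \<theta> X u g" if g: "g \<in> carrier (K.Q 0)" for g
        using \<theta>_natural[OF Xm Dr(2) Dr(2) Dr(4) w g] b1(3)[OF k(1) mhom_closed[OF K.\<delta> g]] k(2)[OF g] by simp
      then have "?u = u" by (rule \<theta>_inject[OF Xm dbr u' u(1)])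
      then have "t = tensor_map R (Pr (Suc 0)) (right_mod C) ?H (\<lambda>x. er (dr 0 x)) ?w"
        using u(2) tensor_map_comp[OF Dr(2) Dr(2) CR H Dr(4) Dr(3) w] by simp
      also have "\<dots> = \<zero>\<^bsub>tensor R (right_mod C) ?H\<^esub>"
        by (rule tensor_map_zero[OF Dr(2) CR H mhom_comp[OF Dr(4) Dr(3)] Dr(6) w])
      finally show "t = \<zero>\<^bsub>tensor_mod R C ?H\<^esub>" by simp
    qed
    show "eval_counit X ` carrier (tensor_mod R C ?H) = carrier X"
    proof
      show "eval_counit X ` carrier (tensor_mod R C ?H) \<subseteq> carrier X" using mhom_closed[OF c(1)] by blast
      show "carrier X \<subseteq> eval_counit X ` carrier (tensor_mod R C ?H)"
      proof
        fix y assume y: "y \<in> carrier X"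
        have "(\<lambda>s. s \<odot>\<^bsub>X\<^esub> y) \<in> mhom S (reg S) X"
          by (rule smult_mhom_reg[OF Xm y mhom_id])
        then have "\<exists>k\<in>mhom S (K.Q 0) X. \<forall>s\<in>carrier (reg S). k (K.\<rho>0 s) = s \<odot>\<^bsub>X\<^esub> y"
        proof (rule fp_injective_factor[OF inf smallS X K.regA K.fpgQ K.fpg_image_\<rho> K.\<rho>0])
          fix s assume s: "s \<in> carrier (reg S)" "K.\<rho>0 s = \<zero>\<^bsub>K.Q 0\<^esub>"
          have z: "\<zero>\<^bsub>S\<^esub> \<in> carrier (reg S)" by simp
          have "K.\<rho>0 \<zero>\<^bsub>S\<^esub> = \<zero>\<^bsub>K.Q 0\<^esub>" using mhom_zero[OF K.regA K.Q K.\<rho>0] by simp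
          then have "s = \<zero>\<^bsub>S\<^esub>" using inj_onD[OF K.inj_\<rho> _ s(1) z] s(2) by simp
          then show "s \<odot>\<^bsub>X\<^esub> y = \<zero>\<^bsub>X\<^esub>" using y by simp
        qed
        then obtain k where k: "k \<in> mhom S (K.Q 0) X" "\<And>s. s \<in> carrier S \<Longrightarrow> k (K.\<rho>0 s) = s \<odot>\<^bsub>X\<^esub> y" by auto
        note b0 = \<theta>_bij[OF Xm dbr[of 0]]
        let ?u = "\<theta>_inv X (Pr 0) (mr 0) (vr 0) (\<xi>r 0) k"
        have u: "?u \<in> carrier (tensor R (Pr 0) ?H)" by (rule b0(2)[OF k(1)])
        have "eval_counit X (?E ?u) = y"
          unfolding cE1[OF u] b0(3)[OF k(1) one] using k(2)[of "\<one>\<^bsub>S\<^esub>"] y by simp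
        moreover have "?E ?u \<in> carrier (tensor_mod R C ?H)" using ahom_closed[OF E(1) u] by simp
        ultimately show "y \<in> eval_counit X ` carrier (tensor_mod R C ?H)" by (metis imageI)
      qed
    qed
  qed
qed

end

section \<open>\<open>fp\<^sub>n\<close>-flat modules lie in the Auslander class\<close>

text \<open>\<open>\<gamma>\<close> is the map \<open>Hom\<^sub>S(P, C) \<otimes>\<^sub>R Y \<rightarrow> Hom\<^sub>S(P, C \<otimes>\<^sub>R Y)\<close>, \<open>g \<otimes> y \<mapsto> (p \<mapsto> g p \<otimes> y)\<close>.\<close>

context bimod
begin

abbreviation "QL P \<equiv> homL (right_mod C) S P (left_mod C)"

definition \<gamma> :: "('r, 'b) module \<Rightarrow> (('p \<Rightarrow> 'c) \<times> 'b \<Rightarrow>\<^sub>0 int) set \<Rightarrow> 'p \<Rightarrow> ('c \<times> 'b \<Rightarrow>\<^sub>0 int) set"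
  where "\<gamma> Y t p = tlift (tensor R (right_mod C) Y) (\<lambda>g y. pure_tensor R (right_mod C) Y (g p) y) t"

lemma lmodule_QL: "lmodule S P \<Longrightarrow> lmodule (opp R) (QL P)"
  by (rule two_mod.lmodule_homL[OF two_mod_RL])

lemma \<gamma>_ahom:
  assumes Y: "lmodule R Y" and P: "lmodule S P" and p: "p \<in> carrier P"
  shows "(\<lambda>t. \<gamma> Y t p) \<in> ahom (tensor R (QL P) Y) (tensor R (right_mod C) Y)"
    "\<And>g y. g \<in> carrier (QL P) \<Longrightarrow> y \<in> carrier Y \<Longrightarrow>
      \<gamma> Y (pure_tensor R (QL P) Y g y) p = pure_tensor R (right_mod C) Y (g p) y"
proof -
  interpret T: tensor_pair R "QL P" Y by (rule tensor_pairI[OF lmodule_QL[OF P] Y])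
  interpret U: tensor_pair R "right_mod C" Y by (rule tensor_pairI[OF CR Y])
  note L = T.tlift[OF U.abelian_tensor, of "\<lambda>g y. U.tp (g p) y"]
  have gc: "g p \<in> carrier (right_mod C)" if "g \<in> carrier (QL P)" for g
    using that mhom_closed[of g S P "left_mod C" p] p by simp
  have 1: "U.tp (g p) y \<in> carrier (tensor R (right_mod C) Y)" if "g \<in> carrier (QL P)" "y \<in> carrier Y" for g y
    using gc that by blast
  have 2: "U.tp ((g \<oplus>\<^bsub>QL P\<^esub> g') p) y = U.tp (g p) y \<oplus>\<^bsub>tensor R (right_mod C) Y\<^esub> U.tp (g' p) y"
    if "g \<in> carrier (QL P)" "g' \<in> carrier (QL P)" "y \<in> carrier Y" for g g' y
    using U.tp_add_l[OF gc[OF that(1)] gc[OF that(2)] that(3)] p by simp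
  have 3: "U.tp (g p) (y \<oplus>\<^bsub>Y\<^esub> y') = U.tp (g p) y \<oplus>\<^bsub>tensor R (right_mod C) Y\<^esub> U.tp (g p) y'"
    if "g \<in> carrier (QL P)" "y \<in> carrier Y" "y' \<in> carrier Y" for g y y'
    using U.tp_add_r[OF gc[OF that(1)] that(2,3)] .
  have 4: "U.tp ((r \<odot>\<^bsub>QL P\<^esub> g) p) y = U.tp (g p) (r \<odot>\<^bsub>Y\<^esub> y)"
    if "r \<in> carrier R" "g \<in> carrier (QL P)" "y \<in> carrier Y" for r g y
    using U.tp_bal[OF that(1) gc[OF that(2)] that(3)] p by simp
  show "(\<lambda>t. \<gamma> Y t p) \<in> ahom (tensor R (QL P) Y) (tensor R (right_mod C) Y)"
    unfolding \<gamma>_def by (rule L(1)) (fact 1 2 3 4)+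
  show "\<gamma> Y (T.tp g y) p = U.tp (g p) y" if "g \<in> carrier (QL P)" "y \<in> carrier Y" for g y
    unfolding \<gamma>_def by (rule L(2)) (fact 1 2 3 4 that)+
qed

lemma \<gamma>_mhom:
  assumes Y: "lmodule R Y" and P: "lmodule S P" and t: "t \<in> carrier (tensor R (QL P) Y)"
  shows "\<gamma> Y t \<in> mhom S P (tensor_mod R C Y)"
proof (rule mhomI)
  interpret P: lmodule S P by fact
  interpret T: tensor_pair R "QL P" Y by (rule tensor_pairI[OF lmodule_QL[OF P] Y])
  interpret U: tensor_pair R "right_mod C" Y by (rule tensor_pairI[OF CR Y])
  interpret M: lmodule S "tensor_mod R C Y" by (rule lmodule_tensor_mod[OF Y])
  note gm = \<gamma>_ahom[OF Y P]
  have gc: "g p \<in> carrier C" if "g \<in> carrier (QL P)" "p \<in> carrier P" for g p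
    using that mhom_closed[of g S P "left_mod C" p] by simp
  show "\<gamma> Y t p \<in> carrier (tensor_mod R C Y)" if "p \<in> carrier P" for p
    using ahom_closed[OF gm(1)[OF that] t] by simp
  show "\<gamma> Y t (p \<oplus>\<^bsub>P\<^esub> q) = \<gamma> Y t p \<oplus>\<^bsub>tensor_mod R C Y\<^esub> \<gamma> Y t q" if p: "p \<in> carrier P" "q \<in> carrier P" for p q
    unfolding tensor_mod_simps
  proof (rule T.tensor_ahom_eq[OF U.abelian_tensor gm(1)[OF P.a_closed[OF p]]
        ahom_add_map[OF U.abelian_tensor gm(1)[OF p(1)] gm(1)[OF p(2)]] _ t])
    fix g y assume gy: "g \<in> carrier (QL P)" "y \<in> carrier Y"
    show "\<gamma> Y (T.tp g y) (p \<oplus>\<^bsub>P\<^esub> q) = \<gamma> Y (T.tp g y) p \<oplus>\<^bsub>tensor R (right_mod C) Y\<^esub> \<gamma> Y (T.tp g y) q"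
      unfolding gm(2)[OF P.a_closed[OF p] gy] gm(2)[OF p(1) gy] gm(2)[OF p(2) gy]
      using mhom_add[of g S P "left_mod C" p q] gy p U.tp_add_l gc by simp
  qed
  show "\<gamma> Y t (s \<odot>\<^bsub>P\<^esub> p) = s \<odot>\<^bsub>tensor_mod R C Y\<^esub> \<gamma> Y t p" if s: "s \<in> carrier S" and p: "p \<in> carrier P" for s p
  proof (rule T.tensor_ahom_eq[OF M.abelian_group_axioms _ _ _ t])
    show "(\<lambda>t. \<gamma> Y t (s \<odot>\<^bsub>P\<^esub> p)) \<in> ahom (tensor R (QL P) Y) (tensor_mod R C Y)"
      unfolding ahom_tensor_mod by (rule gm(1)[OF P.smult_closed[OF s p]])
    show "(\<lambda>t. s \<odot>\<^bsub>tensor_mod R C Y\<^esub> \<gamma> Y t p) \<in> ahom (tensor R (QL P) Y) (tensor_mod R C Y)"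
      by (rule ahom_comp[OF gm(1)[OF p, unfolded ahom_tensor_mod(2)[symmetric]] M.smult_ahom[OF s]])
    fix g y assume gy: "g \<in> carrier (QL P)" "y \<in> carrier Y"
    show "\<gamma> Y (T.tp g y) (s \<odot>\<^bsub>P\<^esub> p) = s \<odot>\<^bsub>tensor_mod R C Y\<^esub> \<gamma> Y (T.tp g y) p"
      unfolding gm(2)[OF P.smult_closed[OF s p] gy] gm(2)[OF p gy] smult_tp[OF Y s gc[OF gy(1) p] gy(2)]
      using mhom_smult[of g S P "left_mod C" s p] gy s p by simp
  qed
qed

text \<open>Mirror image of \<open>\<mu>\<close> for left modules: the rank one map attached to a
  functional and an element of C.\<close>

definition \<nu> :: "('s, 'p) module \<Rightarrow> ('p \<Rightarrow> 's) \<Rightarrow> 'c \<Rightarrow> 'p \<Rightarrow> 'c"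
  where "\<nu> P \<zeta> c = (\<lambda>p\<in>carrier P. \<zeta> p \<odot>\<^bsub>C\<^esub> c)"

lemma \<nu>_mhom:
  assumes P: "lmodule S P" and z: "\<zeta> \<in> mhom S P (reg S)"
  shows "\<nu> P \<zeta> \<in> mhom (opp R) (right_mod C) (QL P)"
proof (rule mhomI)
  have zc: "\<zeta> p \<in> carrier S" if "p \<in> carrier P" for p using mhom_closed[OF z that] by simp
  show "\<nu> P \<zeta> c \<in> carrier (QL P)" if "c \<in> carrier (right_mod C)" for c
    unfolding \<nu>_def using mhom_restrict[OF P smult_mhom_reg[OF CL _ z]] that by simp
  show "\<nu> P \<zeta> (c \<oplus>\<^bsub>right_mod C\<^esub> c') = \<nu> P \<zeta> c \<oplus>\<^bsub>QL P\<^esub> \<nu> P \<zeta> c'"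
    if "c \<in> carrier (right_mod C)" "c' \<in> carrier (right_mod C)" for c c'
    using that zc CL.smult_r_distr by (auto simp: \<nu>_def intro!: restrict_ext)
  show "\<nu> P \<zeta> (r \<odot>\<^bsub>right_mod C\<^esub> c) = r \<odot>\<^bsub>QL P\<^esub> \<nu> P \<zeta> c" if "r \<in> carrier (opp R)" "c \<in> carrier (right_mod C)" for r c
    using that zc comm by (auto simp: \<nu>_def intro!: restrict_ext)
qed

text \<open>A map \<open>F\<close> out of \<open>P\<close> is known from the tensors
  \<open>F (v j)\<close>; each is pushed into \<open>Hom(P, C) \<otimes> Y\<close> by replacing its
  component \<open>c\<close> in C by \<open>\<nu> P (\<xi> j) c\<close>.\<close>

definition \<gamma>_inv :: "('r, 'b) module \<Rightarrow> ('s, 'p) module \<Rightarrow> nat \<Rightarrow> (nat \<Rightarrow> 'p) \<Rightarrow> (nat \<Rightarrow> 'p \<Rightarrow> 's) \<Rightarrow>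
    ('p \<Rightarrow> ('c \<times> 'b \<Rightarrow>\<^sub>0 int) set) \<Rightarrow> (('p \<Rightarrow> 'c) \<times> 'b \<Rightarrow>\<^sub>0 int) set"
  where "\<gamma>_inv Y P m v \<xi> F = gsum (tensor R (QL P) Y)
    (\<lambda>j. tensor_map R (right_mod C) (QL P) Y (\<nu> P (\<xi> j)) (F (v j))) m"

text \<open>Starting from \<open>F\<close>, the \<open>j\<close>-th summand evaluated at
  \<open>p\<close> is \<open>F (v j)\<close> multiplied by \<open>\<xi> j p\<close>, as
  \<open>key\<close> shows, and the dual basis expansion of \<open>F p\<close> adds these up.
  Starting from a pure tensor, \<open>g\<close> is the sum of the maps
  \<open>\<nu> P (\<xi> j) (g (v j))\<close>.\<close>

lemma \<gamma>_bij:
  assumes Y: "lmodule R Y" and db: "dual_basis S P m v \<xi>"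
  shows "\<And>t. t \<in> carrier (tensor R (QL P) Y) \<Longrightarrow> \<gamma>_inv Y P m v \<xi> (\<gamma> Y t) = t"
    "\<And>F. F \<in> mhom S P (tensor_mod R C Y) \<Longrightarrow> \<gamma>_inv Y P m v \<xi> F \<in> carrier (tensor R (QL P) Y)"
    "\<And>F p. F \<in> mhom S P (tensor_mod R C Y) \<Longrightarrow> p \<in> carrier P \<Longrightarrow> \<gamma> Y (\<gamma>_inv Y P m v \<xi> F) p = F p"
proof -
  note D = dual_basisD[OF db]
  have QP: "lmodule (opp R) (QL P)" by (rule lmodule_QL[OF D(1)])
  have M: "lmodule S (tensor_mod R C Y)" by (rule lmodule_tensor_mod[OF Y])
  interpret P: lmodule S P by (rule D(1))
  interpret Q: lmodule "opp R" "QL P" by (rule QP)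
  interpret T: tensor_pair R "QL P" Y by (rule tensor_pairI[OF QP Y])
  interpret U: tensor_pair R "right_mod C" Y by (rule tensor_pairI[OF CR Y])
  interpret M: lmodule S "tensor_mod R C Y" by (rule M)
  note gm = \<gamma>_ahom[OF Y D(1)]
  note \<nu> = \<nu>_mhom[OF D(1) D(3)]
  note tm = tensor_map[OF CR QP Y \<nu>]
  have Fc: "F p \<in> carrier (tensor R (right_mod C) Y)" if "F \<in> mhom S P (tensor_mod R C Y)" "p \<in> carrier P" for F p
    using mhom_closed[OF that] by simp
  show 2: "\<gamma>_inv Y P m v \<xi> F \<in> carrier (tensor R (QL P) Y)" if F: "F \<in> mhom S P (tensor_mod R C Y)" for F
    unfolding \<gamma>_inv_def by (rule T.TT.gsum_closed) (use ahom_closed[OF tm(1)] Fc[OF F D(2)] in blast)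
  have ad: "(\<lambda>t. \<gamma>_inv Y P m v \<xi> (\<gamma> Y t)) \<in> ahom (tensor R (QL P) Y) (tensor R (QL P) Y)"
  proof (rule ahomI)
    show "\<gamma>_inv Y P m v \<xi> (\<gamma> Y t) \<in> carrier (tensor R (QL P) Y)" if "t \<in> carrier (tensor R (QL P) Y)" for t
      by (rule 2[OF \<gamma>_mhom[OF Y D(1) that]])
    fix s t assume st: "s \<in> carrier (tensor R (QL P) Y)" "t \<in> carrier (tensor R (QL P) Y)"
    let ?a = "\<lambda>j t. tensor_map R (right_mod C) (QL P) Y (\<nu> P (\<xi> j)) (\<gamma> Y t (v j))"
    have c: "?a j t \<in> carrier (tensor R (QL P) Y)" if "j < m" "t \<in> carrier (tensor R (QL P) Y)" for j t
      by (rule ahom_closed[OF tm(1)[OF that(1)] ahom_closed[OF gm(1)[OF D(2)[OF that(1)]] that(2)]])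
    have "?a j (s \<oplus>\<^bsub>tensor R (QL P) Y\<^esub> t) = ?a j s \<oplus>\<^bsub>tensor R (QL P) Y\<^esub> ?a j t" if "j < m" for j
      by (rule ahom_add[OF ahom_comp[OF gm(1)[OF D(2)[OF that]] tm(1)[OF that]] st])
    then have "\<gamma>_inv Y P m v \<xi> (\<gamma> Y (s \<oplus>\<^bsub>tensor R (QL P) Y\<^esub> t)) =
        gsum (tensor R (QL P) Y) (\<lambda>j. ?a j s \<oplus>\<^bsub>tensor R (QL P) Y\<^esub> ?a j t) m"
      unfolding \<gamma>_inv_def by (intro gsum_cong) auto
    also have "\<dots> = \<gamma>_inv Y P m v \<xi> (\<gamma> Y s) \<oplus>\<^bsub>tensor R (QL P) Y\<^esub> \<gamma>_inv Y P m v \<xi> (\<gamma> Y t)"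
      unfolding \<gamma>_inv_def by (rule T.TT.gsum_add) (use c st in auto)
    finally show "\<gamma>_inv Y P m v \<xi> (\<gamma> Y (s \<oplus>\<^bsub>tensor R (QL P) Y\<^esub> t)) =
        \<gamma>_inv Y P m v \<xi> (\<gamma> Y s) \<oplus>\<^bsub>tensor R (QL P) Y\<^esub> \<gamma>_inv Y P m v \<xi> (\<gamma> Y t)" .
  qed
  show "\<gamma>_inv Y P m v \<xi> (\<gamma> Y t) = t" if t: "t \<in> carrier (tensor R (QL P) Y)" for t
  proof (rule T.tensor_ahom_eq[OF T.abelian_tensor ad ahom_id _ t])
    fix g y assume gy: "g \<in> carrier (QL P)" "y \<in> carrier Y"
    have g: "g \<in> mhom S P (left_mod C)" using gy(1) by simp
    have gv: "g (v j) \<in> carrier (right_mod C)" if "j < m" for j using mhom_closed[OF g D(2)[OF that]] by simp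
    have nc: "\<nu> P (\<xi> j) (g (v j)) \<in> carrier (QL P)" if "j < m" for j by (rule mhom_closed[OF \<nu>[OF that] gv[OF that]])
    have "\<gamma>_inv Y P m v \<xi> (\<gamma> Y (T.tp g y)) = gsum (tensor R (QL P) Y) (\<lambda>j. T.tp (\<nu> P (\<xi> j) (g (v j))) y) m"
      unfolding \<gamma>_inv_def
    proof (rule gsum_cong)
      fix j assume j: "j < m"
      show "tensor_map R (right_mod C) (QL P) Y (\<nu> P (\<xi> j)) (\<gamma> Y (T.tp g y) (v j)) = T.tp (\<nu> P (\<xi> j) (g (v j))) y"
        unfolding gm(2)[OF D(2)[OF j] gy] by (rule tm(2)[OF j gv[OF j] gy(2)])
    qed
    also have "\<dots> = T.tp (gsum (QL P) (\<lambda>j. \<nu> P (\<xi> j) (g (v j))) m) y"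
      by (rule ahom_gsum[OF Q.abelian_group_axioms T.abelian_tensor T.tp_ahom_l[OF gy(2)] nc, symmetric])
    also have "gsum (QL P) (\<lambda>j. \<nu> P (\<xi> j) (g (v j))) m = g"
    proof (rule ext_eqI[of _ "carrier P"])
      have gs: "gsum (QL P) h n p = gsum (left_mod C) (\<lambda>j. h j p) n" if "p \<in> carrier P" for h n p
        using that by (induction n) auto
      show "gsum (QL P) (\<lambda>j. \<nu> P (\<xi> j) (g (v j))) m p = g p" if p: "p \<in> carrier P" for p
        unfolding gs[OF p] using dual_basis_hom[OF db CL g p] p by (simp add: \<nu>_def)
      have "gsum (QL P) (\<lambda>j. \<nu> P (\<xi> j) (g (v j))) m \<in> carrier (QL P)" by (rule Q.gsum_closed[OF nc])
      then show "gsum (QL P) (\<lambda>j. \<nu> P (\<xi> j) (g (v j))) m \<in> extensional (carrier P)" by simp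
    qed (use gy in simp)
    finally show "\<gamma>_inv Y P m v \<xi> (\<gamma> Y (T.tp g y)) = T.tp g y" .
  qed
  show "\<gamma> Y (\<gamma>_inv Y P m v \<xi> F) p = F p" if F: "F \<in> mhom S P (tensor_mod R C Y)" and p: "p \<in> carrier P" for F p
  proof -
    have key: "\<gamma> Y (tensor_map R (right_mod C) (QL P) Y (\<nu> P (\<xi> j)) t) p = \<xi> j p \<odot>\<^bsub>tensor_mod R C Y\<^esub> t"
      if j: "j < m" and t: "t \<in> carrier (tensor R (right_mod C) Y)" for j t
    proof (rule U.tensor_ahom_eq[OF M.abelian_group_axioms _ _ _ t])
      note x = D(5)[OF j p]
      show "(\<lambda>t. \<gamma> Y (tensor_map R (right_mod C) (QL P) Y (\<nu> P (\<xi> j)) t) p) \<in> ahom (tensor R (right_mod C) Y) (tensor_mod R C Y)"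
        unfolding ahom_tensor_mod by (rule ahom_comp[OF tm(1)[OF j] gm(1)[OF p]])
      show "(\<lambda>t. \<xi> j p \<odot>\<^bsub>tensor_mod R C Y\<^esub> t) \<in> ahom (tensor R (right_mod C) Y) (tensor_mod R C Y)"
        using M.smult_ahom[OF x] unfolding ahom_tensor_mod .
      fix c y assume cy: "c \<in> carrier (right_mod C)" "y \<in> carrier Y"
      then have cC: "c \<in> carrier C" by simp
      show "\<gamma> Y (tensor_map R (right_mod C) (QL P) Y (\<nu> P (\<xi> j)) (U.tp c y)) p = \<xi> j p \<odot>\<^bsub>tensor_mod R C Y\<^esub> U.tp c y"
        unfolding tm(2)[OF j cy] gm(2)[OF p mhom_closed[OF \<nu>[OF j] cy(1)] cy(2)] smult_tp[OF Y x cC cy(2)]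
        using p by (simp add: \<nu>_def)
    qed
    have "\<gamma> Y (\<gamma>_inv Y P m v \<xi> F) p = gsum (tensor R (right_mod C) Y)
        (\<lambda>j. \<gamma> Y (tensor_map R (right_mod C) (QL P) Y (\<nu> P (\<xi> j)) (F (v j))) p) m"
      unfolding \<gamma>_inv_def
      by (rule ahom_gsum[OF T.abelian_tensor U.abelian_tensor gm(1)[OF p]])
        (use ahom_closed[OF tm(1)] Fc[OF F D(2)] in blast)
    also have "\<dots> = gsum (tensor R (right_mod C) Y) (\<lambda>j. \<xi> j p \<odot>\<^bsub>tensor_mod R C Y\<^esub> F (v j)) m"
      by (rule gsum_cong) (rule key[OF _ Fc[OF F D(2)]])
    also have "\<dots> = gsum (tensor_mod R C Y) (\<lambda>j. \<xi> j p \<odot>\<^bsub>tensor_mod R C Y\<^esub> F (v j)) m"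
    proof -
      have "gsum (tensor R (right_mod C) Y) h n = gsum (tensor_mod R C Y) h n" for h n by (induction n) simp_all
      then show ?thesis .
    qed
    also have "\<dots> = F p" by (rule dual_basis_hom[OF db M F p, symmetric])
    finally show ?thesis .
  qed
qed

lemma \<gamma>_inject:
  assumes Y: "lmodule R Y" and db: "dual_basis S P m v \<xi>"
    and s: "s \<in> carrier (tensor R (QL P) Y)" and t: "t \<in> carrier (tensor R (QL P) Y)"
    and e: "\<And>p. p \<in> carrier P \<Longrightarrow> \<gamma> Y s p = \<gamma> Y t p"
  shows "s = t"
proof -
  have "\<gamma>_inv Y P m v \<xi> (\<gamma> Y s) = \<gamma>_inv Y P m v \<xi> (\<gamma> Y t)"
    unfolding \<gamma>_inv_def by (rule gsum_cong) (use e dual_basisD(2)[OF db] in simp)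
  then show ?thesis using \<gamma>_bij(1)[OF Y db s] \<gamma>_bij(1)[OF Y db t] by simp
qed

lemma \<gamma>_zero:
  assumes "lmodule R Y" "lmodule S P" "p \<in> carrier P"
  shows "\<gamma> Y \<zero>\<^bsub>tensor R (QL P) Y\<^esub> p = \<zero>\<^bsub>tensor R (right_mod C) Y\<^esub>"
  by (rule ahom_zero[OF tensor_pair.abelian_tensor[OF tensor_pairI[OF lmodule_QL[OF assms(2)] assms(1)]]
        tensor_pair.abelian_tensor[OF tensor_pairI[OF CR assms(1)]] \<gamma>_ahom(1)[OF assms]])

lemma \<gamma>_natural:
  assumes Y: "lmodule R Y" and P: "lmodule S P" and P': "lmodule S P'"
    and d: "d \<in> mhom S P P'" and t: "t \<in> carrier (tensor R (QL P') Y)" and p: "p \<in> carrier P"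
  shows "\<gamma> Y (tensor_map R (QL P') (QL P) Y (precomp P d) t) p = \<gamma> Y t (d p)"
proof -
  note Q = lmodule_QL[OF P] and Q' = lmodule_QL[OF P']
  note pm = two_mod.precomp_mhom[OF two_mod_RL P d]
  interpret T: tensor_pair R "QL P'" Y by (rule tensor_pairI[OF Q' Y])
  note dp = mhom_closed[OF d p]
  show ?thesis
  proof (rule T.tensor_ahom_eq[OF tensor_pair.abelian_tensor[OF tensor_pairI[OF CR Y]]
        ahom_comp[OF tensor_map(1)[OF Q' Q Y pm] \<gamma>_ahom(1)[OF Y P p]] \<gamma>_ahom(1)[OF Y P' dp] _ t])
    fix g y assume gy: "g \<in> carrier (QL P')" "y \<in> carrier Y"
    show "\<gamma> Y (tensor_map R (QL P') (QL P) Y (precomp P d) (T.tp g y)) p = \<gamma> Y (T.tp g y) (d p)"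
      unfolding tensor_map(2)[OF Q' Q Y pm gy] \<gamma>_ahom(2)[OF Y P p mhom_closed[OF pm gy(1)] gy(2)]
        \<gamma>_ahom(2)[OF Y P' dp gy] using p by (simp add: precomp_def)
  qed
qed

end

context foxby
begin

theorem fp_flat_Tor_vanish:
  fixes Y :: "('r, 'u) module"
  assumes Y: "fp_flat n R Y"
  shows "Tor_vanish R Pr dr Y"
  unfolding Tor_vanish_def
proof (intro allI ballI impI)
  fix i t assume t: "t \<in> carrier (tensor R (Pr (Suc i)) Y)"
    "tensor_map R (Pr (Suc i)) (Pr i) Y (dr i) t = \<zero>\<^bsub>tensor R (Pr i) Y\<^esub>"
  show "\<exists>u\<in>carrier (tensor R (Pr (Suc (Suc i))) Y).
      t = tensor_map R (Pr (Suc (Suc i))) (Pr (Suc i)) Y (dr (Suc i)) u"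
    by (rule fp_flat_exact[OF inf smallR Y Dr(2) Dr(2) dual_basis_fpg[OF dbr]
          fpg_exact_res(2)[OF resr dual_basis_fpg[OF dbr]] Dr(4) Dr(4) Dr(9) t])
qed

text \<open>A cocycle is \<open>\<gamma>\<close> of a tensor that, by naturality, the next
  differential kills. Flatness of \<open>Y\<close> on the dual complex writes this tensor as an
  image, and \<open>\<gamma>\<close> of the preimage is the required map.\<close>

theorem fp_flat_Ext_vanish:
  fixes Y :: "('r, 'u) module"
  assumes Y: "fp_flat n R Y"
  shows "Ext_vanish S Pl dl (tensor_mod R C Y)"
  unfolding Ext_vanish_def
proof (intro allI ballI impI)
  interpret K: dual_complex "opp R" "right_mod C" S "left_mod C" Pl dl el ml vl \<xi>l by (rule dcl)
  have Ym: "lmodule R Y" using Y by (simp add: fp_flat_def)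
  fix i F assume F: "F \<in> mhom S (Pl (Suc i)) (tensor_mod R C Y)"
    and F0: "\<forall>x\<in>carrier (Pl (Suc (Suc i))). F (dl (Suc i) x) = \<zero>\<^bsub>tensor_mod R C Y\<^esub>"
  note b1 = \<gamma>_bij[OF Ym dbl[of "Suc i"]]
  let ?t = "\<gamma>_inv Y (Pl (Suc i)) (ml (Suc i)) (vl (Suc i)) (\<xi>l (Suc i)) F"
  have t: "?t \<in> carrier (tensor R (K.Q (Suc i)) Y)" by (rule b1(2)[OF F])
  have t0: "tensor_map R (K.Q (Suc i)) (K.Q (Suc (Suc i))) Y (K.\<delta> (Suc i)) ?t = \<zero>\<^bsub>tensor R (K.Q (Suc (Suc i))) Y\<^esub>"
  proof (rule \<gamma>_inject[OF Ym dbl tensor_map_closed[OF K.Q K.Q Ym K.\<delta> t]])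
    interpret T: tensor_pair R "K.Q (Suc (Suc i))" Y by (rule tensor_pairI[OF K.Q Ym])
    show "\<zero>\<^bsub>tensor R (K.Q (Suc (Suc i))) Y\<^esub> \<in> carrier (tensor R (K.Q (Suc (Suc i))) Y)" by simp
    fix p assume p: "p \<in> carrier (Pl (Suc (Suc i)))"
    show "\<gamma> Y (tensor_map R (K.Q (Suc i)) (K.Q (Suc (Suc i))) Y (K.\<delta> (Suc i)) ?t) p = \<gamma> Y \<zero>\<^bsub>tensor R (K.Q (Suc (Suc i))) Y\<^esub> p"
      unfolding \<gamma>_natural[OF Ym Dl(2) Dl(2) Dl(4) t p] b1(3)[OF F mhom_closed[OF Dl(4) p]] \<gamma>_zero[OF Ym Dl(2) p]
      using F0 p by simp
  qed
  obtain u where u: "u \<in> carrier (tensor R (K.Q i) Y)" "?t = tensor_map R (K.Q i) (K.Q (Suc i)) Y (K.\<delta> i) u"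
    using fp_flat_exact[OF inf smallR Y K.Q K.Q K.fpgQ K.fpg_image_\<delta> K.\<delta> K.\<delta> K.exact_\<delta> t t0] by blast
  have "F x = \<gamma> Y u (dl i x)" if x: "x \<in> carrier (Pl (Suc i))" for x
    using b1(3)[OF F x] \<gamma>_natural[OF Ym Dl(2) Dl(2) Dl(4) u(1) x] unfolding u(2) by simp
  then show "\<exists>g\<in>mhom S (Pl i) (tensor_mod R C Y). \<forall>x\<in>carrier (Pl (Suc i)). F x = g (dl i x)"
    using \<gamma>_mhom[OF Ym Dl(2) u(1)] by blast
qed

text \<open>The unit is compared with \<open>y \<mapsto> \<one> \<otimes> y\<close> followed by the
  map that \<open>\<rho>0\<close> induces. Flatness makes the latter injective, and exactness of the
  tensored dual complex at its term of index 0 gives surjectivity.\<close>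

theorem fp_flat_unit:
  fixes Y :: "('r, 'u) module"
  assumes Y: "fp_flat n R Y"
  shows "eval_unit R C Y \<in> miso R Y (hom_mod S C (tensor_mod R C Y))"
proof -
  interpret K: dual_complex "opp R" "right_mod C" S "left_mod C" Pl dl el ml vl \<xi>l by (rule dcl)
  have Ym: "lmodule R Y" using Y by (simp add: fp_flat_def)
  interpret Y: lmodule R Y by fact
  interpret R: ring R by (rule ringR)
  let ?T = "tensor_mod R C Y"
  have T: "lmodule S ?T" by (rule lmodule_tensor_mod[OF Ym])
  let ?G = "reg (opp R)"
  interpret G: tensor_pair R ?G Y by (rule tensor_pairI[OF K.regA Ym])
  interpret Q0: tensor_pair R "K.Q 0" Y by (rule tensor_pairI[OF K.Q Ym])
  interpret U: tensor_pair R "right_mod C" Y by (rule tensor_pairI[OF CR Ym])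
  let ?r = "tensor_map R ?G (K.Q 0) Y K.\<rho>0"
  note r = tensor_map[OF K.regA K.Q Ym K.\<rho>0]
  have one: "\<one>\<^bsub>R\<^esub> \<in> carrier ?G" by simp
  have r1: "\<gamma> Y (?r (G.tp \<one>\<^bsub>R\<^esub> y)) p = U.tp (el p) y" if "y \<in> carrier Y" "p \<in> carrier (Pl 0)" for y p
  proof -
    have ep: "el p \<in> carrier C" using mhom_closed[OF Dl(3) that(2)] by simp
    show ?thesis
      unfolding r(2)[OF one that(1)] \<gamma>_ahom(2)[OF Ym Dl(2) that(2) mhom_closed[OF K.\<rho>0 one] that(1)]
      using CR.smult_one ep that(2) by (simp add: K.\<rho>_def)
  qed
  note u = eval_unit_mhom[OF Ym]
  show ?thesis
  proof (rule misoI[OF u])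
    show "inj_on (eval_unit R C Y) (carrier Y)"
    proof (rule ahom_inj[OF Y.abelian_group_axioms lmodule_ab[OF lmodule_hom_mod[OF T]] mhom_ahom[OF u]])
      fix y assume y: "y \<in> carrier Y" "eval_unit R C Y y = \<zero>\<^bsub>hom_mod S C ?T\<^esub>"
      have z: "U.tp c y = \<zero>\<^bsub>tensor R (right_mod C) Y\<^esub>" if "c \<in> carrier C" for c
        using fun_cong[OF y(2), of c] that by (simp add: eval_unit_def)
      have "?r (G.tp \<one>\<^bsub>R\<^esub> y) = \<zero>\<^bsub>tensor R (K.Q 0) Y\<^esub>"
      proof (rule \<gamma>_inject[OF Ym dbl])
        show "?r (G.tp \<one>\<^bsub>R\<^esub> y) \<in> carrier (tensor R (K.Q 0) Y)"
          by (rule ahom_closed[OF r(1) G.tp_closed[OF one y(1)]])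
        show "\<gamma> Y (?r (G.tp \<one>\<^bsub>R\<^esub> y)) p = \<gamma> Y \<zero>\<^bsub>tensor R (K.Q 0) Y\<^esub> p" if "p \<in> carrier (Pl 0)" for p
          unfolding r1[OF y(1) that] \<gamma>_zero[OF Ym Dl(2) that] using z mhom_closed[OF Dl(3) that] by simp
      qed simp
      then have t: "G.tp \<one>\<^bsub>R\<^esub> y = \<zero>\<^bsub>tensor R ?G Y\<^esub>"
        by (rule fp_flat_inj[OF inf smallR Y K.fpg_reg K.fpgQ K.\<rho>0 K.inj_\<rho> G.tp_closed[OF one y(1)]])
      \<comment> \<open>Multiplication sends \<open>\<one> \<otimes> y\<close> back to
        \<open>y\<close>, so this tensor vanishes only if \<open>y\<close> does.\<close>
      note L = G.tlift[OF Y.abelian_group_axioms, of "\<lambda>a y. a \<odot>\<^bsub>Y\<^esub> y"]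
      have 1: "a \<odot>\<^bsub>Y\<^esub> y \<in> carrier Y" if "a \<in> carrier ?G" "y \<in> carrier Y" for a y using that by simp
      have 2: "(a \<oplus>\<^bsub>?G\<^esub> a') \<odot>\<^bsub>Y\<^esub> y = a \<odot>\<^bsub>Y\<^esub> y \<oplus>\<^bsub>Y\<^esub> a' \<odot>\<^bsub>Y\<^esub> y"
        if "a \<in> carrier ?G" "a' \<in> carrier ?G" "y \<in> carrier Y" for a a' y using that Y.smult_l_distr by simp
      have 3: "a \<odot>\<^bsub>Y\<^esub> (y \<oplus>\<^bsub>Y\<^esub> y') = a \<odot>\<^bsub>Y\<^esub> y \<oplus>\<^bsub>Y\<^esub> a \<odot>\<^bsub>Y\<^esub> y'"
        if "a \<in> carrier ?G" "y \<in> carrier Y" "y' \<in> carrier Y" for a y y' using that Y.smult_r_distr by simp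
      have 4: "(r \<odot>\<^bsub>?G\<^esub> a) \<odot>\<^bsub>Y\<^esub> y = a \<odot>\<^bsub>Y\<^esub> (r \<odot>\<^bsub>Y\<^esub> y)"
        if "r \<in> carrier R" "a \<in> carrier ?G" "y \<in> carrier Y" for r a y using that Y.smult_assoc[of a r y] by simp
      have l1: "tlift Y (\<lambda>a y. a \<odot>\<^bsub>Y\<^esub> y) \<in> ahom (tensor R ?G Y) Y" by (rule L(1)) (fact 1 2 3 4)+
      have "tlift Y (\<lambda>a y. a \<odot>\<^bsub>Y\<^esub> y) (G.tp \<one>\<^bsub>R\<^esub> y) = \<one>\<^bsub>R\<^esub> \<odot>\<^bsub>Y\<^esub> y" by (rule L(2)) (fact 1 2 3 4 one y(1))+
      then show "y = \<zero>\<^bsub>Y\<^esub>"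
        unfolding t using ahom_zero[OF G.abelian_tensor Y.abelian_group_axioms l1] y(1) by simp
    qed
    show "eval_unit R C Y ` carrier Y = carrier (hom_mod S C ?T)"
    proof
      show "eval_unit R C Y ` carrier Y \<subseteq> carrier (hom_mod S C ?T)" using mhom_closed[OF u] by blast
      show "carrier (hom_mod S C ?T) \<subseteq> eval_unit R C Y ` carrier Y"
      proof
        fix f assume f: "f \<in> carrier (hom_mod S C ?T)"
        then have f': "f \<in> mhom S (left_mod C) ?T" by simp
        \<comment> \<open>Composition with the augmentation turns \<open>f\<close> into a cocycle of
          degree zero, hence through \<open>\<gamma>\<close> into a tensor killed by the
          differential.\<close>
        have F: "(\<lambda>p. f (el p)) \<in> mhom S (Pl 0) ?T" by (rule mhom_comp[OF Dl(3) f'])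
        note b0 = \<gamma>_bij[OF Ym dbl[of 0]]
        let ?t = "\<gamma>_inv Y (Pl 0) (ml 0) (vl 0) (\<xi>l 0) (\<lambda>p. f (el p))"
        have t: "?t \<in> carrier (tensor R (K.Q 0) Y)" by (rule b0(2)[OF F])
        have t0: "tensor_map R (K.Q 0) (K.Q (Suc 0)) Y (K.\<delta> 0) ?t = \<zero>\<^bsub>tensor R (K.Q (Suc 0)) Y\<^esub>"
        proof (rule \<gamma>_inject[OF Ym dbl tensor_map_closed[OF K.Q K.Q Ym K.\<delta> t]])
          interpret Q1: tensor_pair R "K.Q (Suc 0)" Y by (rule tensor_pairI[OF K.Q Ym])
          show "\<zero>\<^bsub>tensor R (K.Q (Suc 0)) Y\<^esub> \<in> carrier (tensor R (K.Q (Suc 0)) Y)" by simp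
          fix p assume p: "p \<in> carrier (Pl (Suc 0))"
          show "\<gamma> Y (tensor_map R (K.Q 0) (K.Q (Suc 0)) Y (K.\<delta> 0) ?t) p = \<gamma> Y \<zero>\<^bsub>tensor R (K.Q (Suc 0)) Y\<^esub> p"
            unfolding \<gamma>_natural[OF Ym Dl(2) Dl(2) Dl(4) t p] b0(3)[OF F mhom_closed[OF Dl(4) p]]
              \<gamma>_zero[OF Ym Dl(2) p] Dl(6)[OF p]
            using mhom_zero[OF CL T f'] by simp
        qed
        have "\<exists>u\<in>carrier (tensor R ?G Y). ?t = ?r u"
          by (rule fp_flat_exact[OF inf smallR Y K.regA K.Q K.fpgQ K.fpg_image_\<delta> K.\<rho>0 K.\<delta> _ t t0])
            (use K.exact_\<rho> in simp)
        then obtain w where w: "w \<in> carrier (tensor R ?G Y)" "?t = ?r w" by blast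
        \<comment> \<open>Scalars move across from the regular module, and a difference of tensors
          \<open>\<one> \<otimes> y\<close> is again of this form.\<close>
        have "\<exists>y\<in>carrier Y. w = G.tp \<one>\<^bsub>R\<^esub> y"
          using w(1)
        proof (induction w rule: G.tensor_induct)
          case zero
          show ?case by (rule bexI[of _ "\<zero>\<^bsub>Y\<^esub>"]) (simp_all add: G.tp_zero_r)
        next
          case (minus s t)
          then obtain y y' where "y \<in> carrier Y" "s = G.tp \<one>\<^bsub>R\<^esub> y" "y' \<in> carrier Y" "t = G.tp \<one>\<^bsub>R\<^esub> y'" by blast
          then show ?case
            using ahom_minus[OF Y.abelian_group_axioms G.abelian_tensor G.tp_ahom_r[OF one], of y y']
            by (intro bexI[of _ "y \<ominus>\<^bsub>Y\<^esub> y'"]) simp_all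
        next
          case (pure a y)
          then have "G.tp a y = G.tp \<one>\<^bsub>R\<^esub> (a \<odot>\<^bsub>Y\<^esub> y)" using G.tp_bal[of a "\<one>\<^bsub>R\<^esub>" y] by simp
          then show ?case using pure by (intro bexI[of _ "a \<odot>\<^bsub>Y\<^esub> y"]) simp_all
        qed
        then obtain y where y: "y \<in> carrier Y" "w = G.tp \<one>\<^bsub>R\<^esub> y" by blast
        have fe: "f (el p) = U.tp (el p) y" if "p \<in> carrier (Pl 0)" for p
          using b0(3)[OF F that] r1[OF y(1) that] unfolding w(2) y(2) by simp
        have "f = eval_unit R C Y y"
        proof (rule ext_eqI[of _ "carrier C"])
          fix c assume c: "c \<in> carrier C"
          then have "c \<in> el ` carrier (Pl 0)" using Dl(5) by simp
          then show "f c = eval_unit R C Y y c" using fe c by (auto simp: eval_unit_def)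
        qed (use f in \<open>auto simp: eval_unit_def\<close>)
        then show "f \<in> eval_unit R C Y ` carrier Y" using y(1) by blast
      qed
    qed
  qed
qed

end

section \<open>Short exact sequences and the vanishing conditions\<close>

context foxby
begin

abbreviation "EV N \<equiv> Ext_vanish S Pl dl N"
abbreviation "TV M \<equiv> Tor_vanish R Pr dr M"

lemma EV_D:
  assumes "EV N" "f \<in> mhom S (Pl (Suc i)) N" "\<And>x. x \<in> carrier (Pl (Suc (Suc i))) \<Longrightarrow> f (dl (Suc i) x) = \<zero>\<^bsub>N\<^esub>"
  shows "\<exists>g\<in>mhom S (Pl i) N. \<forall>x\<in>carrier (Pl (Suc i)). f x = g (dl i x)"
  using assms unfolding Ext_vanish_def by blast

lemma EV_I:
  assumes "\<And>i f. f \<in> mhom S (Pl (Suc i)) N \<Longrightarrow> (\<And>x. x \<in> carrier (Pl (Suc (Suc i))) \<Longrightarrow> f (dl (Suc i) x) = \<zero>\<^bsub>N\<^esub>) \<Longrightarrow>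
    \<exists>g\<in>mhom S (Pl i) N. \<forall>x\<in>carrier (Pl (Suc i)). f x = g (dl i x)"
  shows "EV N"
  using assms unfolding Ext_vanish_def by blast

lemma lift_l:
  assumes s: "ses S A f B g D" and h: "h \<in> mhom S (Pl i) D"
  shows "\<exists>y\<in>mhom S (Pl i) B. \<forall>x\<in>carrier (Pl i). g (y x) = h x"
  by (rule dual_basis_lift[OF dbl sesD(2,3,5,7)[OF s] h])

text \<open>In the long exact sequence \<open>Ext^i(C, D)\<close> lies between
  \<open>Ext^i(C, B)\<close> and \<open>Ext^(i+1)(C, A)\<close>. By elements: lift the cocycle to
  \<open>B\<close>, correct the lift by a cochain of \<open>A\<close> so that it becomes a cocycle,
  and use that it is then a coboundary.\<close>

lemma EV_cokernel:
  assumes s: "ses S A f B g D" and A: "EV A" and B: "EV B"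
  shows "EV D"
proof (rule EV_I)
  note E = sesD[OF s]
  interpret B: lmodule S B by (rule E)
  fix i h assume h: "h \<in> mhom S (Pl (Suc i)) D" "\<And>x. x \<in> carrier (Pl (Suc (Suc i))) \<Longrightarrow> h (dl (Suc i) x) = \<zero>\<^bsub>D\<^esub>"
  obtain y where y: "y \<in> mhom S (Pl (Suc i)) B" "\<And>x. x \<in> carrier (Pl (Suc i)) \<Longrightarrow> g (y x) = h x"
    using lift_l[OF s h(1)] by blast
  have yd: "(\<lambda>x. y (dl (Suc i) x)) \<in> mhom S (Pl (Suc (Suc i))) B" by (rule mhom_comp[OF Dl(4) y(1)])
  obtain x where x: "x \<in> mhom S (Pl (Suc (Suc i))) A" "\<And>p. p \<in> carrier (Pl (Suc (Suc i))) \<Longrightarrow> f (x p) = y (dl (Suc i) p)"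
    using ses_factor[OF s Dl(2) yd] y(2) h(2) mhom_closed[OF Dl(4)] by metis
  have "x (dl (Suc (Suc i)) p) = \<zero>\<^bsub>A\<^esub>" if p: "p \<in> carrier (Pl (Suc (Suc (Suc i))))" for p
  proof -
    have "f (x (dl (Suc (Suc i)) p)) = f \<zero>\<^bsub>A\<^esub>"
      using x(2)[OF mhom_closed[OF Dl(4) p]] Dl(7)[OF p] mhom_zero[OF Dl(2) E(2) y(1)] mhom_zero[OF E(1,2,4)] by simp
    then show ?thesis
      using inj_onD[OF E(6) _ mhom_closed[OF x(1) mhom_closed[OF Dl(4) p]]] mhom_zero[OF Dl(2) E(1) x(1)]
        lmodule_ab[OF E(1)] abelian_group.axioms(1) abelian_monoid.zero_closed by metis
  qed
  then obtain x' where x': "x' \<in> mhom S (Pl (Suc i)) A" "\<And>p. p \<in> carrier (Pl (Suc (Suc i))) \<Longrightarrow> x p = x' (dl (Suc i) p)"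
    using EV_D[OF A x(1)] by blast
  let ?z = "\<lambda>p. y p \<ominus>\<^bsub>B\<^esub> f (x' p)"
  have z: "?z \<in> mhom S (Pl (Suc i)) B" by (rule mhom_diff_map[OF E(2) y(1) mhom_comp[OF x'(1) E(4)]])
  have "?z (dl (Suc i) p) = \<zero>\<^bsub>B\<^esub>" if p: "p \<in> carrier (Pl (Suc (Suc i)))" for p
    using x(2)[OF p] x'(2)[OF p] mhom_closed[OF yd p] by (simp add: B.minus_eq_zero_iff)
  then obtain y' where y': "y' \<in> mhom S (Pl i) B" "\<And>p. p \<in> carrier (Pl (Suc i)) \<Longrightarrow> ?z p = y' (dl i p)"
    using EV_D[OF B z] by blast
  show "\<exists>k\<in>mhom S (Pl i) D. \<forall>x\<in>carrier (Pl (Suc i)). h x = k (dl i x)"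
  proof (rule bexI[OF _ mhom_comp[OF y'(1) E(5)]], rule ballI)
    fix p assume p: "p \<in> carrier (Pl (Suc i))"
    note fx = mhom_closed[OF E(4) mhom_closed[OF x'(1) p]]
    have "g (y' (dl i p)) = g (y p) \<ominus>\<^bsub>D\<^esub> g (f (x' p))"
      unfolding y'(2)[OF p, symmetric] by (rule mhom_minus[OF E(2,3,5) mhom_closed[OF y(1) p] fx])
    also have "\<dots> = h p"
      using y(2)[OF p] E(8)[OF mhom_closed[OF x'(1) p]] mhom_closed[OF h(1) p]
        abelian_group.minus_zero_right[OF lmodule_ab[OF E(3)]] by simp
    finally show "h p = g (y' (dl i p))" by simp
  qed
qed

text \<open>The obstruction lies in \<open>Ext^1(C, A)\<close>: a lift of \<open>h\<close> composed
  with the augmentation is corrected by a map into \<open>A\<close> until it vanishes on the kernel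
  of \<open>el\<close>, and then it descends to C.\<close>

lemma EV_hom_onto:
  assumes s: "ses S A f B g D" and A: "EV A" and h: "h \<in> mhom S (left_mod C) D"
  shows "\<exists>k\<in>mhom S (left_mod C) B. \<forall>x\<in>carrier C. g (k x) = h x"
proof -
  note E = sesD[OF s]
  interpret A: lmodule S A by (rule E)
  interpret B: lmodule S B by (rule E)
  have he: "(\<lambda>x. h (el x)) \<in> mhom S (Pl 0) D" by (rule mhom_comp[OF Dl(3) h])
  obtain y where y: "y \<in> mhom S (Pl 0) B" "\<And>x. x \<in> carrier (Pl 0) \<Longrightarrow> g (y x) = h (el x)"
    using lift_l[OF s he] by blast
  have yd: "(\<lambda>x. y (dl 0 x)) \<in> mhom S (Pl (Suc 0)) B" by (rule mhom_comp[OF Dl(4) y(1)])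
  have gyd: "g (y (dl 0 x)) = \<zero>\<^bsub>D\<^esub>" if "x \<in> carrier (Pl (Suc 0))" for x
    using y(2)[OF mhom_closed[OF Dl(4) that]] Dl(6)[OF that] mhom_zero[OF CL E(3) h] by simp
  obtain x where x: "x \<in> mhom S (Pl (Suc 0)) A" "\<And>p. p \<in> carrier (Pl (Suc 0)) \<Longrightarrow> f (x p) = y (dl 0 p)"
    using ses_factor[OF s Dl(2) yd gyd] by blast
  have "x (dl (Suc 0) p) = \<zero>\<^bsub>A\<^esub>" if p: "p \<in> carrier (Pl (Suc (Suc 0)))" for p
  proof -
    have "f (x (dl (Suc 0) p)) = f \<zero>\<^bsub>A\<^esub>"
      using x(2)[OF mhom_closed[OF Dl(4) p]] Dl(7)[OF p] mhom_zero[OF Dl(2) E(2) y(1)] mhom_zero[OF E(1,2,4)] by simp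
    then show ?thesis
      by (rule inj_onD[OF E(6) _ mhom_closed[OF x(1) mhom_closed[OF Dl(4) p]] A.zero_closed])
  qed
  then obtain x' where x': "x' \<in> mhom S (Pl 0) A" "\<And>p. p \<in> carrier (Pl (Suc 0)) \<Longrightarrow> x p = x' (dl 0 p)"
    using EV_D[OF A x(1)] by blast
  let ?z = "\<lambda>p. y p \<ominus>\<^bsub>B\<^esub> f (x' p)"
  have z: "?z \<in> mhom S (Pl 0) B" by (rule mhom_diff_map[OF E(2) y(1) mhom_comp[OF x'(1) E(4)]])
  have zd: "?z (dl 0 p) = \<zero>\<^bsub>B\<^esub>" if p: "p \<in> carrier (Pl (Suc 0))" for p
    using x(2)[OF p] x'(2)[OF p] mhom_closed[OF yd p] by (simp add: B.minus_eq_zero_iff)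
  have "\<exists>k\<in>mhom S (left_mod C) B. \<forall>p\<in>carrier (Pl 0). k (el p) = ?z p"
    by (rule factor_onto[OF Dl(2) CL E(2) Dl(3) Dl(5) z]) (use Dl(8) zd in blast)
  then obtain k where k: "k \<in> mhom S (left_mod C) B" "\<And>p. p \<in> carrier (Pl 0) \<Longrightarrow> k (el p) = ?z p" by blast
  have "g (k c) = h c" if c: "c \<in> carrier C" for c
  proof -
    have "c \<in> el ` carrier (Pl 0)" using Dl(5) c by simp
    then obtain p where p: "p \<in> carrier (Pl 0)" "c = el p" by blast
    have "g (k c) = g (y p) \<ominus>\<^bsub>D\<^esub> g (f (x' p))"
      unfolding p(2) k(2)[OF p(1)]
      by (rule mhom_minus[OF E(2,3,5) mhom_closed[OF y(1) p(1)] mhom_closed[OF E(4) mhom_closed[OF x'(1) p(1)]]])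
    also have "\<dots> = h c"
      using y(2)[OF p(1)] E(8)[OF mhom_closed[OF x'(1) p(1)]] mhom_closed[OF he p(1)]
        abelian_group.minus_zero_right[OF lmodule_ab[OF E(3)]] p(2) by simp
    finally show ?thesis .
  qed
  then show ?thesis using k(1) by blast
qed

text \<open>\<open>Ext^(i+1)(C, A)\<close> lies between \<open>Ext^i(C, D)\<close> and
  \<open>Ext^(i+1)(C, B)\<close>. For \<open>i = 0\<close> the first of these is
  \<open>Hom(C, D)\<close>, about which vanishing says nothing; surjectivity on Hom takes its
  place.\<close>

lemma EV_kernel:
  assumes s: "ses S A f B g D" and B: "EV B" and D: "EV D"
    and on: "\<And>h. h \<in> mhom S (left_mod C) D \<Longrightarrow> \<exists>k\<in>mhom S (left_mod C) B. \<forall>x\<in>carrier C. g (k x) = h x"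
  shows "EV A"
proof (rule EV_I)
  note E = sesD[OF s]
  interpret B: lmodule S B by (rule E)
  interpret D: lmodule S D by (rule E)
  fix i a assume a: "a \<in> mhom S (Pl (Suc i)) A" "\<And>x. x \<in> carrier (Pl (Suc (Suc i))) \<Longrightarrow> a (dl (Suc i) x) = \<zero>\<^bsub>A\<^esub>"
  have fa: "(\<lambda>x. f (a x)) \<in> mhom S (Pl (Suc i)) B" by (rule mhom_comp[OF a(1) E(4)])
  have "f (a (dl (Suc i) x)) = \<zero>\<^bsub>B\<^esub>" if "x \<in> carrier (Pl (Suc (Suc i)))" for x
    using a(2)[OF that] mhom_zero[OF E(1,2,4)] by simp
  then obtain y where y: "y \<in> mhom S (Pl i) B" "\<And>x. x \<in> carrier (Pl (Suc i)) \<Longrightarrow> f (a x) = y (dl i x)"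
    using EV_D[OF B fa] by blast
  have gy: "(\<lambda>x. g (y x)) \<in> mhom S (Pl i) D" by (rule mhom_comp[OF y(1) E(5)])
  have gyd: "g (y (dl i x)) = \<zero>\<^bsub>D\<^esub>" if "x \<in> carrier (Pl (Suc i))" for x
    using y(2)[OF that] E(8)[OF mhom_closed[OF a(1) that]] by simp
  \<comment> \<open>\<open>y0\<close> is a cocycle with the same image in \<open>D\<close> as
    \<open>y\<close>, so that \<open>y - y0\<close> comes from \<open>A\<close>: for
    \<open>i > 0\<close> it is a coboundary, for \<open>i = 0\<close> it is induced by a map from
    C.\<close>
  have "\<exists>y0\<in>mhom S (Pl i) B. (\<forall>x\<in>carrier (Pl (Suc i)). y0 (dl i x) = \<zero>\<^bsub>B\<^esub>) \<and> (\<forall>x\<in>carrier (Pl i). g (y0 x) = g (y x))"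
  proof (cases i)
    case 0
    have "\<exists>k\<in>mhom S (left_mod C) D. \<forall>p\<in>carrier (Pl 0). k (el p) = g (y p)"
      by (rule factor_onto[OF Dl(2) CL E(3) Dl(3) Dl(5) gy[unfolded 0]]) (use Dl(8) gyd[unfolded 0] in blast)
    then obtain h where h: "h \<in> mhom S (left_mod C) D" "\<And>p. p \<in> carrier (Pl 0) \<Longrightarrow> h (el p) = g (y p)" by blast
    obtain k where k: "k \<in> mhom S (left_mod C) B" "\<And>x. x \<in> carrier C \<Longrightarrow> g (k x) = h x" using on[OF h(1)] by blast
    show ?thesis unfolding 0
    proof (rule bexI[OF _ mhom_comp[OF Dl(3) k(1)]], intro conjI ballI)
      show "k (el (dl 0 x)) = \<zero>\<^bsub>B\<^esub>" if "x \<in> carrier (Pl (Suc 0))" for x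
        using Dl(6)[OF that] mhom_zero[OF CL E(2) k(1)] by simp
      show "g (k (el x)) = g (y x)" if "x \<in> carrier (Pl 0)" for x
        using k(2) mhom_closed[OF Dl(3) that] h(2)[OF that] by simp
    qed
  next
    case (Suc j)
    obtain z where z: "z \<in> mhom S (Pl j) D" "\<And>x. x \<in> carrier (Pl (Suc j)) \<Longrightarrow> g (y x) = z (dl j x)"
      using EV_D[OF D gy[unfolded Suc] gyd[unfolded Suc]] by blast
    obtain w where w: "w \<in> mhom S (Pl j) B" "\<And>x. x \<in> carrier (Pl j) \<Longrightarrow> g (w x) = z x" using lift_l[OF s z(1)] by blast
    show ?thesis unfolding Suc
    proof (rule bexI[OF _ mhom_comp[OF Dl(4) w(1)]], intro conjI ballI)
      show "w (dl j (dl (Suc j) x)) = \<zero>\<^bsub>B\<^esub>" if "x \<in> carrier (Pl (Suc (Suc j)))" for x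
        using Dl(7)[OF that] mhom_zero[OF Dl(2) E(2) w(1)] by simp
      show "g (w (dl j x)) = g (y x)" if "x \<in> carrier (Pl (Suc j))" for x
        using w(2)[OF mhom_closed[OF Dl(4) that]] z(2)[OF that] by simp
    qed
  qed
  then obtain y0 where y0: "y0 \<in> mhom S (Pl i) B" "\<And>x. x \<in> carrier (Pl (Suc i)) \<Longrightarrow> y0 (dl i x) = \<zero>\<^bsub>B\<^esub>"
    "\<And>x. x \<in> carrier (Pl i) \<Longrightarrow> g (y0 x) = g (y x)" by blast
  have d: "(\<lambda>x. y x \<ominus>\<^bsub>B\<^esub> y0 x) \<in> mhom S (Pl i) B" by (rule mhom_diff_map[OF E(2) y(1) y0(1)])
  have "g (y x \<ominus>\<^bsub>B\<^esub> y0 x) = \<zero>\<^bsub>D\<^esub>" if "x \<in> carrier (Pl i)" for x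
    using mhom_minus[OF E(2,3,5) mhom_closed[OF y(1) that] mhom_closed[OF y0(1) that]] y0(3)[OF that]
      mhom_closed[OF gy that] by (simp add: D.minus_eq_zero_iff)
  then obtain x where x: "x \<in> mhom S (Pl i) A" "\<And>p. p \<in> carrier (Pl i) \<Longrightarrow> f (x p) = y p \<ominus>\<^bsub>B\<^esub> y0 p"
    using ses_factor[OF s Dl(2) d] by blast
  have "a p = x (dl i p)" if p: "p \<in> carrier (Pl (Suc i))" for p
  proof -
    note dp = mhom_closed[OF Dl(4) p]
    have "f (x (dl i p)) = f (a p)"
      using x(2)[OF dp] y(2)[OF p] y0(2)[OF p] mhom_closed[OF y(1) dp] by simp
    then show ?thesis using inj_onD[OF E(6) _ mhom_closed[OF x(1) dp] mhom_closed[OF a(1) p]] by simp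
  qed
  then show "\<exists>k\<in>mhom S (Pl i) A. \<forall>x\<in>carrier (Pl (Suc i)). a x = k (dl i x)" using x(1) by blast
qed

end

text \<open>The functionals induce coordinate maps from \<open>P \<otimes> X\<close> to
  \<open>X\<close>, natural in \<open>X\<close>, and a tensor is the sum of the \<open>v j\<close>
  tensored with its coordinates. The coordinates of \<open>t\<close> are zero because the injective
  \<open>f\<close> sends them to those of its image.\<close>

lemma dual_basis_flat:
  assumes db: "dual_basis (opp R) P m v \<xi>" and A: "lmodule R A" and B: "lmodule R B"
    and f: "f \<in> mhom R A B" "inj_on f (carrier A)"
    and t: "t \<in> carrier (tensor R P A)" "tmap2 R P B f t = \<zero>\<^bsub>tensor R P B\<^esub>"
  shows "t = \<zero>\<^bsub>tensor R P A\<^esub>"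
proof -
  note D = dual_basisD[OF db]
  interpret P: lmodule "opp R" P by (rule D(1))
  interpret T: tensor_pair R P A by (rule tensor_pairI[OF D(1) A])
  interpret U: tensor_pair R P B by (rule tensor_pairI[OF D(1) B])
  note fm = tmap2[OF D(1) A B f(1)]
  have coord: "tlift X (\<lambda>p a. \<xi> j p \<odot>\<^bsub>X\<^esub> a) \<in> ahom (tensor R P X) X"
    "\<And>p a. p \<in> carrier P \<Longrightarrow> a \<in> carrier X \<Longrightarrow> tlift X (\<lambda>p a. \<xi> j p \<odot>\<^bsub>X\<^esub> a) (pure_tensor R P X p a) = \<xi> j p \<odot>\<^bsub>X\<^esub> a"
    if X: "lmodule R X" and j: "j < m" for X :: "('a, 'x) module" and j
  proof -
    interpret X: lmodule R X by fact
    interpret V: tensor_pair R P X by (rule tensor_pairI[OF D(1) X])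
    have xc: "\<xi> j p \<in> carrier R" if "p \<in> carrier P" for p using D(5)[OF j that] by simp
    have 1: "\<xi> j p \<odot>\<^bsub>X\<^esub> a \<in> carrier X" if "p \<in> carrier P" "a \<in> carrier X" for p a using xc that by simp
    have 2: "\<xi> j (p \<oplus>\<^bsub>P\<^esub> p') \<odot>\<^bsub>X\<^esub> a = \<xi> j p \<odot>\<^bsub>X\<^esub> a \<oplus>\<^bsub>X\<^esub> \<xi> j p' \<odot>\<^bsub>X\<^esub> a"
      if "p \<in> carrier P" "p' \<in> carrier P" "a \<in> carrier X" for p p' a
      using mhom_add[OF D(3)[OF j]] xc that X.smult_l_distr by simp
    have 3: "\<xi> j p \<odot>\<^bsub>X\<^esub> (a \<oplus>\<^bsub>X\<^esub> a') = \<xi> j p \<odot>\<^bsub>X\<^esub> a \<oplus>\<^bsub>X\<^esub> \<xi> j p \<odot>\<^bsub>X\<^esub> a'"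
      if "p \<in> carrier P" "a \<in> carrier X" "a' \<in> carrier X" for p a a'
      using xc that X.smult_r_distr by simp
    have 4: "\<xi> j (r \<odot>\<^bsub>P\<^esub> p) \<odot>\<^bsub>X\<^esub> a = \<xi> j p \<odot>\<^bsub>X\<^esub> (r \<odot>\<^bsub>X\<^esub> a)"
      if "r \<in> carrier R" "p \<in> carrier P" "a \<in> carrier X" for r p a
      using mhom_smult[OF D(3)[OF j], of r p] xc that X.smult_assoc by simp
    note L = V.tlift[OF X.abelian_group_axioms, of "\<lambda>p a. \<xi> j p \<odot>\<^bsub>X\<^esub> a"]
    show "tlift X (\<lambda>p a. \<xi> j p \<odot>\<^bsub>X\<^esub> a) \<in> ahom (tensor R P X) X" by (rule L(1)) (fact 1 2 3 4)+
    show "tlift X (\<lambda>p a. \<xi> j p \<odot>\<^bsub>X\<^esub> a) (pure_tensor R P X p a) = \<xi> j p \<odot>\<^bsub>X\<^esub> a"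
      if "p \<in> carrier P" "a \<in> carrier X" for p a by (rule L(2)) (fact 1 2 3 4 that)+
  qed
  let ?c = "\<lambda>j. tlift A (\<lambda>p a. \<xi> j p \<odot>\<^bsub>A\<^esub> a)" and ?d = "\<lambda>j. tlift B (\<lambda>p a. \<xi> j p \<odot>\<^bsub>B\<^esub> a)"
  have fc: "f (?c j t) = ?d j (tmap2 R P B f t)" if j: "j < m" for j
  proof (rule T.tensor_ahom_eq[OF lmodule_ab[OF B] ahom_comp[OF coord(1)[OF A j] mhom_ahom[OF f(1)]]
        ahom_comp[OF fm(1) coord(1)[OF B j]] _ t(1)])
    fix p a assume pa: "p \<in> carrier P" "a \<in> carrier A"
    have "\<xi> j p \<in> carrier R" using D(5)[OF j pa(1)] by simp
    then show "f (?c j (T.tp p a)) = ?d j (tmap2 R P B f (T.tp p a))"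
      unfolding fm(2)[OF pa] coord(2)[OF A j pa] coord(2)[OF B j pa(1) mhom_closed[OF f(1) pa(2)]]
      by (rule mhom_smult[OF f(1) _ pa(2)])
  qed
  have c0: "?c j t = \<zero>\<^bsub>A\<^esub>" if j: "j < m" for j
  proof -
    have "f (?c j t) = f \<zero>\<^bsub>A\<^esub>"
      unfolding fc[OF j] t(2) using ahom_zero[OF U.abelian_tensor lmodule_ab[OF B] coord(1)[OF B j]]
        mhom_zero[OF A B f(1)] by simp
    then show ?thesis using inj_onD[OF f(2) _ ahom_closed[OF coord(1)[OF A j] t(1)] T.B.zero_closed] by blast
  qed
  have "gsum (tensor R P A) (\<lambda>j. T.tp (v j) (?c j t)) m = t"
  proof (rule T.tensor_ahom_eq[OF T.abelian_tensor _ ahom_id _ t(1)])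
    show "(\<lambda>t. gsum (tensor R P A) (\<lambda>j. T.tp (v j) (?c j t)) m) \<in> ahom (tensor R P A) (tensor R P A)"
    proof (rule ahomI)
      have cl: "T.tp (v j) (?c j t) \<in> carrier (tensor R P A)" if "t \<in> carrier (tensor R P A)" "j < m" for j t
        using ahom_closed[OF coord(1)[OF A that(2)] that(1)] D(2)[OF that(2)] by simp
      show "gsum (tensor R P A) (\<lambda>j. T.tp (v j) (?c j t)) m \<in> carrier (tensor R P A)" if "t \<in> carrier (tensor R P A)" for t
        by (rule T.TT.gsum_closed[OF cl[OF that]])
      fix s t assume st: "s \<in> carrier (tensor R P A)" "t \<in> carrier (tensor R P A)"
      have "gsum (tensor R P A) (\<lambda>j. T.tp (v j) (?c j (s \<oplus>\<^bsub>tensor R P A\<^esub> t))) m =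
          gsum (tensor R P A) (\<lambda>j. T.tp (v j) (?c j s) \<oplus>\<^bsub>tensor R P A\<^esub> T.tp (v j) (?c j t)) m"
        by (rule gsum_cong)
          (rule ahom_add[OF ahom_comp[OF coord(1)[OF A] T.tp_ahom_r[OF D(2)]] st])
      also have "\<dots> = gsum (tensor R P A) (\<lambda>j. T.tp (v j) (?c j s)) m \<oplus>\<^bsub>tensor R P A\<^esub>
          gsum (tensor R P A) (\<lambda>j. T.tp (v j) (?c j t)) m"
        by (rule T.TT.gsum_add[OF cl[OF st(1)] cl[OF st(2)]])
      finally show "gsum (tensor R P A) (\<lambda>j. T.tp (v j) (?c j (s \<oplus>\<^bsub>tensor R P A\<^esub> t))) m =
          gsum (tensor R P A) (\<lambda>j. T.tp (v j) (?c j s)) m \<oplus>\<^bsub>tensor R P A\<^esub> gsum (tensor R P A) (\<lambda>j. T.tp (v j) (?c j t)) m" .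
    qed
    fix p a assume pa: "p \<in> carrier P" "a \<in> carrier A"
    have "gsum (tensor R P A) (\<lambda>j. T.tp (v j) (?c j (T.tp p a))) m = gsum (tensor R P A) (\<lambda>j. T.tp (\<xi> j p \<odot>\<^bsub>P\<^esub> v j) a) m"
    proof (rule gsum_cong)
      fix j assume j: "j < m"
      have x: "\<xi> j p \<in> carrier R" using D(5)[OF j pa(1)] by simp
      show "T.tp (v j) (?c j (T.tp p a)) = T.tp (\<xi> j p \<odot>\<^bsub>P\<^esub> v j) a"
        unfolding coord(2)[OF A j pa] by (rule T.tp_bal[OF x D(2)[OF j] pa(2), symmetric])
    qed
    also have "\<dots> = T.tp (gsum P (\<lambda>j. \<xi> j p \<odot>\<^bsub>P\<^esub> v j) m) a"
      by (rule ahom_gsum[OF P.abelian_group_axioms T.abelian_tensor T.tp_ahom_l[OF pa(2)], symmetric])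
        (use D(2) D(5)[OF _ pa(1)] in auto)
    finally show "gsum (tensor R P A) (\<lambda>j. T.tp (v j) (?c j (T.tp p a))) m = T.tp p a" using D(4)[OF pa(1)] by simp
  qed
  moreover have "gsum (tensor R P A) (\<lambda>j. T.tp (v j) (?c j t)) m = gsum (tensor R P A) (\<lambda>j. \<zero>\<^bsub>tensor R P A\<^esub>) m"
    by (rule gsum_cong) (use c0 T.tp_zero_r D(2) in simp)
  ultimately show ?thesis by simp
qed

section \<open>The ladder of tensored resolutions over a short exact sequence\<close>

locale foxby_ses = foxby S R C Pl dl el ml vl \<xi>l Pr dr er mr vr \<xi>r
  for S :: "'s ring" and R :: "'r ring" and C :: "('s, 'r, 'u) bimodule"
    and Pl dl el ml vl \<xi>l Pr dr er mr vr \<xi>r +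
  fixes A :: "('r, 'a) module" and f :: "'a \<Rightarrow> 'b" and B :: "('r, 'b) module" and g :: "'b \<Rightarrow> 'd" and D :: "('r, 'd) module"
  assumes s: "ses R A f B g D"
begin

lemmas E = sesD[OF s]

abbreviation "TT X i \<equiv> tensor R (Pr i) X"
abbreviation "bd X i \<equiv> tensor_map R (Pr (Suc i)) (Pr i) X (dr i)"
abbreviation "F i \<equiv> tmap2 R (Pr i) B f"
abbreviation "G i \<equiv> tmap2 R (Pr i) D g"
abbreviation "TC X \<equiv> tensor R (right_mod C) X"
abbreviation "au X \<equiv> tensor_map R (Pr 0) (right_mod C) X er"
abbreviation "FC \<equiv> tmap2 R (right_mod C) B f"
abbreviation "GC \<equiv> tmap2 R (right_mod C) D g"

lemma ab: "lmodule R X \<Longrightarrow> abelian_group (TT X i)" "lmodule R X \<Longrightarrow> abelian_group (TC X)"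
  by (rule tensor_pair.abelian_tensor[OF tensor_pairI[OF Dr(2)]], assumption)
    (rule tensor_pair.abelian_tensor[OF tensor_pairI[OF CR]])

lemma bd: "lmodule R X \<Longrightarrow> bd X i \<in> ahom (TT X (Suc i)) (TT X i)"
  by (rule tensor_map(1)[OF Dr(2) Dr(2) _ Dr(4)])

lemma au: "lmodule R X \<Longrightarrow> au X \<in> ahom (TT X 0) (TC X)"
  by (rule tensor_map(1)[OF Dr(2) CR _ Dr(3)])

lemma FG: "F i \<in> ahom (TT A i) (TT B i)" "G i \<in> ahom (TT B i) (TT D i)"
  "FC \<in> ahom (TC A) (TC B)" "GC \<in> ahom (TC B) (TC D)"
  by (rule tmap2(1)[OF Dr(2) E(1,2,4)], rule tmap2(1)[OF Dr(2) E(2,3,5)],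
      rule tmap2(1)[OF CR E(1,2,4)], rule tmap2(1)[OF CR E(2,3,5)])

lemma bdbd: "lmodule R X \<Longrightarrow> t \<in> carrier (TT X (Suc (Suc i))) \<Longrightarrow> bd X i (bd X (Suc i) t) = \<zero>\<^bsub>TT X i\<^esub>"
  using tensor_map_comp[where t = t, OF Dr(2)[of "Suc (Suc i)"] Dr(2)[of "Suc i"] Dr(2)[of i] _ Dr(4) Dr(4), of X]
    tensor_map_zero[where t = t, OF Dr(2)[of "Suc (Suc i)"] Dr(2)[of i] _ mhom_comp[OF Dr(4) Dr(4)] Dr(7), of X] by simp

lemma aubd: "lmodule R X \<Longrightarrow> t \<in> carrier (TT X (Suc 0)) \<Longrightarrow> au X (bd X 0 t) = \<zero>\<^bsub>TC X\<^esub>"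
  using tensor_map_comp[OF Dr(2) Dr(2) CR _ Dr(4) Dr(3), of X t]
    tensor_map_zero[OF Dr(2) CR _ mhom_comp[OF Dr(4) Dr(3)] Dr(6), of X t] by simp

lemma au_exact: "lmodule R X \<Longrightarrow> t \<in> carrier (TT X 0) \<Longrightarrow> au X t = \<zero>\<^bsub>TC X\<^esub> \<Longrightarrow> \<exists>u\<in>carrier (TT X (Suc 0)). t = bd X 0 u"
  by (rule tensor_right_exact1[OF Dr(2) Dr(2) CR _ Dr(4) Dr(3) Dr(5) Dr(8)])

lemma au_onto: "lmodule R X \<Longrightarrow> t \<in> carrier (TC X) \<Longrightarrow> \<exists>u\<in>carrier (TT X 0). t = au X u"
  by (rule tensor_map_onto[OF Dr(2) CR _ Dr(3) Dr(5)])

lemma F_bd: "t \<in> carrier (TT A (Suc i)) \<Longrightarrow> F i (bd A i t) = bd B i (F (Suc i) t)"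
  by (rule tensor_map_tmap2[OF Dr(2) Dr(2) E(1,2) Dr(4) E(4)])

lemma G_bd: "t \<in> carrier (TT B (Suc i)) \<Longrightarrow> G i (bd B i t) = bd D i (G (Suc i) t)"
  by (rule tensor_map_tmap2[OF Dr(2) Dr(2) E(2,3) Dr(4) E(5)])

lemma F_au: "t \<in> carrier (TT A 0) \<Longrightarrow> FC (au A t) = au B (F 0 t)"
  by (rule tensor_map_tmap2[OF Dr(2) CR E(1,2) Dr(3) E(4)])

lemma GF: "t \<in> carrier (TT A i) \<Longrightarrow> G i (F i t) = \<zero>\<^bsub>TT D i\<^esub>"
  using tmap2_comp[where t = t, OF Dr(2)[of i] E(1-5)] tmap2_zero[where t = t, OF Dr(2)[of i] E(1,3) mhom_comp[OF E(4,5)] E(8)] by simp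

lemma GFC: "t \<in> carrier (TC A) \<Longrightarrow> GC (FC t) = \<zero>\<^bsub>TC D\<^esub>"
  using tmap2_comp[where t = t, OF CR E(1-5)] tmap2_zero[where t = t, OF CR E(1,3) mhom_comp[OF E(4,5)] E(8)] by simp

lemma F_inj: "t \<in> carrier (TT A i) \<Longrightarrow> F i t = \<zero>\<^bsub>TT B i\<^esub> \<Longrightarrow> t = \<zero>\<^bsub>TT A i\<^esub>"
  by (rule dual_basis_flat[OF dbr E(1,2,4,6)])

lemma F_inj_on: "inj_on (F i) (carrier (TT A i))"
  by (rule ahom_inj[OF ab(1)[OF E(1)] ab(1)[OF E(2)] FG(1) F_inj])

lemma G_exact: "t \<in> carrier (TT B i) \<Longrightarrow> G i t = \<zero>\<^bsub>TT D i\<^esub> \<Longrightarrow> \<exists>u\<in>carrier (TT A i). t = F i u"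
  by (rule tensor_right_exact2[OF Dr(2) E(1,2,3,4,5,7,9)])

lemma GC_exact: "t \<in> carrier (TC B) \<Longrightarrow> GC t = \<zero>\<^bsub>TC D\<^esub> \<Longrightarrow> \<exists>u\<in>carrier (TC A). t = FC u"
  by (rule tensor_right_exact2[OF CR E(1,2,3,4,5,7,9)])

lemma G_onto: "t \<in> carrier (TT D i) \<Longrightarrow> \<exists>u\<in>carrier (TT B i). t = G i u"
  by (rule tmap2_onto[OF Dr(2) E(2,3,5,7)])

lemma GC_onto: "t \<in> carrier (TC D) \<Longrightarrow> \<exists>u\<in>carrier (TC B). t = GC u"
  by (rule tmap2_onto[OF CR E(2,3,5,7)])

lemma TV_D: "TV X \<Longrightarrow> t \<in> carrier (TT X (Suc i)) \<Longrightarrow> bd X i t = \<zero>\<^bsub>TT X i\<^esub> \<Longrightarrow>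
    \<exists>u\<in>carrier (TT X (Suc (Suc i))). t = bd X (Suc i) u"
  unfolding Tor_vanish_def by blast

lemma TV_I: "(\<And>i t. t \<in> carrier (TT X (Suc i)) \<Longrightarrow> bd X i t = \<zero>\<^bsub>TT X i\<^esub> \<Longrightarrow>
    \<exists>u\<in>carrier (TT X (Suc (Suc i))). t = bd X (Suc i) u) \<Longrightarrow> TV X"
  unfolding Tor_vanish_def by blast

text \<open>\<open>Tor_(i+1)(C, D)\<close> vanishes, and with it the connecting map:
  \<open>y\<close> can be changed by a boundary until its image in the complex of \<open>D\<close>
  is zero, and then it comes from \<open>A\<close>. Index 0 serves injectivity on the tensor product
  with C, positive indices serve \<open>TV_kernel\<close>.\<close>

lemma boundary_reflect:
  assumes D: "TV D" and t: "t \<in> carrier (TT A i)" and y: "y \<in> carrier (TT B (Suc i))" "F i t = bd B i y"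
  shows "\<exists>x\<in>carrier (TT A (Suc i)). t = bd A i x"
proof -
  interpret B1: abelian_group "TT B (Suc i)" by (rule ab(1)[OF E(2)])
  interpret D1: abelian_group "TT D (Suc i)" by (rule ab(1)[OF E(3)])
  interpret B0: abelian_group "TT B i" by (rule ab(1)[OF E(2)])
  have "bd D i (G (Suc i) y) = \<zero>\<^bsub>TT D i\<^esub>"
    using G_bd[OF y(1)] y(2) GF[OF t] by simp
  then obtain z where z: "z \<in> carrier (TT D (Suc (Suc i)))" "G (Suc i) y = bd D (Suc i) z"
    using TV_D[OF D ahom_closed[OF FG(2) y(1)]] by blast
  obtain w where w: "w \<in> carrier (TT B (Suc (Suc i)))" "z = G (Suc (Suc i)) w" using G_onto[OF z(1)] by blast
  have bw: "bd B (Suc i) w \<in> carrier (TT B (Suc i))" by (rule ahom_closed[OF bd[OF E(2)] w(1)])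
  have "G (Suc i) (y \<ominus>\<^bsub>TT B (Suc i)\<^esub> bd B (Suc i) w) = \<zero>\<^bsub>TT D (Suc i)\<^esub>"
    unfolding ahom_minus[OF ab(1)[OF E(2)] ab(1)[OF E(3)] FG(2) y(1) bw] G_bd[OF w(1)] z(2) w(2)[symmetric]
    using ahom_closed[OF bd[OF E(3)] z(1)] by (simp add: D1.minus_eq_zero_iff)
  then obtain x where x: "x \<in> carrier (TT A (Suc i))" "y \<ominus>\<^bsub>TT B (Suc i)\<^esub> bd B (Suc i) w = F (Suc i) x"
    using G_exact[OF B1.minus_closed[OF y(1) bw]] by blast
  have "F i (bd A i x) = bd B i y \<ominus>\<^bsub>TT B i\<^esub> bd B i (bd B (Suc i) w)"
    unfolding F_bd[OF x(1)] x(2)[symmetric] by (rule ahom_minus[OF ab(1)[OF E(2)] ab(1)[OF E(2)] bd[OF E(2)] y(1) bw])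
  also have "\<dots> = F i t"
    unfolding bdbd[OF E(2) w(1)] y(2) using ahom_closed[OF bd[OF E(2)] y(1)] by simp
  finally have "bd A i x = t"
    by (rule inj_onD[OF F_inj_on _ ahom_closed[OF bd[OF E(1)] x(1)] t])
  then show ?thesis using x(1) by blast
qed

lemma TV_kernel:
  assumes B: "TV B" and D: "TV D"
  shows "TV A"
proof (rule TV_I)
  fix i t assume t: "t \<in> carrier (TT A (Suc i))" "bd A i t = \<zero>\<^bsub>TT A i\<^esub>"
  have "bd B i (F (Suc i) t) = \<zero>\<^bsub>TT B i\<^esub>"
    using F_bd[OF t(1)] t(2) ahom_zero[OF ab(1)[OF E(1)] ab(1)[OF E(2)] FG(1)] by simp
  then obtain y where "y \<in> carrier (TT B (Suc (Suc i)))" "F (Suc i) t = bd B (Suc i) y"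
    using TV_D[OF B ahom_closed[OF FG(1) t(1)]] by blast
  then show "\<exists>u\<in>carrier (TT A (Suc (Suc i))). t = bd A (Suc i) u" by (rule boundary_reflect[OF D t(1)])
qed

text \<open>The kernel of the induced map is the image of \<open>Tor_1(C, D)\<close>; after lifting
  to \<open>Pr 0\<close> this is \<open>boundary_reflect\<close> at index 0.\<close>

lemma TV_inj:
  assumes D: "TV D" and t: "t \<in> carrier (TC A)" "FC t = \<zero>\<^bsub>TC B\<^esub>"
  shows "t = \<zero>\<^bsub>TC A\<^esub>"
proof -
  obtain a where a: "a \<in> carrier (TT A 0)" "t = au A a" using au_onto[OF E(1) t(1)] by blast
  have "au B (F 0 a) = \<zero>\<^bsub>TC B\<^esub>" using F_au[OF a(1)] a(2) t(2) by simp
  then obtain y where "y \<in> carrier (TT B (Suc 0))" "F 0 a = bd B 0 y"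
    using au_exact[OF E(2) ahom_closed[OF FG(1) a(1)]] by blast
  then obtain x where "x \<in> carrier (TT A (Suc 0))" "a = bd A 0 x" using boundary_reflect[OF D a(1)] by blast
  then show ?thesis using a(2) aubd[OF E(1)] by simp
qed

text \<open>\<open>Tor_(i+1)(C, D)\<close> lies between \<open>Tor_(i+1)(C, B)\<close> and
  \<open>Tor_i(C, A)\<close>; for \<open>i = 0\<close> the latter is the tensor product itself, and
  injectivity on it takes the place of vanishing.\<close>

lemma TV_cokernel:
  assumes A: "TV A" and B: "TV B" and inj: "\<And>t. t \<in> carrier (TC A) \<Longrightarrow> FC t = \<zero>\<^bsub>TC B\<^esub> \<Longrightarrow> t = \<zero>\<^bsub>TC A\<^esub>"
  shows "TV D"
proof (rule TV_I)
  fix i z assume z: "z \<in> carrier (TT D (Suc i))" "bd D i z = \<zero>\<^bsub>TT D i\<^esub>"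
  interpret B1: abelian_group "TT B (Suc i)" by (rule ab(1)[OF E(2)])
  interpret D1: abelian_group "TT D (Suc i)" by (rule ab(1)[OF E(3)])
  interpret B0: abelian_group "TT B i" by (rule ab(1)[OF E(2)])
  obtain y where y: "y \<in> carrier (TT B (Suc i))" "z = G (Suc i) y" using G_onto[OF z(1)] by blast
  have by': "bd B i y \<in> carrier (TT B i)" by (rule ahom_closed[OF bd[OF E(2)] y(1)])
  have "G i (bd B i y) = \<zero>\<^bsub>TT D i\<^esub>" using G_bd[OF y(1)] y(2) z(2) by simp
  then obtain x where x: "x \<in> carrier (TT A i)" "bd B i y = F i x" using G_exact[OF by'] by blast
  \<comment> \<open>\<open>x\<close> represents the value of the connecting map and has to be a
    boundary. For \<open>i > 0\<close> it is a cycle because \<open>F\<close> is injective; for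
    \<open>i = 0\<close> the augmentation kills it by \<open>inj\<close>.\<close>
  have "\<exists>x'\<in>carrier (TT A (Suc i)). x = bd A i x'"
  proof (cases i)
    case 0
    have "FC (au A x) = \<zero>\<^bsub>TC B\<^esub>"
      using F_au[of x] x aubd[OF E(2), of y] y(1) unfolding 0 by simp
    then have "au A x = \<zero>\<^bsub>TC A\<^esub>" by (rule inj[OF ahom_closed[OF au[OF E(1)] x(1)[unfolded 0]]])
    then show ?thesis unfolding 0 by (rule au_exact[OF E(1) x(1)[unfolded 0]])
  next
    case (Suc j)
    have "F j (bd A j x) = \<zero>\<^bsub>TT B j\<^esub>"
      using F_bd[of x j] x bdbd[OF E(2), of y j] y(1) unfolding Suc by simp
    then have "bd A j x = \<zero>\<^bsub>TT A j\<^esub>" by (rule F_inj[OF ahom_closed[OF bd[OF E(1)] x(1)[unfolded Suc]]])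
    then show ?thesis unfolding Suc by (rule TV_D[OF A x(1)[unfolded Suc]])
  qed
  then obtain x' where x': "x' \<in> carrier (TT A (Suc i))" "x = bd A i x'" by blast
  have fx: "F (Suc i) x' \<in> carrier (TT B (Suc i))" by (rule ahom_closed[OF FG(1) x'(1)])
  have "bd B i (y \<ominus>\<^bsub>TT B (Suc i)\<^esub> F (Suc i) x') = \<zero>\<^bsub>TT B i\<^esub>"
    unfolding ahom_minus[OF ab(1)[OF E(2)] ab(1)[OF E(2)] bd[OF E(2)] y(1) fx]
    using F_bd[OF x'(1)] x(2) x'(2) by' by (simp add: B0.minus_eq_zero_iff)
  then obtain w where w: "w \<in> carrier (TT B (Suc (Suc i)))" "y \<ominus>\<^bsub>TT B (Suc i)\<^esub> F (Suc i) x' = bd B (Suc i) w"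
    using TV_D[OF B B1.minus_closed[OF y(1) fx]] by blast
  have "z = G (Suc i) (y \<ominus>\<^bsub>TT B (Suc i)\<^esub> F (Suc i) x')"
    unfolding ahom_minus[OF ab(1)[OF E(2)] ab(1)[OF E(3)] FG(2) y(1) fx] GF[OF x'(1)] y(2)[symmetric]
    using z(1) by simp
  also have "\<dots> = bd D (Suc i) (G (Suc (Suc i)) w)" unfolding w(2) by (rule G_bd[OF w(1)])
  finally show "\<exists>u\<in>carrier (TT D (Suc (Suc i))). z = bd D (Suc i) u" using ahom_closed[OF FG(2) w(1)] by blast
qed

lemma ses_tensor:
  assumes D: "TV D"
  shows "ses S (tensor_mod R C A) FC (tensor_mod R C B) GC (tensor_mod R C D)"
proof (rule sesI[OF lmodule_tensor_mod[OF E(1)] lmodule_tensor_mod[OF E(2)] lmodule_tensor_mod[OF E(3)]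
      tmap2_mhom[OF E(1,2,4)] tmap2_mhom[OF E(2,3,5)]])
  show "inj_on FC (carrier (tensor_mod R C A))"
    using ahom_inj[OF ab(2)[OF E(1)] ab(2)[OF E(2)] FG(3) TV_inj[OF D]] by simp
  show "GC ` carrier (tensor_mod R C B) = carrier (tensor_mod R C D)"
  proof
    show "GC ` carrier (tensor_mod R C B) \<subseteq> carrier (tensor_mod R C D)" using ahom_closed[OF FG(4)] by auto
    show "carrier (tensor_mod R C D) \<subseteq> GC ` carrier (tensor_mod R C B)" using GC_onto by auto
  qed
qed (use GFC GC_exact in auto)

end

section \<open>Finite resolutions\<close>

lemma misoI_inverse:
  assumes "f \<in> mhom R A B" "g \<in> mhom R B A" "\<And>x. x \<in> carrier A \<Longrightarrow> g (f x) = x" "\<And>y. y \<in> carrier B \<Longrightarrow> f (g y) = y"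
  shows "f \<in> miso R A B"
proof (rule misoI[OF assms(1)])
  show "inj_on f (carrier A)" by (rule inj_on_inverseI[where g = g]) (rule assms(3))
  show "f ` carrier A = carrier B"
    using mhom_closed[OF assms(1)] mhom_closed[OF assms(2)] assms(4) by (metis image_eqI image_subsetI subsetI subset_antisym)
qed

text \<open>Together with \<open>miso_retraction\<close> a two-out-of-three rule, to be fed with the
  triangle identities of the evaluation maps.\<close>

lemma miso_section:
  assumes f: "f \<in> mhom R A B" and g: "g \<in> miso R B A" and gf: "\<And>x. x \<in> carrier A \<Longrightarrow> g (f x) = x"
  shows "f \<in> miso R A B"
proof (rule misoI_inverse[OF f misoD(1)[OF g] gf])
  fix y assume y: "y \<in> carrier B"
  note gy = mhom_closed[OF misoD(1)[OF g] y]
  show "f (g y) = y" by (rule inj_onD[OF misoD(2)[OF g] gf[OF gy] mhom_closed[OF f gy] y])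
qed

lemma miso_retraction:
  assumes g: "g \<in> mhom R B A" and f: "f \<in> miso R A B" and gf: "\<And>x. x \<in> carrier A \<Longrightarrow> g (f x) = x"
  shows "g \<in> miso R B A"
proof (rule misoI_inverse[OF g misoD(1)[OF f] _ gf])
  fix y assume "y \<in> carrier B"
  then obtain x where "x \<in> carrier A" "y = f x" using misoD(3)[OF f] by blast
  then show "f (g y) = y" using gf by simp
qed

lemma zero_sub:
  assumes "lmodule R B"
  shows "lmodule R (sub B {\<zero>\<^bsub>B\<^esub>})" "carrier (sub B {\<zero>\<^bsub>B\<^esub>}) = {\<zero>\<^bsub>sub B {\<zero>\<^bsub>B\<^esub>}\<^esub>}"
proof -
  interpret B: lmodule R B by fact
  show "lmodule R (sub B {\<zero>\<^bsub>B\<^esub>})" by (rule lmodule_sub[OF assms]) auto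
qed simp

text \<open>Counterpart of \<open>ses_miso\<close> with first term zero: closure under cokernels of
  monomorphisms then contains closure under isomorphism.\<close>

lemma ses_miso_right:
  assumes "lmodule R A" "lmodule R B" "lmodule R Z" "carrier Z = {\<zero>\<^bsub>Z\<^esub>}" "f \<in> miso R A B"
  shows "ses R Z (\<lambda>_. \<zero>\<^bsub>A\<^esub>) A f B"
proof (rule sesI[OF assms(3,1,2)])
  note f = misoD[OF assms(5)]
  interpret A: lmodule R A by fact
  show "(\<lambda>_. \<zero>\<^bsub>A\<^esub>) \<in> mhom R Z A" by (rule mhom_zero_map[OF assms(1)])
  show "f \<in> mhom R A B" "f ` carrier A = carrier B" using f by blast+
  show "inj_on (\<lambda>_. \<zero>\<^bsub>A\<^esub>) (carrier Z)" unfolding assms(4) by simp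
  show "f \<zero>\<^bsub>A\<^esub> = \<zero>\<^bsub>B\<^esub>" by (rule mhom_zero[OF assms(1,2) f(1)])
  then show "\<exists>x\<in>carrier Z. y = \<zero>\<^bsub>A\<^esub>" if "y \<in> carrier A" "f y = \<zero>\<^bsub>B\<^esub>" for y
    using inj_onD[OF f(2) _ that(1) A.zero_closed] that(2) assms(4) by simp
qed

text \<open>The terms of a finite resolution must have their elements in \<open>'u\<close>; this
  exchanges a Hom module or a tensor product in the middle for its copy there.\<close>

lemma ses_miso_mid:
  assumes s: "ses R A f B g D" and B': "lmodule R B'" and t: "\<phi> \<in> miso R B B'"
  shows "ses R A (\<lambda>x. \<phi> (f x)) B' (\<lambda>y. g (inv_into (carrier B) \<phi> y)) D"
proof -
  note E = sesD[OF s] and t1 = misoD[OF t] and t2 = misoD[OF miso_inv[OF sesD(2)[OF s] t]]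
  let ?k = "inv_into (carrier B) \<phi>"
  have k: "?k (\<phi> x) = x" if "x \<in> carrier B" for x using t1(2) that by simp
  show ?thesis
  proof (rule sesI[OF E(1) B' E(3) mhom_comp[OF E(4) t1(1)] mhom_comp[OF t2(1) E(5)]])
    show "inj_on (\<lambda>x. \<phi> (f x)) (carrier A)"
      by (rule inj_onI) (rule inj_onD[OF E(6)], rule inj_onD[OF t1(2)], use mhom_closed[OF E(4)] in auto)
    have "(\<lambda>y. g (?k y)) ` carrier B' = g ` (?k ` carrier B')" by (simp add: image_image)
    then show "(\<lambda>y. g (?k y)) ` carrier B' = carrier D" unfolding t2(3) E(7) .
    show "g (?k (\<phi> (f x))) = \<zero>\<^bsub>D\<^esub>" if "x \<in> carrier A" for x
      using k[OF mhom_closed[OF E(4) that]] E(8)[OF that] by simp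
    show "\<exists>x\<in>carrier A. y = \<phi> (f x)" if y: "y \<in> carrier B'" "g (?k y) = \<zero>\<^bsub>D\<^esub>" for y
    proof -
      obtain x where x: "x \<in> carrier A" "?k y = f x" using E(9)[OF mhom_closed[OF t2(1) y(1)] y(2)] by blast
      have "y \<in> \<phi> ` carrier B" using y(1) t1(3) by simp
      then have "y = \<phi> (?k y)" by (simp add: f_inv_into_f)
      then show ?thesis using x by auto
    qed
  qed
qed

section \<open>Taking off the first term of a finite resolution\<close>

text \<open>Even length zero has a term of index 1, the zero module that ends the sequence; it is
  taken inside \<open>I\<close>, so that it lies in the right type.\<close>

lemma right_resolved_0I:
  fixes I :: "('r, 'u) module"
  assumes M: "lmodule R M" and I: "lmodule R I" and e: "\<phi> \<in> miso R M I" and P: "\<I> I"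
  shows "right_resolved R \<I> 0 M"
proof -
  let ?Z = "sub I {\<zero>\<^bsub>I\<^esub>}"
  let ?I = "case_nat I (\<lambda>_. ?Z)"
  note z = zero_sub[OF I] and m = misoD[OF e]
  have "right_exact_seq R (Suc 0) M \<phi> (\<lambda>_ _. \<zero>\<^bsub>I\<^esub>) ?I"
    unfolding right_exact_seq_def
  proof (intro conjI allI impI)
    show "lmodule R (?I i)" if "i \<le> Suc 0" for i using I z(1) by (cases i) auto
    show "(\<lambda>_. \<zero>\<^bsub>I\<^esub>) \<in> mhom R (?I i) (?I (Suc i))" if "i < Suc 0" for i
      using that mhom_zero_map[OF z(1), of I] by simp
    show "\<phi> ` carrier M = a_kernel (?I 0) (?I 1) (\<lambda>_. \<zero>\<^bsub>I\<^esub>)" using m(3) by (simp add: a_kernel_eq)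
  qed (use M m in auto)
  then show ?thesis
    unfolding right_resolved_def using P by (intro exI[of _ ?I] exI conjI) auto
qed

lemma right_resolved_0D:
  fixes \<I> :: "('r, 'u) module \<Rightarrow> bool"
  assumes "right_resolved R \<I> 0 M"
  shows "lmodule R M" "\<exists>(I :: ('r, 'u) module) \<phi>. lmodule R I \<and> \<phi> \<in> miso R M I \<and> \<I> I"
proof -
  obtain I :: "nat \<Rightarrow> ('r, 'u) module" and d e where r: "right_exact_seq R (Suc 0) M e d I" "carrier (I (Suc 0)) = {\<zero>\<^bsub>I (Suc 0)\<^esub>}" "\<I> (I 0)"
    using assms unfolding right_resolved_def by auto
  show "lmodule R M" using r(1) unfolding right_exact_seq_def by simp
  have L: "lmodule R (I 0)" "e \<in> mhom R M (I 0)" "d 0 \<in> mhom R (I 0) (I (Suc 0))" "inj_on e (carrier M)"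
    "e ` carrier M = a_kernel (I 0) (I (Suc 0)) (d 0)"
    using r(1) unfolding right_exact_seq_def by simp_all
  have "a_kernel (I 0) (I (Suc 0)) (d 0) = carrier (I 0)"
    using mhom_closed[OF L(3)] r(2) by (auto simp: a_kernel_eq)
  then show "\<exists>(I :: ('r, 'u) module) \<phi>. lmodule R I \<and> \<phi> \<in> miso R M I \<and> \<I> I"
    using misoI[OF L(2,4)] L(1,5) r(3) by auto
qed

lemma right_resolved_SucI:
  fixes I :: "('r, 'u) module"
  assumes s: "ses R M f I g L" and P: "\<I> I" and L: "right_resolved R \<I> k L"
  shows "right_resolved R \<I> (Suc k) M"
proof -
  note E = sesD[OF s]
  obtain J :: "nat \<Rightarrow> ('r, 'u) module" and d e where r: "right_exact_seq R (Suc k) L e d J" "carrier (J (Suc k)) = {\<zero>\<^bsub>J (Suc k)\<^esub>}"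
    "\<And>i. i \<le> k \<Longrightarrow> \<I> (J i)" using L unfolding right_resolved_def by blast
  have H: "\<And>i. i \<le> Suc k \<Longrightarrow> lmodule R (J i)" "e \<in> mhom R L (J 0)" "\<And>i. i < Suc k \<Longrightarrow> d i \<in> mhom R (J i) (J (Suc i))"
    "inj_on e (carrier L)" "e ` carrier L = a_kernel (J 0) (J 1) (d 0)"
    "\<And>i. Suc i < Suc k \<Longrightarrow> d i ` carrier (J i) = a_kernel (J (Suc i)) (J (Suc (Suc i))) (d (Suc i))"
    using r(1) unfolding right_exact_seq_def by simp_all
  interpret L: lmodule R L by (rule E(3))
  let ?J = "case_nat I J" and ?d = "case_nat (\<lambda>x. e (g x)) d"
  have eg: "(\<lambda>x. e (g x)) \<in> mhom R I (J 0)" by (rule mhom_comp[OF E(5) H(2)])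
  have "right_exact_seq R (Suc (Suc k)) M f ?d ?J"
    unfolding right_exact_seq_def
  proof (intro conjI allI impI)
    show "lmodule R (?J i)" if "i \<le> Suc (Suc k)" for i using that E(2) H(1) by (cases i) auto
    show "?d i \<in> mhom R (?J i) (?J (Suc i))" if "i < Suc (Suc k)" for i using that eg H(3) by (cases i) auto
    have "g y = \<zero>\<^bsub>L\<^esub> \<longleftrightarrow> e (g y) = \<zero>\<^bsub>J 0\<^esub>" if "y \<in> carrier I" for y
      using inj_on_eq_iff[OF H(4) mhom_closed[OF E(5) that] L.zero_closed] mhom_zero[OF E(3) H(1) H(2)] by simp
    then have "a_kernel I (J 0) (\<lambda>x. e (g x)) = {y \<in> carrier I. g y = \<zero>\<^bsub>L\<^esub>}" by (auto simp: a_kernel_eq)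
    also have "\<dots> = f ` carrier M" using s unfolding ses_def by simp
    finally show "f ` carrier M = a_kernel (?J 0) (?J 1) (?d 0)" by simp
    have "(\<lambda>x. e (g x)) ` carrier I = e ` (g ` carrier I)" by (simp add: image_image)
    then show "?d i ` carrier (?J i) = a_kernel (?J (Suc i)) (?J (Suc (Suc i))) (?d (Suc i))" if "Suc i < Suc (Suc k)" for i
      using that H(5,6) E(7) by (cases i) auto
  qed (use E in auto)
  moreover have "\<I> (?J i)" if "i \<le> Suc k" for i using that P r(3) by (cases i) auto
  ultimately show ?thesis
    unfolding right_resolved_def using r(2) by (intro exI[of _ ?J] exI[of _ ?d] exI[of _ f]) auto
qed

text \<open>The cokernel is realised as the image of the differential in \<open>I (Suc 0)\<close>,
  so \<open>L\<close> has its elements in \<open>'u\<close> even when \<open>M\<close> does not.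
  Later inductions therefore leave a foreign type after one step.\<close>

lemma right_resolved_SucD:
  fixes \<I> :: "('r, 'u) module \<Rightarrow> bool"
  assumes "right_resolved R \<I> (Suc k) M"
  shows "\<exists>(I :: ('r, 'u) module) (L :: ('r, 'u) module) f g. ses R M f I g L \<and> \<I> I \<and> right_resolved R \<I> k L"
proof -
  obtain I :: "nat \<Rightarrow> ('r, 'u) module" and d e where r: "right_exact_seq R (Suc (Suc k)) M e d I"
    "carrier (I (Suc (Suc k))) = {\<zero>\<^bsub>I (Suc (Suc k))\<^esub>}" "\<And>i. i \<le> Suc k \<Longrightarrow> \<I> (I i)"
    using assms unfolding right_resolved_def by blast
  have H: "lmodule R M" "\<And>i. i \<le> Suc (Suc k) \<Longrightarrow> lmodule R (I i)" "e \<in> mhom R M (I 0)"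
    "\<And>i. i < Suc (Suc k) \<Longrightarrow> d i \<in> mhom R (I i) (I (Suc i))"
    "inj_on e (carrier M)" "e ` carrier M = a_kernel (I 0) (I 1) (d 0)"
    "\<And>i. Suc i < Suc (Suc k) \<Longrightarrow> d i ` carrier (I i) = a_kernel (I (Suc i)) (I (Suc (Suc i))) (d (Suc i))"
    using r(1) unfolding right_exact_seq_def by simp_all
  let ?L = "sub (I (Suc 0)) (d 0 ` carrier (I 0))"
  have d0: "d 0 \<in> mhom R (I 0) (I (Suc 0))" using H(4) by simp
  have I0: "lmodule R (I 0)" "lmodule R (I (Suc 0))" using H(2) by simp_all
  have "ses R M e (I 0) (d 0) ?L"
    unfolding ses_def using H(1,3,5,6) I0 lmodule_image[OF I0 d0] mhom_into_sub[OF d0] by (simp add: a_kernel_eq)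
  moreover have "right_exact_seq R (Suc k) ?L (\<lambda>x. x) (\<lambda>i. d (Suc i)) (\<lambda>i. I (Suc i))"
    unfolding right_exact_seq_def
  proof (intro conjI allI impI)
    show "lmodule R ?L" by (rule lmodule_image[OF I0 d0])
    show "(\<lambda>x. x) \<in> mhom R ?L (I (Suc 0))"
      by (rule mhom_restrict_sub[OF mhom_id]) (use mhom_closed[OF d0] in blast)
    show "inj_on (\<lambda>x. x) (carrier ?L)" by (rule inj_onI)
  qed (use H(2,4,7) in auto)
  then have "right_resolved R \<I> k ?L"
    unfolding right_resolved_def using r(2,3) by (intro exI[of _ "\<lambda>i. I (Suc i)"] exI[of _ "\<lambda>i. d (Suc i)"] exI[of _ "\<lambda>x. x"]) auto
  ultimately show ?thesis using r(3) by blast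
qed

lemma right_resolved_miso:
  fixes \<I> :: "('r, 'u) module \<Rightarrow> bool"
  assumes M: "lmodule R M" and \<phi>: "\<phi> \<in> miso R M M'" and r: "right_resolved R \<I> k M'"
  shows "right_resolved R \<I> k M"
proof (cases k)
  case 0
  then obtain I :: "('r, 'u) module" and \<psi> where I: "lmodule R I" "\<psi> \<in> miso R M' I" "\<I> I"
    using right_resolved_0D[OF r[unfolded 0]] by blast
  show ?thesis unfolding 0 by (rule right_resolved_0I[OF M I(1) miso_comp[OF \<phi> I(2)]]) (rule I(3))
next
  case (Suc k')
  then obtain I L :: "('r, 'u) module" and f g where s: "ses R M' f I g L" "\<I> I" "right_resolved R \<I> k' L"
    using right_resolved_SucD[OF r[unfolded Suc]] by blast
  note E = sesD[OF s(1)] and m = misoD[OF \<phi>]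
  have "ses R M (\<lambda>x. f (\<phi> x)) I g L"
    unfolding ses_def
  proof (intro conjI M E(2,3,5,7) mhom_comp[OF m(1) E(4)])
    show "inj_on (\<lambda>x. f (\<phi> x)) (carrier M)"
      by (rule inj_onI) (rule inj_onD[OF m(2)], rule inj_onD[OF E(6)], use mhom_closed[OF m(1)] in auto)
    have "(\<lambda>x. f (\<phi> x)) ` carrier M = f ` (\<phi> ` carrier M)" by (simp add: image_image)
    then show "(\<lambda>x. f (\<phi> x)) ` carrier M = {y \<in> carrier I. g y = \<zero>\<^bsub>L\<^esub>}" using m(3) s(1) unfolding ses_def by simp
  qed
  then show ?thesis unfolding Suc by (rule right_resolved_SucI[OF _ s(2,3)])
qed

lemma left_resolved_0I:
  fixes F :: "('r, 'u) module"
  assumes N: "lmodule R N" and F: "lmodule R F" and e: "\<phi> \<in> miso R F N" and P: "\<F> F"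
  shows "left_resolved R \<F> 0 N"
proof -
  let ?Z = "sub F {\<zero>\<^bsub>F\<^esub>}"
  let ?F = "case_nat F (\<lambda>_. ?Z)"
  note z = zero_sub[OF F] and m = misoD[OF e]
  interpret F: lmodule R F by fact
  have "left_exact_seq R (Suc 0) ?F (\<lambda>_ x. x) \<phi> N"
    unfolding left_exact_seq_def
  proof (intro conjI allI impI)
    show "lmodule R (?F i)" if "i \<le> Suc 0" for i using F z(1) by (cases i) auto
    show "(\<lambda>x. x) \<in> mhom R (?F (Suc i)) (?F i)" if "i < Suc 0" for i
      using that mhom_restrict_sub[OF mhom_id, of "{\<zero>\<^bsub>F\<^esub>}" F R] by simp
    have "\<phi> x = \<zero>\<^bsub>N\<^esub> \<longleftrightarrow> x = \<zero>\<^bsub>F\<^esub>" if "x \<in> carrier F" for x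
      using inj_on_eq_iff[OF m(2) that F.zero_closed] mhom_zero[OF F N m(1)] by simp
    then have "{x \<in> carrier F. \<phi> x = \<zero>\<^bsub>N\<^esub>} = {\<zero>\<^bsub>F\<^esub>}" using F.zero_closed by blast
    then show "(\<lambda>x. x) ` carrier (?F 1) = a_kernel (?F 0) N \<phi>" by (simp add: a_kernel_eq)
  qed (use N m in auto)
  then show ?thesis
    unfolding left_resolved_def using P by (intro exI[of _ ?F] exI conjI) auto
qed

lemma left_resolved_0D:
  fixes \<F> :: "('r, 'u) module \<Rightarrow> bool"
  assumes "left_resolved R \<F> 0 N"
  shows "lmodule R N" "\<exists>(F :: ('r, 'u) module) \<phi>. lmodule R F \<and> \<phi> \<in> miso R F N \<and> \<F> F"
proof -
  obtain F :: "nat \<Rightarrow> ('r, 'u) module" and d e where r: "left_exact_seq R (Suc 0) F d e N" "carrier (F (Suc 0)) = {\<zero>\<^bsub>F (Suc 0)\<^esub>}" "\<F> (F 0)"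
    using assms unfolding left_resolved_def by auto
  show N: "lmodule R N" using r(1) unfolding left_exact_seq_def by simp
  have L: "lmodule R (F 0)" "lmodule R (F (Suc 0))" "e \<in> mhom R (F 0) N" "d 0 \<in> mhom R (F (Suc 0)) (F 0)" "e ` carrier (F 0) = carrier N"
    "d 0 ` carrier (F (Suc 0)) = a_kernel (F 0) N e"
    using r(1) unfolding left_exact_seq_def by simp_all
  have "a_kernel (F 0) N e = {\<zero>\<^bsub>F 0\<^esub>}"
    using L(6) r(2) mhom_zero[OF L(2,1,4)] by auto
  then have "inj_on e (carrier (F 0))"
    by (intro ahom_inj[OF lmodule_ab[OF L(1)] lmodule_ab[OF N] mhom_ahom[OF L(3)]]) (auto simp: a_kernel_eq)
  then show "\<exists>(F :: ('r, 'u) module) \<phi>. lmodule R F \<and> \<phi> \<in> miso R F N \<and> \<F> F"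
    using misoI[OF L(3) _ L(5)] L(1) r(3) by blast
qed

lemma left_resolved_SucI:
  fixes F :: "('r, 'u) module"
  assumes s: "ses R K f F g N" and P: "\<F> F" and K: "left_resolved R \<F> k K"
  shows "left_resolved R \<F> (Suc k) N"
proof -
  note E = sesD[OF s]
  obtain J :: "nat \<Rightarrow> ('r, 'u) module" and d e where r: "left_exact_seq R (Suc k) J d e K" "carrier (J (Suc k)) = {\<zero>\<^bsub>J (Suc k)\<^esub>}"
    "\<And>i. i \<le> k \<Longrightarrow> \<F> (J i)" using K unfolding left_resolved_def by blast
  have ker: "f ` carrier K = a_kernel F N g" using s unfolding ses_def a_kernel_eq by simp
  have "left_exact_seq R (Suc (Suc k)) (case_nat F J) (case_nat (\<lambda>x. f (e x)) d) g N"
    by (rule left_exact_seq_Suc[OF E(2,3,5,7,4,6) ker r(1)])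
  moreover have "\<F> (case_nat F J i)" if "i \<le> Suc k" for i using that P r(3) by (cases i) auto
  ultimately show ?thesis
    unfolding left_resolved_def using r(2)
    by (intro exI[of _ "case_nat F J"] exI[of _ "case_nat (\<lambda>x. f (e x)) d"] exI[of _ g]) auto
qed

text \<open>The kernel is taken inside \<open>F 0\<close>, so \<open>K\<close> has its elements in
  \<open>'u\<close> whatever the type of \<open>N\<close>.\<close>

lemma left_resolved_SucD:
  fixes \<F> :: "('r, 'u) module \<Rightarrow> bool"
  assumes "left_resolved R \<F> (Suc k) N"
  shows "\<exists>(F :: ('r, 'u) module) (K :: ('r, 'u) module) f g. ses R K f F g N \<and> \<F> F \<and> left_resolved R \<F> k K"
proof -
  obtain F :: "nat \<Rightarrow> ('r, 'u) module" and d e where r: "left_exact_seq R (Suc (Suc k)) F d e N"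
    "carrier (F (Suc (Suc k))) = {\<zero>\<^bsub>F (Suc (Suc k))\<^esub>}" "\<And>i. i \<le> Suc k \<Longrightarrow> \<F> (F i)"
    using assms unfolding left_resolved_def by blast
  have H: "lmodule R N" "\<And>i. i \<le> Suc (Suc k) \<Longrightarrow> lmodule R (F i)" "e \<in> mhom R (F 0) N"
    "\<And>i. i < Suc (Suc k) \<Longrightarrow> d i \<in> mhom R (F (Suc i)) (F i)" "e ` carrier (F 0) = carrier N"
    "d 0 ` carrier (F 1) = a_kernel (F 0) N e"
    "\<And>i. Suc i < Suc (Suc k) \<Longrightarrow> d (Suc i) ` carrier (F (Suc (Suc i))) = a_kernel (F (Suc i)) (F i) (d i)"
    using r(1) unfolding left_exact_seq_def by simp_all
  let ?K = "sub (F 0) (a_kernel (F 0) N e)"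
  have F0: "lmodule R (F 0)" "lmodule R (F (Suc 0))" using H(2) by simp_all
  have d0: "d 0 \<in> mhom R (F (Suc 0)) (F 0)" using H(4) by simp
  have K: "lmodule R ?K" unfolding a_kernel_eq by (rule lmodule_kernel[OF F0(1) H(1,3)])
  have dK: "d 0 \<in> mhom R (F (Suc 0)) ?K" by (rule mhom_into_sub[OF d0]) (use H(6) in auto)
  have "ses R ?K (\<lambda>x. x) (F 0) e N"
    unfolding ses_def using K F0 H(1,3,5) mhom_restrict_sub[OF mhom_id, of "a_kernel (F 0) N e" "F 0" R]
    by (auto simp: a_kernel_eq inj_on_def)
  moreover have "left_exact_seq R (Suc k) (\<lambda>i. F (Suc i)) (\<lambda>i. d (Suc i)) (d 0) ?K"
    unfolding left_exact_seq_def
  proof (intro conjI allI impI K dK)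
    show "d 0 ` carrier (F (Suc 0)) = carrier ?K" using H(6) by simp
    show "d (Suc 0) ` carrier (F (Suc 1)) = a_kernel (F (Suc 0)) ?K (d 0)" using H(7)[of 0] by (simp add: a_kernel_eq)
  qed (use H(2,4,7) in auto)
  then have "left_resolved R \<F> k ?K"
    unfolding left_resolved_def using r(2,3) by (intro exI[of _ "\<lambda>i. F (Suc i)"] exI[of _ "\<lambda>i. d (Suc i)"] exI[of _ "d 0"]) auto
  ultimately show ?thesis using r(3) by blast
qed

lemma left_resolved_miso:
  fixes \<F> :: "('r, 'u) module \<Rightarrow> bool"
  assumes N': "lmodule R N'" and \<phi>: "\<phi> \<in> miso R N N'" and r: "left_resolved R \<F> k N"
  shows "left_resolved R \<F> k N'"
proof (cases k)
  case 0
  then obtain F :: "('r, 'u) module" and \<psi> where F: "lmodule R F" "\<psi> \<in> miso R F N" "\<F> F"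
    using left_resolved_0D[OF r[unfolded 0]] by blast
  show ?thesis unfolding 0 by (rule left_resolved_0I[OF N' F(1) miso_comp[OF F(2) \<phi>]]) (rule F(3))
next
  case (Suc k')
  then obtain F K :: "('r, 'u) module" and f g where s: "ses R K f F g N" "\<F> F" "left_resolved R \<F> k' K"
    using left_resolved_SucD[OF r[unfolded Suc]] by blast
  note E = sesD[OF s(1)] and m = misoD[OF \<phi>]
  have "ses R K f F (\<lambda>x. \<phi> (g x)) N'"
    unfolding ses_def
  proof (intro conjI N' E(1,2,4,6) mhom_comp[OF E(5) m(1)])
    have "(\<lambda>x. \<phi> (g x)) ` carrier F = \<phi> ` (g ` carrier F)" by (simp add: image_image)
    then show "(\<lambda>x. \<phi> (g x)) ` carrier F = carrier N'" using m(3) E(7) by simp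
    interpret N: lmodule R N by (rule E(3))
    have "\<phi> (g y) = \<zero>\<^bsub>N'\<^esub> \<longleftrightarrow> g y = \<zero>\<^bsub>N\<^esub>" if "y \<in> carrier F" for y
      using inj_on_eq_iff[OF m(2) mhom_closed[OF E(5) that] N.zero_closed] mhom_zero[OF E(3) N' m(1)] by simp
    then show "f ` carrier K = {y \<in> carrier F. \<phi> (g y) = \<zero>\<^bsub>N'\<^esub>}" using s(1) unfolding ses_def by auto
  qed
  then show ?thesis unfolding Suc by (rule left_resolved_SucI[OF _ s(2,3)])
qed

section \<open>Closure properties of the Auslander and Bass classes\<close>

context bimod
begin

lemma hmap_comp:
  "hmap C g (hmap C f \<phi>) = hmap C (\<lambda>x. g (f x)) \<phi>"
  by (simp add: hmap_def cong: restrict_cong)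

lemma hmap_miso:
  assumes N: "lmodule S N" and N': "lmodule S N'" and \<phi>: "\<phi> \<in> miso S N N'"
  shows "hmap C \<phi> \<in> miso R (hom_mod S C N) (hom_mod S C N')"
proof (rule misoI_inverse[OF hmap_mhom[OF N misoD(1)[OF \<phi>]] hmap_mhom[OF N' misoD(1)[OF miso_inv[OF N \<phi>]]]])
  note m = misoD[OF \<phi>]
  show "hmap C (inv_into (carrier N) \<phi>) (hmap C \<phi> f) = f" if "f \<in> carrier (hom_mod S C N)" for f
    unfolding hmap_comp
    by (rule ext_eqI[of _ "carrier C"])
      (use that m(2) mhom_closed[of f S "left_mod C" N] in \<open>auto simp: hmap_def\<close>)
  show "hmap C \<phi> (hmap C (inv_into (carrier N) \<phi>) f) = f" if "f \<in> carrier (hom_mod S C N')" for f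
    unfolding hmap_comp
    by (rule ext_eqI[of _ "carrier C"])
      (use that m(3) mhom_closed[of f S "left_mod C" N'] in \<open>auto simp: hmap_def f_inv_into_f\<close>)
qed

lemma tmap2_miso:
  assumes M: "lmodule R M" and M': "lmodule R M'" and \<phi>: "\<phi> \<in> miso R M M'"
  shows "tmap2 R (right_mod C) M' \<phi> \<in> miso S (tensor_mod R C M) (tensor_mod R C M')"
proof -
  note m = misoD[OF \<phi>] and n = misoD[OF miso_inv[OF M \<phi>]]
  show ?thesis
  proof (rule misoI_inverse[OF tmap2_mhom[OF M M' m(1)] tmap2_mhom[OF M' M n(1)]])
    fix t assume "t \<in> carrier (tensor_mod R C M)"
    then have t: "t \<in> carrier (tensor R (right_mod C) M)" by simp
    have "tmap2 R (right_mod C) M (\<lambda>x. inv_into (carrier M) \<phi> (\<phi> x)) t = tmap2 R (right_mod C) M (\<lambda>x. x) t"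
      by (rule tmap2_cong[OF CR M M mhom_comp[OF m(1) n(1)] mhom_id _ t]) (use m(2) in simp)
    then show "tmap2 R (right_mod C) M (inv_into (carrier M) \<phi>) (tmap2 R (right_mod C) M' \<phi> t) = t"
      using tmap2_comp[OF CR M M' M m(1) n(1) t] tmap2_id[OF CR M t] by simp
  next
    fix t assume "t \<in> carrier (tensor_mod R C M')"
    then have t: "t \<in> carrier (tensor R (right_mod C) M')" by simp
    have "tmap2 R (right_mod C) M' (\<lambda>x. \<phi> (inv_into (carrier M) \<phi> x)) t = tmap2 R (right_mod C) M' (\<lambda>x. x) t"
      by (rule tmap2_cong[OF CR M' M' mhom_comp[OF n(1) m(1)] mhom_id _ t]) (use m(3) in \<open>simp add: f_inv_into_f\<close>)
    then show "tmap2 R (right_mod C) M' \<phi> (tmap2 R (right_mod C) M (inv_into (carrier M) \<phi>) t) = t"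
      using tmap2_comp[OF CR M' M M' n(1) m(1) t] tmap2_id[OF CR M' t] by simp
  qed
qed

lemma eval_unit_natural:
  assumes M: "lmodule R M" and M': "lmodule R M'" and f: "f \<in> mhom R M M'" and m: "m \<in> carrier M"
  shows "hmap C (tmap2 R (right_mod C) M' f) (eval_unit R C M m) = eval_unit R C M' (f m)"
  using tmap2(2)[OF CR M M' f] m by (auto simp: hmap_def eval_unit_def intro!: restrict_ext)

lemma eval_counit_natural:
  assumes N: "lmodule S N" and N': "lmodule S N'" and f: "f \<in> mhom S N N'"
    and t: "t \<in> carrier (tensor_mod R C (hom_mod S C N))"
  shows "eval_counit N' (tmap2 R (right_mod C) (hom_mod S C N') (hmap C f) t) = f (eval_counit N t)"
proof -
  note H = lmodule_hom_mod[OF N] and H' = lmodule_hom_mod[OF N'] and h = hmap_mhom[OF N f]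
  interpret T: tensor_pair R "right_mod C" "hom_mod S C N" by (rule tpair[OF H])
  have a: "eval_counit N \<in> ahom (tensor R (right_mod C) (hom_mod S C N)) N"
    "eval_counit N' \<in> ahom (tensor R (right_mod C) (hom_mod S C N')) N'"
    using mhom_ahom[OF eval_counit(1)[OF N]] mhom_ahom[OF eval_counit(1)[OF N']] by (simp_all add: ahom_tensor_mod)
  show ?thesis
  proof (rule T.tensor_ahom_eq[OF lmodule_ab[OF N'] ahom_comp[OF tmap2(1)[OF CR H H' h] a(2)]
        ahom_comp[OF a(1) mhom_ahom[OF f]]])
    fix c k assume "c \<in> carrier (right_mod C)" and k: "k \<in> carrier (hom_mod S C N)"
    then have c: "c \<in> carrier C" "c \<in> carrier (right_mod C)" by simp_all
    show "eval_counit N' (tmap2 R (right_mod C) (hom_mod S C N') (hmap C f) (T.tp c k)) = f (eval_counit N (T.tp c k))"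
      unfolding tmap2(2)[OF CR H H' h c(2) k] eval_counit(2)[OF N' c(1) mhom_closed[OF h k]] eval_counit(2)[OF N c(1) k]
      using c(1) by (simp add: hmap_def)
  qed (use t in simp)
qed

lemma tensor_zero_mod:
  assumes A: "lmodule (opp R) A" and Z: "lmodule R Z" "carrier Z = {\<zero>\<^bsub>Z\<^esub>}" and t: "t \<in> carrier (tensor R A Z)"
  shows "t = \<zero>\<^bsub>tensor R A Z\<^esub>"
proof -
  interpret T: tensor_pair R A Z by (rule tensor_pairI[OF A Z(1)])
  show ?thesis
    by (rule T.tensor_ahom_eq[OF T.abelian_tensor ahom_id ahom_zero_map[OF T.abelian_tensor] _ t])
      (use Z(2) T.tp_zero_r in auto)
qed

end

context foxby
begin

lemma foxby_sesI:
  "ses R A f B g D \<Longrightarrow> foxby_ses S R C Pl dl el ml vl \<xi>l Pr dr er mr vr \<xi>r A f B g D"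
  by (rule foxby_ses.intro[OF foxby_axioms foxby_ses_axioms.intro])

lemma EV_zero:
  assumes Z: "lmodule S Z" "carrier Z = {\<zero>\<^bsub>Z\<^esub>}"
  shows "EV Z"
proof (rule EV_I)
  fix i f assume "f \<in> mhom S (Pl (Suc i)) Z"
  then show "\<exists>g\<in>mhom S (Pl i) Z. \<forall>x\<in>carrier (Pl (Suc i)). f x = g (dl i x)"
    using mhom_closed[of f S "Pl (Suc i)" Z] Z(2)
    by (intro bexI[OF _ mhom_zero_map[OF Z(1)]]) auto
qed

lemma TV_zero:
  assumes Z: "lmodule R Z" "carrier Z = {\<zero>\<^bsub>Z\<^esub>}"
  shows "TV Z"
  unfolding Tor_vanish_def
proof (intro allI ballI impI)
  fix i t assume t: "t \<in> carrier (tensor R (Pr (Suc i)) Z)"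
  interpret T: tensor_pair R "Pr (Suc (Suc i))" Z by (rule tensor_pairI[OF Dr(2) Z(1)])
  show "\<exists>u\<in>carrier (tensor R (Pr (Suc (Suc i))) Z). t = tensor_map R (Pr (Suc (Suc i))) (Pr (Suc i)) Z (dr (Suc i)) u"
    by (rule bexI[OF _ T.TT.zero_closed])
      (use tensor_zero_mod[OF Dr(2) Z t] tensor_map_zero_elt[OF Dr(2) Dr(2) Z(1) Dr(4)] in simp)
qed

lemma EV_miso:
  assumes A: "lmodule S A" and B: "lmodule S B" and \<phi>: "\<phi> \<in> miso S A B" and v: "EV B"
  shows "EV A"
proof (rule EV_I)
  note m = misoD[OF \<phi>] and n = misoD[OF miso_inv[OF A \<phi>]]
  fix i f assume f: "f \<in> mhom S (Pl (Suc i)) A" "\<And>x. x \<in> carrier (Pl (Suc (Suc i))) \<Longrightarrow> f (dl (Suc i) x) = \<zero>\<^bsub>A\<^esub>"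
  obtain g where g: "g \<in> mhom S (Pl i) B" "\<And>x. x \<in> carrier (Pl (Suc i)) \<Longrightarrow> \<phi> (f x) = g (dl i x)"
    using EV_D[OF v mhom_comp[OF f(1) m(1)]] f(2) mhom_zero[OF A B m(1)] by auto
  have "f x = inv_into (carrier A) \<phi> (g (dl i x))" if "x \<in> carrier (Pl (Suc i))" for x
    unfolding g(2)[OF that, symmetric] using m(2) mhom_closed[OF f(1) that] by simp
  then show "\<exists>g\<in>mhom S (Pl i) A. \<forall>x\<in>carrier (Pl (Suc i)). f x = g (dl i x)"
    by (intro bexI[OF _ mhom_comp[OF g(1) n(1)]]) simp
qed

lemma TV_miso:
  assumes A: "lmodule R A" and B: "lmodule R B" and \<phi>: "\<phi> \<in> miso R A B" and v: "TV B"
  shows "TV A"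
proof -
  note z = zero_sub[OF B]
  from foxby_ses.TV_kernel[OF foxby_sesI[OF ses_miso[OF A B z \<phi>]] v TV_zero[OF z]] show ?thesis .
qed

text \<open>The Auslander class with Tor and Ext replaced by vanishing on the fixed resolutions; the
  final theorem identifies it with \<open>Auslander\<close>.\<close>

definition Aus :: "('r, 'm) module \<Rightarrow> bool"
  where "Aus M \<longleftrightarrow> lmodule R M \<and> TV M \<and> EV (tensor_mod R C M) \<and>
    eval_unit R C M \<in> miso R M (hom_mod S C (tensor_mod R C M))"

definition Bas :: "('s, 'm) module \<Rightarrow> bool"
  where "Bas N \<longleftrightarrow> lmodule S N \<and> EV N \<and> TV (hom_mod S C N) \<and>
    eval_counit N \<in> miso S (tensor_mod R C (hom_mod S C N)) N"

text \<open>Left exactness is general; surjectivity at the right end is where \<open>EV A\<close>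
  enters, through \<open>EV_hom_onto\<close>.\<close>

lemma ses_hom:
  assumes s: "ses S A f B g D" and v: "EV A"
  shows "ses R (hom_mod S C A) (hmap C f) (hom_mod S C B) (hmap C g) (hom_mod S C D)"
proof -
  note E = sesD[OF s]
  show ?thesis
  proof (rule sesI[OF lmodule_hom_mod[OF E(1)] lmodule_hom_mod[OF E(2)] lmodule_hom_mod[OF E(3)]
        hmap_mhom[OF E(1,4)] hmap_mhom[OF E(2,5)]])
    show "inj_on (hmap C f) (carrier (hom_mod S C A))"
    proof (rule inj_onI)
      fix x y assume xy: "x \<in> carrier (hom_mod S C A)" "y \<in> carrier (hom_mod S C A)" "hmap C f x = hmap C f y"
      show "x = y"
      proof (rule ext_eqI[of _ "carrier C"])
        fix c assume c: "c \<in> carrier C"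
        have "x c \<in> carrier A" "y c \<in> carrier A"
          using xy(1,2) mhom_closed[of _ S "left_mod C" A c] c by auto
        moreover have "f (x c) = f (y c)" using fun_cong[OF xy(3), of c] c by (simp add: hmap_def)
        ultimately show "x c = y c" using inj_onD[OF E(6)] by blast
      qed (use xy in auto)
    qed
    show "hmap C g ` carrier (hom_mod S C B) = carrier (hom_mod S C D)"
    proof
      show "hmap C g ` carrier (hom_mod S C B) \<subseteq> carrier (hom_mod S C D)"
        using mhom_closed[OF hmap_mhom[OF E(2,5)]] by blast
      show "carrier (hom_mod S C D) \<subseteq> hmap C g ` carrier (hom_mod S C B)"
      proof
        fix h assume h: "h \<in> carrier (hom_mod S C D)"
        then have "h \<in> mhom S (left_mod C) D" by simp
        then obtain k where k: "k \<in> mhom S (left_mod C) B" "\<And>x. x \<in> carrier C \<Longrightarrow> g (k x) = h x"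
          using EV_hom_onto[OF s v] by blast
        have "h = hmap C g (restrict k (carrier C))"
          by (rule ext_eqI[of _ "carrier C"]) (use h k(2) in \<open>auto simp: hmap_def\<close>)
        moreover have "restrict k (carrier C) \<in> carrier (hom_mod S C B)" using mhom_restrict[OF CL k(1)] by simp
        ultimately show "h \<in> hmap C g ` carrier (hom_mod S C B)" by blast
      qed
    qed
    show "hmap C g (hmap C f x) = \<zero>\<^bsub>hom_mod S C D\<^esub>" if "x \<in> carrier (hom_mod S C A)" for x
    proof -
      have "g (f (x c)) = \<zero>\<^bsub>D\<^esub>" if "c \<in> carrier C" for c
        using E(8)[of "x c"] mhom_closed[of x S "left_mod C" A c] \<open>x \<in> _\<close> that by simp
      then show ?thesis unfolding hmap_comp by (auto simp: hmap_def intro!: restrict_ext)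
    qed
    show "\<exists>x\<in>carrier (hom_mod S C A). y = hmap C f x"
      if y: "y \<in> carrier (hom_mod S C B)" "hmap C g y = \<zero>\<^bsub>hom_mod S C D\<^esub>" for y
    proof -
      have y': "y \<in> mhom S (left_mod C) B" using y(1) by simp
      have "g (y c) = \<zero>\<^bsub>D\<^esub>" if "c \<in> carrier (left_mod C)" for c
        using fun_cong[OF y(2), of c] that by (simp add: hmap_def)
      then obtain x where x: "x \<in> mhom S (left_mod C) A" "\<And>c. c \<in> carrier C \<Longrightarrow> f (x c) = y c"
        using ses_factor[OF s CL y'] by auto
      have "y = hmap C f (restrict x (carrier C))"
        by (rule ext_eqI[of _ "carrier C"]) (use y(1) x(2) in \<open>auto simp: hmap_def\<close>)
      then show ?thesis using mhom_restrict[OF CL x(1)] by (intro bexI[of _ "restrict x (carrier C)"]) auto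
    qed
  qed
qed

text \<open>Supplies the third term when an isomorphism is treated as a short exact sequence in
  \<open>Aus_miso\<close>.\<close>

lemma Aus_zero:
  assumes Z: "lmodule R Z" "carrier Z = {\<zero>\<^bsub>Z\<^esub>}"
  shows "Aus Z"
proof -
  have T: "lmodule S (tensor_mod R C Z)" by (rule lmodule_tensor_mod[OF Z(1)])
  interpret T: lmodule S "tensor_mod R C Z" by (rule T)
  interpret Z: lmodule R Z by (rule Z(1))
  have T0: "carrier (tensor_mod R C Z) = {\<zero>\<^bsub>tensor_mod R C Z\<^esub>}"
    using tensor_zero_mod[OF CR Z] T.zero_closed unfolding tensor_mod_simps by blast
  have u: "eval_unit R C Z \<in> miso R Z (hom_mod S C (tensor_mod R C Z))"
  proof (rule misoI[OF eval_unit_mhom[OF Z(1)]])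
    show "inj_on (eval_unit R C Z) (carrier Z)" unfolding Z(2) by simp
    have "f = eval_unit R C Z \<zero>\<^bsub>Z\<^esub>" if f: "f \<in> carrier (hom_mod S C (tensor_mod R C Z))" for f
    proof (rule ext_eqI[of _ "carrier C"])
      note u = mhom_closed[OF eval_unit_mhom[OF Z(1)] Z.zero_closed]
      show "f c = eval_unit R C Z \<zero>\<^bsub>Z\<^esub> c" if "c \<in> carrier C" for c
        using mhom_closed[of f S "left_mod C" "tensor_mod R C Z" c]
          mhom_closed[of "eval_unit R C Z \<zero>\<^bsub>Z\<^esub>" S "left_mod C" "tensor_mod R C Z" c] f u T0 that by simp
    qed (use f in \<open>auto simp: eval_unit_def\<close>)
    then have "carrier (hom_mod S C (tensor_mod R C Z)) \<subseteq> {eval_unit R C Z \<zero>\<^bsub>Z\<^esub>}" by auto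
    then show "eval_unit R C Z ` carrier Z = carrier (hom_mod S C (tensor_mod R C Z))"
      using mhom_closed[OF eval_unit_mhom[OF Z(1)] Z.zero_closed] unfolding Z(2) image_insert image_empty by auto
  qed
  show ?thesis
    unfolding Aus_def by (intro conjI Z(1) TV_zero[OF Z] EV_zero[OF T T0] u)
qed

lemma Bas_zero:
  assumes Z: "lmodule S Z" "carrier Z = {\<zero>\<^bsub>Z\<^esub>}"
  shows "Bas Z"
proof -
  have H: "lmodule R (hom_mod S C Z)" by (rule lmodule_hom_mod[OF Z(1)])
  interpret H: lmodule R "hom_mod S C Z" by (rule H)
  have "f = \<zero>\<^bsub>hom_mod S C Z\<^esub>" if f: "f \<in> carrier (hom_mod S C Z)" for f
    by (rule ext_eqI[of _ "carrier C"])
      (use f mhom_closed[of f S "left_mod C" Z] Z(2) in auto)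
  then have H0: "carrier (hom_mod S C Z) = {\<zero>\<^bsub>hom_mod S C Z\<^esub>}" using H.zero_closed by blast
  have T: "lmodule S (tensor_mod R C (hom_mod S C Z))" by (rule lmodule_tensor_mod[OF H])
  interpret T: lmodule S "tensor_mod R C (hom_mod S C Z)" by (rule T)
  have T0: "carrier (tensor_mod R C (hom_mod S C Z)) = {\<zero>\<^bsub>tensor_mod R C (hom_mod S C Z)\<^esub>}"
    using tensor_zero_mod[OF CR H H0] T.zero_closed unfolding tensor_mod_simps by blast
  have u: "eval_counit Z \<in> miso S (tensor_mod R C (hom_mod S C Z)) Z"
    by (rule misoI[OF eval_counit(1)[OF Z(1)]])
      (use T0 Z(2) mhom_zero[OF T Z(1) eval_counit(1)[OF Z(1)]] in simp_all)
  show ?thesis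
    unfolding Bas_def by (intro conjI Z(1) EV_zero[OF Z] TV_zero[OF H H0] u)
qed

text \<open>\<open>C \<otimes> -\<close> keeps the sequence exact because Tor of \<open>D\<close>
  vanishes. For Ext of \<open>C \<otimes> A\<close> each map from C to \<open>C \<otimes> D\<close>
  must lift: it is the unit at some \<open>x\<close> in \<open>D\<close>, and the unit at a preimage
  of \<open>x\<close> in \<open>B\<close> lifts it. The unit of \<open>A\<close> is then bijective
  by the chase of the five lemma.\<close>

lemma Aus_kernel:
  assumes s: "ses R A f B g D" and B: "Aus B" and D: "Aus D"
  shows "Aus A"
    "ses S (tensor_mod R C A) (tmap2 R (right_mod C) B f) (tensor_mod R C B)
      (tmap2 R (right_mod C) D g) (tensor_mod R C D)"
proof -
  note E = sesD[OF s]
  let ?f = "tmap2 R (right_mod C) B f" and ?g = "tmap2 R (right_mod C) D g"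
  have vB: "TV B" "EV (tensor_mod R C B)" "eval_unit R C B \<in> miso R B (hom_mod S C (tensor_mod R C B))"
    and vD: "TV D" "EV (tensor_mod R C D)" "eval_unit R C D \<in> miso R D (hom_mod S C (tensor_mod R C D))"
    using B D unfolding Aus_def by blast+
  interpret Z: foxby_ses S R C Pl dl el ml vl \<xi>l Pr dr er mr vr \<xi>r A f B g D by (rule foxby_sesI[OF s])
  note mB = misoD[OF vB(3)] and mD = misoD[OF vD(3)]
  interpret A: lmodule R A by (rule E)
  interpret B: lmodule R B by (rule E)
  interpret D: lmodule R D by (rule E)
  show st: "ses S (tensor_mod R C A) ?f (tensor_mod R C B) ?g (tensor_mod R C D)" by (rule Z.ses_tensor[OF vD(1)])
  note F = sesD[OF st]
  have TA: "TV A" by (rule Z.TV_kernel[OF vB(1) vD(1)])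
  have EA: "EV (tensor_mod R C A)"
  proof (rule EV_kernel[OF st vB(2) vD(2)])
    fix h assume h: "h \<in> mhom S (left_mod C) (tensor_mod R C D)"
    have "restrict h (carrier C) \<in> carrier (hom_mod S C (tensor_mod R C D))" using mhom_restrict[OF CL h] by simp
    then obtain x where x: "x \<in> carrier D" "restrict h (carrier C) = eval_unit R C D x" using mD(3) by blast
    obtain b where b: "b \<in> carrier B" "x = g b" using E(7) x(1) by blast
    have k: "eval_unit R C B b \<in> mhom S (left_mod C) (tensor_mod R C B)" using mhom_closed[OF mB(1) b(1)] by simp
    have "?g (eval_unit R C B b c) = h c" if c: "c \<in> carrier C" for c
      using fun_cong[OF eval_unit_natural[OF E(2,3,5) b(1)], of c] fun_cong[OF x(2), of c] b(2) c
      by (simp add: hmap_def)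
    then show "\<exists>k\<in>mhom S (left_mod C) (tensor_mod R C B). \<forall>x\<in>carrier C. ?g (k x) = h x" using k by blast
  qed
  note sh = ses_hom[OF st EA]
  note G = sesD[OF sh] and uA = eval_unit_mhom[OF E(1)]
  have nat: "hmap C ?f (eval_unit R C A a) = eval_unit R C B (f a)" if "a \<in> carrier A" for a
    by (rule eval_unit_natural[OF E(1,2,4) that])
  have "eval_unit R C A \<in> miso R A (hom_mod S C (tensor_mod R C A))"
  proof (rule misoI[OF uA])
    show "inj_on (eval_unit R C A) (carrier A)"
    proof (rule inj_onI)
      fix x y assume xy: "x \<in> carrier A" "y \<in> carrier A" "eval_unit R C A x = eval_unit R C A y"
      then have "eval_unit R C B (f x) = eval_unit R C B (f y)" using nat by metis
      then have "f x = f y" using inj_onD[OF mB(2)] mhom_closed[OF E(4)] xy by blast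
      then show "x = y" using inj_onD[OF E(6)] xy by blast
    qed
    show "eval_unit R C A ` carrier A = carrier (hom_mod S C (tensor_mod R C A))"
    proof
      show "eval_unit R C A ` carrier A \<subseteq> carrier (hom_mod S C (tensor_mod R C A))" using mhom_closed[OF uA] by blast
      show "carrier (hom_mod S C (tensor_mod R C A)) \<subseteq> eval_unit R C A ` carrier A"
      proof
        fix h assume h: "h \<in> carrier (hom_mod S C (tensor_mod R C A))"
        obtain b where b: "b \<in> carrier B" "hmap C ?f h = eval_unit R C B b"
          using mhom_closed[OF G(4) h] mB(3) by blast
        have "eval_unit R C D (g b) = \<zero>\<^bsub>hom_mod S C (tensor_mod R C D)\<^esub>"
          using eval_unit_natural[OF E(2,3,5) b(1)] b(2) G(8)[OF h] by simp
        also have "\<dots> = eval_unit R C D \<zero>\<^bsub>D\<^esub>"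
          by (rule mhom_zero[OF E(3) G(3) mD(1), symmetric])
        finally have "g b = \<zero>\<^bsub>D\<^esub>"
          by (rule inj_onD[OF mD(2) _ mhom_closed[OF E(5) b(1)] D.zero_closed])
        then obtain a where a: "a \<in> carrier A" "b = f a" using E(9)[OF b(1)] by blast
        have "hmap C ?f h = hmap C ?f (eval_unit R C A a)" using nat[OF a(1)] a(2) b(2) by simp
        then have "h = eval_unit R C A a" by (rule inj_onD[OF G(6) _ h mhom_closed[OF uA a(1)]])
        then show "h \<in> eval_unit R C A ` carrier A" using a(1) by blast
      qed
    qed
  qed
  then show "Aus A" unfolding Aus_def using E(1) TA EA by blast
qed

text \<open>Tor of \<open>Hom(C, D)\<close> vanishes once \<open>C \<otimes> Hom(C, A)\<close>
  embeds in \<open>C \<otimes> Hom(C, B)\<close>, and the counits identify this map with the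
  injective \<open>f\<close>. The counit of \<open>D\<close> follows from those of \<open>A\<close>
  and \<open>B\<close> by a chase.\<close>

lemma Bas_cokernel:
  assumes s: "ses S A f B g D" and A: "Bas A" and B: "Bas B"
  shows "Bas D"
    "ses R (hom_mod S C A) (hmap C f) (hom_mod S C B) (hmap C g) (hom_mod S C D)"
proof -
  note E = sesD[OF s]
  have vA: "EV A" "TV (hom_mod S C A)" "eval_counit A \<in> miso S (tensor_mod R C (hom_mod S C A)) A"
    and vB: "EV B" "TV (hom_mod S C B)" "eval_counit B \<in> miso S (tensor_mod R C (hom_mod S C B)) B"
    using A B unfolding Bas_def by blast+
  note mA = misoD[OF vA(3)] and mB = misoD[OF vB(3)]
  interpret A: lmodule S A by (rule E)
  interpret B: lmodule S B by (rule E)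
  interpret D: lmodule S D by (rule E)
  show sh: "ses R (hom_mod S C A) (hmap C f) (hom_mod S C B) (hmap C g) (hom_mod S C D)" by (rule ses_hom[OF s vA(1)])
  interpret Z: foxby_ses S R C Pl dl el ml vl \<xi>l Pr dr er mr vr \<xi>r "hom_mod S C A" "hmap C f" "hom_mod S C B" "hmap C g" "hom_mod S C D"
    by (rule foxby_sesI[OF sh])
  have ED: "EV D" by (rule EV_cokernel[OF s vA(1) vB(1)])
  note HA = lmodule_hom_mod[OF E(1)] and HB = lmodule_hom_mod[OF E(2)] and HD = lmodule_hom_mod[OF E(3)]
  note TA = lmodule_tensor_mod[OF HA] and TB = lmodule_tensor_mod[OF HB] and TD = lmodule_tensor_mod[OF HD]
  note nf = eval_counit_natural[OF E(1,2,4)] and ng = eval_counit_natural[OF E(2,3,5)]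
  interpret TA: lmodule S "tensor_mod R C (hom_mod S C A)" by (rule TA)
  have zB: "eval_counit B \<zero>\<^bsub>tensor_mod R C (hom_mod S C B)\<^esub> = \<zero>\<^bsub>B\<^esub>" by (rule mhom_zero[OF TB E(2) mB(1)])
  have TDv: "TV (hom_mod S C D)"
  proof (rule Z.TV_cokernel[OF vA(2) vB(2)])
    fix t assume t: "t \<in> carrier (Z.TC (hom_mod S C A))" "Z.FC t = \<zero>\<^bsub>Z.TC (hom_mod S C B)\<^esub>"
    then have t': "t \<in> carrier (tensor_mod R C (hom_mod S C A))" by simp
    have "f (eval_counit A t) = f \<zero>\<^bsub>A\<^esub>" using nf[OF t'] t(2) zB mhom_zero[OF E(1,2,4)] by simp
    then have "eval_counit A t = \<zero>\<^bsub>A\<^esub>" by (rule inj_onD[OF E(6) _ mhom_closed[OF mA(1) t'] A.zero_closed])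
    also have "\<dots> = eval_counit A \<zero>\<^bsub>tensor_mod R C (hom_mod S C A)\<^esub>" by (rule mhom_zero[OF TA E(1) mA(1), symmetric])
    finally have "t = \<zero>\<^bsub>tensor_mod R C (hom_mod S C A)\<^esub>" by (rule inj_onD[OF mA(2) _ t' TA.zero_closed])
    then show "t = \<zero>\<^bsub>Z.TC (hom_mod S C A)\<^esub>" by simp
  qed
  have "eval_counit D \<in> miso S (tensor_mod R C (hom_mod S C D)) D"
  proof (rule misoI[OF eval_counit(1)[OF E(3)]])
    show "inj_on (eval_counit D) (carrier (tensor_mod R C (hom_mod S C D)))"
    proof (rule ahom_inj[OF lmodule_ab[OF TD] D.abelian_group_axioms mhom_ahom[OF eval_counit(1)[OF E(3)]]])
      fix w assume "w \<in> carrier (tensor_mod R C (hom_mod S C D))" and w0: "eval_counit D w = \<zero>\<^bsub>D\<^esub>"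
      then obtain u where u: "u \<in> carrier (tensor_mod R C (hom_mod S C B))" "w = Z.GC u" using Z.GC_onto by auto
      have "g (eval_counit B u) = \<zero>\<^bsub>D\<^esub>" using ng[OF u(1)] u(2) w0 by simp
      then obtain k where k: "k \<in> carrier A" "eval_counit B u = f k" using E(9)[OF mhom_closed[OF mB(1) u(1)]] by blast
      obtain x where x: "x \<in> carrier (tensor_mod R C (hom_mod S C A))" "k = eval_counit A x" using mA(3) k(1) by blast
      have fx: "Z.FC x \<in> carrier (tensor_mod R C (hom_mod S C B))" using ahom_closed[OF Z.FG(3)] x(1) by simp
      have "eval_counit B u = eval_counit B (Z.FC x)" using nf[OF x(1)] k(2) x(2) by simp
      then have "u = Z.FC x" by (rule inj_onD[OF mB(2) _ u(1) fx])
      then show "w = \<zero>\<^bsub>tensor_mod R C (hom_mod S C D)\<^esub>" using u(2) Z.GFC x(1) by simp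
    qed
    show "eval_counit D ` carrier (tensor_mod R C (hom_mod S C D)) = carrier D"
    proof
      show "eval_counit D ` carrier (tensor_mod R C (hom_mod S C D)) \<subseteq> carrier D"
        using mhom_closed[OF eval_counit(1)[OF E(3)]] by blast
      show "carrier D \<subseteq> eval_counit D ` carrier (tensor_mod R C (hom_mod S C D))"
      proof
        fix y assume "y \<in> carrier D"
        then obtain b where b: "b \<in> carrier B" "y = g b" using E(7) by blast
        obtain u where u: "u \<in> carrier (tensor_mod R C (hom_mod S C B))" "b = eval_counit B u" using mB(3) b(1) by blast
        have "y = eval_counit D (Z.GC u)" using ng[OF u(1)] b(2) u(2) by simp
        moreover have "Z.GC u \<in> carrier (tensor_mod R C (hom_mod S C D))" using ahom_closed[OF Z.FG(4)] u(1) by simp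
        ultimately show "y \<in> eval_counit D ` carrier (tensor_mod R C (hom_mod S C D))" by blast
      qed
    qed
  qed
  then show "Bas D" unfolding Bas_def using E(3) ED TDv by blast
qed

lemma Aus_miso:
  assumes A: "lmodule R A" and \<phi>: "\<phi> \<in> miso R A B" and B: "Aus B"
  shows "Aus A"
proof -
  have Bm: "lmodule R B" using B by (simp add: Aus_def)
  note z = zero_sub[OF Bm]
  show ?thesis by (rule Aus_kernel(1)[OF ses_miso[OF A Bm z \<phi>] B Aus_zero[OF z]])
qed

lemma Bas_miso:
  assumes B: "lmodule S B" and \<phi>: "\<phi> \<in> miso S A B" and A: "Bas A"
  shows "Bas B"
proof -
  have Am: "lmodule S A" using A by (simp add: Bas_def)
  note z = zero_sub[OF Am]
  show ?thesis by (rule Bas_cokernel(1)[OF ses_miso_right[OF Am B z \<phi>] Bas_zero[OF z] A])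
qed

text \<open>By a triangle identity the unit at \<open>Hom(C, X)\<close> is a section of the map
  induced by the counit of \<open>X\<close>; that map is an isomorphism, hence so is the unit.
  Vanishing of Ext passes to \<open>C \<otimes> Hom(C, X)\<close> along the counit.\<close>

lemma fp_injective_Aus:
  fixes X :: "('s, 'u) module"
  assumes X: "fp_injective n S X"
  shows "Aus (hom_mod S C X)"
proof -
  have Xm: "lmodule S X" using X by (simp add: fp_injective_def)
  let ?H = "hom_mod S C X"
  have H: "lmodule R ?H" by (rule lmodule_hom_mod[OF Xm])
  have T: "lmodule S (tensor_mod R C ?H)" by (rule lmodule_tensor_mod[OF H])
  note c = fp_injective_counit[OF X]
  have "EV (tensor_mod R C ?H)" by (rule EV_miso[OF T Xm c fp_injective_Ext_vanish[OF X]])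
  moreover have "eval_unit R C ?H \<in> miso R ?H (hom_mod S C (tensor_mod R C ?H))"
  proof (rule miso_section[OF eval_unit_mhom[OF H] hmap_miso[OF T Xm c]])
    show "hmap C (eval_counit X) (eval_unit R C ?H h) = h" if h: "h \<in> carrier ?H" for h
      by (rule ext_eqI[of _ "carrier C"]) (use h eval_counit(2)[OF Xm] in \<open>auto simp: hmap_def eval_unit_def\<close>)
  qed
  ultimately show ?thesis unfolding Aus_def using H fp_injective_Tor_vanish[OF X] by blast
qed

text \<open>The other triangle identity makes the counit at \<open>C \<otimes> Y\<close> a
  retraction of the map induced by the unit of \<open>Y\<close>, which is an isomorphism.\<close>

lemma fp_flat_Bas:
  fixes Y :: "('r, 'u) module"
  assumes Y: "fp_flat n R Y"
  shows "Bas (tensor_mod R C Y)"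
proof -
  have Ym: "lmodule R Y" using Y by (simp add: fp_flat_def)
  let ?T = "tensor_mod R C Y"
  have T: "lmodule S ?T" by (rule lmodule_tensor_mod[OF Ym])
  have H: "lmodule R (hom_mod S C ?T)" by (rule lmodule_hom_mod[OF T])
  note u = fp_flat_unit[OF Y]
  have "TV (hom_mod S C ?T)"
    by (rule TV_miso[OF H Ym miso_inv[OF Ym u] fp_flat_Tor_vanish[OF Y]])
  moreover have "eval_counit ?T \<in> miso S (tensor_mod R C (hom_mod S C ?T)) ?T"
  proof (rule miso_retraction[OF eval_counit(1)[OF T] tmap2_miso[OF Ym H u]])
    fix t assume "t \<in> carrier ?T"
    then have t: "t \<in> carrier (tensor R (right_mod C) Y)" by simp
    interpret P: tensor_pair R "right_mod C" Y by (rule tpair[OF Ym])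
    note tm = tmap2[OF CR Ym H misoD(1)[OF u]]
    show "eval_counit ?T (tmap2 R (right_mod C) (hom_mod S C ?T) (eval_unit R C Y) t) = t"
    proof (rule P.tensor_ahom_eq[OF P.abelian_tensor _ ahom_id _ t])
      show "(\<lambda>t. eval_counit ?T (tmap2 R (right_mod C) (hom_mod S C ?T) (eval_unit R C Y) t)) \<in>
          ahom (tensor R (right_mod C) Y) (tensor R (right_mod C) Y)"
        by (rule ahom_comp[OF tm(1) mhom_ahom[OF eval_counit(1)[OF T], unfolded ahom_tensor_mod]])
      fix c y assume "c \<in> carrier (right_mod C)" and y: "y \<in> carrier Y"
      then have c: "c \<in> carrier (right_mod C)" "c \<in> carrier C" by simp_all
      show "eval_counit ?T (tmap2 R (right_mod C) (hom_mod S C ?T) (eval_unit R C Y) (P.tp c y)) = P.tp c y"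
        unfolding tm(2)[OF c(1) y] eval_counit(2)[OF T c(2) mhom_closed[OF misoD(1)[OF u] y]]
        using c(2) by (simp add: eval_unit_def)
    qed
  qed
  ultimately show ?thesis unfolding Bas_def using T fp_flat_Ext_vanish[OF Y] by blast
qed

section \<open>Resolutions by \<open>C\<close>-injective and \<open>C\<close>-flat modules\<close>

text \<open>C is finitely generated, so a map out of it is known from finitely many values, and
  \<open>Hom(C, X)\<close> embeds as a set in a finite power of \<open>X\<close>.\<close>

lemma hom_mod_transport:
  fixes X :: "('s, 'u) module"
  assumes X: "lmodule S X"
  shows "\<exists>(I :: ('r, 'u) module) \<phi>. lmodule R I \<and> \<phi> \<in> miso R (hom_mod S C X) I"
proof (rule transport_module[OF lmodule_hom_mod[OF X]])
  interpret X: lmodule S X by fact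
  obtain m v where v: "gens S (left_mod C) m v" using fpg_gens[OF fpgl] by blast
  note G = gensD[OF v]
  let ?i = "\<lambda>f j. if j < m then f (v j) else \<zero>\<^bsub>X\<^esub>"
  have "inj_on ?i (carrier (hom_mod S C X))"
  proof (rule inj_onI)
    fix f h assume fh: "f \<in> carrier (hom_mod S C X)" "h \<in> carrier (hom_mod S C X)" "?i f = ?i h"
    have e: "f (v j) = h (v j)" if "j < m" for j using fun_cong[OF fh(3), of j] that by simp
    have fh': "f \<in> mhom S (left_mod C) X" "h \<in> mhom S (left_mod C) X" using fh by simp_all
    show "f = h"
    proof (rule ext_eqI[of _ "carrier C"])
      fix c assume "c \<in> carrier C"
      then obtain a where a: "a \<in> carrier (pw (reg S) m)" "c = lincomb (left_mod C) m v a" using G(2)[of c] by auto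
      have ac: "a i \<in> carrier S" for i using pw_closed[OF lmodule_ab[OF lmodule_reg[OF ringS]] a(1)] by simp
      have "f c = lincomb X m (\<lambda>i. f (v i)) a" unfolding a(2) by (rule lincomb_hom[OF CL X fh'(1) G(1) ac])
      also have "\<dots> = lincomb X m (\<lambda>i. h (v i)) a" by (rule lincomb_cong) (use e in auto)
      also have "\<dots> = h c" unfolding a(2) by (rule lincomb_hom[OF CL X fh'(2) G(1) ac, symmetric])
      finally show "f c = h c" .
    qed (use fh in auto)
  qed
  moreover have "?i ` carrier (hom_mod S C X) \<subseteq> carrier (pw X m)"
    using G(1) mhom_closed[of _ S "left_mod C" X] by (auto simp: pw_carrier)
  ultimately have "carrier (hom_mod S C X) \<lesssim> carrier (pw X m)" unfolding lepoll_def by blast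
  also have "carrier (pw X m) \<lesssim> (UNIV :: 'u set)" by (rule small_pw[OF inf subset_imp_lepoll]) simp
  finally show "carrier (hom_mod S C X) \<lesssim> (UNIV :: 'u set)" .
qed

text \<open>With finitely many generators \<open>v j\<close> of the right module C every tensor is a
  sum of \<open>v j \<otimes> y j\<close>, so the tensor product is an image of a finite power of
  \<open>Y\<close>.\<close>

lemma tensor_mod_transport:
  fixes Y :: "('r, 'u) module"
  assumes Y: "lmodule R Y"
  shows "\<exists>(F :: ('s, 'u) module) \<phi>. lmodule S F \<and> \<phi> \<in> miso S (tensor_mod R C Y) F"
proof (rule transport_module[OF lmodule_tensor_mod[OF Y]])
  interpret Y: lmodule R Y by fact
  interpret T: tensor_pair R "right_mod C" Y by (rule tpair[OF Y])
  interpret W: lmodule R "pw Y m" for m by (rule lmodule_pw[OF Y])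
  obtain m v where v: "gens (opp R) (right_mod C) m v" using fpg_gens[OF fpgr] by blast
  note G = gensD[OF v]
  let ?T = "tensor R (right_mod C) Y"
  let ?s = "\<lambda>y. gsum ?T (\<lambda>j. T.tp (v j) (y j)) m"
  have yc: "y j \<in> carrier Y" if "y \<in> carrier (pw Y m)" for y j by (rule pw_closed[OF Y.abelian_group_axioms that])
  have s: "?s \<in> ahom (pw Y m) ?T"
  proof (rule ahomI)
    show "?s y \<in> carrier ?T" if "y \<in> carrier (pw Y m)" for y
      by (rule T.TT.gsum_closed) (use G(1) yc[OF that] in auto)
    fix y z assume yz: "y \<in> carrier (pw Y m)" "z \<in> carrier (pw Y m)"
    have "?s (y \<oplus>\<^bsub>pw Y m\<^esub> z) = gsum ?T (\<lambda>j. T.tp (v j) (y j) \<oplus>\<^bsub>?T\<^esub> T.tp (v j) (z j)) m"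
      by (rule gsum_cong) (use T.tp_add_r[OF G(1)] yc[OF yz(1)] yc[OF yz(2)] in simp)
    also have "\<dots> = ?s y \<oplus>\<^bsub>?T\<^esub> ?s z"
      by (rule T.TT.gsum_add) (use G(1) yc[OF yz(1)] yc[OF yz(2)] in auto)
    finally show "?s (y \<oplus>\<^bsub>pw Y m\<^esub> z) = ?s y \<oplus>\<^bsub>?T\<^esub> ?s z" .
  qed
  have "\<exists>y\<in>carrier (pw Y m). t = ?s y" if "t \<in> carrier ?T" for t
    using that
  proof (induction t rule: T.tensor_induct)
    case zero
    show ?case
      by (rule bexI[OF _ W.zero_closed]) (rule ahom_zero[OF W.abelian_group_axioms T.abelian_tensor s, symmetric])
  next
    case (minus t u)
    then obtain y z where yz: "y \<in> carrier (pw Y m)" "t = ?s y" "z \<in> carrier (pw Y m)" "u = ?s z" by blast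
    show ?case
      by (rule bexI[OF _ W.minus_closed[OF yz(1,3)]])
        (use ahom_minus[OF W.abelian_group_axioms T.abelian_tensor s yz(1,3)] yz(2,4) in simp)
  next
    case (pure c y)
    obtain a where a: "a \<in> carrier (pw (reg (opp R)) m)" "c = lincomb (right_mod C) m v a" using G(2)[OF pure(1)] by blast
    have ac: "a i \<in> carrier R" for i
      using pw_closed[OF lmodule_ab[OF lmodule_reg[OF ring_opp[OF ringR]]] a(1)] by simp
    let ?y = "\<lambda>j. if j < m then a j \<odot>\<^bsub>Y\<^esub> y else \<zero>\<^bsub>Y\<^esub>"
    have "T.tp c y = gsum ?T (\<lambda>j. T.tp (a j \<odot>\<^bsub>right_mod C\<^esub> v j) y) m"
      unfolding a(2) lincomb_def
      by (rule ahom_gsum[OF CR.abelian_group_axioms T.abelian_tensor T.tp_ahom_l[OF pure(2)]])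
        (rule CR.smult_closed, use ac G(1) in auto)
    also have "\<dots> = ?s ?y"
      by (rule gsum_cong) (use T.tp_bal[OF ac G(1) pure(2)] in simp)
    finally show ?case
      using ac pure(2) by (intro bexI[of _ ?y]) (auto simp: pw_carrier)
  qed
  then have "carrier (tensor_mod R C Y) \<subseteq> ?s ` carrier (pw Y m)" by auto
  from small_image[OF small_pw[OF inf subset_imp_lepoll] this]
  show "carrier (tensor_mod R C Y) \<lesssim> (UNIV :: 'u set)" by simp
qed

text \<open>The counit identifies \<open>C \<otimes> Hom(C, X)\<close> with \<open>X\<close>, so
  tensoring undoes the passage from \<open>X\<close> to \<open>Hom(C, X)\<close>.\<close>

lemma C_fp_injective_cases:
  fixes I :: "('r, 'u) module"
  assumes "C_fp_injective n S R C I"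
  shows "Aus I" "\<exists>(X :: ('s, 'u) module) \<phi>. fp_injective n S X \<and> \<phi> \<in> miso S (tensor_mod R C I) X"
proof -
  have Im: "lmodule R I" using assms by (simp add: C_fp_injective_def)
  obtain X :: "('s, 'u) module" and \<phi> where X: "fp_injective n S X" "\<phi> \<in> miso R I (hom_mod S C X)"
    using assms unfolding C_fp_injective_def by blast
  have Xm: "lmodule S X" using X by (simp add: fp_injective_def)
  show "Aus I" by (rule Aus_miso[OF Im X(2) fp_injective_Aus[OF X(1)]])
  show "\<exists>(X :: ('s, 'u) module) \<phi>. fp_injective n S X \<and> \<phi> \<in> miso S (tensor_mod R C I) X"
    using X(1) miso_comp[OF tmap2_miso[OF Im lmodule_hom_mod[OF Xm] X(2)] fp_injective_counit[OF X(1)]] by blast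
qed

lemma C_fp_flat_cases:
  fixes F :: "('s, 'u) module"
  assumes "C_fp_flat n S R C F"
  shows "Bas F" "\<exists>(Y :: ('r, 'u) module) \<phi>. fp_flat n R Y \<and> \<phi> \<in> miso R (hom_mod S C F) Y"
proof -
  have Fm: "lmodule S F" using assms by (simp add: C_fp_flat_def)
  obtain Y :: "('r, 'u) module" and \<phi> where Y: "fp_flat n R Y" "\<phi> \<in> miso S F (tensor_mod R C Y)"
    using assms unfolding C_fp_flat_def by blast
  have Ym: "lmodule R Y" using Y by (simp add: fp_flat_def)
  show "Bas F" by (rule Bas_miso[OF Fm miso_inv[OF Fm Y(2)] fp_flat_Bas[OF Y(1)]])
  show "\<exists>(Y :: ('r, 'u) module) \<phi>. fp_flat n R Y \<and> \<phi> \<in> miso R (hom_mod S C F) Y"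
    using Y(1) miso_comp[OF hmap_miso[OF Fm lmodule_tensor_mod[OF Ym] Y(2)] miso_inv[OF Ym fp_flat_unit[OF Y(1)]]] by blast
qed

text \<open>The cokernel \<open>L\<close> of the first map lies in the Auslander class by induction,
  so closure under kernels gives both \<open>Aus M\<close> and exactness of the tensored sequence,
  which then starts the resolution of \<open>C \<otimes> M\<close>.\<close>

lemma right_resolved_forward:
  fixes M :: "('r, 'u) module"
  shows "right_resolved R (C_fp_injective n S R C) k M \<Longrightarrow>
    Aus M \<and> right_resolved S (fp_injective n S :: ('s, 'u) module \<Rightarrow> bool) k (tensor_mod R C M)"
proof (induction k arbitrary: M)
  case 0
  obtain I :: "('r, 'u) module" and \<phi> where I: "lmodule R I" "\<phi> \<in> miso R M I" "C_fp_injective n S R C I"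
    and M: "lmodule R M"
    using right_resolved_0D[OF 0] by blast
  note c = C_fp_injective_cases[OF I(3)]
  obtain X :: "('s, 'u) module" and \<psi> where X: "fp_injective n S X" "\<psi> \<in> miso S (tensor_mod R C I) X" using c(2) by blast
  have Xm: "lmodule S X" using X by (simp add: fp_injective_def)
  show ?case
    using Aus_miso[OF M I(2) c(1)]
      right_resolved_0I[OF lmodule_tensor_mod[OF M] Xm miso_comp[OF tmap2_miso[OF M I(1,2)] X(2)], of "fp_injective n S", OF X(1)]
    by blast
next
  case (Suc k)
  obtain I L :: "('r, 'u) module" and f g where s: "ses R M f I g L" "C_fp_injective n S R C I"
    "right_resolved R (C_fp_injective n S R C) k L"
    using right_resolved_SucD[OF Suc.prems] by blast
  note c = C_fp_injective_cases[OF s(2)]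
  have L: "Aus L" "right_resolved S (fp_injective n S :: ('s, 'u) module \<Rightarrow> bool) k (tensor_mod R C L)"
    using Suc.IH[OF s(3)] by blast+
  obtain X :: "('s, 'u) module" and \<psi> where X: "fp_injective n S X" "\<psi> \<in> miso S (tensor_mod R C I) X" using c(2) by blast
  have Xm: "lmodule S X" using X by (simp add: fp_injective_def)
  note A = Aus_kernel[OF s(1) c(1) L(1)]
  show ?case
    using A(1) right_resolved_SucI[OF ses_miso_mid[OF A(2) Xm X(2)], of "fp_injective n S", OF X(1) L(2)] by blast
qed

lemma C_fp_injective_transport:
  fixes X :: "('s, 'u) module"
  assumes X: "fp_injective n S X"
  shows "\<exists>(I :: ('r, 'u) module) \<phi>. lmodule R I \<and> \<phi> \<in> miso R (hom_mod S C X) I \<and> C_fp_injective n S R C I"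
proof -
  have Xm: "lmodule S X" using X by (simp add: fp_injective_def)
  obtain I :: "('r, 'u) module" and \<phi> where I: "lmodule R I" "\<phi> \<in> miso R (hom_mod S C X) I"
    using hom_mod_transport[OF Xm] by blast
  show ?thesis
    using I X miso_inv[OF lmodule_hom_mod[OF Xm] I(2)] unfolding C_fp_injective_def by blast
qed

lemma C_fp_flat_transport:
  fixes Y :: "('r, 'u) module"
  assumes Y: "fp_flat n R Y"
  shows "\<exists>(F :: ('s, 'u) module) \<phi>. lmodule S F \<and> \<phi> \<in> miso S (tensor_mod R C Y) F \<and> C_fp_flat n S R C F"
proof -
  have Ym: "lmodule R Y" using Y by (simp add: fp_flat_def)
  obtain F :: "('s, 'u) module" and \<phi> where F: "lmodule S F" "\<phi> \<in> miso S (tensor_mod R C Y) F"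
    using tensor_mod_transport[OF Ym] by blast
  show ?thesis
    using F Y miso_inv[OF lmodule_tensor_mod[OF Ym] F(2)] unfolding C_fp_flat_def by blast
qed

lemma right_resolved_hom_0:
  assumes r: "right_resolved S (fp_injective n S :: ('s, 'u) module \<Rightarrow> bool) 0 W"
  shows "right_resolved R (C_fp_injective n S R C) 0 (hom_mod S C W)"
proof -
  obtain X :: "('s, 'u) module" and \<psi> where X: "lmodule S X" "\<psi> \<in> miso S W X" "fp_injective n S X" and W: "lmodule S W"
    using right_resolved_0D[OF r] by blast
  obtain I :: "('r, 'u) module" and \<phi> where I: "lmodule R I" "\<phi> \<in> miso R (hom_mod S C X) I" "C_fp_injective n S R C I"
    using C_fp_injective_transport[OF X(3)] by blast
  show ?thesis
    by (rule right_resolved_0I[OF lmodule_hom_mod[OF W] I(1) miso_comp[OF hmap_miso[OF W X(1,2)] I(2)]]) (rule I(3))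
qed

text \<open>The induction step with its hypothesis as a premise: \<open>W\<close> has an arbitrary
  type and \<open>L\<close> lies in \<open>'u\<close>, whereas an induction fixes one type.
  \<open>right_resolved_hom\<close> runs the induction inside \<open>'u\<close> and then uses the
  step once more for \<open>W\<close>.\<close>

lemma right_resolved_hom_Suc:
  fixes k :: nat
  assumes IH: "\<And>L :: ('s, 'u) module. right_resolved S (fp_injective n S :: ('s, 'u) module \<Rightarrow> bool) k L \<Longrightarrow> EV L \<Longrightarrow>
      right_resolved R (C_fp_injective n S R C) k (hom_mod S C L)"
    and r: "right_resolved S (fp_injective n S :: ('s, 'u) module \<Rightarrow> bool) (Suc k) W" and v: "EV W"
  shows "right_resolved R (C_fp_injective n S R C) (Suc k) (hom_mod S C W)"
proof -
  obtain X L :: "('s, 'u) module" and f g where s: "ses S W f X g L" "fp_injective n S X"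
    "right_resolved S (fp_injective n S :: ('s, 'u) module \<Rightarrow> bool) k L"
    using right_resolved_SucD[OF r] by blast
  \<comment> \<open>Vanishing of Ext is the property carried through the steps: it makes
    \<open>Hom(C, -)\<close> exact on the sequence, and the cokernel inherits it.\<close>
  have "EV L" by (rule EV_cokernel[OF s(1) v fp_injective_Ext_vanish[OF s(2)]])
  then have L: "right_resolved R (C_fp_injective n S R C) k (hom_mod S C L)" by (rule IH[OF s(3)])
  obtain I :: "('r, 'u) module" and \<phi> where I: "lmodule R I" "\<phi> \<in> miso R (hom_mod S C X) I" "C_fp_injective n S R C I"
    using C_fp_injective_transport[OF s(2)] by blast
  show ?thesis
    by (rule right_resolved_SucI[OF ses_miso_mid[OF ses_hom[OF s(1) v] I(1,2)]]) (rule I(3), rule L)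
qed

lemma right_resolved_hom:
  assumes r: "right_resolved S (fp_injective n S :: ('s, 'u) module \<Rightarrow> bool) k W" and v: "EV W"
  shows "right_resolved R (C_fp_injective n S R C) k (hom_mod S C W)"
proof -
  have u: "right_resolved R (C_fp_injective n S R C) k (hom_mod S C L)"
    if "right_resolved S (fp_injective n S :: ('s, 'u) module \<Rightarrow> bool) k L" "EV L" for L :: "('s, 'u) module" and k
    using that
  proof (induction k arbitrary: L)
    case 0
    show ?case by (rule right_resolved_hom_0[OF 0(1)])
  next
    case (Suc k)
    show ?case by (rule right_resolved_hom_Suc[OF Suc.IH Suc.prems])
  qed
  show ?thesis
  proof (cases k)
    case 0
    then show ?thesis using right_resolved_hom_0 r by simp
  next
    case (Suc j)
    show ?thesis unfolding Suc by (rule right_resolved_hom_Suc[OF u r[unfolded Suc] v])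
  qed
qed

lemma left_resolved_forward:
  fixes N :: "('s, 'u) module"
  shows "left_resolved S (C_fp_flat n S R C) k N \<Longrightarrow>
    Bas N \<and> left_resolved R (fp_flat n R :: ('r, 'u) module \<Rightarrow> bool) k (hom_mod S C N)"
proof (induction k arbitrary: N)
  case 0
  obtain F :: "('s, 'u) module" and \<phi> where F: "lmodule S F" "\<phi> \<in> miso S F N" "C_fp_flat n S R C F"
    and N: "lmodule S N"
    using left_resolved_0D[OF 0] by blast
  note c = C_fp_flat_cases[OF F(3)]
  obtain Y :: "('r, 'u) module" and \<psi> where Y: "fp_flat n R Y" "\<psi> \<in> miso R (hom_mod S C F) Y" using c(2) by blast
  have Ym: "lmodule R Y" using Y by (simp add: fp_flat_def)
  show ?case
    using Bas_miso[OF N F(2) c(1)]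
      left_resolved_0I[OF lmodule_hom_mod[OF N] Ym
        miso_comp[OF miso_inv[OF lmodule_hom_mod[OF F(1)] Y(2)] hmap_miso[OF F(1) N F(2)]], of "fp_flat n R", OF Y(1)]
    by blast
next
  case (Suc k)
  obtain F K :: "('s, 'u) module" and f g where s: "ses S K f F g N" "C_fp_flat n S R C F"
    "left_resolved S (C_fp_flat n S R C) k K"
    using left_resolved_SucD[OF Suc.prems] by blast
  note c = C_fp_flat_cases[OF s(2)]
  have K: "Bas K" "left_resolved R (fp_flat n R :: ('r, 'u) module \<Rightarrow> bool) k (hom_mod S C K)"
    using Suc.IH[OF s(3)] by blast+
  obtain Y :: "('r, 'u) module" and \<psi> where Y: "fp_flat n R Y" "\<psi> \<in> miso R (hom_mod S C F) Y" using c(2) by blast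
  have Ym: "lmodule R Y" using Y by (simp add: fp_flat_def)
  note A = Bas_cokernel[OF s(1) K(1) c(1)]
  show ?case
    using A(1) left_resolved_SucI[OF ses_miso_mid[OF A(2) Ym Y(2)], of "fp_flat n R", OF Y(1) K(2)] by blast
qed

lemma left_resolved_tensor_0:
  assumes r: "left_resolved R (fp_flat n R :: ('r, 'u) module \<Rightarrow> bool) 0 W"
  shows "left_resolved S (C_fp_flat n S R C) 0 (tensor_mod R C W)"
proof -
  obtain Y :: "('r, 'u) module" and \<psi> where Y: "lmodule R Y" "\<psi> \<in> miso R Y W" "fp_flat n R Y" and W: "lmodule R W"
    using left_resolved_0D[OF r] by blast
  obtain F :: "('s, 'u) module" and \<phi> where F: "lmodule S F" "\<phi> \<in> miso S (tensor_mod R C Y) F" "C_fp_flat n S R C F"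
    using C_fp_flat_transport[OF Y(3)] by blast
  show ?thesis
    by (rule left_resolved_0I[OF lmodule_tensor_mod[OF W] F(1)
          miso_comp[OF miso_inv[OF lmodule_tensor_mod[OF Y(1)] F(2)] tmap2_miso[OF Y(1) W Y(2)]]]) (rule F(3))
qed

text \<open>Kept apart from the induction because the type of \<open>W\<close> may differ from that
  of the kernel \<open>K\<close>. Here \<open>TV\<close> is carried along: it makes
  \<open>C \<otimes> -\<close> exact on the sequence and is inherited by the kernel.\<close>

lemma left_resolved_tensor_Suc:
  fixes k :: nat
  assumes IH: "\<And>L :: ('r, 'u) module. left_resolved R (fp_flat n R :: ('r, 'u) module \<Rightarrow> bool) k L \<Longrightarrow> TV L \<Longrightarrow>
      left_resolved S (C_fp_flat n S R C) k (tensor_mod R C L)"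
    and r: "left_resolved R (fp_flat n R :: ('r, 'u) module \<Rightarrow> bool) (Suc k) W" and v: "TV W"
  shows "left_resolved S (C_fp_flat n S R C) (Suc k) (tensor_mod R C W)"
proof -
  obtain Y K :: "('r, 'u) module" and f g where s: "ses R K f Y g W" "fp_flat n R Y"
    "left_resolved R (fp_flat n R :: ('r, 'u) module \<Rightarrow> bool) k K"
    using left_resolved_SucD[OF r] by blast
  interpret Z: foxby_ses S R C Pl dl el ml vl \<xi>l Pr dr er mr vr \<xi>r K f Y g W by (rule foxby_sesI[OF s(1)])
  have "TV K" by (rule Z.TV_kernel[OF fp_flat_Tor_vanish[OF s(2)] v])
  then have K: "left_resolved S (C_fp_flat n S R C) k (tensor_mod R C K)" by (rule IH[OF s(3)])
  obtain F :: "('s, 'u) module" and \<phi> where F: "lmodule S F" "\<phi> \<in> miso S (tensor_mod R C Y) F" "C_fp_flat n S R C F"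
    using C_fp_flat_transport[OF s(2)] by blast
  show ?thesis
    by (rule left_resolved_SucI[OF ses_miso_mid[OF Z.ses_tensor[OF v] F(1,2)]]) (rule F(3), rule K)
qed

lemma left_resolved_tensor:
  assumes r: "left_resolved R (fp_flat n R :: ('r, 'u) module \<Rightarrow> bool) k W" and v: "TV W"
  shows "left_resolved S (C_fp_flat n S R C) k (tensor_mod R C W)"
proof -
  have u: "left_resolved S (C_fp_flat n S R C) k (tensor_mod R C L)"
    if "left_resolved R (fp_flat n R :: ('r, 'u) module \<Rightarrow> bool) k L" "TV L" for L :: "('r, 'u) module" and k
    using that
  proof (induction k arbitrary: L)
    case 0
    show ?case by (rule left_resolved_tensor_0[OF 0(1)])
  next
    case (Suc k)
    show ?case by (rule left_resolved_tensor_Suc[OF Suc.IH Suc.prems])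
  qed
  show ?thesis
  proof (cases k)
    case 0
    then show ?thesis using left_resolved_tensor_0 r by simp
  next
    case (Suc j)
    show ?thesis unfolding Suc by (rule left_resolved_tensor_Suc[OF u r[unfolded Suc] v])
  qed
qed

text \<open>For the converse, \<open>Hom(C, -)\<close> is applied to the resolution of
  \<open>C \<otimes> M\<close>, and the unit leads back to \<open>M\<close>.\<close>

theorem C_fp_injective_resolved_iff:
  fixes M :: "('r, 'u) module"
  assumes M: "lmodule R M"
  shows "right_resolved R (C_fp_injective n S R C) k M \<longleftrightarrow>
    Aus M \<and> right_resolved S (fp_injective n S :: ('s, 'u) module \<Rightarrow> bool) k (tensor_mod R C M)"
proof
  assume r: "Aus M \<and> right_resolved S (fp_injective n S :: ('s, 'u) module \<Rightarrow> bool) k (tensor_mod R C M)"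
  then have u: "EV (tensor_mod R C M)" "eval_unit R C M \<in> miso R M (hom_mod S C (tensor_mod R C M))"
    unfolding Aus_def by blast+
  show "right_resolved R (C_fp_injective n S R C) k M"
    by (rule right_resolved_miso[OF M u(2) right_resolved_hom[OF conjunct2[OF r] u(1)]])
qed (rule right_resolved_forward)

text \<open>For the converse, \<open>C \<otimes> -\<close> is applied to the resolution of
  \<open>Hom(C, N)\<close>, and the counit leads back to \<open>N\<close>.\<close>

theorem C_fp_flat_resolved_iff:
  fixes N :: "('s, 'u) module"
  assumes N: "lmodule S N"
  shows "left_resolved S (C_fp_flat n S R C) k N \<longleftrightarrow>
    Bas N \<and> left_resolved R (fp_flat n R :: ('r, 'u) module \<Rightarrow> bool) k (hom_mod S C N)"
proof
  assume r: "Bas N \<and> left_resolved R (fp_flat n R :: ('r, 'u) module \<Rightarrow> bool) k (hom_mod S C N)"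
  then have u: "TV (hom_mod S C N)" "eval_counit N \<in> miso S (tensor_mod R C (hom_mod S C N)) N"
    unfolding Bas_def by blast+
  show "left_resolved S (C_fp_flat n S R C) k N"
    by (rule left_resolved_miso[OF N u(2) left_resolved_tensor[OF conjunct2[OF r] u(1)]])
qed (rule left_resolved_forward)

end

theorem corollary3p9:
  fixes R :: "'r ring" and S :: "'s ring"
    and C :: "('s, 'r, 'u) bimodule"
    and M :: "('r, 'u) module" and N :: "('s, 'u) module"
    and n k :: nat
  assumes universe: "infinite (UNIV :: 'u set)"
      "carrier R \<lesssim> (UNIV :: 'u set)" "carrier S \<lesssim> (UNIV :: 'u set)"
    and "ring R" and "ring S"
    and "faithfully_semidualizing S R C"
    and "n \<ge> 1"
    and "lmodule R M" and "lmodule S N"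
  shows "(right_resolved R (C_fp_injective n S R C) k M \<longleftrightarrow>
            Auslander S R C M \<and>
            right_resolved S (fp_injective n S :: ('s, 'u) module \<Rightarrow> bool) k (tensor_mod R C M)) \<and>
         (left_resolved S (C_fp_flat n S R C) k N \<longleftrightarrow>
            Bass S R C N \<and>
            left_resolved R (fp_flat n R :: ('r, 'u) module \<Rightarrow> bool) k (hom_mod S C N))"
proof -
  have sd: "semidualizing S R C" using assms(6) by (simp add: faithfully_semidualizing_def)
  have bm: "bimodule S R C" using sd by (simp add: semidualizing_def)
  interpret bimod S R C by (rule bimod.intro[OF bm assms(4)])
  obtain Pl dl el where l: "proj_resolution S (left_mod C) Pl dl el" "\<And>i. fin_gen S (Pl i)"
    using sd unfolding semidualizing_def by blast
  obtain Pr dr er where r: "proj_resolution (opp R) (right_mod C) Pr dr er" "\<And>i. fin_gen (opp R) (Pr i)"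
    using sd unfolding semidualizing_def by blast
  \<comment> \<open>The resolutions provided by \<open>semidualizing\<close> have finitely generated
    projective terms, so they carry the dual bases that the chosen resolutions inside Ext and Tor
    may lack.\<close>
  have "\<forall>i. \<exists>m v \<xi>. dual_basis S (Pl i) m v \<xi>"
    using projective_dual_basis[OF universe(1,3) proj_resolutionD(2)[OF l(1)] l(2)] by blast
  then obtain ml vl \<xi>l where dbl: "\<And>i. dual_basis S (Pl i) (ml i) (vl i) (\<xi>l i)" by metis
  have oR: "carrier (opp R) \<lesssim> (UNIV :: 'u set)" using universe(2) by simp
  have "\<forall>i. \<exists>m v \<xi>. dual_basis (opp R) (Pr i) m v \<xi>"
    using projective_dual_basis[OF universe(1) oR proj_resolutionD(2)[OF r(1)] r(2)] by blast
  then obtain mr vr \<xi>r where dbr: "\<And>i. dual_basis (opp R) (Pr i) (mr i) (vr i) (\<xi>r i)" by metis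
  interpret foxby S R C Pl dl el ml vl \<xi>l Pr dr er mr vr \<xi>r
  proof (unfold_locales)
    show "Ext_vanish S Pl dl (left_mod C)"
      using sd Ext_vanish_iff[OF l(1) CL] unfolding semidualizing_def by blast
    show "Ext_vanish (opp R) Pr dr (right_mod C)"
      using sd Ext_vanish_iff[OF r(1) CR] unfolding semidualizing_def by blast
    show "(\<lambda>s. \<lambda>x\<in>carrier C. s \<odot>\<^bsub>C\<^esub> x)
      \<in> iso (add_monoid S) (add_monoid (hom_group (opp R) (right_mod C) (right_mod C)))"
      "(\<lambda>r. \<lambda>x\<in>carrier C. rsmult C x r)
      \<in> iso (add_monoid R) (add_monoid (hom_group S (left_mod C) (left_mod C)))"
      using sd unfolding semidualizing_def by blast+
  qed (fact universe proj_resolutionD(1)[OF l(1)] proj_resolutionD(1)[OF r(1)] dbl dbr)+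
  \<comment> \<open>Here the Ext and Tor groups of the definitions are exchanged for vanishing on
    the two fixed resolutions.\<close>
  have "Auslander S R C M \<longleftrightarrow> Aus M"
    unfolding Auslander_def Aus_def
    using Tor_vanish_iff[OF r(1)] Ext_vanish_iff[OF l(1) lmodule_tensor_mod] by blast
  moreover have "Bass S R C N \<longleftrightarrow> Bas N"
    unfolding Bass_def Bas_def
    using Tor_vanish_iff[OF r(1) lmodule_hom_mod] Ext_vanish_iff[OF l(1)] by blast
  ultimately show ?thesis
    using C_fp_injective_resolved_iff[OF assms(8)] C_fp_flat_resolved_iff[OF assms(9)] by blast
qed

end
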